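(* The inclusion $\mathbf{Lex}\hookrightarrow\mathbf{Clan}$, sending a finite-limit category $\mathcal C$ to the clan $(\mathcal C,\mathrm{mor}(\mathcal C))$ in which all morphisms are display maps (or, equivalently, the inclusion $\mathbf{CompCat}_{\mathrm{rtd},\mathrm{triv}}\hookrightarrow\mathbf{CompCat}_{\mathrm{rtd},\mathrm{repl},\mathrm{compcl}}$ of rooted trivial comprehension categories into rooted replete composition-closed comprehension categories), has a right adjoint.
   Context: **Finite-limit categories and clans.** $\mathbf{Lex}$ is the 2-category of categories with finite limits, functors preserving finite limits, and natural transformations. A display map category is a category $\mathcal C$ with a replete (isomorphism-invariant) class $\mathcal D$ of morphisms, the display maps, such that for any display map $d$ and any map $f$ into its target there is a display map that is a pullback of $d$ along $f$. It is rooted if $\mathcal C$ has a terminal object and all morphisms to it are composites of display maps (and isomorphisms). A *clan* is a rooted display map category $(\mathcal C,\mathcal D)$ with $\mathcal D$ closed under composition and containing all identities. $\mathbf{Clan}$ is the 2-category of clans, functors preserving display maps, pullbacks of display maps, and terminal objects, and all natural transformations. **Comprehension categories.** A comprehension category $(\mathcal C,\mathcal T,p,\chi)$ is a category $\mathcal C$, a fibration $p:\mathcal T\to\mathcal C$, and a functor $\chi:\mathcal T\to\mathcal C^{\to}$ to the arrow category with $\mathrm{cod}\circ\chi=p$ strictly, sending $p$-cartesian maps to pullback squares. For $A\in\mathcal T_\Gamma=p^{-1}(\Gamma)$ the domain of $\chi(A)$ is written $\Gamma.A$. A *pseudo map* $(F,\bar F,\varphi)$ is a functor $F:\mathcal C\to\mathcal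 C'$, a functor $\bar F:\mathcal T\to\mathcal T'$ strictly over $F$ preserving cartesian maps, and a natural isomorphism $\varphi:\chi'\bar F\cong F^{\to}\chi$ lying strictly over the identity of $F$. A *transformation* $(F,\bar F,\varphi)\Rightarrow(G,\bar G,\gamma)$ is a natural transformation $\alpha:F\Rightarrow G$ and another $\bar\alpha:\bar F\Rightarrow\bar G$ strictly over $\alpha$, with $\gamma_A\circ\chi'(\bar\alpha_A)=\alpha_{\Gamma.A}\circ\varphi_A$ for all $A\in\mathcal T_\Gamma$. A comprehension category is *subcategorical* if $\chi$ is a full subcategory inclusion; *replete* if moreover $\mathcal T$ is a replete subcategory of $\mathcal C^{\to}$; *composition-closed* if (subcategorical and) the class of maps in $\mathcal T$ is closed under composition and includes identities; *trivial* if $\chi$ is an identity (so $\mathcal T=\mathcal C^{\to}$). It is *rooted* if equipped with a distinguished terminal object $1$ such that every object is isomorphic to an iterated context extension $1.A_0\ldots A_{n-1}$, $n\ge0$, with each $A_k\in\mathcal T_{1.A_0\ldots A_{k-1}}$. $\mathbf{CompCat}_{\mathrm{rtd},\mathrm{triv}}$ and $\mathbf{CompCat}_{\mathrm{rtd},\mathrm{repl},\mathrm{compcl}}$ are the 2-categories of such comprehension categories, with pseudo maps preserving $1$ up to specified isomorphism, and transformations commuting at $1$ with these isomorphisms. **Conventions.** 2-categories and 2-functors are strict; a right adjoint is a right 2-adjoint (2-natural isomorphisms of hom-categories). *)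

theory Defs
  imports "HOL-Library.FuncSet"
begin

section \<open>Categories, functors, natural transformations\<close>

text \<open>
  A category consists of a set of objects in \<^typ>\<open>'o\<close> and a set of arrows in \<^typ>\<open>'m\<close>.
  All structure maps are \<^const>\<open>undefined\<close> outside their domains, so that equality of
  records is equality of categories (and likewise for functors and natural transformations
  below); this matters because all 2-categorical notions used here are strict.
\<close>

record ('o, 'm) cat =
  Obj :: "'o set"
  Arr :: "'m set"
  Dom :: "'m \<Rightarrow> 'o"
  Cod :: "'m \<Rightarrow> 'o"
  Id :: "'o \<Rightarrow> 'm"
  Comp :: "'m \<Rightarrow> 'm \<Rightarrow> 'm"

definition homs :: "('o, 'm) cat \<Rightarrow> 'o \<Rightarrow> 'o \<Rightarrow> 'm set" where
  "homs C X Y = {f \<in> Arr C. Dom C f = X \<and> Cod C f = Y}"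

definition composable :: "('o, 'm) cat \<Rightarrow> 'm \<Rightarrow> 'm \<Rightarrow> bool" where
  "composable C g f \<longleftrightarrow> g \<in> Arr C \<and> f \<in> Arr C \<and> Cod C f = Dom C g"

definition category :: "('o, 'm) cat \<Rightarrow> bool" where
  "category C \<longleftrightarrow>
     Dom C \<in> Arr C \<rightarrow>\<^sub>E Obj C \<and> Cod C \<in> Arr C \<rightarrow>\<^sub>E Obj C \<and> Id C \<in> Obj C \<rightarrow>\<^sub>E Arr C \<and>
     (\<forall>X \<in> Obj C. Id C X \<in> homs C X X) \<and>
     (\<forall>g f. composable C g f \<longrightarrow> Comp C g f \<in> homs C (Dom C f) (Cod C g)) \<and>
     (\<forall>g f. \<not> composable C g f \<longrightarrow> Comp C g f = undefined) \<and>
     (\<forall>f \<in> Arr C. Comp C f (Id C (Dom C f)) = f \<and> Comp C (Id C (Cod C f)) f = f) \<and>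
     (\<forall>h g f. composable C h g \<and> composable C g f \<longrightarrow>
        Comp C h (Comp C g f) = Comp C (Comp C h g) f)"

definition is_iso :: "('o, 'm) cat \<Rightarrow> 'm \<Rightarrow> bool" where
  "is_iso C f \<longleftrightarrow> f \<in> Arr C \<and>
     (\<exists>g \<in> homs C (Cod C f) (Dom C f).
        Comp C g f = Id C (Dom C f) \<and> Comp C f g = Id C (Cod C f))"

definition isomorphic :: "('o, 'm) cat \<Rightarrow> 'o \<Rightarrow> 'o \<Rightarrow> bool" where
  "isomorphic C X Y \<longleftrightarrow> (\<exists>f \<in> homs C X Y. is_iso C f)"

definition replete_in :: "('o, 'm) cat \<Rightarrow> 'o set \<Rightarrow> bool" where
  "replete_in C S \<longleftrightarrow> S \<subseteq> Obj C \<and> (\<forall>X \<in> S. \<forall>Y \<in> Obj C. isomorphic C X Y \<longrightarrow> Y \<in> S)"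

definition full_subcat :: "('o, 'm) cat \<Rightarrow> 'o set \<Rightarrow> ('o, 'm) cat" where
  "full_subcat C S =
    (let A = {f \<in> Arr C. Dom C f \<in> S \<and> Cod C f \<in> S} in
     \<lparr> Obj = S, Arr = A, Dom = restrict (Dom C) A, Cod = restrict (Cod C) A,
       Id = restrict (Id C) S,
       Comp = (\<lambda>g f. if g \<in> A \<and> f \<in> A then Comp C g f else undefined) \<rparr>)"

definition prod_cat :: "('o, 'm) cat \<Rightarrow> ('p, 'n) cat \<Rightarrow> ('o \<times> 'p, 'm \<times> 'n) cat" where
  "prod_cat C D =
     \<lparr> Obj = Obj C \<times> Obj D, Arr = Arr C \<times> Arr D,
       Dom = (\<lambda>(f, g) \<in> Arr C \<times> Arr D. (Dom C f, Dom D g)),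
       Cod = (\<lambda>(f, g) \<in> Arr C \<times> Arr D. (Cod C f, Cod D g)),
       Id = (\<lambda>(X, Y) \<in> Obj C \<times> Obj D. (Id C X, Id D Y)),
       Comp = (\<lambda>(f', g') (f, g).
         if composable C f' f \<and> composable D g' g then (Comp C f' f, Comp D g' g)
         else undefined) \<rparr>"

record ('o, 'm, 'p, 'n) ftor =
  fob :: "'o \<Rightarrow> 'p"
  farr :: "'m \<Rightarrow> 'n"

definition is_functor ::
    "('o, 'm) cat \<Rightarrow> ('p, 'n) cat \<Rightarrow> ('o, 'm, 'p, 'n) ftor \<Rightarrow> bool" where
  "is_functor C D F \<longleftrightarrow>
     fob F \<in> Obj C \<rightarrow>\<^sub>E Obj D \<and> farr F \<in> Arr C \<rightarrow>\<^sub>E Arr D \<and>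
     (\<forall>f \<in> Arr C. farr F f \<in> homs D (fob F (Dom C f)) (fob F (Cod C f))) \<and>
     (\<forall>X \<in> Obj C. farr F (Id C X) = Id D (fob F X)) \<and>
     (\<forall>g f. composable C g f \<longrightarrow> farr F (Comp C g f) = Comp D (farr F g) (farr F f))"

definition id_functor :: "('o, 'm) cat \<Rightarrow> ('o, 'm, 'o, 'm) ftor" where
  "id_functor C = \<lparr> fob = (\<lambda>X \<in> Obj C. X), farr = (\<lambda>f \<in> Arr C. f) \<rparr>"

definition fcomp ::
    "('o, 'm) cat \<Rightarrow> ('p, 'n, 'q, 'r) ftor \<Rightarrow> ('o, 'm, 'p, 'n) ftor \<Rightarrow> ('o, 'm, 'q, 'r) ftor"
  where
  "fcomp C G F =
     \<lparr> fob = compose (Obj C) (fob G) (fob F), farr = compose (Arr C) (farr G) (farr F) \<rparr>"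

definition cat_iso ::
    "('o, 'm) cat \<Rightarrow> ('p, 'n) cat \<Rightarrow> ('o, 'm, 'p, 'n) ftor \<Rightarrow> bool" where
  "cat_iso C D F \<longleftrightarrow> is_functor C D F \<and>
     (\<exists>G. is_functor D C G \<and> fcomp C G F = id_functor C \<and> fcomp D F G = id_functor D)"

definition nat_trans ::
    "('o, 'm) cat \<Rightarrow> ('p, 'n) cat \<Rightarrow> ('o, 'm, 'p, 'n) ftor \<Rightarrow> ('o, 'm, 'p, 'n) ftor \<Rightarrow>
     ('o \<Rightarrow> 'n) \<Rightarrow> bool" where
  "nat_trans C D F G \<alpha> \<longleftrightarrow>
     \<alpha> \<in> Obj C \<rightarrow>\<^sub>E Arr D \<and>
     (\<forall>X \<in> Obj C. \<alpha> X \<in> homs D (fob F X) (fob G X)) \<and>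
     (\<forall>f \<in> Arr C. Comp D (\<alpha> (Cod C f)) (farr F f) = Comp D (farr G f) (\<alpha> (Dom C f)))"

definition nat_iso ::
    "('o, 'm) cat \<Rightarrow> ('p, 'n) cat \<Rightarrow> ('o, 'm, 'p, 'n) ftor \<Rightarrow> ('o, 'm, 'p, 'n) ftor \<Rightarrow>
     ('o \<Rightarrow> 'n) \<Rightarrow> bool" where
  "nat_iso C D F G \<alpha> \<longleftrightarrow> nat_trans C D F G \<alpha> \<and> (\<forall>X \<in> Obj C. is_iso D (\<alpha> X))"

definition id_nt ::
    "('o, 'm) cat \<Rightarrow> ('p, 'n) cat \<Rightarrow> ('o, 'm, 'p, 'n) ftor \<Rightarrow> 'o \<Rightarrow> 'n" where
  "id_nt C D F = (\<lambda>X \<in> Obj C. Id D (fob F X))"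

definition vcomp_nt ::
    "('o, 'm) cat \<Rightarrow> ('p, 'n) cat \<Rightarrow> ('o \<Rightarrow> 'n) \<Rightarrow> ('o \<Rightarrow> 'n) \<Rightarrow> 'o \<Rightarrow> 'n" where
  "vcomp_nt C D \<beta> \<alpha> = (\<lambda>X \<in> Obj C. Comp D (\<beta> X) (\<alpha> X))"

text \<open>
  Horizontal composite of \<open>\<beta> : G \<Rightarrow> G'\<close> and \<open>\<alpha> : F \<Rightarrow> F'\<close>, where \<open>C\<close> is the source of
  \<open>F\<close>, \<open>F'\<close> and \<open>E\<close> is the target of \<open>G\<close>, \<open>G'\<close>.
\<close>

definition hcomp_nt ::
    "('o, 'm) cat \<Rightarrow> ('q, 'r) cat \<Rightarrow> ('p, 'n, 'q, 'r) ftor \<Rightarrow> ('o, 'm, 'p, 'n) ftor \<Rightarrow>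
     ('p \<Rightarrow> 'r) \<Rightarrow> ('o \<Rightarrow> 'n) \<Rightarrow> 'o \<Rightarrow> 'r" where
  "hcomp_nt C E G F' \<beta> \<alpha> = (\<lambda>X \<in> Obj C. Comp E (\<beta> (fob F' X)) (farr G (\<alpha> X)))"


section \<open>Arrow categories\<close>

datatype 'm square = Square (sq_src: 'm) (sq_tgt: 'm) (sq_top: 'm) (sq_bot: 'm)

text \<open>
  \<open>Square f g u v\<close> is the map \<open>(u, v) : f \<rightarrow> g\<close> with \<open>u\<close> between the domains, \<open>v\<close> between the
  codomains, and \<open>v f = g u\<close>.
\<close>

definition squares :: "('o, 'm) cat \<Rightarrow> 'm square set" where
  "squares C = {s. sq_src s \<in> Arr C \<and> sq_tgt s \<in> Arr C \<and>
     sq_top s \<in> homs C (Dom C (sq_src s)) (Dom C (sq_tgt s)) \<and>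
     sq_bot s \<in> homs C (Cod C (sq_src s)) (Cod C (sq_tgt s)) \<and>
     Comp C (sq_bot s) (sq_src s) = Comp C (sq_tgt s) (sq_top s)}"

definition arrow_cat :: "('o, 'm) cat \<Rightarrow> ('m, 'm square) cat" where
  "arrow_cat C =
     \<lparr> Obj = Arr C, Arr = squares C,
       Dom = restrict sq_src (squares C), Cod = restrict sq_tgt (squares C),
       Id = (\<lambda>f \<in> Arr C. Square f f (Id C (Dom C f)) (Id C (Cod C f))),
       Comp = (\<lambda>t s. if t \<in> squares C \<and> s \<in> squares C \<and> sq_tgt s = sq_src t
          then Square (sq_src s) (sq_tgt t)
                 (Comp C (sq_top t) (sq_top s)) (Comp C (sq_bot t) (sq_bot s))
          else undefined) \<rparr>"

definition cod_functor :: "('o, 'm) cat \<Rightarrow> ('m, 'm square, 'o, 'm) ftor" where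
  "cod_functor C = \<lparr> fob = (\<lambda>f \<in> Arr C. Cod C f), farr = restrict sq_bot (squares C) \<rparr>"

definition map_square :: "('o, 'm, 'p, 'n) ftor \<Rightarrow> 'm square \<Rightarrow> 'n square" where
  "map_square F s =
     Square (farr F (sq_src s)) (farr F (sq_tgt s)) (farr F (sq_top s)) (farr F (sq_bot s))"

definition arrow_functor ::
    "('o, 'm) cat \<Rightarrow> ('o, 'm, 'p, 'n) ftor \<Rightarrow> ('m, 'm square, 'n, 'n square) ftor" where
  "arrow_functor C F =
     \<lparr> fob = restrict (farr F) (Arr C), farr = restrict (map_square F) (squares C) \<rparr>"


section \<open>Limits\<close>

definition terminal :: "('o, 'm) cat \<Rightarrow> 'o \<Rightarrow> bool" where
  "terminal C t \<longleftrightarrow> t \<in> Obj C \<and> (\<forall>X \<in> Obj C. \<exists>!f. f \<in> homs C X t)"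

text \<open>
  \<open>is_pullback C d f q d'\<close>: the square \<open>d q = f d'\<close> is a pullback, i.e. \<open>d'\<close> is a pullback of
  \<open>d\<close> along \<open>f\<close>.
\<close>

definition is_pullback :: "('o, 'm) cat \<Rightarrow> 'm \<Rightarrow> 'm \<Rightarrow> 'm \<Rightarrow> 'm \<Rightarrow> bool" where
  "is_pullback C d f q d' \<longleftrightarrow>
     composable C d q \<and> composable C f d' \<and> Dom C q = Dom C d' \<and> Comp C d q = Comp C f d' \<and>
     (\<forall>a b. composable C d a \<and> composable C f b \<and> Dom C a = Dom C b \<and> Comp C d a = Comp C f b \<longrightarrow>
        (\<exists>!h. h \<in> homs C (Dom C a) (Dom C q) \<and> Comp C q h = a \<and> Comp C d' h = b))"

definition is_cone ::
    "('i, 'j) cat \<Rightarrow> ('o, 'm) cat \<Rightarrow> ('i, 'j, 'o, 'm) ftor \<Rightarrow> 'o \<Rightarrow> ('i \<Rightarrow> 'm) \<Rightarrow> bool" where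
  "is_cone J C D L l \<longleftrightarrow> L \<in> Obj C \<and> (\<forall>i \<in> Obj J. l i \<in> homs C L (fob D i)) \<and>
     (\<forall>u \<in> Arr J. Comp C (farr D u) (l (Dom J u)) = l (Cod J u))"

definition is_limit ::
    "('i, 'j) cat \<Rightarrow> ('o, 'm) cat \<Rightarrow> ('i, 'j, 'o, 'm) ftor \<Rightarrow> 'o \<Rightarrow> ('i \<Rightarrow> 'm) \<Rightarrow> bool" where
  "is_limit J C D L l \<longleftrightarrow> is_cone J C D L l \<and>
     (\<forall>M k. is_cone J C D M k \<longrightarrow>
        (\<exists>!h. h \<in> homs C M L \<and> (\<forall>i \<in> Obj J. Comp C (l i) h = k i)))"

definition finite_category :: "('i, 'j) cat \<Rightarrow> bool" where
  "finite_category J \<longleftrightarrow> category J \<and> finite (Obj J) \<and> finite (Arr J)"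

text \<open>
  Index categories with objects and arrows in \<^typ>\<open>nat\<close> suffice: every finite category is
  isomorphic to one of these.
\<close>

definition has_finite_limits :: "('o, 'm) cat \<Rightarrow> bool" where
  "has_finite_limits C \<longleftrightarrow>
     (\<forall>(J :: (nat, nat) cat) D. finite_category J \<and> is_functor J C D \<longrightarrow> (\<exists>L l. is_limit J C D L l))"

definition preserves_finite_limits ::
    "('o, 'm) cat \<Rightarrow> ('p, 'n) cat \<Rightarrow> ('o, 'm, 'p, 'n) ftor \<Rightarrow> bool" where
  "preserves_finite_limits C C' F \<longleftrightarrow>
     (\<forall>(J :: (nat, nat) cat) D L l.
        finite_category J \<and> is_functor J C D \<and> is_limit J C D L l \<longrightarrow>
        is_limit J C' (fcomp J F D) (fob F L) (\<lambda>i. farr F (l i)))"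


section \<open>Strict 2-categories, 2-functors and 2-adjunctions\<close>

text \<open>
  Categories enriched in categories: \<open>HComp K X Y Z\<close> is the composition functor
  \<open>Hom K Y Z \<times> Hom K X Y \<rightarrow> Hom K X Z\<close>.  Objects and arrows of the hom-categories are the
  1-cells and 2-cells.
\<close>

record ('x, 'f, 'a) two_cat =
  Ob :: "'x set"
  Hom :: "'x \<Rightarrow> 'x \<Rightarrow> ('f, 'a) cat"
  Unit :: "'x \<Rightarrow> 'f"
  HComp :: "'x \<Rightarrow> 'x \<Rightarrow> 'x \<Rightarrow> ('f \<times> 'f, 'a \<times> 'a, 'f, 'a) ftor"

definition comp1 :: "('x, 'f, 'a) two_cat \<Rightarrow> 'x \<Rightarrow> 'x \<Rightarrow> 'x \<Rightarrow> 'f \<Rightarrow> 'f \<Rightarrow> 'f" where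
  "comp1 K X Y Z g f = fob (HComp K X Y Z) (g, f)"

definition comp2 :: "('x, 'f, 'a) two_cat \<Rightarrow> 'x \<Rightarrow> 'x \<Rightarrow> 'x \<Rightarrow> 'a \<Rightarrow> 'a \<Rightarrow> 'a" where
  "comp2 K X Y Z b a = farr (HComp K X Y Z) (b, a)"

definition two_category :: "('x, 'f, 'a) two_cat \<Rightarrow> bool" where
  "two_category K \<longleftrightarrow>
     (\<forall>X \<in> Ob K. \<forall>Y \<in> Ob K. category (Hom K X Y)) \<and>
     (\<forall>X \<in> Ob K. Unit K X \<in> Obj (Hom K X X)) \<and>
     (\<forall>X \<in> Ob K. \<forall>Y \<in> Ob K. \<forall>Z \<in> Ob K.
        is_functor (prod_cat (Hom K Y Z) (Hom K X Y)) (Hom K X Z) (HComp K X Y Z)) \<and>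
     (\<forall>X \<in> Ob K. \<forall>Y \<in> Ob K.
        (\<forall>f \<in> Obj (Hom K X Y).
           comp1 K X Y Y (Unit K Y) f = f \<and> comp1 K X X Y f (Unit K X) = f) \<and>
        (\<forall>a \<in> Arr (Hom K X Y).
           comp2 K X Y Y (Id (Hom K Y Y) (Unit K Y)) a = a \<and>
           comp2 K X X Y a (Id (Hom K X X) (Unit K X)) = a)) \<and>
     (\<forall>W \<in> Ob K. \<forall>X \<in> Ob K. \<forall>Y \<in> Ob K. \<forall>Z \<in> Ob K.
        (\<forall>h \<in> Obj (Hom K Y Z). \<forall>g \<in> Obj (Hom K X Y). \<forall>f \<in> Obj (Hom K W X).
           comp1 K W Y Z h (comp1 K W X Y g f) = comp1 K W X Z (comp1 K X Y Z h g) f) \<and>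
        (\<forall>c \<in> Arr (Hom K Y Z). \<forall>b \<in> Arr (Hom K X Y). \<forall>a \<in> Arr (Hom K W X).
           comp2 K W Y Z c (comp2 K W X Y b a) = comp2 K W X Z (comp2 K X Y Z c b) a))"

record ('x, 'f, 'a, 'y, 'g, 'b) two_ftor =
  tob :: "'x \<Rightarrow> 'y"
  thom :: "'x \<Rightarrow> 'x \<Rightarrow> ('f, 'a, 'g, 'b) ftor"

definition two_functor ::
    "('x, 'f, 'a) two_cat \<Rightarrow> ('y, 'g, 'b) two_cat \<Rightarrow> ('x, 'f, 'a, 'y, 'g, 'b) two_ftor \<Rightarrow> bool"
  where
  "two_functor K L T \<longleftrightarrow>
     (\<forall>X \<in> Ob K. tob T X \<in> Ob L) \<and>
     (\<forall>X \<in> Ob K. \<forall>Y \<in> Ob K.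
        is_functor (Hom K X Y) (Hom L (tob T X) (tob T Y)) (thom T X Y)) \<and>
     (\<forall>X \<in> Ob K. fob (thom T X X) (Unit K X) = Unit L (tob T X)) \<and>
     (\<forall>X \<in> Ob K. \<forall>Y \<in> Ob K. \<forall>Z \<in> Ob K.
        (\<forall>g \<in> Obj (Hom K Y Z). \<forall>f \<in> Obj (Hom K X Y).
           fob (thom T X Z) (comp1 K X Y Z g f) =
           comp1 L (tob T X) (tob T Y) (tob T Z) (fob (thom T Y Z) g) (fob (thom T X Y) f)) \<and>
        (\<forall>b \<in> Arr (Hom K Y Z). \<forall>a \<in> Arr (Hom K X Y).
           farr (thom T X Z) (comp2 K X Y Z b a) =
           comp2 L (tob T X) (tob T Y) (tob T Z) (farr (thom T Y Z) b) (farr (thom T X Y) a)))"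

text \<open>
  \<open>\<Phi> X Y : L(I X, Y) \<rightarrow> K(X, R Y)\<close> is an isomorphism of categories, 2-natural in
  \<open>X\<close> and \<open>Y\<close>: it commutes with \<open>h \<mapsto> g h (I f)\<close> and \<open>k \<mapsto> (R g) k f\<close> on 1-cells and on 2-cells.
\<close>

definition is_right_2_adjoint ::
    "('x, 'f, 'a) two_cat \<Rightarrow> ('y, 'g, 'b) two_cat \<Rightarrow> ('x, 'f, 'a, 'y, 'g, 'b) two_ftor \<Rightarrow>
     ('y, 'g, 'b, 'x, 'f, 'a) two_ftor \<Rightarrow> bool" where
  "is_right_2_adjoint K L I R \<longleftrightarrow>
     two_functor L K R \<and>
     (\<exists>\<Phi>.
       (\<forall>X \<in> Ob K. \<forall>Y \<in> Ob L. cat_iso (Hom L (tob I X) Y) (Hom K X (tob R Y)) (\<Phi> X Y)) \<and>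
       (\<forall>X \<in> Ob K. \<forall>X' \<in> Ob K. \<forall>Y \<in> Ob L. \<forall>Y' \<in> Ob L.
         (\<forall>f \<in> Obj (Hom K X' X). \<forall>g \<in> Obj (Hom L Y Y'). \<forall>h \<in> Obj (Hom L (tob I X) Y).
            fob (\<Phi> X' Y')
              (comp1 L (tob I X') Y Y' g (comp1 L (tob I X') (tob I X) Y h (fob (thom I X' X) f))) =
            comp1 K X' (tob R Y) (tob R Y') (fob (thom R Y Y') g)
              (comp1 K X' X (tob R Y) (fob (\<Phi> X Y) h) f)) \<and>
         (\<forall>a \<in> Arr (Hom K X' X). \<forall>b \<in> Arr (Hom L Y Y'). \<forall>c \<in> Arr (Hom L (tob I X) Y).
            farr (\<Phi> X' Y')
              (comp2 L (tob I X') Y Y' b (comp2 L (tob I X') (tob I X) Y c (farr (thom I X' X) a))) =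
            comp2 K X' (tob R Y) (tob R Y') (farr (thom R Y Y') b)
              (comp2 K X' X (tob R Y) (farr (\<Phi> X Y) c) a))))"

definition has_right_2_adjoint ::
    "('x, 'f, 'a) two_cat \<Rightarrow> ('y, 'g, 'b) two_cat \<Rightarrow> ('x, 'f, 'a, 'y, 'g, 'b) two_ftor \<Rightarrow> bool"
  where
  "has_right_2_adjoint K L I \<longleftrightarrow>
     two_category K \<and> two_category L \<and> two_functor K L I \<and> (\<exists>R. is_right_2_adjoint K L I R)"


section \<open>Finite-limit categories and clans\<close>

text \<open>
  The 2-category of categories with extra structure: the objects are the elements of \<open>obs\<close>, with
  underlying category given by \<open>und\<close>; 1-cells are the functors in \<open>S\<close>, and 2-cells are all natural
  transformations \<open>\<alpha> : F \<Rightarrow> G\<close>, recorded as triples \<open>(F, G, \<alpha>)\<close>.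
\<close>

type_synonym ('o, 'm, 'p, 'n) nt =
  "('o, 'm, 'p, 'n) ftor \<times> ('o, 'm, 'p, 'n) ftor \<times> ('o \<Rightarrow> 'n)"

definition functor_cat ::
    "('o, 'm) cat \<Rightarrow> ('p, 'n) cat \<Rightarrow> ('o, 'm, 'p, 'n) ftor set \<Rightarrow>
     (('o, 'm, 'p, 'n) ftor, ('o, 'm, 'p, 'n) nt) cat" where
  "functor_cat C D S =
    (let A = {(F, G, \<alpha>). F \<in> S \<and> G \<in> S \<and> nat_trans C D F G \<alpha>} in
     \<lparr> Obj = S, Arr = A,
       Dom = (\<lambda>(F, G, \<alpha>) \<in> A. F), Cod = (\<lambda>(F, G, \<alpha>) \<in> A. G),
       Id = (\<lambda>F \<in> S. (F, F, id_nt C D F)),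
       Comp = (\<lambda>(G', H, \<beta>) (F, G, \<alpha>).
         if (G', H, \<beta>) \<in> A \<and> (F, G, \<alpha>) \<in> A \<and> G = G' then (F, H, vcomp_nt C D \<beta> \<alpha>)
         else undefined) \<rparr>)"

definition cat_two_cat ::
    "'x set \<Rightarrow> ('x \<Rightarrow> ('o, 'm) cat) \<Rightarrow> ('x \<Rightarrow> 'x \<Rightarrow> ('o, 'm, 'o, 'm) ftor set) \<Rightarrow>
     ('x, ('o, 'm, 'o, 'm) ftor, ('o, 'm, 'o, 'm) nt) two_cat" where
  "cat_two_cat obs und S =
    (let H = (\<lambda>X Y. functor_cat (und X) (und Y) (S X Y)) in
     \<lparr> Ob = obs, Hom = H, Unit = (\<lambda>X. id_functor (und X)),
       HComp = (\<lambda>X Y Z.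
         \<lparr> fob = (\<lambda>(G, F) \<in> Obj (H Y Z) \<times> Obj (H X Y). fcomp (und X) G F),
           farr = (\<lambda>((G, G', \<beta>), (F, F', \<alpha>)) \<in> Arr (H Y Z) \<times> Arr (H X Y).
             (fcomp (und X) G F, fcomp (und X) G' F', hcomp_nt (und X) (und Z) G F' \<beta> \<alpha>)) \<rparr>) \<rparr>)"

type_synonym ('o, 'm) lex_2cat =
  "(('o, 'm) cat, ('o, 'm, 'o, 'm) ftor, ('o, 'm, 'o, 'm) nt) two_cat"

definition Lex :: "('o, 'm) lex_2cat" where
  "Lex = cat_two_cat {C. category C \<and> has_finite_limits C} (\<lambda>C. C)
     (\<lambda>C D. {F. is_functor C D F \<and> preserves_finite_limits C D F})"

definition display_map_category :: "('o, 'm) cat \<Rightarrow> 'm set \<Rightarrow> bool" where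
  "display_map_category C D \<longleftrightarrow>
     category C \<and> D \<subseteq> Arr C \<and> replete_in (arrow_cat C) D \<and>
     (\<forall>d \<in> D. \<forall>f \<in> Arr C. Cod C f = Cod C d \<longrightarrow> (\<exists>q. \<exists>d' \<in> D. is_pullback C d f q d'))"

inductive_set display_composites :: "('o, 'm) cat \<Rightarrow> 'm set \<Rightarrow> 'm set"
  for C :: "('o, 'm) cat" and D :: "'m set" where
    display: "d \<in> D \<Longrightarrow> d \<in> display_composites C D"
  | iso: "is_iso C f \<Longrightarrow> f \<in> display_composites C D"
  | comp: "g \<in> display_composites C D \<Longrightarrow> f \<in> display_composites C D \<Longrightarrow> composable C g f \<Longrightarrow>
      Comp C g f \<in> display_composites C D"

definition rooted_dmc :: "('o, 'm) cat \<Rightarrow> 'm set \<Rightarrow> bool" where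
  "rooted_dmc C D \<longleftrightarrow> display_map_category C D \<and>
     (\<exists>t. terminal C t \<and> (\<forall>f \<in> Arr C. Cod C f = t \<longrightarrow> f \<in> display_composites C D))"

definition comp_closed :: "('o, 'm) cat \<Rightarrow> 'm set \<Rightarrow> bool" where
  "comp_closed C D \<longleftrightarrow>
     (\<forall>g \<in> D. \<forall>f \<in> D. composable C g f \<longrightarrow> Comp C g f \<in> D) \<and> (\<forall>X \<in> Obj C. Id C X \<in> D)"

definition clan :: "('o, 'm) cat \<times> 'm set \<Rightarrow> bool" where
  "clan = (\<lambda>(C, D). rooted_dmc C D \<and> comp_closed C D)"

definition clan_map ::
    "('o, 'm) cat \<times> 'm set \<Rightarrow> ('p, 'n) cat \<times> 'n set \<Rightarrow> ('o, 'm, 'p, 'n) ftor \<Rightarrow> bool" where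
  "clan_map = (\<lambda>(C, D) (C', D') F.
     is_functor C C' F \<and>
     (\<forall>d \<in> D. farr F d \<in> D') \<and>
     (\<forall>d \<in> D. \<forall>f q d'. is_pullback C d f q d' \<longrightarrow>
        is_pullback C' (farr F d) (farr F f) (farr F q) (farr F d')) \<and>
     (\<forall>t. terminal C t \<longrightarrow> terminal C' (fob F t)))"

type_synonym ('o, 'm) clan_2cat =
  "(('o, 'm) cat \<times> 'm set, ('o, 'm, 'o, 'm) ftor, ('o, 'm, 'o, 'm) nt) two_cat"

definition Clan :: "('o, 'm) clan_2cat" where
  "Clan = cat_two_cat {X. clan X} fst (\<lambda>X Y. {F. clan_map X Y F})"

definition Lex_to_Clan ::
    "(('o, 'm) cat, ('o, 'm, 'o, 'm) ftor, ('o, 'm, 'o, 'm) nt,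
      ('o, 'm) cat \<times> 'm set, ('o, 'm, 'o, 'm) ftor, ('o, 'm, 'o, 'm) nt) two_ftor" where
  "Lex_to_Clan = \<lparr> tob = (\<lambda>C. (C, Arr C)), thom = (\<lambda>C D. id_functor (Hom Lex C D)) \<rparr>"


section \<open>Comprehension categories\<close>

definition cartesian ::
    "('a, 'b) cat \<Rightarrow> ('o, 'm) cat \<Rightarrow> ('a, 'b, 'o, 'm) ftor \<Rightarrow> 'b \<Rightarrow> bool" where
  "cartesian T C p t \<longleftrightarrow> t \<in> Arr T \<and>
     (\<forall>s \<in> Arr T. \<forall>h. Cod T s = Cod T t \<and>
        h \<in> homs C (fob p (Dom T s)) (fob p (Dom T t)) \<and> Comp C (farr p t) h = farr p s \<longrightarrow>
        (\<exists>!k. k \<in> homs T (Dom T s) (Dom T t) \<and> farr p k = h \<and> Comp T t k = s))"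

definition fibration ::
    "('a, 'b) cat \<Rightarrow> ('o, 'm) cat \<Rightarrow> ('a, 'b, 'o, 'm) ftor \<Rightarrow> bool" where
  "fibration T C p \<longleftrightarrow> is_functor T C p \<and>
     (\<forall>A \<in> Obj T. \<forall>f \<in> Arr C. Cod C f = fob p A \<longrightarrow>
        (\<exists>t. cartesian T C p t \<and> Cod T t = A \<and> farr p t = f))"

record ('o, 'm, 'a, 'b) compcat =
  base :: "('o, 'm) cat"
  total :: "('a, 'b) cat"
  proj :: "('a, 'b, 'o, 'm) ftor"
  compr :: "('a, 'b, 'm, 'm square) ftor"

definition comprehension_category :: "('o, 'm, 'a, 'b, 'z) compcat_scheme \<Rightarrow> bool" where
  "comprehension_category X \<longleftrightarrow>
     category (base X) \<and> category (total X) \<and>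
     fibration (total X) (base X) (proj X) \<and>
     is_functor (total X) (arrow_cat (base X)) (compr X) \<and>
     fcomp (total X) (cod_functor (base X)) (compr X) = proj X \<and>
     (\<forall>t. cartesian (total X) (base X) (proj X) t \<longrightarrow>
        (let s = farr (compr X) t
         in is_pullback (base X) (sq_tgt s) (sq_bot s) (sq_top s) (sq_src s)))"

definition ext_dom :: "('o, 'm, 'a, 'b, 'z) compcat_scheme \<Rightarrow> 'a \<Rightarrow> 'o" where
  "ext_dom X A = Dom (base X) (fob (compr X) A)"

definition subcategorical :: "('o, 'm, 'm, 'm square, 'z) compcat_scheme \<Rightarrow> bool" where
  "subcategorical X \<longleftrightarrow>
     Obj (total X) \<subseteq> Arr (base X) \<and>
     total X = full_subcat (arrow_cat (base X)) (Obj (total X)) \<and>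
     compr X = id_functor (total X)"

definition replete :: "('o, 'm, 'm, 'm square, 'z) compcat_scheme \<Rightarrow> bool" where
  "replete X \<longleftrightarrow> subcategorical X \<and> replete_in (arrow_cat (base X)) (Obj (total X))"

definition composition_closed :: "('o, 'm, 'm, 'm square, 'z) compcat_scheme \<Rightarrow> bool" where
  "composition_closed X \<longleftrightarrow> subcategorical X \<and> comp_closed (base X) (Obj (total X))"

definition trivial :: "('o, 'm, 'm, 'm square, 'z) compcat_scheme \<Rightarrow> bool" where
  "trivial X \<longleftrightarrow>
     total X = arrow_cat (base X) \<and> compr X = id_functor (arrow_cat (base X))"

record ('o, 'm, 'a, 'b) rcompcat = "('o, 'm, 'a, 'b) compcat" +
  root :: 'o

inductive iterated_ext :: "('o, 'm, 'a, 'b) rcompcat \<Rightarrow> 'o \<Rightarrow> bool"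
  for X :: "('o, 'm, 'a, 'b) rcompcat" where
    root: "iterated_ext X (root X)"
  | ext: "iterated_ext X \<Gamma> \<Longrightarrow> A \<in> Obj (total X) \<Longrightarrow> fob (proj X) A = \<Gamma> \<Longrightarrow>
      iterated_ext X (ext_dom X A)"

definition rooted_compcat :: "('o, 'm, 'a, 'b) rcompcat \<Rightarrow> bool" where
  "rooted_compcat X \<longleftrightarrow> comprehension_category X \<and> terminal (base X) (root X) \<and>
     (\<forall>\<Gamma> \<in> Obj (base X). \<exists>\<Delta>. iterated_ext X \<Delta> \<and> isomorphic (base X) \<Gamma> \<Delta>)"

record ('o, 'm, 'a, 'b) pmap =
  pm_base :: "('o, 'm, 'o, 'm) ftor"
  pm_total :: "('a, 'b, 'a, 'b) ftor"
  pm_compr :: "'a \<Rightarrow> 'm square"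

definition pseudo_map ::
    "('o, 'm, 'a, 'b, 'z) compcat_scheme \<Rightarrow> ('o, 'm, 'a, 'b, 'z) compcat_scheme \<Rightarrow>
     ('o, 'm, 'a, 'b, 'y) pmap_scheme \<Rightarrow> bool" where
  "pseudo_map X Y F \<longleftrightarrow>
     is_functor (base X) (base Y) (pm_base F) \<and>
     is_functor (total X) (total Y) (pm_total F) \<and>
     fcomp (total X) (proj Y) (pm_total F) = fcomp (total X) (pm_base F) (proj X) \<and>
     (\<forall>t. cartesian (total X) (base X) (proj X) t \<longrightarrow>
        cartesian (total Y) (base Y) (proj Y) (farr (pm_total F) t)) \<and>
     nat_iso (total X) (arrow_cat (base Y))
       (fcomp (total X) (compr Y) (pm_total F))
       (fcomp (total X) (arrow_functor (base X) (pm_base F)) (compr X))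
       (pm_compr F) \<and>
     (\<forall>A \<in> Obj (total X).
        sq_bot (pm_compr F A) = Id (base Y) (fob (pm_base F) (fob (proj X) A)))"

text \<open>The field \<open>pm_root\<close> is the specified isomorphism \<open>F 1 \<cong> 1\<close>.\<close>

record ('o, 'm, 'a, 'b) rpmap = "('o, 'm, 'a, 'b) pmap" +
  pm_root :: 'm

definition rooted_pseudo_map ::
    "('o, 'm, 'a, 'b) rcompcat \<Rightarrow> ('o, 'm, 'a, 'b) rcompcat \<Rightarrow> ('o, 'm, 'a, 'b) rpmap \<Rightarrow> bool"
  where
  "rooted_pseudo_map X Y F \<longleftrightarrow> pseudo_map X Y F \<and>
     pm_root F \<in> homs (base Y) (fob (pm_base F) (root X)) (root Y) \<and> is_iso (base Y) (pm_root F)"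

definition transformation ::
    "('o, 'm, 'a, 'b, 'z) compcat_scheme \<Rightarrow> ('o, 'm, 'a, 'b, 'z) compcat_scheme \<Rightarrow>
     ('o, 'm, 'a, 'b, 'y) pmap_scheme \<Rightarrow> ('o, 'm, 'a, 'b, 'y) pmap_scheme \<Rightarrow>
     ('o \<Rightarrow> 'm) \<Rightarrow> ('a \<Rightarrow> 'b) \<Rightarrow> bool" where
  "transformation X Y F G \<alpha> \<alpha>' \<longleftrightarrow>
     nat_trans (base X) (base Y) (pm_base F) (pm_base G) \<alpha> \<and>
     nat_trans (total X) (total Y) (pm_total F) (pm_total G) \<alpha>' \<and>
     (\<forall>A \<in> Obj (total X).
        farr (proj Y) (\<alpha>' A) = \<alpha> (fob (proj X) A) \<and>
        Comp (base Y) (sq_top (pm_compr G A)) (sq_top (farr (compr Y) (\<alpha>' A))) =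
        Comp (base Y) (\<alpha> (ext_dom X A)) (sq_top (pm_compr F A)))"

definition rooted_transformation ::
    "('o, 'm, 'a, 'b) rcompcat \<Rightarrow> ('o, 'm, 'a, 'b) rcompcat \<Rightarrow>
     ('o, 'm, 'a, 'b) rpmap \<Rightarrow> ('o, 'm, 'a, 'b) rpmap \<Rightarrow> ('o \<Rightarrow> 'm) \<Rightarrow> ('a \<Rightarrow> 'b) \<Rightarrow> bool" where
  "rooted_transformation X Y F G \<alpha> \<alpha>' \<longleftrightarrow> transformation X Y F G \<alpha> \<alpha>' \<and>
     Comp (base Y) (pm_root G) (\<alpha> (root X)) = pm_root F"

definition id_rpmap :: "('o, 'm, 'a, 'b) rcompcat \<Rightarrow> ('o, 'm, 'a, 'b) rpmap" where
  "id_rpmap X =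
     \<lparr> pm_base = id_functor (base X), pm_total = id_functor (total X),
       pm_compr = (\<lambda>A \<in> Obj (total X). Id (arrow_cat (base X)) (fob (compr X) A)),
       pm_root = Id (base X) (root X) \<rparr>"

text \<open>
  The composite of \<open>G : Y \<rightarrow> Z\<close> and \<open>F : X \<rightarrow> Y\<close>; its comprehension isomorphism at \<open>A\<close> pastes
  that of \<open>G\<close> at the image of \<open>A\<close> with the image under \<open>G\<close> of that of \<open>F\<close> at \<open>A\<close>.
\<close>

definition comp_rpmap ::
    "('o, 'm, 'a, 'b) rcompcat \<Rightarrow> ('o, 'm, 'a, 'b) rcompcat \<Rightarrow>
     ('o, 'm, 'a, 'b) rpmap \<Rightarrow> ('o, 'm, 'a, 'b) rpmap \<Rightarrow> ('o, 'm, 'a, 'b) rpmap" where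
  "comp_rpmap X Z G F =
     \<lparr> pm_base = fcomp (base X) (pm_base G) (pm_base F),
       pm_total = fcomp (total X) (pm_total G) (pm_total F),
       pm_compr = (\<lambda>A \<in> Obj (total X). Comp (arrow_cat (base Z))
          (map_square (pm_base G) (pm_compr F A)) (pm_compr G (fob (pm_total F) A))),
       pm_root = Comp (base Z) (pm_root G) (farr (pm_base G) (pm_root F)) \<rparr>"

type_synonym ('o, 'm, 'a, 'b) rtrans =
  "('o, 'm, 'a, 'b) rpmap \<times> ('o, 'm, 'a, 'b) rpmap \<times> ('o \<Rightarrow> 'm) \<times> ('a \<Rightarrow> 'b)"

definition compcat_hom ::
    "('o, 'm, 'a, 'b) rcompcat \<Rightarrow> ('o, 'm, 'a, 'b) rcompcat \<Rightarrow>
     (('o, 'm, 'a, 'b) rpmap, ('o, 'm, 'a, 'b) rtrans) cat" where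
  "compcat_hom X Y =
    (let S = {F. rooted_pseudo_map X Y F};
         A = {(F, G, \<alpha>, \<alpha>'). F \<in> S \<and> G \<in> S \<and> rooted_transformation X Y F G \<alpha> \<alpha>'} in
     \<lparr> Obj = S, Arr = A,
       Dom = (\<lambda>(F, G, \<alpha>, \<alpha>') \<in> A. F), Cod = (\<lambda>(F, G, \<alpha>, \<alpha>') \<in> A. G),
       Id = (\<lambda>F \<in> S. (F, F, id_nt (base X) (base Y) (pm_base F),
                            id_nt (total X) (total Y) (pm_total F))),
       Comp = (\<lambda>(G', H, \<beta>, \<beta>') (F, G, \<alpha>, \<alpha>').
         if (G', H, \<beta>, \<beta>') \<in> A \<and> (F, G, \<alpha>, \<alpha>') \<in> A \<and> G = G'
         then (F, H, vcomp_nt (base X) (base Y) \<beta> \<alpha>, vcomp_nt (total X) (total Y) \<beta>' \<alpha>')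
         else undefined) \<rparr>)"

type_synonym ('o, 'm, 'a, 'b) compcat_2cat =
  "(('o, 'm, 'a, 'b) rcompcat, ('o, 'm, 'a, 'b) rpmap, ('o, 'm, 'a, 'b) rtrans) two_cat"

text \<open>The full sub-2-category of rooted comprehension categories on a given class of objects.\<close>

definition CompCat_rtd_on ::
    "('o, 'm, 'a, 'b) rcompcat set \<Rightarrow> ('o, 'm, 'a, 'b) compcat_2cat" where
  "CompCat_rtd_on obs =
     \<lparr> Ob = {X \<in> obs. rooted_compcat X}, Hom = compcat_hom, Unit = id_rpmap,
       HComp = (\<lambda>X Y Z.
         \<lparr> fob = (\<lambda>(G, F) \<in> Obj (compcat_hom Y Z) \<times> Obj (compcat_hom X Y). comp_rpmap X Z G F),
           farr = (\<lambda>((G, G', \<beta>, \<beta>'), (F, F', \<alpha>, \<alpha>')) \<in>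
                      Arr (compcat_hom Y Z) \<times> Arr (compcat_hom X Y).
             (comp_rpmap X Z G F, comp_rpmap X Z G' F',
              hcomp_nt (base X) (base Z) (pm_base G) (pm_base F') \<beta> \<alpha>,
              hcomp_nt (total X) (total Z) (pm_total G) (pm_total F') \<beta>' \<alpha>')) \<rparr>) \<rparr>"

definition CompCat_rtd_triv :: "('o, 'm, 'm, 'm square) compcat_2cat" where
  "CompCat_rtd_triv = CompCat_rtd_on {X. trivial X}"

definition CompCat_rtd_repl_compcl :: "('o, 'm, 'm, 'm square) compcat_2cat" where
  "CompCat_rtd_repl_compcl = CompCat_rtd_on {X. replete X \<and> composition_closed X}"

definition CompCat_inclusion ::
    "(('o, 'm, 'm, 'm square) rcompcat, ('o, 'm, 'm, 'm square) rpmap,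
      ('o, 'm, 'm, 'm square) rtrans,
      ('o, 'm, 'm, 'm square) rcompcat, ('o, 'm, 'm, 'm square) rpmap,
      ('o, 'm, 'm, 'm square) rtrans) two_ftor" where
  "CompCat_inclusion =
     \<lparr> tob = (\<lambda>X. X), thom = (\<lambda>X Y. id_functor (Hom CompCat_rtd_triv X Y)) \<rparr>"

end

theory Submission
  imports Defs
begin

text \<open>
  Call an object \<open>X\<close> of a clan separated if its diagonal \<open>X \<rightarrow> X \<times> X\<close> is a display map.  Every map
  into a separated object is a display map (factor it through its graph, a pullback of the
  diagonal), and separated objects are closed under pullbacks and contain the terminal object, so
  they span a full subcategory with finite limits.  A clan map out of a finite-limit category with
  all maps as display maps preserves products and sends diagonals to display maps, hence takes
  values in separated objects.  The coreflection therefore keeps the separated objects.  As functors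
  and natural transformations do not record their codomain category, the hom-categories of the
  adjunction are literally equal, and the counit is an identity functor read as an inclusion.
\<close>

section \<open>Categories and functors\<close>

text \<open>Strictness leaves no room for choices. Separatedness is a property stable under
  isomorphism, so whether a square is a pullback or an object is terminal is the same question among
  the separated objects and in the whole clan; this makes the two sets of 1-cells equal rather than
  merely equivalent. Two definitions have to be reconciled: a left exact functor preserves limits of
  all finite diagrams, a clan map only pullbacks of display maps and terminal objects. Rebuilding
  finite limits from pullbacks and a terminal object, together with their images under a functor,
  shows that the notions agree when every map is a display map. The second adjunction is not a
  translation of the first: a pseudo map carries comprehension isomorphisms and an isomorphism at
  the root, which a clan map does not record. It uses the first through underlying clans: the base
  functor of a pseudo map out of a trivial object is a clan map, so its values are separated, and
  the extra isomorphisms then lie in the full subcategory.\<close>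

lemma category_facts:
  assumes "category C"
  shows cat_dom: "f \<in> Arr C \<Longrightarrow> Dom C f \<in> Obj C"
    and cat_cod: "f \<in> Arr C \<Longrightarrow> Cod C f \<in> Obj C"
    and cat_id: "X \<in> Obj C \<Longrightarrow> Id C X \<in> Arr C"
    and cat_dom_id: "X \<in> Obj C \<Longrightarrow> Dom C (Id C X) = X"
    and cat_cod_id: "X \<in> Obj C \<Longrightarrow> Cod C (Id C X) = X"
    and cat_comp: "g \<in> Arr C \<Longrightarrow> f \<in> Arr C \<Longrightarrow> Cod C f = Dom C g \<Longrightarrow> Comp C g f \<in> Arr C"
    and cat_dom_comp:
      "g \<in> Arr C \<Longrightarrow> f \<in> Arr C \<Longrightarrow> Cod C f = Dom C g \<Longrightarrow> Dom C (Comp C g f) = Dom C f"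
    and cat_cod_comp:
      "g \<in> Arr C \<Longrightarrow> f \<in> Arr C \<Longrightarrow> Cod C f = Dom C g \<Longrightarrow> Cod C (Comp C g f) = Cod C g"
    and cat_id_right: "f \<in> Arr C \<Longrightarrow> Dom C f = X \<Longrightarrow> Comp C f (Id C X) = f"
    and cat_id_left: "f \<in> Arr C \<Longrightarrow> Cod C f = X \<Longrightarrow> Comp C (Id C X) f = f"
    and cat_assoc: "h \<in> Arr C \<Longrightarrow> g \<in> Arr C \<Longrightarrow> f \<in> Arr C \<Longrightarrow> Cod C f = Dom C g \<Longrightarrow>
      Cod C g = Dom C h \<Longrightarrow> Comp C (Comp C h g) f = Comp C h (Comp C g f)"
    and cat_comp_undefined: "\<not> composable C g f \<Longrightarrow> Comp C g f = undefined"
    and cat_dom_ext: "Dom C \<in> extensional (Arr C)"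
    and cat_cod_ext: "Cod C \<in> extensional (Arr C)"
    and cat_id_ext: "Id C \<in> extensional (Obj C)"
  using assms unfolding category_def homs_def composable_def
  by (auto simp: PiE_def Pi_iff)

text \<open>Always instantiated at a given category, as in \<open>cat_simps[OF C]\<close>. What
  remains are conditional rewrite rules whose premises are facts about sources and targets, which
  the simplifier can discharge.\<close>

lemmas cat_simps = cat_dom cat_cod cat_id cat_dom_id cat_cod_id cat_comp cat_dom_comp cat_cod_comp
  cat_id_right cat_id_left cat_assoc

text \<open>Composites are kept associated to the right, so equations are used after composition with \<open>h\<close>.\<close>

lemma cat_comp_cong:
  assumes "category C" "Comp C g f = Comp C g' f'"
    and "g \<in> Arr C" "f \<in> Arr C" "Cod C f = Dom C g"
    and "g' \<in> Arr C" "f' \<in> Arr C" "Cod C f' = Dom C g'"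
    and "h \<in> Arr C" "Cod C h = Dom C f"
  shows "Comp C g (Comp C f h) = Comp C g' (Comp C f' h)"
proof -
  have "Dom C f = Dom C f'"
    using assms cat_dom_comp[OF assms(1)] by metis
  then show ?thesis using assms cat_assoc[OF assms(1)] by metis
qed

lemma homsD:
  assumes "f \<in> homs C X Y"
  shows "f \<in> Arr C" "Dom C f = X" "Cod C f = Y"
  using assms by (auto simp: homs_def)

lemma homsI: "f \<in> Arr C \<Longrightarrow> Dom C f = X \<Longrightarrow> Cod C f = Y \<Longrightarrow> f \<in> homs C X Y"
  by (simp add: homs_def)

lemma categoryI:
  assumes "\<And>f. f \<in> Arr C \<Longrightarrow> Dom C f \<in> Obj C" "\<And>f. f \<in> Arr C \<Longrightarrow> Cod C f \<in> Obj C"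
    and "\<And>X. X \<in> Obj C \<Longrightarrow> Id C X \<in> homs C X X"
    and "Dom C \<in> extensional (Arr C)" "Cod C \<in> extensional (Arr C)"
    and "Id C \<in> extensional (Obj C)"
    and "\<And>g f. g \<in> Arr C \<Longrightarrow> f \<in> Arr C \<Longrightarrow> Cod C f = Dom C g \<Longrightarrow>
      Comp C g f \<in> homs C (Dom C f) (Cod C g)"
    and "\<And>g f. \<not> composable C g f \<Longrightarrow> Comp C g f = undefined"
    and "\<And>f. f \<in> Arr C \<Longrightarrow> Comp C f (Id C (Dom C f)) = f"
    and "\<And>f. f \<in> Arr C \<Longrightarrow> Comp C (Id C (Cod C f)) f = f"
    and "\<And>h g f. h \<in> Arr C \<Longrightarrow> g \<in> Arr C \<Longrightarrow> f \<in> Arr C \<Longrightarrow> Cod C f = Dom C g \<Longrightarrow>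
      Cod C g = Dom C h \<Longrightarrow> Comp C h (Comp C g f) = Comp C (Comp C h g) f"
  shows "category C"
  using assms unfolding category_def composable_def
  by (auto simp: PiE_def Pi_iff homs_def)

lemma functor_facts:
  assumes "is_functor C D F"
  shows ftor_ob: "X \<in> Obj C \<Longrightarrow> fob F X \<in> Obj D"
    and ftor_arr: "f \<in> Arr C \<Longrightarrow> farr F f \<in> Arr D"
    and ftor_dom: "f \<in> Arr C \<Longrightarrow> Dom D (farr F f) = fob F (Dom C f)"
    and ftor_cod: "f \<in> Arr C \<Longrightarrow> Cod D (farr F f) = fob F (Cod C f)"
    and ftor_id: "X \<in> Obj C \<Longrightarrow> farr F (Id C X) = Id D (fob F X)"
    and ftor_comp: "g \<in> Arr C \<Longrightarrow> f \<in> Arr C \<Longrightarrow> Cod C f = Dom C g \<Longrightarrow>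
      farr F (Comp C g f) = Comp D (farr F g) (farr F f)"
    and ftor_ob_ext: "fob F \<in> extensional (Obj C)"
    and ftor_arr_ext: "farr F \<in> extensional (Arr C)"
  using assms unfolding is_functor_def homs_def composable_def
  by (auto simp: PiE_def Pi_iff)

lemmas ftor_simps = ftor_ob ftor_arr ftor_dom ftor_cod ftor_id ftor_comp

lemma is_functorI:
  assumes "\<And>X. X \<in> Obj C \<Longrightarrow> fob F X \<in> Obj D"
    and "\<And>f. f \<in> Arr C \<Longrightarrow> farr F f \<in> homs D (fob F (Dom C f)) (fob F (Cod C f))"
    and "\<And>X. X \<in> Obj C \<Longrightarrow> farr F (Id C X) = Id D (fob F X)"
    and "\<And>g f. g \<in> Arr C \<Longrightarrow> f \<in> Arr C \<Longrightarrow> Cod C f = Dom C g \<Longrightarrow>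
      farr F (Comp C g f) = Comp D (farr F g) (farr F f)"
    and "fob F \<in> extensional (Obj C)" "farr F \<in> extensional (Arr C)"
  shows "is_functor C D F"
  using assms unfolding is_functor_def composable_def
  by (auto simp: PiE_def Pi_iff homs_def)

text \<open>Functors do not record their target, so \<open>D\<close> and \<open>D'\<close> may
  differ. A functor into a full subcategory can thus be compared with one into the ambient
  category.\<close>

lemma ftor_eqI:
  assumes "is_functor C D F" "is_functor C D' G"
    and "\<And>X. X \<in> Obj C \<Longrightarrow> fob F X = fob G X" "\<And>f. f \<in> Arr C \<Longrightarrow> farr F f = farr G f"
  shows "F = (G :: ('o, 'm, 'p, 'n) ftor)"
proof -
  have "fob F = fob G" "farr F = farr G"
    using assms by (auto intro: extensionalityI ftor_ob_ext ftor_arr_ext)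
  then show ?thesis by simp
qed

lemma id_functor_simps [simp]:
  "X \<in> Obj C \<Longrightarrow> fob (id_functor C) X = X" "f \<in> Arr C \<Longrightarrow> farr (id_functor C) f = f"
  by (simp_all add: id_functor_def)

lemma id_functor: "category C \<Longrightarrow> is_functor C C (id_functor C)"
  by (rule is_functorI) (auto simp: cat_simps id_functor_def intro!: homsI)

lemma fcomp_simps [simp]:
  "X \<in> Obj C \<Longrightarrow> fob (fcomp C G F) X = fob G (fob F X)"
  "f \<in> Arr C \<Longrightarrow> farr (fcomp C G F) f = farr G (farr F f)"
  by (simp_all add: fcomp_def compose_def)

lemma fcomp_functor:
  assumes "category C" "is_functor C D F" "is_functor D E G"
  shows "is_functor C E (fcomp C G F)"
proof (rule is_functorI)
  note [simp] = cat_simps[OF assms(1)] ftor_simps[OF assms(2)] ftor_simps[OF assms(3)]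
  show "fob (fcomp C G F) X \<in> Obj E" if "X \<in> Obj C" for X using that by simp
  show "farr (fcomp C G F) f \<in> homs E (fob (fcomp C G F) (Dom C f)) (fob (fcomp C G F) (Cod C f))"
    if "f \<in> Arr C" for f using that by (intro homsI) simp_all
  show "farr (fcomp C G F) (Id C X) = Id E (fob (fcomp C G F) X)" if "X \<in> Obj C" for X
    using that by simp
  show "farr (fcomp C G F) (Comp C g f) = Comp E (farr (fcomp C G F) g) (farr (fcomp C G F) f)"
    if "g \<in> Arr C" "f \<in> Arr C" "Cod C f = Dom C g" for g f using that by simp
qed (auto simp: fcomp_def)

lemma fcomp_id_left:
  assumes "is_functor C D F"
  shows "fcomp C (id_functor D) F = F"
  using ftor_ob_ext[OF assms] ftor_arr_ext[OF assms]
  unfolding fcomp_def compose_def id_functor_def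
  by (intro ftor.equality) (auto simp: fun_eq_iff ftor_simps[OF assms] extensional_def)

lemma fcomp_id_right:
  assumes "is_functor C D F"
  shows "fcomp C F (id_functor C) = F"
  using ftor_ob_ext[OF assms] ftor_arr_ext[OF assms]
  unfolding fcomp_def compose_def id_functor_def
  by (intro ftor.equality) (auto simp: fun_eq_iff ftor_simps[OF assms] extensional_def)

text \<open>Composites are cut off to \<open>undefined\<close> outside their source. Since
  \<open>F\<close> carries \<open>C\<close> into \<open>D\<close>, the cut-off of the composite of
  \<open>H\<close> and \<open>G\<close> at \<open>D\<close> is never met.\<close>

lemma fcomp_assoc:
  "is_functor C D F \<Longrightarrow> fcomp C H (fcomp C G F) = fcomp C (fcomp D H G) F"
  unfolding fcomp_def compose_def by (rule ftor.equality) (auto simp: fun_eq_iff ftor_simps)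

section \<open>Natural transformations\<close>

lemma nat_trans_facts:
  assumes "nat_trans C D F G \<alpha>"
  shows nt_arr: "X \<in> Obj C \<Longrightarrow> \<alpha> X \<in> Arr D"
    and nt_dom: "X \<in> Obj C \<Longrightarrow> Dom D (\<alpha> X) = fob F X"
    and nt_cod: "X \<in> Obj C \<Longrightarrow> Cod D (\<alpha> X) = fob G X"
    and nt_nat: "f \<in> Arr C \<Longrightarrow>
      Comp D (\<alpha> (Cod C f)) (farr F f) = Comp D (farr G f) (\<alpha> (Dom C f))"
    and nt_ext: "\<alpha> \<in> extensional (Obj C)"
  using assms unfolding nat_trans_def homs_def by (auto simp: PiE_def)

lemmas nt_simps = nt_arr nt_dom nt_cod

lemma nat_transI:
  assumes "\<And>X. X \<in> Obj C \<Longrightarrow> \<alpha> X \<in> homs D (fob F X) (fob G X)"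
    and "\<And>f. f \<in> Arr C \<Longrightarrow>
      Comp D (\<alpha> (Cod C f)) (farr F f) = Comp D (farr G f) (\<alpha> (Dom C f))"
    and "\<alpha> \<in> extensional (Obj C)"
  shows "nat_trans C D F G \<alpha>"
  using assms unfolding nat_trans_def homs_def by (auto simp: PiE_def)

lemma id_nt:
  assumes "category C" "category D" "is_functor C D F"
  shows "nat_trans C D F F (id_nt C D F)"
  using assms
  by (intro nat_transI) (auto simp: id_nt_def cat_simps[OF assms(1)] cat_simps[OF assms(2)]
      ftor_simps[OF assms(3)] intro!: homsI)

lemma vcomp_nt:
  assumes C: "category C" and D: "category D"
    and F: "is_functor C D F" and G: "is_functor C D G" and H: "is_functor C D H"
    and \<alpha>: "nat_trans C D F G \<alpha>" and \<beta>: "nat_trans C D G H \<beta>"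
  shows "nat_trans C D F H (vcomp_nt C D \<beta> \<alpha>)"
proof -
  note [simp] = cat_simps[OF C] cat_simps[OF D] ftor_simps[OF F] ftor_simps[OF G] ftor_simps[OF H]
    nt_simps[OF \<alpha>] nt_simps[OF \<beta>]
  show ?thesis
  proof (rule nat_transI)
    fix f assume f [simp]: "f \<in> Arr C"
    have "Comp D (Comp D (\<beta> (Cod C f)) (\<alpha> (Cod C f))) (farr F f) =
        Comp D (Comp D (\<beta> (Cod C f)) (farr G f)) (\<alpha> (Dom C f))"
      using nt_nat[OF \<alpha> f] by simp
    also have "\<dots> = Comp D (farr H f) (Comp D (\<beta> (Dom C f)) (\<alpha> (Dom C f)))"
      using cat_comp_cong[OF D nt_nat[OF \<beta> f], of "\<alpha> (Dom C f)"] by simp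
    finally show "Comp D (vcomp_nt C D \<beta> \<alpha> (Cod C f)) (farr F f) =
        Comp D (farr H f) (vcomp_nt C D \<beta> \<alpha> (Dom C f))"
      by (simp add: vcomp_nt_def)
  qed (auto simp: vcomp_nt_def intro!: homsI)
qed

text \<open>Naturality of \<alpha>, pushed through \<open>G\<close>, moves \<open>f\<close> past the
  inner component; naturality of \<beta> at \<open>farr F' f\<close> moves it past the outer
  one.\<close>

lemma hcomp_nt:
  assumes C: "category C" and D: "category D" and E: "category E"
    and F: "is_functor C D F" and F': "is_functor C D F'"
    and G: "is_functor D E G" and G': "is_functor D E G'"
    and \<alpha>: "nat_trans C D F F' \<alpha>" and \<beta>: "nat_trans D E G G' \<beta>"
  shows "nat_trans C E (fcomp C G F) (fcomp C G' F') (hcomp_nt C E G F' \<beta> \<alpha>)"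
proof -
  note [simp] = cat_simps[OF C] cat_simps[OF D] cat_simps[OF E] ftor_simps[OF F]
    ftor_simps[OF F'] ftor_simps[OF G] ftor_simps[OF G'] nt_simps[OF \<alpha>] nt_simps[OF \<beta>]
  show ?thesis
  proof (rule nat_transI)
    fix f assume f [simp]: "f \<in> Arr C"
    have "Comp E (farr G (\<alpha> (Cod C f))) (farr G (farr F f)) =
        Comp E (farr G (farr F' f)) (farr G (\<alpha> (Dom C f)))"
      using arg_cong[OF nt_nat[OF \<alpha> f], of "farr G"] by simp
    then have "Comp E (Comp E (\<beta> (fob F' (Cod C f))) (farr G (\<alpha> (Cod C f)))) (farr G (farr F f)) =
        Comp E (\<beta> (fob F' (Cod C f))) (Comp E (farr G (farr F' f)) (farr G (\<alpha> (Dom C f))))"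
      by simp
    also have "\<dots> =
        Comp E (farr G' (farr F' f)) (Comp E (\<beta> (fob F' (Dom C f))) (farr G (\<alpha> (Dom C f))))"
      using cat_comp_cong[OF E nt_nat[OF \<beta>, of "farr F' f"], of "farr G (\<alpha> (Dom C f))"] by simp
    finally show "Comp E (hcomp_nt C E G F' \<beta> \<alpha> (Cod C f)) (farr (fcomp C G F) f) =
        Comp E (farr (fcomp C G' F') f) (hcomp_nt C E G F' \<beta> \<alpha> (Dom C f))"
      by (simp add: hcomp_nt_def)
  qed (auto simp: hcomp_nt_def intro!: homsI)
qed

lemma vcomp_id_left:
  assumes D: "category D" and \<alpha>: "nat_trans C D F G \<alpha>"
  shows "vcomp_nt C D (id_nt C D G) \<alpha> = \<alpha>"
  using nt_ext[OF \<alpha>] by (intro extensionalityI[of _ "Obj C"])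
    (auto simp: vcomp_nt_def id_nt_def cat_simps[OF D] nt_simps[OF \<alpha>])

lemma vcomp_id_right:
  assumes D: "category D" and \<alpha>: "nat_trans C D F G \<alpha>"
  shows "vcomp_nt C D \<alpha> (id_nt C D F) = \<alpha>"
  using nt_ext[OF \<alpha>] by (intro extensionalityI[of _ "Obj C"])
    (auto simp: vcomp_nt_def id_nt_def cat_simps[OF D] nt_simps[OF \<alpha>])

lemma vcomp_assoc:
  assumes D: "category D" and \<alpha>: "nat_trans C D F G \<alpha>" and \<beta>: "nat_trans C D G H \<beta>"
    and \<gamma>: "nat_trans C D H K \<gamma>"
  shows "vcomp_nt C D \<gamma> (vcomp_nt C D \<beta> \<alpha>) = vcomp_nt C D (vcomp_nt C D \<gamma> \<beta>) \<alpha>"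
  by (rule extensionalityI[of _ "Obj C"])
    (auto simp: vcomp_nt_def cat_simps[OF D] nt_simps[OF \<alpha>] nt_simps[OF \<beta>] nt_simps[OF \<gamma>])

lemma hcomp_id:
  assumes "category D" "category E" "is_functor C D F" "is_functor D E G"
  shows "hcomp_nt C E G F (id_nt D E G) (id_nt C D F) = id_nt C E (fcomp C G F)"
  by (rule extensionalityI[of _ "Obj C"])
    (auto simp: hcomp_nt_def id_nt_def cat_simps[OF assms(1)] cat_simps[OF assms(2)]
      ftor_simps[OF assms(3)] ftor_simps[OF assms(4)])

text \<open>The interchange law. Its only content is naturality of \<beta> at the component of
  \<alpha>', which exchanges the two middle factors; the rest is functoriality of
  \<open>G\<close>.\<close>

lemma hcomp_vcomp:
  assumes C: "category C" and D: "category D" and E: "category E"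
    and F: "is_functor C D F" and F': "is_functor C D F'" and F'': "is_functor C D F''"
    and G: "is_functor D E G" and G': "is_functor D E G'" and G'': "is_functor D E G''"
    and \<alpha>: "nat_trans C D F F' \<alpha>" and \<alpha>': "nat_trans C D F' F'' \<alpha>'"
    and \<beta>: "nat_trans D E G G' \<beta>" and \<beta>': "nat_trans D E G' G'' \<beta>'"
  shows "hcomp_nt C E G F'' (vcomp_nt D E \<beta>' \<beta>) (vcomp_nt C D \<alpha>' \<alpha>) =
    vcomp_nt C E (hcomp_nt C E G' F'' \<beta>' \<alpha>') (hcomp_nt C E G F' \<beta> \<alpha>)"
proof (rule extensionalityI[of _ "Obj C"])
  note [simp] = cat_simps[OF C] cat_simps[OF D] cat_simps[OF E] ftor_simps[OF F]
    ftor_simps[OF F'] ftor_simps[OF F''] ftor_simps[OF G] ftor_simps[OF G'] ftor_simps[OF G'']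
    nt_simps[OF \<alpha>] nt_simps[OF \<alpha>'] nt_simps[OF \<beta>] nt_simps[OF \<beta>']
  fix X assume [simp]: "X \<in> Obj C"
  have "Comp E (\<beta> (fob F'' X)) (Comp E (farr G (\<alpha>' X)) (farr G (\<alpha> X))) =
      Comp E (farr G' (\<alpha>' X)) (Comp E (\<beta> (fob F' X)) (farr G (\<alpha> X)))"
    using cat_comp_cong[OF E nt_nat[OF \<beta>, of "\<alpha>' X"], of "farr G (\<alpha> X)"] by simp
  then show "hcomp_nt C E G F'' (vcomp_nt D E \<beta>' \<beta>) (vcomp_nt C D \<alpha>' \<alpha>) X =
      vcomp_nt C E (hcomp_nt C E G' F'' \<beta>' \<alpha>') (hcomp_nt C E G F' \<beta> \<alpha>) X"
    by (simp add: hcomp_nt_def vcomp_nt_def)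
qed (simp_all add: hcomp_nt_def vcomp_nt_def)

text \<open>With the components of \<open>hcomp_nt\<close> written in this order, the two sides
  differ only by functoriality of \<open>H\<close> and associativity; no naturality square
  enters.\<close>

lemma hcomp_assoc:
  assumes D: "category D" and E: "category E" and L: "category L"
    and F': "is_functor C D F'" and G: "is_functor D E G" and G': "is_functor D E G'"
    and H: "is_functor E L H" and H': "is_functor E L H'"
    and \<alpha>: "nat_trans C D F F' \<alpha>" and \<beta>: "nat_trans D E G G' \<beta>" and \<gamma>: "nat_trans E L H H' \<gamma>"
  shows "hcomp_nt C L H (fcomp C G' F') \<gamma> (hcomp_nt C E G F' \<beta> \<alpha>) =
    hcomp_nt C L (fcomp D H G) F' (hcomp_nt D L H G' \<gamma> \<beta>) \<alpha>"
  by (rule extensionalityI[of _ "Obj C"])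
    (auto simp: hcomp_nt_def cat_simps[OF D] cat_simps[OF E] cat_simps[OF L] ftor_simps[OF F']
      ftor_simps[OF G] ftor_simps[OF G'] ftor_simps[OF H] ftor_simps[OF H']
      nt_simps[OF \<alpha>] nt_simps[OF \<beta>] nt_simps[OF \<gamma>])

lemma hcomp_id_left:
  assumes "category D" "is_functor C D F'" and \<alpha>: "nat_trans C D F F' \<alpha>"
  shows "hcomp_nt C D (id_functor D) F' (id_nt D D (id_functor D)) \<alpha> = \<alpha>"
  using nt_ext[OF \<alpha>] by (intro extensionalityI[of _ "Obj C"])
    (auto simp: hcomp_nt_def id_nt_def cat_simps[OF assms(1)] ftor_simps[OF assms(2)] nt_simps[OF \<alpha>])

lemma hcomp_id_right:
  assumes "category C" "category D" "is_functor C D F" and \<alpha>: "nat_trans C D F F' \<alpha>"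
  shows "hcomp_nt C D F (id_functor C) \<alpha> (id_nt C C (id_functor C)) = \<alpha>"
  using nt_ext[OF \<alpha>] by (intro extensionalityI[of _ "Obj C"])
    (auto simp: hcomp_nt_def id_nt_def cat_simps[OF assms(1)] cat_simps[OF assms(2)]
      ftor_simps[OF assms(3)] nt_simps[OF \<alpha>])

section \<open>Strict 2-categories\<close>

lemma prod_cat_simps:
  "Obj (prod_cat C D) = Obj C \<times> Obj D"
  "Arr (prod_cat C D) = Arr C \<times> Arr D"
  "f \<in> Arr C \<Longrightarrow> g \<in> Arr D \<Longrightarrow> Dom (prod_cat C D) (f, g) = (Dom C f, Dom D g)"
  "f \<in> Arr C \<Longrightarrow> g \<in> Arr D \<Longrightarrow> Cod (prod_cat C D) (f, g) = (Cod C f, Cod D g)"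
  "X \<in> Obj C \<Longrightarrow> Y \<in> Obj D \<Longrightarrow> Id (prod_cat C D) (X, Y) = (Id C X, Id D Y)"
  "composable C f' f \<Longrightarrow> composable D g' g \<Longrightarrow>
    Comp (prod_cat C D) (f', g') (f, g) = (Comp C f' f, Comp D g' g)"
  by (simp_all add: prod_cat_def)

lemma two_category_facts:
  assumes "two_category K" "X \<in> Ob K" "Y \<in> Ob K"
  shows hom_category: "category (Hom K X Y)"
    and unit_obj: "Unit K X \<in> Obj (Hom K X X)"
    and hcomp_functor: "Z \<in> Ob K \<Longrightarrow>
      is_functor (prod_cat (Hom K Y Z) (Hom K X Y)) (Hom K X Z) (HComp K X Y Z)"
    and comp1_unit_left: "f \<in> Obj (Hom K X Y) \<Longrightarrow> comp1 K X Y Y (Unit K Y) f = f"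
    and comp2_unit_left: "a \<in> Arr (Hom K X Y) \<Longrightarrow>
      comp2 K X Y Y (Id (Hom K Y Y) (Unit K Y)) a = a"
  using assms unfolding two_category_def by blast+

lemma two_category_assoc:
  assumes "two_category K" "W \<in> Ob K" "X \<in> Ob K" "Y \<in> Ob K" "Z \<in> Ob K"
  shows comp1_assoc: "h \<in> Obj (Hom K Y Z) \<Longrightarrow> g \<in> Obj (Hom K X Y) \<Longrightarrow> f \<in> Obj (Hom K W X) \<Longrightarrow>
      comp1 K W X Z (comp1 K X Y Z h g) f = comp1 K W Y Z h (comp1 K W X Y g f)"
    and comp2_assoc: "c \<in> Arr (Hom K Y Z) \<Longrightarrow> b \<in> Arr (Hom K X Y) \<Longrightarrow> a \<in> Arr (Hom K W X) \<Longrightarrow>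
      comp2 K W X Z (comp2 K X Y Z c b) a = comp2 K W Y Z c (comp2 K W X Y b a)"
  using assms unfolding two_category_def by metis+

text \<open>Functoriality of \<open>HComp\<close>, read off at pairs: preservation of composition in
  the product category is the interchange law.\<close>

lemma comp_facts:
  assumes "two_category K" "X \<in> Ob K" "Y \<in> Ob K" "Z \<in> Ob K"
  shows comp1_obj: "g \<in> Obj (Hom K Y Z) \<Longrightarrow> f \<in> Obj (Hom K X Y) \<Longrightarrow>
      comp1 K X Y Z g f \<in> Obj (Hom K X Z)"
    and comp2_arr: "b \<in> Arr (Hom K Y Z) \<Longrightarrow> a \<in> Arr (Hom K X Y) \<Longrightarrow>
      comp2 K X Y Z b a \<in> Arr (Hom K X Z)"
    and comp2_dom: "b \<in> Arr (Hom K Y Z) \<Longrightarrow> a \<in> Arr (Hom K X Y) \<Longrightarrow>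
      Dom (Hom K X Z) (comp2 K X Y Z b a) = comp1 K X Y Z (Dom (Hom K Y Z) b) (Dom (Hom K X Y) a)"
    and comp2_cod: "b \<in> Arr (Hom K Y Z) \<Longrightarrow> a \<in> Arr (Hom K X Y) \<Longrightarrow>
      Cod (Hom K X Z) (comp2 K X Y Z b a) = comp1 K X Y Z (Cod (Hom K Y Z) b) (Cod (Hom K X Y) a)"
    and comp2_id: "g \<in> Obj (Hom K Y Z) \<Longrightarrow> f \<in> Obj (Hom K X Y) \<Longrightarrow>
      comp2 K X Y Z (Id (Hom K Y Z) g) (Id (Hom K X Y) f) = Id (Hom K X Z) (comp1 K X Y Z g f)"
    and comp2_interchange: "composable (Hom K Y Z) b' b \<Longrightarrow> composable (Hom K X Y) a' a \<Longrightarrow>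
      comp2 K X Y Z (Comp (Hom K Y Z) b' b) (Comp (Hom K X Y) a' a) =
      Comp (Hom K X Z) (comp2 K X Y Z b' a') (comp2 K X Y Z b a)"
proof -
  note F = ftor_simps[OF hcomp_functor[OF assms]]
  note [simp] = prod_cat_simps comp1_def comp2_def
  show "comp1 K X Y Z g f \<in> Obj (Hom K X Z)"
    if "g \<in> Obj (Hom K Y Z)" "f \<in> Obj (Hom K X Y)" for g f
    using F(1)[of "(g, f)"] that by simp
  show "comp2 K X Y Z b a \<in> Arr (Hom K X Z)"
    "Dom (Hom K X Z) (comp2 K X Y Z b a) = comp1 K X Y Z (Dom (Hom K Y Z) b) (Dom (Hom K X Y) a)"
    "Cod (Hom K X Z) (comp2 K X Y Z b a) = comp1 K X Y Z (Cod (Hom K Y Z) b) (Cod (Hom K X Y) a)"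
    if "b \<in> Arr (Hom K Y Z)" "a \<in> Arr (Hom K X Y)" for b a
    using F(2,3,4)[of "(b, a)"] that by simp_all
  show "comp2 K X Y Z (Id (Hom K Y Z) g) (Id (Hom K X Y) f) = Id (Hom K X Z) (comp1 K X Y Z g f)"
    if "g \<in> Obj (Hom K Y Z)" "f \<in> Obj (Hom K X Y)" for g f
    using F(5)[of "(g, f)"] that by simp
  show "comp2 K X Y Z (Comp (Hom K Y Z) b' b) (Comp (Hom K X Y) a' a) =
      Comp (Hom K X Z) (comp2 K X Y Z b' a') (comp2 K X Y Z b a)"
    if "composable (Hom K Y Z) b' b" "composable (Hom K X Y) a' a" for b' b a' a
    using F(6)[of "(b', a')" "(b, a)"] that by (simp add: composable_def)
qed

text \<open>
  The right adjoint of a locally full inclusion whose hom-categories into \<open>Y\<close> literally are those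
  into \<open>r Y\<close>: the counit at \<open>Y\<close> is the unit 1-cell of \<open>r Y\<close> read as a 1-cell into \<open>Y\<close>.
\<close>

lemma has_right_2_adjointI:
  fixes K :: "('x, 'f, 'a) two_cat" and L :: "('y, 'f, 'a) two_cat"
  assumes K: "two_category K" and L: "two_category L"
    and I: "I = \<lparr> tob = i, thom = (\<lambda>X X'. id_functor (Hom K X X')) \<rparr>"
    and i: "\<And>X. X \<in> Ob K \<Longrightarrow> i X \<in> Ob L"
    and hom_i: "\<And>X X'. X \<in> Ob K \<Longrightarrow> X' \<in> Ob K \<Longrightarrow> Hom L (i X) (i X') = Hom K X X'"
    and unit_i: "\<And>X. X \<in> Ob K \<Longrightarrow> Unit L (i X) = Unit K X"
    and hcomp_i: "\<And>X X' X''. X \<in> Ob K \<Longrightarrow> X' \<in> Ob K \<Longrightarrow> X'' \<in> Ob K \<Longrightarrow>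
      HComp L (i X) (i X') (i X'') = HComp K X X' X''"
    and r: "\<And>Y. Y \<in> Ob L \<Longrightarrow> r Y \<in> Ob K"
    and hom_r: "\<And>X Y. X \<in> Ob K \<Longrightarrow> Y \<in> Ob L \<Longrightarrow> Hom L (i X) Y = Hom K X (r Y)"
    and hcomp_r: "\<And>X X' Y. X \<in> Ob K \<Longrightarrow> X' \<in> Ob K \<Longrightarrow> Y \<in> Ob L \<Longrightarrow>
      HComp L (i X) (i X') Y = HComp K X X' (r Y)"
  shows "has_right_2_adjoint K L I"
proof -
  have comp_i: "comp1 L (i X) (i X') (i X'') = comp1 K X X' X''"
    "comp2 L (i X) (i X') (i X'') = comp2 K X X' X''"
    if "X \<in> Ob K" "X' \<in> Ob K" "X'' \<in> Ob K" for X X' X''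
    using that by (simp_all add: fun_eq_iff comp1_def comp2_def hcomp_i)
  have comp_r: "comp1 K X X' (r Y) = comp1 L (i X) (i X') Y"
    "comp2 K X X' (r Y) = comp2 L (i X) (i X') Y"
    if "X \<in> Ob K" "X' \<in> Ob K" "Y \<in> Ob L" for X X' Y
    using that by (simp_all add: fun_eq_iff comp1_def comp2_def hcomp_r)
  have T: "two_functor K L I"
    unfolding two_functor_def I
    using hom_category[OF K] unit_obj[OF K] comp1_obj[OF K] comp2_arr[OF K]
    by (auto simp: i hom_i unit_i comp_i id_functor)

  define \<epsilon> where "\<epsilon> Y = Unit K (r Y)" for Y
  \<comment> \<open>The identity 2-cell on the counit; composing with it gives the action of the
    right adjoint on 2-cells.\<close>
  define \<epsilon>2 where "\<epsilon>2 Y = Id (Hom K (r Y) (r Y)) (\<epsilon> Y)" for Y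
  have \<epsilon>: "\<epsilon> Y \<in> Obj (Hom L (i (r Y)) Y)" if "Y \<in> Ob L" for Y
    using unit_obj[OF K, of "r Y" "r Y"] that by (simp add: hom_r r \<epsilon>_def)
  have \<epsilon>2_eq: "\<epsilon>2 Y = Id (Hom L (i (r Y)) Y) (\<epsilon> Y)" if "Y \<in> Ob L" for Y
    using that by (simp add: \<epsilon>2_def hom_r r)
  have cat: "category (Hom L (i (r Y)) Y)" if "Y \<in> Ob L" for Y
    using hom_category[OF L] that by (simp add: i r)
  have \<epsilon>2: "\<epsilon>2 Y \<in> Arr (Hom L (i (r Y)) Y)"
    "Dom (Hom L (i (r Y)) Y) (\<epsilon>2 Y) = \<epsilon> Y" "Cod (Hom L (i (r Y)) Y) (\<epsilon>2 Y) = \<epsilon> Y"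
    "Comp (Hom L (i (r Y)) Y) (\<epsilon>2 Y) (\<epsilon>2 Y) = \<epsilon>2 Y" if "Y \<in> Ob L" for Y
    using that \<epsilon>[OF that] by (simp_all add: \<epsilon>2_eq cat_simps[OF cat])
  \<comment> \<open>Composition of 1-cells into \<open>Y\<close> in \<open>L\<close> is composition
    of 1-cells into \<open>r Y\<close> in \<open>K\<close>, and there the counit is a unit
    1-cell.\<close>
  have \<epsilon>_left: "comp1 L (i X) (i (r Y)) Y (\<epsilon> Y) k = k"
    if "X \<in> Ob K" "Y \<in> Ob L" "k \<in> Obj (Hom L (i X) Y)" for X Y k
    using comp1_unit_left[OF K, of X "r Y" k] that by (simp add: r hom_r comp_r \<epsilon>_def)
  have \<epsilon>2_left: "comp2 L (i X) (i (r Y)) Y (\<epsilon>2 Y) k = k"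
    if "X \<in> Ob K" "Y \<in> Ob L" "k \<in> Arr (Hom L (i X) Y)" for X Y k
    using comp2_unit_left[OF K, of X "r Y" k] that by (simp add: r hom_r comp_r \<epsilon>_def \<epsilon>2_def)

  have hom_ir: "Hom L (i X) (i (r Y)) = Hom L (i X) Y" if "X \<in> Ob K" "Y \<in> Ob L" for X Y
    using that by (simp add: hom_i hom_r r)

  \<comment> \<open>A 1-cell \<open>g\<close> goes to its composite with the counit. This is a
    1-cell of \<open>L\<close> from \<open>i (r Y)\<close> to \<open>Y'\<close>, hence, the
    hom-categories being equal, a 1-cell of \<open>K\<close> from \<open>r Y\<close> to
    \<open>r Y'\<close>. Nothing is chosen, so strict functoriality can hold.\<close>
  define R :: "('y, 'f, 'a, 'x, 'f, 'a) two_ftor" where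
    "R = \<lparr> tob = r, thom = (\<lambda>Y Y'.
      \<lparr> fob = (\<lambda>g \<in> Obj (Hom L Y Y'). comp1 L (i (r Y)) Y Y' g (\<epsilon> Y)),
        farr = (\<lambda>b \<in> Arr (Hom L Y Y'). comp2 L (i (r Y)) Y Y' b (\<epsilon>2 Y)) \<rparr>) \<rparr>"
  have R_simps: "tob R = r"
    "g \<in> Obj (Hom L Y Y') \<Longrightarrow> fob (thom R Y Y') g = comp1 L (i (r Y)) Y Y' g (\<epsilon> Y)"
    "b \<in> Arr (Hom L Y Y') \<Longrightarrow> farr (thom R Y Y') b = comp2 L (i (r Y)) Y Y' b (\<epsilon>2 Y)" for Y Y' g b
    by (simp_all add: R_def)

  have "two_functor L K R"
    unfolding two_functor_def
  proof (intro conjI ballI)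
    fix Y Y' assume [simp]: "Y \<in> Ob L" "Y' \<in> Ob L"
    note [simp] = cat_simps[OF hom_category[OF L, of Y Y']]
    have hom: "Hom K (r Y) (r Y') = Hom L (i (r Y)) Y'" by (simp add: hom_r r)
    show "is_functor (Hom L Y Y') (Hom K (tob R Y) (tob R Y')) (thom R Y Y')"
      unfolding R_simps(1) hom
    proof (rule is_functorI)
      show "farr (thom R Y Y') (Comp (Hom L Y Y') b' b) =
          Comp (Hom L (i (r Y)) Y') (farr (thom R Y Y') b') (farr (thom R Y Y') b)"
        if "b' \<in> Arr (Hom L Y Y')" "b \<in> Arr (Hom L Y Y')" "Cod (Hom L Y Y') b = Dom (Hom L Y Y') b'"
        for b' b
        using comp2_interchange[OF L, of "i (r Y)" Y Y' b' b "\<epsilon>2 Y" "\<epsilon>2 Y"] that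
        by (simp add: R_simps i r \<epsilon>2 composable_def)
      show "farr (thom R Y Y') (Id (Hom L Y Y') g) = Id (Hom L (i (r Y)) Y') (fob (thom R Y Y') g)"
        if "g \<in> Obj (Hom L Y Y')" for g
        using that by (simp add: R_simps i r \<epsilon> \<epsilon>2_eq comp2_id[OF L])
    qed (auto simp: R_def i r \<epsilon> \<epsilon>2 comp1_obj[OF L] comp2_arr[OF L] comp2_dom[OF L] comp2_cod[OF L]
        intro!: homsI)
  next
    fix Y assume "Y \<in> Ob L"
    then show "fob (thom R Y Y) (Unit L Y) = Unit K (tob R Y)"
      by (simp add: R_simps unit_obj[OF L] comp1_unit_left[OF L] i r \<epsilon>)
        (simp add: \<epsilon>_def)
  next
    \<comment> \<open>The computation is (g \<epsilon>) (f \<epsilon>) = g (\<epsilon> (f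
      \<epsilon>)) = g (f \<epsilon>) = (g f) \<epsilon>: the inner counit is absorbed as a left
      unit.\<close>
    fix Y Y' Y'' g f
    assume "Y \<in> Ob L" "Y' \<in> Ob L" "Y'' \<in> Ob L" "g \<in> Obj (Hom L Y' Y'')" "f \<in> Obj (Hom L Y Y')"
    then show "fob (thom R Y Y'') (comp1 L Y Y' Y'' g f) =
        comp1 K (tob R Y) (tob R Y') (tob R Y'') (fob (thom R Y' Y'') g) (fob (thom R Y Y') f)"
      by (simp add: R_simps comp1_obj[OF L] comp_r i r hom_ir \<epsilon> \<epsilon>_left comp1_assoc[OF L])
  next
    fix Y Y' Y'' b a
    assume "Y \<in> Ob L" "Y' \<in> Ob L" "Y'' \<in> Ob L" "b \<in> Arr (Hom L Y' Y'')" "a \<in> Arr (Hom L Y Y')"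
    then show "farr (thom R Y Y'') (comp2 L Y Y' Y'' b a) =
        comp2 K (tob R Y) (tob R Y') (tob R Y'') (farr (thom R Y' Y'') b) (farr (thom R Y Y') a)"
      by (simp add: R_simps comp2_arr[OF L] comp_r i r hom_ir \<epsilon>2 \<epsilon>2_left comp2_assoc[OF L])
  qed (simp add: R_simps r)
  moreover
  define \<Phi> where "\<Phi> X Y = id_functor (Hom L (i X) Y)" for X Y
  have "cat_iso (Hom L (tob I X) Y) (Hom K X (tob R Y)) (\<Phi> X Y)" if "X \<in> Ob K" "Y \<in> Ob L" for X Y
  proof -
    have c: "category (Hom L (i X) Y)" using that by (simp add: hom_category[OF L] i)
    show ?thesis
      unfolding cat_iso_def I \<Phi>_def R_simps two_ftor.simps hom_r[OF that, symmetric]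
      using id_functor[OF c] fcomp_id_left[OF id_functor[OF c]] by blast
  qed
  ultimately have "is_right_2_adjoint K L I R"
    unfolding is_right_2_adjoint_def
  proof (intro conjI exI[of _ \<Phi>] ballI)
    \<comment> \<open>As \<Phi> is an identity, naturality says that (g \<epsilon>) (h f) = g (h f),
      which is again absorption of the counit from the left.\<close>
    fix X X' Y Y' f g h
    assume "X \<in> Ob K" "X' \<in> Ob K" "Y \<in> Ob L" "Y' \<in> Ob L" "f \<in> Obj (Hom K X' X)"
      "g \<in> Obj (Hom L Y Y')" "h \<in> Obj (Hom L (tob I X) Y)"
    moreover from this have "f \<in> Obj (Hom L (i X') (i X))" by (simp add: hom_i)
    ultimately show "fob (\<Phi> X' Y') (comp1 L (tob I X') Y Y' g
          (comp1 L (tob I X') (tob I X) Y h (fob (thom I X' X) f))) =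
        comp1 K X' (tob R Y) (tob R Y') (fob (thom R Y Y') g)
          (comp1 K X' X (tob R Y) (fob (\<Phi> X Y) h) f)"
      by (simp add: \<Phi>_def I R_simps comp_r i r comp1_obj[OF L] comp1_assoc[OF L] hom_ir \<epsilon> \<epsilon>_left)
  next
    fix X X' Y Y' a b c
    assume "X \<in> Ob K" "X' \<in> Ob K" "Y \<in> Ob L" "Y' \<in> Ob L" "a \<in> Arr (Hom K X' X)"
      "b \<in> Arr (Hom L Y Y')" "c \<in> Arr (Hom L (tob I X) Y)"
    moreover from this have "a \<in> Arr (Hom L (i X') (i X))" by (simp add: hom_i)
    ultimately show "farr (\<Phi> X' Y') (comp2 L (tob I X') Y Y' b
          (comp2 L (tob I X') (tob I X) Y c (farr (thom I X' X) a))) =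
        comp2 K X' (tob R Y) (tob R Y') (farr (thom R Y Y') b)
          (comp2 K X' X (tob R Y) (farr (\<Phi> X Y) c) a)"
      by (simp add: \<Phi>_def I R_simps comp_r i r comp2_arr[OF L] comp2_assoc[OF L] hom_ir \<epsilon>2 \<epsilon>2_left)
  qed
  with K L T show ?thesis unfolding has_right_2_adjoint_def by blast
qed

section \<open>Functor categories and 2-categories of categories with structure\<close>

lemma functor_cat_simps:
  "Obj (functor_cat C D S) = S"
  "(F, G, \<alpha>) \<in> Arr (functor_cat C D S) \<longleftrightarrow> F \<in> S \<and> G \<in> S \<and> nat_trans C D F G \<alpha>"
  "F \<in> S \<Longrightarrow> G \<in> S \<Longrightarrow> nat_trans C D F G \<alpha> \<Longrightarrow> Dom (functor_cat C D S) (F, G, \<alpha>) = F"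
  "F \<in> S \<Longrightarrow> G \<in> S \<Longrightarrow> nat_trans C D F G \<alpha> \<Longrightarrow> Cod (functor_cat C D S) (F, G, \<alpha>) = G"
  "F \<in> S \<Longrightarrow> Id (functor_cat C D S) F = (F, F, id_nt C D F)"
  "F \<in> S \<Longrightarrow> G \<in> S \<Longrightarrow> H \<in> S \<Longrightarrow> nat_trans C D F G \<alpha> \<Longrightarrow> nat_trans C D G H \<beta> \<Longrightarrow>
    Comp (functor_cat C D S) (G, H, \<beta>) (F, G, \<alpha>) = (F, H, vcomp_nt C D \<beta> \<alpha>)"
  by (simp_all add: functor_cat_def Let_def)

lemma functor_cat_undefined:
  "\<not> composable (functor_cat C D S) g f \<Longrightarrow> Comp (functor_cat C D S) g f = undefined"
  by (cases g; cases f) (auto simp: functor_cat_def Let_def composable_def)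

lemma category_functor_cat:
  assumes C: "category C" and D: "category D" and S: "\<And>F. F \<in> S \<Longrightarrow> is_functor C D F"
  shows "category (functor_cat C D S)"
proof -
  have v: "nat_trans C D F H (vcomp_nt C D \<beta> \<alpha>)"
    if "nat_trans C D F G \<alpha>" "nat_trans C D G H \<beta>" "F \<in> S" "G \<in> S" "H \<in> S" for F G H \<alpha> \<beta>
    using vcomp_nt[OF C D] that S by blast
  show ?thesis
  proof (rule categoryI)
    show "Dom (functor_cat C D S) \<in> extensional (Arr (functor_cat C D S))"
      "Cod (functor_cat C D S) \<in> extensional (Arr (functor_cat C D S))"
      "Id (functor_cat C D S) \<in> extensional (Obj (functor_cat C D S))"
      by (simp_all add: functor_cat_def Let_def)
  qed (auto simp: v functor_cat_simps functor_cat_undefined homs_def composable_def S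
      id_nt[OF C D] vcomp_id_left[OF D] vcomp_id_right[OF D] vcomp_assoc[OF D])
qed

lemma cat_two_cat_simps:
  "Ob (cat_two_cat obs und S) = obs"
  "Hom (cat_two_cat obs und S) X Y = functor_cat (und X) (und Y) (S X Y)"
  "Unit (cat_two_cat obs und S) X = id_functor (und X)"
  by (simp_all add: cat_two_cat_def Let_def)

lemma cat_two_cat_comp:
  "G \<in> S Y Z \<Longrightarrow> F \<in> S X Y \<Longrightarrow> comp1 (cat_two_cat obs und S) X Y Z G F = fcomp (und X) G F"
  "(G, G', \<beta>) \<in> Arr (functor_cat (und Y) (und Z) (S Y Z)) \<Longrightarrow>
    (F, F', \<alpha>) \<in> Arr (functor_cat (und X) (und Y) (S X Y)) \<Longrightarrow>
    comp2 (cat_two_cat obs und S) X Y Z (G, G', \<beta>) (F, F', \<alpha>) =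
    (fcomp (und X) G F, fcomp (und X) G' F', hcomp_nt (und X) (und Z) G F' \<beta> \<alpha>)"
  by (simp_all add: cat_two_cat_def Let_def comp1_def comp2_def functor_cat_simps(1))

text \<open>The structure restricts 1-cells only, and 2-cells are all natural transformations
  between them. So closure of \<open>S\<close> under identities and composition is the sole
  condition specific to the structure; the remaining axioms are those of categories, functors and
  natural transformations.\<close>

lemma two_category_cat_two_cat:
  assumes und: "\<And>X. X \<in> obs \<Longrightarrow> category (und X)"
    and S: "\<And>X Y F. X \<in> obs \<Longrightarrow> Y \<in> obs \<Longrightarrow> F \<in> S X Y \<Longrightarrow> is_functor (und X) (und Y) F"
    and S_id: "\<And>X. X \<in> obs \<Longrightarrow> id_functor (und X) \<in> S X X"
    and S_comp: "\<And>X Y Z G F. X \<in> obs \<Longrightarrow> Y \<in> obs \<Longrightarrow> Z \<in> obs \<Longrightarrow> G \<in> S Y Z \<Longrightarrow> F \<in> S X Y \<Longrightarrow>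
      fcomp (und X) G F \<in> S X Z"
  shows "two_category (cat_two_cat obs und S)"
proof -
  let ?K = "cat_two_cat obs und S"
  let ?H = "\<lambda>X Y. functor_cat (und X) (und Y) (S X Y)"
  have hcomp: "nat_trans (und X) (und Z) (fcomp (und X) G F) (fcomp (und X) G' F')
      (hcomp_nt (und X) (und Z) G F' \<beta> \<alpha>)"
    if "X \<in> obs" "Y \<in> obs" "Z \<in> obs" "G \<in> S Y Z" "G' \<in> S Y Z" "F \<in> S X Y" "F' \<in> S X Y"
      "nat_trans (und X) (und Y) F F' \<alpha>" "nat_trans (und Y) (und Z) G G' \<beta>" for X Y Z F F' G G' \<alpha> \<beta>
    using that by (intro hcomp_nt[of "und X" "und Y"]) (auto intro: und S)
  have HComp: "is_functor (prod_cat (?H Y Z) (?H X Y)) (?H X Z) (HComp ?K X Y Z)"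
    if XYZ [simp]: "X \<in> obs" "Y \<in> obs" "Z \<in> obs" for X Y Z
  proof (rule is_functorI)
    have fob: "fob (HComp ?K X Y Z) p = fcomp (und X) (fst p) (snd p)" if "p \<in> S Y Z \<times> S X Y" for p
      using that by (auto simp: cat_two_cat_def Let_def functor_cat_simps(1))
    have farr: "farr (HComp ?K X Y Z) ((G, G', \<beta>), (F, F', \<alpha>)) =
        (fcomp (und X) G F, fcomp (und X) G' F', hcomp_nt (und X) (und Z) G F' \<beta> \<alpha>)"
      if "G \<in> S Y Z" "G' \<in> S Y Z" "nat_trans (und Y) (und Z) G G' \<beta>"
        "F \<in> S X Y" "F' \<in> S X Y" "nat_trans (und X) (und Y) F F' \<alpha>" for G G' \<beta> F F' \<alpha>
      using that by (simp add: cat_two_cat_def Let_def functor_cat_simps)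
    note [simp] = fob farr prod_cat_simps functor_cat_simps
    show "fob (HComp ?K X Y Z) p \<in> Obj (?H X Z)" if "p \<in> Obj (prod_cat (?H Y Z) (?H X Y))" for p
      using that by (auto intro: S_comp[of X Y Z])
    show "farr (HComp ?K X Y Z) p \<in> homs (?H X Z)
        (fob (HComp ?K X Y Z) (Dom (prod_cat (?H Y Z) (?H X Y)) p))
        (fob (HComp ?K X Y Z) (Cod (prod_cat (?H Y Z) (?H X Y)) p))"
      if "p \<in> Arr (prod_cat (?H Y Z) (?H X Y))" for p
      using that by (cases p) (auto simp: hcomp[of X Y Z] S_comp[of X Y Z] intro!: homsI)
    show "farr (HComp ?K X Y Z) (Id (prod_cat (?H Y Z) (?H X Y)) p) =
        Id (?H X Z) (fob (HComp ?K X Y Z) p)" if "p \<in> Obj (prod_cat (?H Y Z) (?H X Y))" for p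
      using that by (cases p) (auto simp: S_comp[of X Y Z] id_nt und S
          hcomp_id[OF und und S S, of Y Z X])
    show "farr (HComp ?K X Y Z) (Comp (prod_cat (?H Y Z) (?H X Y)) q p) =
        Comp (?H X Z) (farr (HComp ?K X Y Z) q) (farr (HComp ?K X Y Z) p)"
      if "q \<in> Arr (prod_cat (?H Y Z) (?H X Y))" "p \<in> Arr (prod_cat (?H Y Z) (?H X Y))"
        "Cod (prod_cat (?H Y Z) (?H X Y)) p = Dom (prod_cat (?H Y Z) (?H X Y)) q" for q p
    proof -
      obtain G G' \<beta> F F' \<alpha> where p: "p = ((G, G', \<beta>), (F, F', \<alpha>))" by (cases p) auto
      obtain G1 G'' \<beta>' F1 F'' \<alpha>' where q: "q = ((G1, G'', \<beta>'), (F1, F'', \<alpha>'))" by (cases q) auto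
      have [simp]: "G1 = G'" "F1 = F'" using that by (auto simp: p q)
      have *: "G \<in> S Y Z" "G' \<in> S Y Z" "G'' \<in> S Y Z" "F \<in> S X Y" "F' \<in> S X Y" "F'' \<in> S X Y"
        "nat_trans (und Y) (und Z) G G' \<beta>" "nat_trans (und Y) (und Z) G' G'' \<beta>'"
        "nat_trans (und X) (und Y) F F' \<alpha>" "nat_trans (und X) (und Y) F' F'' \<alpha>'"
        using that by (auto simp: p q)
      moreover have "nat_trans (und Y) (und Z) G G'' (vcomp_nt (und Y) (und Z) \<beta>' \<beta>)"
        "nat_trans (und X) (und Y) F F'' (vcomp_nt (und X) (und Y) \<alpha>' \<alpha>)"
        by (rule vcomp_nt[OF und und S S S *(7,8)] vcomp_nt[OF und und S S S *(9,10)];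
            rule XYZ *)+
      moreover have "hcomp_nt (und X) (und Z) G F'' (vcomp_nt (und Y) (und Z) \<beta>' \<beta>)
          (vcomp_nt (und X) (und Y) \<alpha>' \<alpha>) =
        vcomp_nt (und X) (und Z) (hcomp_nt (und X) (und Z) G' F'' \<beta>' \<alpha>')
          (hcomp_nt (und X) (und Z) G F' \<beta> \<alpha>)"
        by (rule hcomp_vcomp[OF und und und S S S S S S *(9,10,7,8)]) (use XYZ * in blast)+
      ultimately show ?thesis
        by (simp add: p q composable_def hcomp[of X Y Z] S_comp[of X Y Z])
    qed
  qed (auto simp: cat_two_cat_def Let_def functor_cat_simps prod_cat_simps)
  have hassoc: "hcomp_nt (und W) (und Z) (fcomp (und X) H G) F' (hcomp_nt (und X) (und Z) H G' \<gamma> \<beta>) \<alpha> =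
      hcomp_nt (und W) (und Z) H (fcomp (und W) G' F') \<gamma> (hcomp_nt (und W) (und Y) G F' \<beta> \<alpha>)"
    if "W \<in> obs" "X \<in> obs" "Y \<in> obs" "Z \<in> obs" "F' \<in> S W X" "G \<in> S X Y" "G' \<in> S X Y"
      "H \<in> S Y Z" "H' \<in> S Y Z" "nat_trans (und W) (und X) F F' \<alpha>"
      "nat_trans (und X) (und Y) G G' \<beta>" "nat_trans (und Y) (und Z) H H' \<gamma>"
    for W X Y Z F F' G G' H H' \<alpha> \<beta> \<gamma>
    by (rule hcomp_assoc[OF und und und S S S S S that(10-12), symmetric]; rule that)
  have fassoc: "fcomp (und W) (fcomp (und X) H G) F = fcomp (und W) H (fcomp (und W) G F)"
    if "W \<in> obs" "X \<in> obs" "F \<in> S W X" for W X F G H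
    by (rule fcomp_assoc[OF S[OF that], symmetric])
  show ?thesis
    unfolding two_category_def cat_two_cat_simps
  proof (intro conjI ballI)
    fix X Y a assume "X \<in> obs" "Y \<in> obs" "a \<in> Arr (?H X Y)"
    then show "comp2 ?K X Y Y (Id (?H Y Y) (id_functor (und Y))) a = a"
      "comp2 ?K X X Y a (Id (?H X X) (id_functor (und X))) = a"
      by (cases a; auto simp: cat_two_cat_comp functor_cat_simps id_nt S_id S und id_functor
          fcomp_id_left[OF S] fcomp_id_right[OF S] hcomp_id_left[OF und S]
          hcomp_id_right[OF und und S])+
  next
    fix W X Y Z c b a assume "W \<in> obs" "X \<in> obs" "Y \<in> obs" "Z \<in> obs"
      "c \<in> Arr (?H Y Z)" "b \<in> Arr (?H X Y)" "a \<in> Arr (?H W X)"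
    then obtain F F' \<alpha> G G' \<beta> H H' \<gamma> where
      abc: "a = (F, F', \<alpha>)" "b = (G, G', \<beta>)" "c = (H, H', \<gamma>)"
      and obs: "W \<in> obs" "X \<in> obs" "Y \<in> obs" "Z \<in> obs"
      and F: "F \<in> S W X" "F' \<in> S W X" and G: "G \<in> S X Y" "G' \<in> S X Y"
      and H: "H \<in> S Y Z" "H' \<in> S Y Z" and \<alpha>: "nat_trans (und W) (und X) F F' \<alpha>"
      and \<beta>: "nat_trans (und X) (und Y) G G' \<beta>" and \<gamma>: "nat_trans (und Y) (und Z) H H' \<gamma>"
      by (cases a; cases b; cases c) (auto simp: functor_cat_simps)
    note SC = S_comp[OF obs(1-3)] S_comp[OF obs(2-4)]
    have ba: "nat_trans (und W) (und Y) (fcomp (und W) G F) (fcomp (und W) G' F')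
        (hcomp_nt (und W) (und Y) G F' \<beta> \<alpha>)"
      by (rule hcomp[OF obs(1-3) G F \<alpha> \<beta>])
    have cb: "nat_trans (und X) (und Z) (fcomp (und X) H G) (fcomp (und X) H' G')
        (hcomp_nt (und X) (und Z) H G' \<gamma> \<beta>)"
      by (rule hcomp[OF obs(2-4) H G \<beta> \<gamma>])
    show "comp2 ?K W Y Z c (comp2 ?K W X Y b a) = comp2 ?K W X Z (comp2 ?K X Y Z c b) a"
      by (simp add: abc cat_two_cat_comp functor_cat_simps F G H \<alpha> \<beta> \<gamma> ba cb SC
          fassoc[OF obs(1,2) F(1)] fassoc[OF obs(1,2) F(2)]
          hassoc[OF obs F(2) G H \<alpha> \<beta> \<gamma>])
  qed (auto simp: HComp category_functor_cat und S S_id functor_cat_simps cat_two_cat_comp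
      fcomp_id_left[OF S] fcomp_id_right[OF S] S_comp fassoc)
qed

section \<open>Arrow categories and isomorphisms\<close>

lemma square_iff:
  "Square f g u v \<in> squares C \<longleftrightarrow> f \<in> Arr C \<and> g \<in> Arr C \<and>
    u \<in> Arr C \<and> Dom C u = Dom C f \<and> Cod C u = Dom C g \<and>
    v \<in> Arr C \<and> Dom C v = Cod C f \<and> Cod C v = Cod C g \<and> Comp C v f = Comp C g u"
  by (auto simp: squares_def homs_def)

lemma arrow_cat_simps:
  "Obj (arrow_cat C) = Arr C" "Arr (arrow_cat C) = squares C"
  "s \<in> squares C \<Longrightarrow> Dom (arrow_cat C) s = sq_src s"
  "s \<in> squares C \<Longrightarrow> Cod (arrow_cat C) s = sq_tgt s"
  "f \<in> Arr C \<Longrightarrow> Id (arrow_cat C) f = Square f f (Id C (Dom C f)) (Id C (Cod C f))"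
  "t \<in> squares C \<Longrightarrow> s \<in> squares C \<Longrightarrow> sq_tgt s = sq_src t \<Longrightarrow>
    Comp (arrow_cat C) t s = Square (sq_src s) (sq_tgt t)
      (Comp C (sq_top t) (sq_top s)) (Comp C (sq_bot t) (sq_bot s))"
  by (auto simp: arrow_cat_def)

lemma arrow_comp_square:
  assumes C: "category C" and t: "Square g h u' v' \<in> squares C" and s: "Square f g u v \<in> squares C"
  shows "Square f h (Comp C u' u) (Comp C v' v) \<in> squares C"
proof -
  note [simp] = cat_simps[OF C]
  have st: "f \<in> Arr C" "g \<in> Arr C" "h \<in> Arr C" "u \<in> Arr C" "v \<in> Arr C" "u' \<in> Arr C" "v' \<in> Arr C"
    "Dom C u = Dom C f" "Cod C u = Dom C g" "Dom C v = Cod C f" "Cod C v = Cod C g"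
    "Dom C u' = Dom C g" "Cod C u' = Dom C h" "Dom C v' = Cod C g" "Cod C v' = Cod C h"
    "Comp C v f = Comp C g u" "Comp C v' g = Comp C h u'"
    using assms by (auto simp: square_iff)
  have "Comp C v' (Comp C v f) = Comp C v' (Comp C g u)" by (simp add: st(16))
  also have "\<dots> = Comp C h (Comp C u' u)"
    using cat_comp_cong[OF C st(17), of u] st by simp
  finally show ?thesis using st by (simp add: square_iff)
qed

lemma category_arrow_cat:
  assumes C: "category C"
  shows "category (arrow_cat C)"
proof (rule categoryI)
  note [simp] = arrow_cat_simps cat_simps[OF C]
  show "Id (arrow_cat C) f \<in> homs (arrow_cat C) f f" if "f \<in> Obj (arrow_cat C)" for f
    using that by (intro homsI) (simp_all add: square_iff)
  show "Comp (arrow_cat C) t s \<in> homs (arrow_cat C) (Dom (arrow_cat C) s) (Cod (arrow_cat C) t)"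
    if "t \<in> Arr (arrow_cat C)" "s \<in> Arr (arrow_cat C)" "Cod (arrow_cat C) s = Dom (arrow_cat C) t"
    for t s
    using that arrow_comp_square[OF C] by (cases t; cases s) (auto intro!: homsI)
  show "Comp (arrow_cat C) u (Comp (arrow_cat C) t s) = Comp (arrow_cat C) (Comp (arrow_cat C) u t) s"
    if "u \<in> Arr (arrow_cat C)" "t \<in> Arr (arrow_cat C)" "s \<in> Arr (arrow_cat C)"
      "Cod (arrow_cat C) s = Dom (arrow_cat C) t" "Cod (arrow_cat C) t = Dom (arrow_cat C) u" for u t s
    using that arrow_comp_square[OF C]
    by (cases u; cases t; cases s) (auto simp: square_iff[THEN iffD1])
  show "Comp (arrow_cat C) s (Id (arrow_cat C) (Dom (arrow_cat C) s)) = s"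
    "Comp (arrow_cat C) (Id (arrow_cat C) (Cod (arrow_cat C) s)) s = s" if "s \<in> Arr (arrow_cat C)" for s
    using that by (cases s; simp add: square_iff)+
qed (auto simp: arrow_cat_def squares_def composable_def)

lemma is_isoI:
  assumes "f \<in> Arr C" "g \<in> Arr C" "Dom C g = Cod C f" "Cod C g = Dom C f"
    "Comp C g f = Id C (Dom C f)" "Comp C f g = Id C (Cod C f)"
  shows "is_iso C f"
  using assms unfolding is_iso_def homs_def by auto

lemma is_isoE:
  assumes "is_iso C f"
  obtains g where "f \<in> Arr C" "g \<in> Arr C" "Dom C g = Cod C f" "Cod C g = Dom C f"
    "Comp C g f = Id C (Dom C f)" "Comp C f g = Id C (Cod C f)"
  using assms unfolding is_iso_def homs_def by auto

lemma iso_inverse: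
  assumes "is_iso C u"
  shows "\<exists>v. is_iso C v \<and> v \<in> Arr C \<and> Dom C v = Cod C u \<and> Cod C v = Dom C u \<and>
    Comp C v u = Id C (Dom C u) \<and> Comp C u v = Id C (Cod C u)"
  by (rule is_isoE[OF assms]) (auto intro!: is_isoI[of _ _ u])

lemma is_iso_id: "category C \<Longrightarrow> X \<in> Obj C \<Longrightarrow> is_iso C (Id C X)"
  by (rule is_isoI[of _ _ "Id C X"]) (simp_all add: cat_simps)

lemma is_iso_comp:
  assumes C: "category C" and "is_iso C g" "is_iso C f" and gf: "Cod C f = Dom C g"
  shows "is_iso C (Comp C g f)"
proof -
  note [simp] = cat_simps[OF C]
  obtain g' where g: "g \<in> Arr C" "g' \<in> Arr C" "Dom C g' = Cod C g" "Cod C g' = Dom C g"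
    "Comp C g' g = Id C (Dom C g)" "Comp C g g' = Id C (Cod C g)" by (rule is_isoE[OF assms(2)])
  obtain f' where f: "f \<in> Arr C" "f' \<in> Arr C" "Dom C f' = Cod C f" "Cod C f' = Dom C f"
    "Comp C f' f = Id C (Dom C f)" "Comp C f f' = Id C (Cod C f)" by (rule is_isoE[OF assms(3)])
  have "Comp C g' (Comp C g f) = f" using cat_assoc[OF C, of g' g f] g f gf by simp
  moreover have "Comp C f (Comp C f' g') = g'" using cat_assoc[OF C, of f f' g'] g f gf by simp
  ultimately show ?thesis
    using g f gf by (intro is_isoI[of _ _ "Comp C f' g'"]) simp_all
qed

lemma ftor_iso:
  assumes "category C" "is_functor C D F" "is_iso C f"
  shows "is_iso D (farr F f)"
proof -
  note [simp] = ftor_simps[OF assms(2)] cat_simps[OF assms(1)]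
  obtain g where g: "f \<in> Arr C" "g \<in> Arr C" "Dom C g = Cod C f" "Cod C g = Dom C f"
    "Comp C g f = Id C (Dom C f)" "Comp C f g = Id C (Cod C f)" by (rule is_isoE[OF assms(3)])
  then have "farr F (Comp C g f) = farr F (Id C (Dom C f))" "farr F (Comp C f g) = farr F (Id C (Cod C f))"
    by simp_all
  then show ?thesis
    using g(1-4) by (intro is_isoI[of _ _ "farr F g"]) (simp_all del: g(5,6))
qed

text \<open>The inverse of \<open>u\<close> gives a square backwards because composing the triangle
  \<open>f = g u\<close> with it yields the triangle for the inverse. Comprehension isomorphisms
  have this shape, lying over an identity, so they can be handled through their upper sides.\<close>

lemma arrow_iso_iff:
  assumes C: "category C" and s: "Square f g u (Id C X) \<in> squares C" and X: "X \<in> Obj C"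
  shows "is_iso (arrow_cat C) (Square f g u (Id C X)) \<longleftrightarrow> is_iso C u"
proof
  note [simp] = cat_simps[OF C] arrow_cat_simps
  have *: "f \<in> Arr C" "g \<in> Arr C" "u \<in> Arr C" "Dom C u = Dom C f" "Cod C u = Dom C g"
    "Cod C f = X" "Cod C g = X" "Comp C g u = f"
    using s X by (auto simp: square_iff)
  show "is_iso C u" if iso: "is_iso (arrow_cat C) (Square f g u (Id C X))"
  proof -
    obtain t where t: "t \<in> squares C" "sq_src t = g" "sq_tgt t = f"
      "Comp (arrow_cat C) t (Square f g u (Id C X)) = Id (arrow_cat C) f"
      "Comp (arrow_cat C) (Square f g u (Id C X)) t = Id (arrow_cat C) g"
      by (rule is_isoE[OF iso]) (simp add: s)
    then have "Comp C (sq_top t) u = Id C (Dom C f)" "Comp C u (sq_top t) = Id C (Dom C g)"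
      using s *(1,2) by simp_all
    moreover have "sq_top t \<in> Arr C" "Dom C (sq_top t) = Dom C g" "Cod C (sq_top t) = Dom C f"
      using t(1-3) by (auto simp: squares_def homs_def)
    ultimately show ?thesis using * by (intro is_isoI[of _ _ "sq_top t"]) simp_all
  qed
  show "is_iso (arrow_cat C) (Square f g u (Id C X))" if iso: "is_iso C u"
  proof -
    obtain u' where u': "u' \<in> Arr C" "Dom C u' = Dom C g" "Cod C u' = Dom C f"
      "Comp C u' u = Id C (Dom C f)" "Comp C u u' = Id C (Dom C g)"
      by (rule is_isoE[OF iso]) (simp add: *)
    have "Comp C f u' = g"
      using cat_assoc[OF C, of g u u'] u' * by simp
    then have "Square g f u' (Id C X) \<in> squares C" using u' * X by (simp add: square_iff)
    then show ?thesis
      using s u' * X by (intro is_isoI[of _ _ "Square g f u' (Id C X)"]) simp_all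
  qed
qed

text \<open>The square with the inverse of \<open>f\<close> on top and an identity below. It puts
  every isomorphism into a replete class of maps that contains the identities.\<close>

lemma iso_isomorphic_id:
  assumes C: "category C" and f: "is_iso C f"
  shows "isomorphic (arrow_cat C) (Id C (Cod C f)) f"
proof -
  note [simp] = cat_simps[OF C]
  have fA: "f \<in> Arr C" using f by (simp add: is_iso_def)
  obtain g where g: "is_iso C g" "g \<in> Arr C" "Dom C g = Cod C f" "Cod C g = Dom C f"
    "Comp C f g = Id C (Cod C f)" using iso_inverse[OF f] by blast
  let ?s = "Square (Id C (Cod C f)) f g (Id C (Cod C f))"
  have Y: "Cod C f \<in> Obj C" using fA by simp
  have s: "?s \<in> squares C" using g fA by (simp add: square_iff)
  then have "is_iso (arrow_cat C) ?s" using arrow_iso_iff[OF C s Y] g(1) by simp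
  then show ?thesis
    unfolding isomorphic_def using s by (intro bexI[of _ ?s]) (auto simp: homs_def arrow_cat_simps)
qed

lemma map_square_sel [simp]:
  "sq_src (map_square F s) = farr F (sq_src s)" "sq_tgt (map_square F s) = farr F (sq_tgt s)"
  "sq_top (map_square F s) = farr F (sq_top s)" "sq_bot (map_square F s) = farr F (sq_bot s)"
  by (simp_all add: map_square_def)

lemma arrow_functor_simps [simp]:
  "f \<in> Arr C \<Longrightarrow> fob (arrow_functor C F) f = farr F f"
  "s \<in> squares C \<Longrightarrow> farr (arrow_functor C F) s = map_square F s"
  by (simp_all add: arrow_functor_def)

lemma map_square_squares:
  assumes C: "category C" and F: "is_functor C D F" and s: "s \<in> squares C"
  shows "map_square F s \<in> squares D"
proof (cases s)
  case (Square f g u v)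
  with s have *: "f \<in> Arr C" "g \<in> Arr C" "u \<in> Arr C" "v \<in> Arr C" "Dom C u = Dom C f"
    "Cod C u = Dom C g" "Dom C v = Cod C f" "Cod C v = Cod C g" "Comp C v f = Comp C g u"
    by (auto simp: square_iff)
  have "Comp D (farr F v) (farr F f) = Comp D (farr F g) (farr F u)"
    using arg_cong[OF *(9), of "farr F"] *(1-8) by (simp add: ftor_simps[OF F])
  with * show ?thesis
    by (simp add: Square map_square_def square_iff ftor_simps[OF F])
qed

section \<open>Comprehension categories\<close>

text \<open>The map \<Gamma>.A \<rightarrow> \<Delta>.B of extended contexts induced by a map A
  \<rightarrow> B of the total category.\<close>

abbreviation ext_map :: "('o, 'm, 'a, 'b, 'z) compcat_scheme \<Rightarrow> 'b \<Rightarrow> 'm" where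
  "ext_map X f \<equiv> sq_top (farr (compr X) f)"

lemma compcat_facts:
  assumes "comprehension_category X"
  shows compcat_base: "category (base X)"
    and compcat_total: "category (total X)"
    and compcat_proj: "is_functor (total X) (base X) (proj X)"
    and compcat_compr: "is_functor (total X) (arrow_cat (base X)) (compr X)"
    and compcat_fibration: "fibration (total X) (base X) (proj X)"
    and compcat_cod: "fcomp (total X) (cod_functor (base X)) (compr X) = proj X"
  using assms unfolding comprehension_category_def fibration_def by auto

lemma compr_facts:
  assumes X: "comprehension_category X"
  shows compr_arr: "A \<in> Obj (total X) \<Longrightarrow> fob (compr X) A \<in> Arr (base X)"
    and compr_cod: "A \<in> Obj (total X) \<Longrightarrow> Cod (base X) (fob (compr X) A) = fob (proj X) A"
    and compr_dom: "Dom (base X) (fob (compr X) A) = ext_dom X A"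
    and compr_src: "f \<in> Arr (total X) \<Longrightarrow>
      sq_src (farr (compr X) f) = fob (compr X) (Dom (total X) f)"
    and compr_tgt: "f \<in> Arr (total X) \<Longrightarrow>
      sq_tgt (farr (compr X) f) = fob (compr X) (Cod (total X) f)"
    and compr_bot: "f \<in> Arr (total X) \<Longrightarrow> sq_bot (farr (compr X) f) = farr (proj X) f"
    and compr_squares: "f \<in> Arr (total X) \<Longrightarrow> farr (compr X) f \<in> squares (base X)"
    and ext_dom_obj: "A \<in> Obj (total X) \<Longrightarrow> ext_dom X A \<in> Obj (base X)"
    and ext_map_arr: "f \<in> Arr (total X) \<Longrightarrow> ext_map X f \<in> Arr (base X)"
    and ext_map_dom: "f \<in> Arr (total X) \<Longrightarrow> Dom (base X) (ext_map X f) = ext_dom X (Dom (total X) f)"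
    and ext_map_cod: "f \<in> Arr (total X) \<Longrightarrow> Cod (base X) (ext_map X f) = ext_dom X (Cod (total X) f)"
    and ext_map_id: "A \<in> Obj (total X) \<Longrightarrow> ext_map X (Id (total X) A) = Id (base X) (ext_dom X A)"
    and ext_map_comp: "g \<in> Arr (total X) \<Longrightarrow> f \<in> Arr (total X) \<Longrightarrow>
      Cod (total X) f = Dom (total X) g \<Longrightarrow>
      ext_map X (Comp (total X) g f) = Comp (base X) (ext_map X g) (ext_map X f)"
proof -
  note [simp] = cat_simps[OF compcat_base[OF X]] cat_simps[OF compcat_total[OF X]]
    ftor_simps[OF compcat_compr[OF X]] ftor_simps[OF compcat_proj[OF X]] arrow_cat_simps
  have arr [simp]: "fob (compr X) A \<in> Arr (base X)" if "A \<in> Obj (total X)" for A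
    using ftor_ob[OF compcat_compr[OF X] that] by simp
  show "A \<in> Obj (total X) \<Longrightarrow> fob (compr X) A \<in> Arr (base X)" by simp
  show "Dom (base X) (fob (compr X) A) = ext_dom X A" by (simp add: ext_dom_def)
  show "A \<in> Obj (total X) \<Longrightarrow> Cod (base X) (fob (compr X) A) = fob (proj X) A"
    by (simp add: compcat_cod[OF X, symmetric] cod_functor_def)
  show [simp]: "A \<in> Obj (total X) \<Longrightarrow> ext_dom X A \<in> Obj (base X)"
    by (simp add: ext_dom_def)
  show "A \<in> Obj (total X) \<Longrightarrow> ext_map X (Id (total X) A) = Id (base X) (ext_dom X A)"
    by (simp add: ext_dom_def)
  show [simp]: "farr (compr X) f \<in> squares (base X)"
    "sq_src (farr (compr X) f) = fob (compr X) (Dom (total X) f)"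
    "sq_tgt (farr (compr X) f) = fob (compr X) (Cod (total X) f)"
    "sq_bot (farr (compr X) f) = farr (proj X) f" if "f \<in> Arr (total X)" for f
    using that ftor_arr[OF compcat_compr[OF X] that] ftor_dom[OF compcat_compr[OF X] that]
      ftor_cod[OF compcat_compr[OF X] that]
    by (simp_all add: compcat_cod[OF X, symmetric] cod_functor_def)
  show "ext_map X f \<in> Arr (base X)" "Dom (base X) (ext_map X f) = ext_dom X (Dom (total X) f)"
    "Cod (base X) (ext_map X f) = ext_dom X (Cod (total X) f)" if "f \<in> Arr (total X)" for f
    using \<open>f \<in> Arr (total X) \<Longrightarrow> farr (compr X) f \<in> squares (base X)\<close>[OF that] that
    by (auto simp: squares_def homs_def ext_dom_def)
  show "ext_map X (Comp (total X) g f) = Comp (base X) (ext_map X g) (ext_map X f)"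
    if "g \<in> Arr (total X)" "f \<in> Arr (total X)" "Cod (total X) f = Dom (total X) g" for g f
    using that by simp
qed

lemmas compr_simps = compr_arr compr_cod compr_dom compr_src compr_tgt compr_bot
  compr_squares ext_dom_obj ext_map_arr ext_map_dom ext_map_cod
  ext_map_id ext_map_comp

text \<open>The comprehension isomorphism at \<open>A\<close> without its lower side, which is an
  identity: it runs from the extension by the image of \<open>A\<close> to the image of
  \<Gamma>.A.\<close>

abbreviation pm_ext :: "('o, 'm, 'a, 'b, 'z) pmap_scheme \<Rightarrow> 'a \<Rightarrow> 'm" where
  "pm_ext F A \<equiv> sq_top (pm_compr F A)"

text \<open>A square over an identity is determined by its upper side. The natural isomorphism of a
  pseudo map is therefore unpacked into a family \<open>pm_ext\<close> of isomorphisms in the base,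
  compatible with the display maps (\<open>pm_ext_compr\<close>) and with maps of extensions
  (\<open>pm_ext_nat\<close>).\<close>

lemma pseudo_map_facts:
  assumes X: "comprehension_category X" and Y: "comprehension_category Y" and F: "pseudo_map X Y F"
  shows pm_base_functor: "is_functor (base X) (base Y) (pm_base F)"
    and pm_total_functor: "is_functor (total X) (total Y) (pm_total F)"
    and pm_cartesian: "cartesian (total X) (base X) (proj X) f \<Longrightarrow>
      cartesian (total Y) (base Y) (proj Y) (farr (pm_total F) f)"
    and pm_proj_ob: "A \<in> Obj (total X) \<Longrightarrow>
      fob (proj Y) (fob (pm_total F) A) = fob (pm_base F) (fob (proj X) A)"
    and pm_proj_arr: "f \<in> Arr (total X) \<Longrightarrow>
      farr (proj Y) (farr (pm_total F) f) = farr (pm_base F) (farr (proj X) f)"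
    and pm_compr_square: "A \<in> Obj (total X) \<Longrightarrow> pm_compr F A =
      Square (fob (compr Y) (fob (pm_total F) A)) (farr (pm_base F) (fob (compr X) A))
        (pm_ext F A) (Id (base Y) (fob (pm_base F) (fob (proj X) A)))"
    and pm_compr_squares: "A \<in> Obj (total X) \<Longrightarrow> pm_compr F A \<in> squares (base Y)"
    and pm_compr_ext: "pm_compr F \<in> extensional (Obj (total X))"
    and pm_ext_arr: "A \<in> Obj (total X) \<Longrightarrow> pm_ext F A \<in> Arr (base Y)"
    and pm_ext_dom: "A \<in> Obj (total X) \<Longrightarrow> Dom (base Y) (pm_ext F A) = ext_dom Y (fob (pm_total F) A)"
    and pm_ext_cod: "A \<in> Obj (total X) \<Longrightarrow> Cod (base Y) (pm_ext F A) = fob (pm_base F) (ext_dom X A)"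
    and pm_ext_iso: "A \<in> Obj (total X) \<Longrightarrow> is_iso (base Y) (pm_ext F A)"
    and pm_ext_compr: "A \<in> Obj (total X) \<Longrightarrow>
      Comp (base Y) (farr (pm_base F) (fob (compr X) A)) (pm_ext F A) =
      fob (compr Y) (fob (pm_total F) A)"
    and pm_ext_nat: "f \<in> Arr (total X) \<Longrightarrow>
      Comp (base Y) (pm_ext F (Cod (total X) f)) (ext_map Y (farr (pm_total F) f)) =
      Comp (base Y) (farr (pm_base F) (ext_map X f)) (pm_ext F (Dom (total X) f))"
proof -
  note pm = F[unfolded pseudo_map_def nat_iso_def]
  show base [simp]: "is_functor (base X) (base Y) (pm_base F)"
    and [simp]: "is_functor (total X) (total Y) (pm_total F)"
    and "cartesian (total X) (base X) (proj X) f \<Longrightarrow>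
      cartesian (total Y) (base Y) (proj Y) (farr (pm_total F) f)"
    using pm by blast+
  have eq: "fcomp (total X) (proj Y) (pm_total F) = fcomp (total X) (pm_base F) (proj X)"
    and nt: "nat_trans (total X) (arrow_cat (base Y)) (fcomp (total X) (compr Y) (pm_total F))
       (fcomp (total X) (arrow_functor (base X) (pm_base F)) (compr X)) (pm_compr F)"
    and iso_bot: "A \<in> Obj (total X) \<Longrightarrow> is_iso (arrow_cat (base Y)) (pm_compr F A) \<and>
       sq_bot (pm_compr F A) = Id (base Y) (fob (pm_base F) (fob (proj X) A))" for A
    using pm by blast+
  note bF = ftor_simps[OF \<open>is_functor (base X) (base Y) (pm_base F)\<close>]
    ftor_simps[OF \<open>is_functor (total X) (total Y) (pm_total F)\<close>]
  note [simp] = cat_simps[OF compcat_base[OF X]] cat_simps[OF compcat_total[OF X]]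
    cat_simps[OF compcat_base[OF Y]] cat_simps[OF compcat_total[OF Y]]
    ftor_simps[OF compcat_proj[OF X]] ftor_simps[OF compcat_proj[OF Y]] bF
    compr_simps[OF X] compr_simps[OF Y] arrow_cat_simps
  show p_ob [simp]: "A \<in> Obj (total X) \<Longrightarrow>
      fob (proj Y) (fob (pm_total F) A) = fob (pm_base F) (fob (proj X) A)" for A
    using arg_cong[OF eq, of "\<lambda>G. fob G A"] by simp
  show "f \<in> Arr (total X) \<Longrightarrow>
      farr (proj Y) (farr (pm_total F) f) = farr (pm_base F) (farr (proj X) f)" for f
    using arg_cong[OF eq, of "\<lambda>G. farr G f"] by simp
  have *: "pm_compr F A \<in> squares (base Y)" "sq_src (pm_compr F A) = fob (compr Y) (fob (pm_total F) A)"
    "sq_tgt (pm_compr F A) = farr (pm_base F) (fob (compr X) A)"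
    "sq_bot (pm_compr F A) = Id (base Y) (fob (pm_base F) (fob (proj X) A))"
    "is_iso (arrow_cat (base Y)) (pm_compr F A)" if "A \<in> Obj (total X)" for A
    using iso_bot[OF that] nt_simps[OF nt that] that by (simp_all)
  show sq: "pm_compr F A =
      Square (fob (compr Y) (fob (pm_total F) A)) (farr (pm_base F) (fob (compr X) A))
        (pm_ext F A) (Id (base Y) (fob (pm_base F) (fob (proj X) A)))" if "A \<in> Obj (total X)" for A
    using *[OF that] by (intro square.expand) simp
  show "A \<in> Obj (total X) \<Longrightarrow> pm_compr F A \<in> squares (base Y)" for A using * by blast
  show "pm_compr F \<in> extensional (Obj (total X))" by (rule nt_ext[OF nt])
  show ext: "pm_ext F A \<in> Arr (base Y)" "Dom (base Y) (pm_ext F A) = ext_dom Y (fob (pm_total F) A)"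
    "Cod (base Y) (pm_ext F A) = fob (pm_base F) (ext_dom X A)"
    "Comp (base Y) (farr (pm_base F) (fob (compr X) A)) (pm_ext F A) =
      fob (compr Y) (fob (pm_total F) A)" if "A \<in> Obj (total X)" for A
    using *(1)[OF that] that by (subst (asm) sq; simp add: square_iff)+
  show "is_iso (base Y) (pm_ext F A)" if "A \<in> Obj (total X)" for A
    by (rule iffD1[OF arrow_iso_iff[OF compcat_base[OF Y], of "fob (compr Y) (fob (pm_total F) A)"
            "farr (pm_base F) (fob (compr X) A)" _ "fob (pm_base F) (fob (proj X) A)"]])
      (use *[OF that] that in \<open>simp_all flip: sq[OF that]\<close>)
  show "Comp (base Y) (pm_ext F (Cod (total X) f)) (ext_map Y (farr (pm_total F) f)) =
      Comp (base Y) (farr (pm_base F) (ext_map X f)) (pm_ext F (Dom (total X) f))"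
    if "f \<in> Arr (total X)" for f
  proof -
    have "map_square (pm_base F) (farr (compr X) f) \<in> squares (base Y)"
      using compr_squares[OF X that] by (rule map_square_squares[OF compcat_base[OF X] base])
    then show ?thesis
      using arg_cong[OF nt_nat[OF nt that], of sq_top] that
      by (simp add: *)
  qed
qed

lemmas pm_simps = pm_proj_ob pm_proj_arr pm_compr_squares pm_ext_arr pm_ext_dom pm_ext_cod

text \<open>The converse packing: a family \<open>e\<close> with the properties of
  \<open>pm_ext\<close> suffices, the squares being completed by identities below.\<close>

lemma pseudo_mapI:
  fixes F :: "('o, 'm, 'a, 'b, 'z) pmap_scheme"
  assumes X: "comprehension_category X" and Y: "comprehension_category Y"
    and base: "is_functor (base X) (base Y) (pm_base F)"
    and total: "is_functor (total X) (total Y) (pm_total F)"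
    and cart: "\<And>f. cartesian (total X) (base X) (proj X) f \<Longrightarrow>
      cartesian (total Y) (base Y) (proj Y) (farr (pm_total F) f)"
    and p_ob: "\<And>A. A \<in> Obj (total X) \<Longrightarrow>
      fob (proj Y) (fob (pm_total F) A) = fob (pm_base F) (fob (proj X) A)"
    and p_arr: "\<And>f. f \<in> Arr (total X) \<Longrightarrow>
      farr (proj Y) (farr (pm_total F) f) = farr (pm_base F) (farr (proj X) f)"
    and compr: "pm_compr F = (\<lambda>A \<in> Obj (total X).
      Square (fob (compr Y) (fob (pm_total F) A)) (farr (pm_base F) (fob (compr X) A)) (e A)
        (Id (base Y) (fob (pm_base F) (fob (proj X) A))))"
    and iso: "\<And>A. A \<in> Obj (total X) \<Longrightarrow> is_iso (base Y) (e A)"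
    and dom: "\<And>A. A \<in> Obj (total X) \<Longrightarrow> Dom (base Y) (e A) = ext_dom Y (fob (pm_total F) A)"
    and cod: "\<And>A. A \<in> Obj (total X) \<Longrightarrow> Cod (base Y) (e A) = fob (pm_base F) (ext_dom X A)"
    and e: "\<And>A. A \<in> Obj (total X) \<Longrightarrow>
      Comp (base Y) (farr (pm_base F) (fob (compr X) A)) (e A) = fob (compr Y) (fob (pm_total F) A)"
    and nat: "\<And>f. f \<in> Arr (total X) \<Longrightarrow>
      Comp (base Y) (e (Cod (total X) f)) (ext_map Y (farr (pm_total F) f)) =
      Comp (base Y) (farr (pm_base F) (ext_map X f)) (e (Dom (total X) f))"
  shows "pseudo_map X Y F"
proof -
  note [simp] = cat_simps[OF compcat_base[OF X]] cat_simps[OF compcat_total[OF X]]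
    cat_simps[OF compcat_base[OF Y]] cat_simps[OF compcat_total[OF Y]]
    ftor_simps[OF compcat_proj[OF X]] ftor_simps[OF compcat_proj[OF Y]] ftor_simps[OF base]
    ftor_simps[OF total] compr_simps[OF X] compr_simps[OF Y] arrow_cat_simps
    map_square_squares[OF compcat_base[OF X] base] p_ob p_arr
  have e_arr [simp]: "e A \<in> Arr (base Y)" if "A \<in> Obj (total X)" for A
    using iso[OF that] by (simp add: is_iso_def)
  let ?S = "\<lambda>A. Square (fob (compr Y) (fob (pm_total F) A)) (farr (pm_base F) (fob (compr X) A)) (e A)
        (Id (base Y) (fob (pm_base F) (fob (proj X) A)))"
  have sq [simp]: "?S A \<in> squares (base Y)" if "A \<in> Obj (total X)" for A
    using that by (simp add: square_iff dom cod e)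
  have "nat_iso (total X) (arrow_cat (base Y)) (fcomp (total X) (compr Y) (pm_total F))
       (fcomp (total X) (arrow_functor (base X) (pm_base F)) (compr X)) (pm_compr F)"
    unfolding nat_iso_def
  proof (intro conjI ballI nat_transI)
    fix A assume A: "A \<in> Obj (total X)"
    show "pm_compr F A \<in> homs (arrow_cat (base Y)) (fob (fcomp (total X) (compr Y) (pm_total F)) A)
        (fob (fcomp (total X) (arrow_functor (base X) (pm_base F)) (compr X)) A)"
      using A by (intro homsI) (simp_all add: compr)
    show "is_iso (arrow_cat (base Y)) (pm_compr F A)"
      using A iso[OF A] by (simp add: compr arrow_iso_iff[OF compcat_base[OF Y]])
  next
    fix f assume "f \<in> Arr (total X)"
    then show "Comp (arrow_cat (base Y)) (pm_compr F (Cod (total X) f))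
          (farr (fcomp (total X) (compr Y) (pm_total F)) f) =
        Comp (arrow_cat (base Y))
          (farr (fcomp (total X) (arrow_functor (base X) (pm_base F)) (compr X)) f)
          (pm_compr F (Dom (total X) f))"
      by (simp add: compr nat)
  qed (simp add: compr)
  moreover have "fcomp (total X) (proj Y) (pm_total F) = fcomp (total X) (pm_base F) (proj X)"
    by (rule ftor_eqI[OF fcomp_functor[OF compcat_total[OF X] total compcat_proj[OF Y]]
          fcomp_functor[OF compcat_total[OF X] compcat_proj[OF X] base]]) simp_all
  ultimately show ?thesis
    unfolding pseudo_map_def using base total cart by (simp add: compr)
qed

section \<open>Rooted pseudo maps, their identities and composites\<close>

lemma rooted_compcatD:
  assumes "rooted_compcat X"
  shows "comprehension_category X" "terminal (base X) (root X)" "root X \<in> Obj (base X)"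
  using assms by (auto simp: rooted_compcat_def terminal_def)

lemma rooted_pseudo_mapD:
  assumes "rooted_pseudo_map X Y F"
  shows "pseudo_map X Y F" "pm_root F \<in> Arr (base Y)"
    "Dom (base Y) (pm_root F) = fob (pm_base F) (root X)" "Cod (base Y) (pm_root F) = root Y"
    "is_iso (base Y) (pm_root F)"
  using assms by (auto simp: rooted_pseudo_map_def homs_def)

lemma rooted_pseudo_map_id:
  assumes X: "rooted_compcat X"
  shows "rooted_pseudo_map X X (id_rpmap X)"
proof -
  note C = rooted_compcatD(1)[OF X]
  note [simp] = cat_simps[OF compcat_base[OF C]] cat_simps[OF compcat_total[OF C]]
    ftor_simps[OF compcat_proj[OF C]] compr_simps[OF C] rooted_compcatD(3)[OF X] arrow_cat_simps
  have "pseudo_map X X (id_rpmap X)"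
    by (rule pseudo_mapI[OF C C, where e = "\<lambda>A. Id (base X) (ext_dom X A)"])
      (auto simp: id_rpmap_def id_functor compcat_base[OF C] compcat_total[OF C] is_iso_id
        cartesian_def intro!: restrict_ext)
  then show ?thesis
    by (auto simp: rooted_pseudo_map_def id_rpmap_def is_iso_id compcat_base[OF C] intro!: homsI)
qed

lemma rooted_pseudo_map_comp:
  assumes X: "rooted_compcat X" and Y: "rooted_compcat Y" and Z: "rooted_compcat Z"
    and F: "rooted_pseudo_map X Y F" and G: "rooted_pseudo_map Y Z G"
  shows "rooted_pseudo_map X Z (comp_rpmap X Z G F)"
    and "A \<in> Obj (total X) \<Longrightarrow> pm_ext (comp_rpmap X Z G F) A =
      Comp (base Z) (farr (pm_base G) (pm_ext F A)) (pm_ext G (fob (pm_total F) A))"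
proof -
  note CX = rooted_compcatD(1)[OF X] and CY = rooted_compcatD(1)[OF Y]
    and CZ = rooted_compcatD(1)[OF Z]
  note PF = rooted_pseudo_mapD(1)[OF F] and PG = rooted_pseudo_mapD(1)[OF G]
  note bF = pm_base_functor[OF CX CY PF] and bG = pm_base_functor[OF CY CZ PG]
    and tF = pm_total_functor[OF CX CY PF] and tG = pm_total_functor[OF CY CZ PG]
  note [simp] = cat_simps[OF compcat_base[OF CX]] cat_simps[OF compcat_total[OF CX]]
    cat_simps[OF compcat_base[OF CY]] cat_simps[OF compcat_total[OF CY]]
    cat_simps[OF compcat_base[OF CZ]] cat_simps[OF compcat_total[OF CZ]]
    ftor_simps[OF compcat_proj[OF CX]] ftor_simps[OF compcat_proj[OF CY]]
    ftor_simps[OF compcat_proj[OF CZ]] ftor_simps[OF bF] ftor_simps[OF bG] ftor_simps[OF tF]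
    ftor_simps[OF tG] compr_simps[OF CX] compr_simps[OF CY] compr_simps[OF CZ]
    pm_simps[OF CX CY PF] pm_simps[OF CY CZ PG] rooted_compcatD(3)[OF X] rooted_compcatD(3)[OF Y]
    arrow_cat_simps map_square_squares[OF compcat_base[OF CY] bG] rooted_pseudo_mapD(2-4)[OF F]
    rooted_pseudo_mapD(2-4)[OF G]
  let ?e = "\<lambda>A. Comp (base Z) (farr (pm_base G) (pm_ext F A)) (pm_ext G (fob (pm_total F) A))"
  have c: "pm_compr (comp_rpmap X Z G F) A =
      Square (fob (compr Z) (fob (pm_total G) (fob (pm_total F) A)))
        (farr (pm_base G) (farr (pm_base F) (fob (compr X) A)))
        (?e A) (Id (base Z) (fob (pm_base G) (fob (pm_base F) (fob (proj X) A))))"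
    if A: "A \<in> Obj (total X)" for A
  proof -
    have "sq_src (pm_compr F A) = fob (compr Y) (fob (pm_total F) A)"
      "sq_tgt (pm_compr F A) = farr (pm_base F) (fob (compr X) A)"
      "sq_bot (pm_compr F A) = Id (base Y) (fob (pm_base F) (fob (proj X) A))"
      using arg_cong[OF pm_compr_square[OF CX CY PF A], of sq_src]
        arg_cong[OF pm_compr_square[OF CX CY PF A], of sq_tgt]
        arg_cong[OF pm_compr_square[OF CX CY PF A], of sq_bot] by simp_all
    moreover have "sq_src (pm_compr G (fob (pm_total F) A)) =
        fob (compr Z) (fob (pm_total G) (fob (pm_total F) A))"
      "sq_tgt (pm_compr G (fob (pm_total F) A)) =
        farr (pm_base G) (fob (compr Y) (fob (pm_total F) A))"
      "sq_bot (pm_compr G (fob (pm_total F) A)) =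
        Id (base Z) (fob (pm_base G) (fob (pm_base F) (fob (proj X) A)))"
      using arg_cong[OF pm_compr_square[OF CY CZ PG, of "fob (pm_total F) A"], of sq_src]
        arg_cong[OF pm_compr_square[OF CY CZ PG, of "fob (pm_total F) A"], of sq_tgt]
        arg_cong[OF pm_compr_square[OF CY CZ PG, of "fob (pm_total F) A"], of sq_bot] A by simp_all
    ultimately show ?thesis using A by (simp add: comp_rpmap_def)
  qed
  then show "A \<in> Obj (total X) \<Longrightarrow> pm_ext (comp_rpmap X Z G F) A = ?e A" by simp
  have sel: "pm_base (comp_rpmap X Z G F) = fcomp (base X) (pm_base G) (pm_base F)"
    "pm_total (comp_rpmap X Z G F) = fcomp (total X) (pm_total G) (pm_total F)"
    "pm_root (comp_rpmap X Z G F) = Comp (base Z) (pm_root G) (farr (pm_base G) (pm_root F))"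
    by (simp_all add: comp_rpmap_def)
  have "pseudo_map X Z (comp_rpmap X Z G F)"
  proof (rule pseudo_mapI[OF CX CZ, where e = ?e], unfold sel)
    show "is_functor (base X) (base Z) (fcomp (base X) (pm_base G) (pm_base F))"
      by (rule fcomp_functor[OF compcat_base[OF CX] bF bG])
    show "is_functor (total X) (total Z) (fcomp (total X) (pm_total G) (pm_total F))"
      by (rule fcomp_functor[OF compcat_total[OF CX] tF tG])
    show "cartesian (total Z) (base Z) (proj Z) (farr (fcomp (total X) (pm_total G) (pm_total F)) f)"
      if f: "cartesian (total X) (base X) (proj X) f" for f
    proof -
      have "f \<in> Arr (total X)" using f by (simp add: cartesian_def)
      then show ?thesis
        using pm_cartesian[OF CY CZ PG pm_cartesian[OF CX CY PF f]] by simp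
    qed
    show "pm_compr (comp_rpmap X Z G F) = (\<lambda>A\<in>Obj (total X).
        Square (fob (compr Z) (fob (fcomp (total X) (pm_total G) (pm_total F)) A))
          (farr (fcomp (base X) (pm_base G) (pm_base F)) (fob (compr X) A)) (?e A)
          (Id (base Z) (fob (fcomp (base X) (pm_base G) (pm_base F)) (fob (proj X) A))))"
      by (rule extensionalityI[of _ "Obj (total X)"]) (simp_all add: c, simp add: comp_rpmap_def)
    show "is_iso (base Z) (?e A)" if A: "A \<in> Obj (total X)" for A
      by (rule is_iso_comp[OF compcat_base[OF CZ]
            ftor_iso[OF compcat_base[OF CY] bG pm_ext_iso[OF CX CY PF A]] pm_ext_iso[OF CY CZ PG]])
        (use A in simp_all)
    show "Comp (base Z) (farr (fcomp (base X) (pm_base G) (pm_base F)) (fob (compr X) A)) (?e A) =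
      fob (compr Z) (fob (fcomp (total X) (pm_total G) (pm_total F)) A)" if A: "A \<in> Obj (total X)" for A
    proof -
      have "Comp (base Z) (farr (pm_base G) (farr (pm_base F) (fob (compr X) A)))
          (farr (pm_base G) (pm_ext F A)) = farr (pm_base G) (fob (compr Y) (fob (pm_total F) A))"
        using arg_cong[OF pm_ext_compr[OF CX CY PF A], of "farr (pm_base G)"] A by simp
      from arg_cong[OF this, of "\<lambda>h. Comp (base Z) h (pm_ext G (fob (pm_total F) A))"]
      show ?thesis using A pm_ext_compr[OF CY CZ PG, of "fob (pm_total F) A"] by simp
    qed
    show "Comp (base Z) (?e (Cod (total X) f))
          (ext_map Z (farr (fcomp (total X) (pm_total G) (pm_total F)) f)) =
        Comp (base Z) (farr (fcomp (base X) (pm_base G) (pm_base F)) (ext_map X f))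
          (?e (Dom (total X) f))" if f [simp]: "f \<in> Arr (total X)" for f
    proof -
      \<comment> \<open>Two naturality squares are pasted: the image under \<open>G\<close> of the
        one for \<open>F\<close> at \<open>f\<close>, and the one for \<open>G\<close> at the image
        of \<open>f\<close> under \<open>F\<close>.\<close>
      have "Comp (base Z) (farr (pm_base G) (pm_ext F (Cod (total X) f)))
          (farr (pm_base G) (ext_map Y (farr (pm_total F) f))) =
        Comp (base Z) (farr (pm_base G) (farr (pm_base F) (ext_map X f)))
          (farr (pm_base G) (pm_ext F (Dom (total X) f)))"
        using arg_cong[OF pm_ext_nat[OF CX CY PF f], of "farr (pm_base G)"] by simp
      from cat_comp_cong[OF compcat_base[OF CZ] this, of "pm_ext G (fob (pm_total F) (Dom (total X) f))"]
      show ?thesis using pm_ext_nat[OF CY CZ PG, of "farr (pm_total F) f"] by simp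
    qed
  qed simp_all
  moreover have "is_iso (base Z) (Comp (base Z) (pm_root G) (farr (pm_base G) (pm_root F)))"
    by (rule is_iso_comp[OF compcat_base[OF CZ] rooted_pseudo_mapD(5)[OF G]
          ftor_iso[OF compcat_base[OF CY] bG rooted_pseudo_mapD(5)[OF F]]]) simp
  ultimately show "rooted_pseudo_map X Z (comp_rpmap X Z G F)"
    unfolding rooted_pseudo_map_def by (simp add: sel homs_def)
qed

section \<open>Rooted transformations under vertical and horizontal composition\<close>

lemma rooted_transformationD:
  assumes "rooted_transformation X Y F G \<alpha> \<alpha>'"
  shows "nat_trans (base X) (base Y) (pm_base F) (pm_base G) \<alpha>"
    "nat_trans (total X) (total Y) (pm_total F) (pm_total G) \<alpha>'"
    "A \<in> Obj (total X) \<Longrightarrow> farr (proj Y) (\<alpha>' A) = \<alpha> (fob (proj X) A)"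
    "A \<in> Obj (total X) \<Longrightarrow> Comp (base Y) (pm_ext G A) (ext_map Y (\<alpha>' A)) =
        Comp (base Y) (\<alpha> (ext_dom X A)) (pm_ext F A)"
    "Comp (base Y) (pm_root G) (\<alpha> (root X)) = pm_root F"
  using assms by (auto simp: rooted_transformation_def transformation_def)

lemma rooted_transformation_id:
  assumes X: "rooted_compcat X" and Y: "rooted_compcat Y" and F: "rooted_pseudo_map X Y F"
  shows "rooted_transformation X Y F F (id_nt (base X) (base Y) (pm_base F))
    (id_nt (total X) (total Y) (pm_total F))"
proof -
  note CX = rooted_compcatD(1)[OF X] and CY = rooted_compcatD(1)[OF Y]
  note PF = rooted_pseudo_mapD(1)[OF F]
  note bF = pm_base_functor[OF CX CY PF] and tF = pm_total_functor[OF CX CY PF]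
  note [simp] = cat_simps[OF compcat_base[OF CX]] cat_simps[OF compcat_total[OF CX]]
    cat_simps[OF compcat_base[OF CY]] cat_simps[OF compcat_total[OF CY]]
    ftor_simps[OF compcat_proj[OF CX]] ftor_simps[OF compcat_proj[OF CY]] ftor_simps[OF bF]
    ftor_simps[OF tF] compr_simps[OF CX] compr_simps[OF CY] pm_simps[OF CX CY PF]
    rooted_compcatD(3)[OF X] rooted_compcatD(3)[OF Y] rooted_pseudo_mapD(2-4)[OF F]
  show ?thesis
    unfolding rooted_transformation_def transformation_def
    using id_nt[OF compcat_base[OF CX] compcat_base[OF CY] bF]
      id_nt[OF compcat_total[OF CX] compcat_total[OF CY] tF]
    by (simp add: id_nt_def[of "base X"] id_nt_def[of "total X"])
qed

lemma rooted_transformation_vcomp: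
  assumes X: "rooted_compcat X" and Y: "rooted_compcat Y"
    and F: "rooted_pseudo_map X Y F" and G: "rooted_pseudo_map X Y G" and H: "rooted_pseudo_map X Y H"
    and \<alpha>: "rooted_transformation X Y F G \<alpha> \<alpha>'" and \<beta>: "rooted_transformation X Y G H \<beta> \<beta>'"
  shows "rooted_transformation X Y F H (vcomp_nt (base X) (base Y) \<beta> \<alpha>)
    (vcomp_nt (total X) (total Y) \<beta>' \<alpha>')"
proof -
  note CX = rooted_compcatD(1)[OF X] and CY = rooted_compcatD(1)[OF Y]
  note PF = rooted_pseudo_mapD(1)[OF F] and PG = rooted_pseudo_mapD(1)[OF G]
    and PH = rooted_pseudo_mapD(1)[OF H]
  note bF = pm_base_functor[OF CX CY PF] and tF = pm_total_functor[OF CX CY PF]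
    and bG = pm_base_functor[OF CX CY PG] and tG = pm_total_functor[OF CX CY PG]
    and bH = pm_base_functor[OF CX CY PH] and tH = pm_total_functor[OF CX CY PH]
  note T\<alpha> = rooted_transformationD[OF \<alpha>] and T\<beta> = rooted_transformationD[OF \<beta>]
  note [simp] = cat_simps[OF compcat_base[OF CX]] cat_simps[OF compcat_total[OF CX]]
    cat_simps[OF compcat_base[OF CY]] cat_simps[OF compcat_total[OF CY]]
    ftor_simps[OF compcat_proj[OF CX]] ftor_simps[OF compcat_proj[OF CY]] ftor_simps[OF bF]
    ftor_simps[OF tF] ftor_simps[OF bG] ftor_simps[OF tG] ftor_simps[OF bH] ftor_simps[OF tH]
    compr_simps[OF CX] compr_simps[OF CY] pm_simps[OF CX CY PF] pm_simps[OF CX CY PG]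
    pm_simps[OF CX CY PH] rooted_compcatD(3)[OF X] rooted_compcatD(3)[OF Y]
    rooted_pseudo_mapD(2-4)[OF F] rooted_pseudo_mapD(2-4)[OF G] rooted_pseudo_mapD(2-4)[OF H]
    nt_simps[OF T\<alpha>(1)] nt_simps[OF T\<alpha>(2)] nt_simps[OF T\<beta>(1)] nt_simps[OF T\<beta>(2)]
    T\<alpha>(3) T\<beta>(3)
  show ?thesis
    unfolding rooted_transformation_def transformation_def
  proof (intro conjI ballI)
    show "nat_trans (base X) (base Y) (pm_base F) (pm_base H) (vcomp_nt (base X) (base Y) \<beta> \<alpha>)"
      by (rule vcomp_nt[OF compcat_base[OF CX] compcat_base[OF CY] bF bG bH T\<alpha>(1) T\<beta>(1)])
    show "nat_trans (total X) (total Y) (pm_total F) (pm_total H) (vcomp_nt (total X) (total Y) \<beta>' \<alpha>')"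
      by (rule vcomp_nt[OF compcat_total[OF CX] compcat_total[OF CY] tF tG tH T\<alpha>(2) T\<beta>(2)])
    show "Comp (base Y) (pm_root H) (vcomp_nt (base X) (base Y) \<beta> \<alpha> (root X)) = pm_root F"
      using cat_assoc[OF compcat_base[OF CY], of "pm_root H" "\<beta> (root X)" "\<alpha> (root X)"]
      by (simp add: vcomp_nt_def T\<alpha>(5) T\<beta>(5))
  next
    fix A assume A [simp]: "A \<in> Obj (total X)"
    show "farr (proj Y) (vcomp_nt (total X) (total Y) \<beta>' \<alpha>' A) =
        vcomp_nt (base X) (base Y) \<beta> \<alpha> (fob (proj X) A)"
      by (simp add: vcomp_nt_def)
    show "Comp (base Y) (pm_ext H A) (ext_map Y (vcomp_nt (total X) (total Y) \<beta>' \<alpha>' A)) =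
        Comp (base Y) (vcomp_nt (base X) (base Y) \<beta> \<alpha> (ext_dom X A)) (pm_ext F A)"
      using cat_comp_cong[OF compcat_base[OF CY] T\<beta>(4)[OF A], of "ext_map Y (\<alpha>' A)"] T\<alpha>(4)[OF A]
      by (simp add: vcomp_nt_def)
  qed
qed

lemma rooted_transformation_hcomp:
  assumes X: "rooted_compcat X" and Y: "rooted_compcat Y" and Z: "rooted_compcat Z"
    and F: "rooted_pseudo_map X Y F" and F': "rooted_pseudo_map X Y F'"
    and G: "rooted_pseudo_map Y Z G" and G': "rooted_pseudo_map Y Z G'"
    and \<alpha>: "rooted_transformation X Y F F' \<alpha> \<alpha>'" and \<beta>: "rooted_transformation Y Z G G' \<beta> \<beta>'"
  shows "rooted_transformation X Z (comp_rpmap X Z G F) (comp_rpmap X Z G' F')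
    (hcomp_nt (base X) (base Z) (pm_base G) (pm_base F') \<beta> \<alpha>)
    (hcomp_nt (total X) (total Z) (pm_total G) (pm_total F') \<beta>' \<alpha>')"
proof -
  note CX = rooted_compcatD(1)[OF X] and CY = rooted_compcatD(1)[OF Y]
    and CZ = rooted_compcatD(1)[OF Z]
  note PF = rooted_pseudo_mapD(1)[OF F] and PF' = rooted_pseudo_mapD(1)[OF F']
    and PG = rooted_pseudo_mapD(1)[OF G] and PG' = rooted_pseudo_mapD(1)[OF G']
  note bF = pm_base_functor[OF CX CY PF] and tF = pm_total_functor[OF CX CY PF]
    and bF' = pm_base_functor[OF CX CY PF'] and tF' = pm_total_functor[OF CX CY PF']
    and bG = pm_base_functor[OF CY CZ PG] and tG = pm_total_functor[OF CY CZ PG]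
    and bG' = pm_base_functor[OF CY CZ PG'] and tG' = pm_total_functor[OF CY CZ PG']
  note T\<alpha> = rooted_transformationD[OF \<alpha>] and T\<beta> = rooted_transformationD[OF \<beta>]
  note bZ = compcat_base[OF CZ]
  note [simp] = cat_simps[OF compcat_base[OF CX]] cat_simps[OF compcat_total[OF CX]]
    cat_simps[OF compcat_base[OF CY]] cat_simps[OF compcat_total[OF CY]]
    cat_simps[OF compcat_base[OF CZ]] cat_simps[OF compcat_total[OF CZ]]
    ftor_simps[OF compcat_proj[OF CX]] ftor_simps[OF compcat_proj[OF CY]]
    ftor_simps[OF compcat_proj[OF CZ]]
    ftor_simps[OF bF] ftor_simps[OF tF] ftor_simps[OF bG] ftor_simps[OF tG]
    ftor_simps[OF bF'] ftor_simps[OF tF'] ftor_simps[OF bG'] ftor_simps[OF tG']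
    compr_simps[OF CX] compr_simps[OF CY] compr_simps[OF CZ]
    pm_simps[OF CX CY PF] pm_simps[OF CX CY PF'] pm_simps[OF CY CZ PG] pm_simps[OF CY CZ PG']
    rooted_compcatD(3)[OF X] rooted_compcatD(3)[OF Y] rooted_compcatD(3)[OF Z]
    rooted_pseudo_mapD(2-4)[OF F] rooted_pseudo_mapD(2-4)[OF G]
    rooted_pseudo_mapD(2-4)[OF F'] rooted_pseudo_mapD(2-4)[OF G']
    nt_simps[OF T\<alpha>(1)] nt_simps[OF T\<alpha>(2)] nt_simps[OF T\<beta>(1)] nt_simps[OF T\<beta>(2)]
    T\<alpha>(3) T\<beta>(3) rooted_pseudo_map_comp(2)[OF X Y Z F G] rooted_pseudo_map_comp(2)[OF X Y Z F' G']
  have sel [simp]: "pm_base (comp_rpmap X Z G F) = fcomp (base X) (pm_base G) (pm_base F)"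
    "pm_total (comp_rpmap X Z G F) = fcomp (total X) (pm_total G) (pm_total F)"
    "pm_root (comp_rpmap X Z G F) = Comp (base Z) (pm_root G) (farr (pm_base G) (pm_root F))"
    for G F by (simp_all add: comp_rpmap_def)
  show ?thesis
    unfolding rooted_transformation_def transformation_def sel
  proof (intro conjI ballI)
    show "nat_trans (base X) (base Z) (fcomp (base X) (pm_base G) (pm_base F))
        (fcomp (base X) (pm_base G') (pm_base F'))
        (hcomp_nt (base X) (base Z) (pm_base G) (pm_base F') \<beta> \<alpha>)"
      by (rule hcomp_nt[OF compcat_base[OF CX] compcat_base[OF CY] bZ bF bF' bG bG' T\<alpha>(1) T\<beta>(1)])
    show "nat_trans (total X) (total Z) (fcomp (total X) (pm_total G) (pm_total F))
        (fcomp (total X) (pm_total G') (pm_total F'))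
        (hcomp_nt (total X) (total Z) (pm_total G) (pm_total F') \<beta>' \<alpha>')"
      by (rule hcomp_nt[OF compcat_total[OF CX] compcat_total[OF CY] compcat_total[OF CZ]
            tF tF' tG tG' T\<alpha>(2) T\<beta>(2)])
    \<comment> \<open>The condition at the root combines three equations: the image under
      \<open>G\<close> of the condition for \<alpha>, naturality of \<beta> at the root isomorphism
      of \<open>F'\<close>, and the condition for \<beta>.\<close>
    have "Comp (base Z) (farr (pm_base G) (pm_root F')) (farr (pm_base G) (\<alpha> (root X))) =
        farr (pm_base G) (pm_root F)"
      using arg_cong[OF T\<alpha>(5), of "farr (pm_base G)"] by simp
    moreover have "Comp (base Z) (farr (pm_base G') (pm_root F'))
          (Comp (base Z) (\<beta> (fob (pm_base F') (root X))) (farr (pm_base G) (\<alpha> (root X)))) =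
        Comp (base Z) (\<beta> (root Y))
          (Comp (base Z) (farr (pm_base G) (pm_root F')) (farr (pm_base G) (\<alpha> (root X))))"
      using cat_comp_cong[OF bZ nt_nat[OF T\<beta>(1), of "pm_root F'"], of "farr (pm_base G) (\<alpha> (root X))"]
      by simp
    moreover have "Comp (base Z) (pm_root G') (Comp (base Z) (\<beta> (root Y)) h) =
        Comp (base Z) (pm_root G) h" if "h \<in> Arr (base Z)" "Cod (base Z) h = fob (pm_base G) (root Y)" for h
      using cat_assoc[OF bZ, of "pm_root G'" "\<beta> (root Y)" h] that by (simp add: T\<beta>(5))
    ultimately show "Comp (base Z) (Comp (base Z) (pm_root G') (farr (pm_base G') (pm_root F')))
          (hcomp_nt (base X) (base Z) (pm_base G) (pm_base F') \<beta> \<alpha> (root X)) =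
        Comp (base Z) (pm_root G) (farr (pm_base G) (pm_root F))"
      by (simp add: hcomp_nt_def)
  next
    fix A assume A [simp]: "A \<in> Obj (total X)"
    show "farr (proj Z) (hcomp_nt (total X) (total Z) (pm_total G) (pm_total F') \<beta>' \<alpha>' A) =
        hcomp_nt (base X) (base Z) (pm_base G) (pm_base F') \<beta> \<alpha> (fob (proj X) A)"
      by (simp add: hcomp_nt_def)
    let ?A = "fob (pm_total F') A"
    \<comment> \<open>The compatibility with comprehension is a pasting of four squares: 1 is the
      compatibility of \<beta> at the image of \<open>A\<close>, 2 the naturality of the
      comprehension isomorphism of \<open>G\<close> at \<alpha>', 3 the naturality of \<beta> at
      that of \<open>F'\<close>, and 4 the image under \<open>G\<close> of the compatibility of
      \<alpha>. A trailing \<open>h\<close> lets an equation apply inside a composite associated to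
      the right.\<close>
    have 1: "Comp (base Z) (pm_ext G' ?A) (Comp (base Z) (ext_map Z (\<beta>' ?A)) h) =
        Comp (base Z) (\<beta> (ext_dom Y ?A)) (Comp (base Z) (pm_ext G ?A) h)"
      if "h \<in> Arr (base Z)" "Cod (base Z) h = ext_dom Z (fob (pm_total G) ?A)" for h
      using cat_comp_cong[OF bZ T\<beta>(4), of ?A h] that by simp
    have 2: "Comp (base Z) (pm_ext G ?A) (ext_map Z (farr (pm_total G) (\<alpha>' A))) =
        Comp (base Z) (farr (pm_base G) (ext_map Y (\<alpha>' A))) (pm_ext G (fob (pm_total F) A))"
      using pm_ext_nat[OF CY CZ PG, of "\<alpha>' A"] by simp
    have 3: "Comp (base Z) (farr (pm_base G') (pm_ext F' A)) (Comp (base Z) (\<beta> (ext_dom Y ?A)) h) =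
        Comp (base Z) (\<beta> (fob (pm_base F') (ext_dom X A)))
          (Comp (base Z) (farr (pm_base G) (pm_ext F' A)) h)"
      if "h \<in> Arr (base Z)" "Cod (base Z) h = fob (pm_base G) (ext_dom Y ?A)" for h
      using cat_comp_cong[OF bZ nt_nat[OF T\<beta>(1), of "pm_ext F' A"], of h] that by simp
    have "Comp (base Z) (farr (pm_base G) (pm_ext F' A)) (farr (pm_base G) (ext_map Y (\<alpha>' A))) =
        Comp (base Z) (farr (pm_base G) (\<alpha> (ext_dom X A))) (farr (pm_base G) (pm_ext F A))"
      using arg_cong[OF T\<alpha>(4)[OF A], of "farr (pm_base G)"] by simp
    then have 4: "Comp (base Z) (farr (pm_base G) (pm_ext F' A))
          (Comp (base Z) (farr (pm_base G) (ext_map Y (\<alpha>' A))) h) =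
        Comp (base Z) (farr (pm_base G) (\<alpha> (ext_dom X A)))
          (Comp (base Z) (farr (pm_base G) (pm_ext F A)) h)"
      if "h \<in> Arr (base Z)" "Cod (base Z) h = fob (pm_base G) (ext_dom Y (fob (pm_total F) A))" for h
      by (rule cat_comp_cong[OF bZ]) (simp_all add: that)
    show "Comp (base Z) (pm_ext (comp_rpmap X Z G' F') A)
          (ext_map Z (hcomp_nt (total X) (total Z) (pm_total G) (pm_total F') \<beta>' \<alpha>' A)) =
        Comp (base Z) (hcomp_nt (base X) (base Z) (pm_base G) (pm_base F') \<beta> \<alpha> (ext_dom X A))
          (pm_ext (comp_rpmap X Z G F) A)"
      by (simp add: hcomp_nt_def 1 2 3 4)
  qed
qed

section \<open>Strict unit and associativity laws for rooted pseudo maps\<close>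

lemma rpmap_eqI:
  fixes F G :: "('o, 'm, 'a, 'b) rpmap"
  assumes X: "rooted_compcat X" and Y: "rooted_compcat Y"
    and F: "rooted_pseudo_map X Y F" and G: "rooted_pseudo_map X Y G"
    and "pm_base F = pm_base G" "pm_total F = pm_total G" "pm_root F = pm_root G"
    and ext: "\<And>A. A \<in> Obj (total X) \<Longrightarrow> pm_ext F A = pm_ext G A"
  shows "F = G"
proof -
  note CX = rooted_compcatD(1)[OF X] and CY = rooted_compcatD(1)[OF Y]
  note PF = rooted_pseudo_mapD(1)[OF F] and PG = rooted_pseudo_mapD(1)[OF G]
  have "pm_compr F = pm_compr G"
  proof (rule extensionalityI[OF pm_compr_ext[OF CX CY PF] pm_compr_ext[OF CX CY PG]])
    fix A assume A: "A \<in> Obj (total X)"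
    show "pm_compr F A = pm_compr G A"
      by (subst pm_compr_square[OF CX CY PF A], subst pm_compr_square[OF CX CY PG A])
        (simp add: assms A)
  qed
  then show ?thesis using assms by (intro rpmap.equality) simp_all
qed

lemma comp_rpmap_sel:
  "pm_base (comp_rpmap X Z G F) = fcomp (base X) (pm_base G) (pm_base F)"
  "pm_total (comp_rpmap X Z G F) = fcomp (total X) (pm_total G) (pm_total F)"
  "pm_root (comp_rpmap X Z G F) = Comp (base Z) (pm_root G) (farr (pm_base G) (pm_root F))"
  by (simp_all add: comp_rpmap_def)

lemma id_rpmap_sel:
  "pm_base (id_rpmap X) = id_functor (base X)" "pm_total (id_rpmap X) = id_functor (total X)"
  "pm_root (id_rpmap X) = Id (base X) (root X)"
  by (simp_all add: id_rpmap_def)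

lemma comp_rpmap_unit:
  assumes X: "rooted_compcat X" and Y: "rooted_compcat Y" and F: "rooted_pseudo_map X Y F"
  shows "comp_rpmap X Y (id_rpmap Y) F = F" "comp_rpmap X Y F (id_rpmap X) = F"
proof -
  note CX = rooted_compcatD(1)[OF X] and CY = rooted_compcatD(1)[OF Y]
  note PF = rooted_pseudo_mapD(1)[OF F]
  note bF = pm_base_functor[OF CX CY PF] and tF = pm_total_functor[OF CX CY PF]
  have e: "A \<in> Obj (total Z) \<Longrightarrow> pm_ext (id_rpmap Z) A = Id (base Z) (ext_dom Z A)"
    if "rooted_compcat Z" for Z :: "('a, 'b, 'c, 'd) rcompcat" and A
    using compr_arr[OF rooted_compcatD(1)[OF that]]
    by (simp add: id_rpmap_def arrow_cat_simps ext_dom_def)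
  note [simp] = cat_simps[OF compcat_base[OF CX]] cat_simps[OF compcat_base[OF CY]]
    ftor_simps[OF bF] ftor_simps[OF tF] compr_simps[OF CX] compr_simps[OF CY] pm_simps[OF CX CY PF]
    rooted_compcatD(3)[OF X] rooted_compcatD(3)[OF Y] rooted_pseudo_mapD(2-4)[OF F]
  show "comp_rpmap X Y (id_rpmap Y) F = F"
    by (rule rpmap_eqI[OF X Y rooted_pseudo_map_comp(1)[OF X Y Y F rooted_pseudo_map_id[OF Y]] F])
      (simp_all add: comp_rpmap_sel id_rpmap_sel fcomp_id_left[OF bF] fcomp_id_left[OF tF]
        rooted_pseudo_map_comp(2)[OF X Y Y F rooted_pseudo_map_id[OF Y]] e[OF Y])
  show "comp_rpmap X Y F (id_rpmap X) = F"
    by (rule rpmap_eqI[OF X Y rooted_pseudo_map_comp(1)[OF X X Y rooted_pseudo_map_id[OF X] F] F])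
      (simp_all add: comp_rpmap_sel id_rpmap_sel fcomp_id_right[OF bF] fcomp_id_right[OF tF]
        rooted_pseudo_map_comp(2)[OF X X Y rooted_pseudo_map_id[OF X] F] e[OF X])
qed

lemma comp_rpmap_assoc:
  assumes W: "rooted_compcat W" and X: "rooted_compcat X" and Y: "rooted_compcat Y"
    and Z: "rooted_compcat Z" and F: "rooted_pseudo_map W X F" and G: "rooted_pseudo_map X Y G"
    and H: "rooted_pseudo_map Y Z H"
  shows "comp_rpmap W Z H (comp_rpmap W Y G F) = comp_rpmap W Z (comp_rpmap X Z H G) F"
proof -
  note CW = rooted_compcatD(1)[OF W] and CX = rooted_compcatD(1)[OF X]
    and CY = rooted_compcatD(1)[OF Y] and CZ = rooted_compcatD(1)[OF Z]
  note PF = rooted_pseudo_mapD(1)[OF F] and PG = rooted_pseudo_mapD(1)[OF G]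
    and PH = rooted_pseudo_mapD(1)[OF H]
  note bF = pm_base_functor[OF CW CX PF] and tF = pm_total_functor[OF CW CX PF]
    and bG = pm_base_functor[OF CX CY PG] and tG = pm_total_functor[OF CX CY PG]
    and bH = pm_base_functor[OF CY CZ PH] and tH = pm_total_functor[OF CY CZ PH]
  note GF = rooted_pseudo_map_comp[OF W X Y F G] and HG = rooted_pseudo_map_comp[OF X Y Z G H]
  note H_GF = rooted_pseudo_map_comp[OF W Y Z GF(1) H]
    and HG_F = rooted_pseudo_map_comp[OF W X Z F HG(1)]
  note [simp] = cat_simps[OF compcat_base[OF CX]] cat_simps[OF compcat_base[OF CY]]
    cat_simps[OF compcat_base[OF CZ]]
    ftor_simps[OF bF] ftor_simps[OF tF] ftor_simps[OF bG] ftor_simps[OF tG] ftor_simps[OF bH]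
    ftor_simps[OF tH] compr_simps[OF CX] compr_simps[OF CY] compr_simps[OF CW]
    pm_simps[OF CW CX PF] pm_simps[OF CX CY PG] pm_simps[OF CY CZ PH]
    rooted_compcatD(3)[OF X] rooted_compcatD(3)[OF Y] rooted_compcatD(3)[OF W]
    rooted_pseudo_mapD(2-4)[OF F] rooted_pseudo_mapD(2-4)[OF G] rooted_pseudo_mapD(2-4)[OF H]
  show ?thesis
    by (rule rpmap_eqI[OF W Z H_GF(1) HG_F(1)])
      (simp_all add: comp_rpmap_sel fcomp_assoc[OF bF] fcomp_assoc[OF tF]
        GF(2) HG(2) H_GF(2) HG_F(2))
qed

section \<open>The 2-category of rooted comprehension categories\<close>

lemma compcat_hom_simps:
  "F \<in> Obj (compcat_hom X Y) \<longleftrightarrow> rooted_pseudo_map X Y F"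
  "(F, G, \<alpha>, \<alpha>') \<in> Arr (compcat_hom X Y) \<longleftrightarrow>
    rooted_pseudo_map X Y F \<and> rooted_pseudo_map X Y G \<and> rooted_transformation X Y F G \<alpha> \<alpha>'"
  "rooted_pseudo_map X Y F \<Longrightarrow> rooted_pseudo_map X Y G \<Longrightarrow> rooted_transformation X Y F G \<alpha> \<alpha>' \<Longrightarrow>
    Dom (compcat_hom X Y) (F, G, \<alpha>, \<alpha>') = F"
  "rooted_pseudo_map X Y F \<Longrightarrow> rooted_pseudo_map X Y G \<Longrightarrow> rooted_transformation X Y F G \<alpha> \<alpha>' \<Longrightarrow>
    Cod (compcat_hom X Y) (F, G, \<alpha>, \<alpha>') = G"
  "rooted_pseudo_map X Y F \<Longrightarrow> Id (compcat_hom X Y) F =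
    (F, F, id_nt (base X) (base Y) (pm_base F), id_nt (total X) (total Y) (pm_total F))"
  "rooted_pseudo_map X Y F \<Longrightarrow> rooted_pseudo_map X Y G \<Longrightarrow> rooted_pseudo_map X Y H \<Longrightarrow>
    rooted_transformation X Y F G \<alpha> \<alpha>' \<Longrightarrow> rooted_transformation X Y G H \<beta> \<beta>' \<Longrightarrow>
    Comp (compcat_hom X Y) (G, H, \<beta>, \<beta>') (F, G, \<alpha>, \<alpha>') =
    (F, H, vcomp_nt (base X) (base Y) \<beta> \<alpha>, vcomp_nt (total X) (total Y) \<beta>' \<alpha>')"
  by (simp_all add: compcat_hom_def Let_def)

lemma category_compcat_hom:
  assumes X: "rooted_compcat X" and Y: "rooted_compcat Y"
  shows "category (compcat_hom X Y)"
proof -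
  note bY = compcat_base[OF rooted_compcatD(1)[OF Y]] and tY = compcat_total[OF rooted_compcatD(1)[OF Y]]
  have v: "rooted_transformation X Y F H (vcomp_nt (base X) (base Y) \<beta> \<alpha>)
      (vcomp_nt (total X) (total Y) \<beta>' \<alpha>')"
    if "rooted_transformation X Y F G \<alpha> \<alpha>'" "rooted_transformation X Y G H \<beta> \<beta>'"
      "rooted_pseudo_map X Y F" "rooted_pseudo_map X Y G" "rooted_pseudo_map X Y H"
    for F G H \<alpha> \<alpha>' \<beta> \<beta>'
    using rooted_transformation_vcomp[OF X Y] that by blast
  note [simp] = compcat_hom_simps rooted_transformation_id[OF X Y]
  show ?thesis
  proof (rule categoryI)
    show "Comp (compcat_hom X Y) g f = undefined" if "\<not> composable (compcat_hom X Y) g f" for g f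
      using that by (cases g; cases f) (auto simp: compcat_hom_def Let_def composable_def)
    show "Comp (compcat_hom X Y) f (Id (compcat_hom X Y) (Dom (compcat_hom X Y) f)) = f"
      "Comp (compcat_hom X Y) (Id (compcat_hom X Y) (Cod (compcat_hom X Y) f)) f = f"
      if "f \<in> Arr (compcat_hom X Y)" for f
      using that
      by (cases f; auto simp: vcomp_id_left[OF bY] vcomp_id_left[OF tY] vcomp_id_right[OF bY]
          vcomp_id_right[OF tY] dest: rooted_transformationD)+
    show "Comp (compcat_hom X Y) h (Comp (compcat_hom X Y) g f) =
        Comp (compcat_hom X Y) (Comp (compcat_hom X Y) h g) f"
      if "h \<in> Arr (compcat_hom X Y)" "g \<in> Arr (compcat_hom X Y)" "f \<in> Arr (compcat_hom X Y)"
        "Cod (compcat_hom X Y) f = Dom (compcat_hom X Y) g"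
        "Cod (compcat_hom X Y) g = Dom (compcat_hom X Y) h" for h g f
    proof -
      obtain F G \<alpha> \<alpha>' where f: "f = (F, G, \<alpha>, \<alpha>')" by (cases f) auto
      obtain G1 H \<beta> \<beta>' where g: "g = (G1, H, \<beta>, \<beta>')" by (cases g) auto
      obtain H1 K \<gamma> \<gamma>' where h: "h = (H1, K, \<gamma>, \<gamma>')" by (cases h) auto
      have [simp]: "G1 = G" "H1 = H" using that by (auto simp: f g h)
      have *: "rooted_pseudo_map X Y F" "rooted_pseudo_map X Y G" "rooted_pseudo_map X Y H"
        "rooted_pseudo_map X Y K" and t: "rooted_transformation X Y F G \<alpha> \<alpha>'"
        "rooted_transformation X Y G H \<beta> \<beta>'" "rooted_transformation X Y H K \<gamma> \<gamma>'"
        using that by (auto simp: f g h)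
      show ?thesis
        by (simp add: f g h * t v[OF t(1,2)] v[OF t(2,3)]
          vcomp_assoc[OF bY rooted_transformationD(1)[OF t(1)] rooted_transformationD(1)[OF t(2)]
            rooted_transformationD(1)[OF t(3)]]
          vcomp_assoc[OF tY rooted_transformationD(2)[OF t(1)] rooted_transformationD(2)[OF t(2)]
            rooted_transformationD(2)[OF t(3)]])
    qed
  qed (auto simp: v homs_def, auto simp: compcat_hom_def Let_def)
qed

lemma CompCat_rtd_on_simps:
  "Ob (CompCat_rtd_on obs) = {X \<in> obs. rooted_compcat X}"
  "Hom (CompCat_rtd_on obs) = compcat_hom" "Unit (CompCat_rtd_on obs) = id_rpmap"
  "rooted_pseudo_map Y Z G \<Longrightarrow> rooted_pseudo_map X Y F \<Longrightarrow>
    comp1 (CompCat_rtd_on obs) X Y Z G F = comp_rpmap X Z G F"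
  "rooted_pseudo_map Y Z G \<Longrightarrow> rooted_pseudo_map Y Z G' \<Longrightarrow> rooted_pseudo_map X Y F \<Longrightarrow>
    rooted_pseudo_map X Y F' \<Longrightarrow> rooted_transformation Y Z G G' \<beta> \<beta>' \<Longrightarrow>
    rooted_transformation X Y F F' \<alpha> \<alpha>' \<Longrightarrow>
    comp2 (CompCat_rtd_on obs) X Y Z (G, G', \<beta>, \<beta>') (F, F', \<alpha>, \<alpha>') =
    (comp_rpmap X Z G F, comp_rpmap X Z G' F',
     hcomp_nt (base X) (base Z) (pm_base G) (pm_base F') \<beta> \<alpha>,
     hcomp_nt (total X) (total Z) (pm_total G) (pm_total F') \<beta>' \<alpha>')"
  by (simp_all add: CompCat_rtd_on_def comp1_def comp2_def compcat_hom_simps)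

lemma compcat_hom_objI:
  assumes "rooted_compcat X" "rooted_compcat Y" "rooted_pseudo_map X Y F"
  shows "category (base X)" "category (total X)" "category (base Y)" "category (total Y)"
    "is_functor (base X) (base Y) (pm_base F)" "is_functor (total X) (total Y) (pm_total F)"
proof -
  note CX = rooted_compcatD(1)[OF assms(1)] and CY = rooted_compcatD(1)[OF assms(2)]
  show "category (base X)" "category (total X)" "category (base Y)" "category (total Y)"
    by (rule compcat_base[OF CX] compcat_total[OF CX] compcat_base[OF CY] compcat_total[OF CY])+
  show "is_functor (base X) (base Y) (pm_base F)" "is_functor (total X) (total Y) (pm_total F)"
    using pm_base_functor[OF CX CY] pm_total_functor[OF CX CY] rooted_pseudo_mapD(1)[OF assms(3)]
    by auto
qed

lemma CompCat_hcomp_functor: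
  assumes X: "rooted_compcat X" and Y: "rooted_compcat Y" and Z: "rooted_compcat Z"
  shows "is_functor (prod_cat (compcat_hom Y Z) (compcat_hom X Y)) (compcat_hom X Z)
    (HComp (CompCat_rtd_on obs) X Y Z)"
proof (rule is_functorI)
  let ?P = "prod_cat (compcat_hom Y Z) (compcat_hom X Y)"
  let ?M = "HComp (CompCat_rtd_on obs) X Y Z"
  have fob: "fob ?M (G, F) = comp_rpmap X Z G F"
    if "rooted_pseudo_map Y Z G" "rooted_pseudo_map X Y F" for G F
    using CompCat_rtd_on_simps(4)[OF that] by (simp add: comp1_def)
  have farr: "farr ?M ((G, G', \<beta>, \<beta>'), (F, F', \<alpha>, \<alpha>')) =
      (comp_rpmap X Z G F, comp_rpmap X Z G' F',
       hcomp_nt (base X) (base Z) (pm_base G) (pm_base F') \<beta> \<alpha>,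
       hcomp_nt (total X) (total Z) (pm_total G) (pm_total F') \<beta>' \<alpha>')"
    if "rooted_pseudo_map Y Z G" "rooted_pseudo_map Y Z G'" "rooted_pseudo_map X Y F"
      "rooted_pseudo_map X Y F'" "rooted_transformation Y Z G G' \<beta> \<beta>'"
      "rooted_transformation X Y F F' \<alpha> \<alpha>'" for G G' \<beta> \<beta>' F F' \<alpha> \<alpha>'
    using CompCat_rtd_on_simps(5)[OF that] by (simp add: comp2_def)
  note SC = rooted_pseudo_map_comp(1)[OF X Y Z]
  note HC = rooted_transformation_hcomp[OF X Y Z]
  note [simp] = fob farr prod_cat_simps compcat_hom_simps SC
  show "fob ?M p \<in> Obj (compcat_hom X Z)" if "p \<in> Obj ?P" for p
    using that by (cases p) simp
  show "farr ?M p \<in> homs (compcat_hom X Z) (fob ?M (Dom ?P p)) (fob ?M (Cod ?P p))"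
    if "p \<in> Arr ?P" for p
    using that by (cases p) (auto simp: HC intro!: homsI)
  show "farr ?M (Id ?P p) = Id (compcat_hom X Z) (fob ?M p)" if p: "p \<in> Obj ?P" for p
  proof -
    obtain G F where GF: "p = (G, F)" by (cases p)
    with p have G: "rooted_pseudo_map Y Z G" and F: "rooted_pseudo_map X Y F" by auto
    note g = compcat_hom_objI[OF Y Z G] and f = compcat_hom_objI[OF X Y F]
    show ?thesis
      by (simp add: GF G F rooted_transformation_id[OF X Y] rooted_transformation_id[OF Y Z]
          comp_rpmap_sel hcomp_id[OF f(3) g(3) f(5) g(5)] hcomp_id[OF f(4) g(4) f(6) g(6)])
  qed
  show "farr ?M (Comp ?P q p) = Comp (compcat_hom X Z) (farr ?M q) (farr ?M p)"
    if "q \<in> Arr ?P" "p \<in> Arr ?P" "Cod ?P p = Dom ?P q" for q p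
  proof -
    obtain G G' \<beta> \<beta>' F F' \<alpha> \<alpha>' where p: "p = ((G, G', \<beta>, \<beta>'), (F, F', \<alpha>, \<alpha>'))"
      by (cases p) auto
    obtain G1 G'' \<delta> \<delta>' F1 F'' \<gamma> \<gamma>' where q: "q = ((G1, G'', \<delta>, \<delta>'), (F1, F'', \<gamma>, \<gamma>'))"
      by (cases q) auto
    have [simp]: "G1 = G'" "F1 = F'" using that by (auto simp: p q)
    have G: "rooted_pseudo_map Y Z G" "rooted_pseudo_map Y Z G'" "rooted_pseudo_map Y Z G''"
      and F: "rooted_pseudo_map X Y F" "rooted_pseudo_map X Y F'" "rooted_pseudo_map X Y F''"
      and \<beta>: "rooted_transformation Y Z G G' \<beta> \<beta>'" and \<delta>: "rooted_transformation Y Z G' G'' \<delta> \<delta>'"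
      and \<alpha>: "rooted_transformation X Y F F' \<alpha> \<alpha>'" and \<gamma>: "rooted_transformation X Y F' F'' \<gamma> \<gamma>'"
      using that by (auto simp: p q)
    note g = compcat_hom_objI[OF Y Z G(1)] compcat_hom_objI(5,6)[OF Y Z G(2)]
      compcat_hom_objI(5,6)[OF Y Z G(3)]
    note f = compcat_hom_objI[OF X Y F(1)] compcat_hom_objI(5,6)[OF X Y F(2)]
      compcat_hom_objI(5,6)[OF X Y F(3)]
    note interchange =
      hcomp_vcomp[OF f(1) f(3) g(3) f(5,7,9) g(5,7,9) rooted_transformationD(1)[OF \<alpha>]
        rooted_transformationD(1)[OF \<gamma>] rooted_transformationD(1)[OF \<beta>] rooted_transformationD(1)[OF \<delta>]]
      hcomp_vcomp[OF f(2) f(4) g(4) f(6,8,10) g(6,8,10) rooted_transformationD(2)[OF \<alpha>]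
        rooted_transformationD(2)[OF \<gamma>] rooted_transformationD(2)[OF \<beta>] rooted_transformationD(2)[OF \<delta>]]
    show ?thesis
      using G F \<beta> \<delta> \<alpha> \<gamma> rooted_transformation_vcomp[OF X Y F \<alpha> \<gamma>]
        rooted_transformation_vcomp[OF Y Z G \<beta> \<delta>] HC[OF F(1,2) G(1,2) \<alpha> \<beta>] HC[OF F(2,3) G(2,3) \<gamma> \<delta>]
      by (simp add: p q composable_def interchange)
  qed
qed (simp_all add: CompCat_rtd_on_def prod_cat_simps)

text \<open>The class \<open>obs\<close> only restricts the objects, and both 2-categories of the
  second adjunction are of this form, so one proof serves them both.\<close>

lemma two_category_CompCat_rtd_on:
  "two_category (CompCat_rtd_on (obs :: ('o, 'm, 'a, 'b) rcompcat set))"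
  unfolding two_category_def CompCat_rtd_on_simps(1-3) Ball_def mem_Collect_eq
proof (intro conjI allI impI)
  let ?K = "CompCat_rtd_on obs"
  fix X Y :: "('o, 'm, 'a, 'b) rcompcat"
  assume "X \<in> obs \<and> rooted_compcat X" "Y \<in> obs \<and> rooted_compcat Y"
  then have X: "rooted_compcat X" and Y: "rooted_compcat Y" by blast+
  show "category (compcat_hom X Y)" by (rule category_compcat_hom[OF X Y])
  show "id_rpmap X \<in> Obj (compcat_hom X X)"
    by (simp add: compcat_hom_simps rooted_pseudo_map_id[OF X])
  show "comp1 ?K X Y Y (id_rpmap Y) F = F" "comp1 ?K X X Y F (id_rpmap X) = F"
    if "F \<in> Obj (compcat_hom X Y)" for F
    using that by (simp_all add: compcat_hom_simps CompCat_rtd_on_simps comp_rpmap_unit[OF X Y]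
        rooted_pseudo_map_id[OF X] rooted_pseudo_map_id[OF Y])
  show "comp2 ?K X Y Y (Id (compcat_hom Y Y) (id_rpmap Y)) a = a"
    "comp2 ?K X X Y a (Id (compcat_hom X X) (id_rpmap X)) = a" if "a \<in> Arr (compcat_hom X Y)" for a
  proof -
    obtain F F' \<alpha> \<alpha>' where a: "a = (F, F', \<alpha>, \<alpha>')" by (cases a)
    then have F: "rooted_pseudo_map X Y F" "rooted_pseudo_map X Y F'"
      and \<alpha>: "rooted_transformation X Y F F' \<alpha> \<alpha>'" using that by (auto simp: compcat_hom_simps)
    note f = compcat_hom_objI[OF X Y F(1)] compcat_hom_objI(5,6)[OF X Y F(2)]
    note idX = rooted_pseudo_map_id[OF X] and idY = rooted_pseudo_map_id[OF Y]
    note simps = a F \<alpha> compcat_hom_simps CompCat_rtd_on_simps idX idY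
      rooted_transformation_id[OF X X idX] rooted_transformation_id[OF Y Y idY]
      comp_rpmap_unit[OF X Y] id_rpmap_sel
    show "comp2 ?K X Y Y (Id (compcat_hom Y Y) (id_rpmap Y)) a = a"
      using hcomp_id_left[OF f(3,7) rooted_transformationD(1)[OF \<alpha>]]
        hcomp_id_left[OF f(4,8) rooted_transformationD(2)[OF \<alpha>]]
        rooted_transformation_id[OF Y Y idY]
      by (simp add: simps)
    show "comp2 ?K X X Y a (Id (compcat_hom X X) (id_rpmap X)) = a"
      using hcomp_id_right[OF f(1,3,5) rooted_transformationD(1)[OF \<alpha>]]
        hcomp_id_right[OF f(2,4,6) rooted_transformationD(2)[OF \<alpha>]]
        rooted_transformation_id[OF X X idX]
      by (simp add: simps)
  qed
next
  fix X Y Z :: "('o, 'm, 'a, 'b) rcompcat"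
  assume "X \<in> obs \<and> rooted_compcat X" "Y \<in> obs \<and> rooted_compcat Y" "Z \<in> obs \<and> rooted_compcat Z"
  then show "is_functor (prod_cat (compcat_hom Y Z) (compcat_hom X Y)) (compcat_hom X Z)
      (HComp (CompCat_rtd_on obs) X Y Z)"
    using CompCat_hcomp_functor by blast
next
  let ?K = "CompCat_rtd_on obs"
  fix W X Y Z :: "('o, 'm, 'a, 'b) rcompcat"
  assume "W \<in> obs \<and> rooted_compcat W" "X \<in> obs \<and> rooted_compcat X"
    "Y \<in> obs \<and> rooted_compcat Y" "Z \<in> obs \<and> rooted_compcat Z"
  then have W: "rooted_compcat W" and X: "rooted_compcat X" and Y: "rooted_compcat Y"
    and Z: "rooted_compcat Z" by blast+
  show "comp1 ?K W Y Z h (comp1 ?K W X Y g f) = comp1 ?K W X Z (comp1 ?K X Y Z h g) f"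
    if "h \<in> Obj (compcat_hom Y Z)" "g \<in> Obj (compcat_hom X Y)" "f \<in> Obj (compcat_hom W X)" for h g f
    using that rooted_pseudo_map_comp(1)[OF W X Y, of f g] rooted_pseudo_map_comp(1)[OF X Y Z, of g h]
    by (simp add: compcat_hom_simps CompCat_rtd_on_simps comp_rpmap_assoc[OF W X Y Z])
  show "comp2 ?K W Y Z c (comp2 ?K W X Y b a) = comp2 ?K W X Z (comp2 ?K X Y Z c b) a"
    if "c \<in> Arr (compcat_hom Y Z)" "b \<in> Arr (compcat_hom X Y)" "a \<in> Arr (compcat_hom W X)" for c b a
  proof -
    obtain F F' \<alpha> \<alpha>' where a: "a = (F, F', \<alpha>, \<alpha>')" by (cases a)
    obtain G G' \<beta> \<beta>' where b: "b = (G, G', \<beta>, \<beta>')" by (cases b)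
    obtain H H' \<gamma> \<gamma>' where c: "c = (H, H', \<gamma>, \<gamma>')" by (cases c)
    have F: "rooted_pseudo_map W X F" "rooted_pseudo_map W X F'"
      and \<alpha>: "rooted_transformation W X F F' \<alpha> \<alpha>'"
      and G: "rooted_pseudo_map X Y G" "rooted_pseudo_map X Y G'"
      and \<beta>: "rooted_transformation X Y G G' \<beta> \<beta>'"
      and H: "rooted_pseudo_map Y Z H" "rooted_pseudo_map Y Z H'"
      and \<gamma>: "rooted_transformation Y Z H H' \<gamma> \<gamma>'"
      using that by (auto simp: a b c compcat_hom_simps)
    note f = compcat_hom_objI[OF W X F(2)] and g = compcat_hom_objI[OF X Y G(1)]
      compcat_hom_objI(5,6)[OF X Y G(2)]
    note h = compcat_hom_objI[OF Y Z H(1)] compcat_hom_objI(5,6)[OF Y Z H(2)]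
    note assoc =
      hcomp_assoc[OF f(3) g(3) h(3) f(5) g(5,7) h(5,7) rooted_transformationD(1)[OF \<alpha>]
        rooted_transformationD(1)[OF \<beta>] rooted_transformationD(1)[OF \<gamma>]]
      hcomp_assoc[OF f(4) g(4) h(4) f(6) g(6,8) h(6,8) rooted_transformationD(2)[OF \<alpha>]
        rooted_transformationD(2)[OF \<beta>] rooted_transformationD(2)[OF \<gamma>]]
    show ?thesis
      by (simp add: a b c F G H \<alpha> \<beta> \<gamma> CompCat_rtd_on_simps comp_rpmap_sel assoc
          comp_rpmap_assoc[OF W X Y Z F(1) G(1) H(1)] comp_rpmap_assoc[OF W X Y Z F(2) G(2) H(2)]
          rooted_pseudo_map_comp(1)[OF W X Y F(1) G(1)] rooted_pseudo_map_comp(1)[OF W X Y F(2) G(2)]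
          rooted_pseudo_map_comp(1)[OF X Y Z G(1) H(1)] rooted_pseudo_map_comp(1)[OF X Y Z G(2) H(2)]
          rooted_transformation_hcomp[OF W X Y F G \<alpha> \<beta>] rooted_transformation_hcomp[OF X Y Z G H \<beta> \<gamma>])
  qed
qed

section \<open>Finite limits from pullbacks and a terminal object\<close>

text \<open>Source and target are functions of an arrow, so an equation between composites already
  forces their ends to agree. Equality of sources then need not be carried as a separate premise in
  cancellation lemmas.\<close>

lemma comp_eq_ends:
  assumes "category C" "Comp C g f = Comp C g' f'"
    and "g \<in> Arr C" "f \<in> Arr C" "Cod C f = Dom C g"
    and "g' \<in> Arr C" "f' \<in> Arr C" "Cod C f' = Dom C g'"
  shows "Dom C f = Dom C f'" "Cod C g = Cod C g'"
  using assms cat_dom_comp[OF assms(1)] cat_cod_comp[OF assms(1)] by metis+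

lemma pullback_facts:
  assumes "category C" "is_pullback C d f q d'"
  shows pb_arr: "d \<in> Arr C" "f \<in> Arr C" "q \<in> Arr C" "d' \<in> Arr C"
    and pb_dom: "Cod C q = Dom C d" "Cod C d' = Dom C f" "Dom C q = Dom C d'" "Cod C d = Cod C f"
    and pb_comm: "Comp C d q = Comp C f d'"
proof -
  show *: "d \<in> Arr C" "f \<in> Arr C" "q \<in> Arr C" "d' \<in> Arr C"
    "Cod C q = Dom C d" "Cod C d' = Dom C f" "Dom C q = Dom C d'" "Comp C d q = Comp C f d'"
    using assms(2) by (auto simp: is_pullback_def composable_def)
  show "Cod C d = Cod C f"
    by (rule comp_eq_ends[OF assms(1) *(8)]) (use * in simp_all)
qed

lemma pullback_universal:
  assumes "is_pullback C d f q d'" "a \<in> Arr C" "b \<in> Arr C" "Cod C a = Dom C d" "Cod C b = Dom C f"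
    "Dom C a = Dom C b" "Comp C d a = Comp C f b"
  shows "\<exists>!h. h \<in> homs C (Dom C a) (Dom C q) \<and> Comp C q h = a \<and> Comp C d' h = b"
  using assms unfolding is_pullback_def composable_def by blast

lemma pullback_lift:
  assumes "is_pullback C d f q d'" "a \<in> Arr C" "b \<in> Arr C" "Cod C a = Dom C d" "Cod C b = Dom C f"
    "Dom C a = Dom C b" "Comp C d a = Comp C f b"
  shows "\<exists>h. h \<in> Arr C \<and> Dom C h = Dom C a \<and> Cod C h = Dom C q \<and> Comp C q h = a \<and> Comp C d' h = b"
  using pullback_universal[OF assms] by (auto simp: homs_def)

lemma pullback_unique:
  assumes C: "category C" and P: "is_pullback C d f q d'"
    and "h \<in> Arr C" "k \<in> Arr C" "Cod C h = Dom C q" "Cod C k = Dom C q"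
    "Comp C q h = Comp C q k" "Comp C d' h = Comp C d' k"
  shows "h = k"
proof -
  note [simp] = cat_simps[OF C] pullback_facts[OF C P]
  have D: "Dom C h = Dom C k"
    by (rule comp_eq_ends[OF C assms(7)]) (use assms(3-6) in simp_all)
  have "Comp C d (Comp C q k) = Comp C f (Comp C d' k)"
    by (rule cat_comp_cong[OF C pb_comm[OF C P]]) (use assms in simp_all)
  then have "\<exists>!h. h \<in> homs C (Dom C (Comp C q k)) (Dom C q) \<and> Comp C q h = Comp C q k \<and>
      Comp C d' h = Comp C d' k"
    by (intro pullback_universal[OF P]) (use assms(3-6) in simp_all)
  then show ?thesis using assms(3-8) D homsI[of h C "Dom C k" "Dom C q"] homsI[of k C "Dom C k" "Dom C q"]
    by auto
qed

lemma is_pullbackI: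
  assumes "d \<in> Arr C" "f \<in> Arr C" "q \<in> Arr C" "d' \<in> Arr C"
    "Cod C q = Dom C d" "Cod C d' = Dom C f" "Dom C q = Dom C d'" "Comp C d q = Comp C f d'"
    and "\<And>a b. a \<in> Arr C \<Longrightarrow> b \<in> Arr C \<Longrightarrow> Cod C a = Dom C d \<Longrightarrow> Cod C b = Dom C f \<Longrightarrow>
      Dom C a = Dom C b \<Longrightarrow> Comp C d a = Comp C f b \<Longrightarrow>
      \<exists>h. h \<in> Arr C \<and> Dom C h = Dom C a \<and> Cod C h = Dom C q \<and> Comp C q h = a \<and> Comp C d' h = b"
    and "\<And>h k. h \<in> Arr C \<Longrightarrow> k \<in> Arr C \<Longrightarrow> Cod C h = Dom C q \<Longrightarrow> Cod C k = Dom C q \<Longrightarrow>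
      Dom C h = Dom C k \<Longrightarrow> Comp C q h = Comp C q k \<Longrightarrow> Comp C d' h = Comp C d' k \<Longrightarrow> h = k"
  shows "is_pullback C d f q d'"
  unfolding is_pullback_def composable_def
proof (intro conjI allI impI)
  fix a b assume "(d \<in> Arr C \<and> a \<in> Arr C \<and> Cod C a = Dom C d) \<and>
    (f \<in> Arr C \<and> b \<in> Arr C \<and> Cod C b = Dom C f) \<and> Dom C a = Dom C b \<and> Comp C d a = Comp C f b"
  then obtain h where "h \<in> Arr C" "Dom C h = Dom C a" "Cod C h = Dom C q" "Comp C q h = a"
    "Comp C d' h = b"
    using assms(9) by blast
  then show "\<exists>!h. h \<in> homs C (Dom C a) (Dom C q) \<and> Comp C q h = a \<and> Comp C d' h = b"
    using assms(10) by (intro ex1I[of _ h]) (auto simp: homs_def)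
qed (use assms in simp_all)

lemma pullback_sym:
  assumes C: "category C" and P: "is_pullback C d f q d'"
  shows "is_pullback C f d d' q"
proof (rule is_pullbackI)
  show "Comp C f d' = Comp C d q" by (rule pb_comm[OF C P, symmetric])
  show "\<exists>h. h \<in> Arr C \<and> Dom C h = Dom C a \<and> Cod C h = Dom C d' \<and> Comp C d' h = a \<and> Comp C q h = b"
    if "a \<in> Arr C" "b \<in> Arr C" "Cod C a = Dom C f" "Cod C b = Dom C d" "Dom C a = Dom C b"
      "Comp C f a = Comp C d b" for a b
    using pullback_lift[OF P that(2,1,4,3) that(5,6)[symmetric]] that pb_dom(3)[OF C P] by auto
  show "h = k" if "h \<in> Arr C" "k \<in> Arr C" "Cod C h = Dom C d'" "Cod C k = Dom C d'"
      "Comp C d' h = Comp C d' k" "Comp C q h = Comp C q k" for h k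
    by (rule pullback_unique[OF C P]) (use that pb_dom(3)[OF C P] in auto)
qed (simp_all add: pullback_facts(1-7)[OF C P] pb_dom(4)[OF C P, symmetric])

lemma pullback_iso:
  assumes C: "category C" and P: "is_pullback C d f q d'" and P': "is_pullback C d f q' d''"
  obtains u where "is_iso C u" "Dom C u = Dom C q'" "Cod C u = Dom C q" "Comp C q u = q'"
    "Comp C d' u = d''"
proof -
  note [simp] = cat_simps[OF C] pullback_facts(1-8)[OF C P] pullback_facts(1-8)[OF C P']
    pb_comm[OF C P] pb_comm[OF C P']
  have "\<exists>u. u \<in> Arr C \<and> Dom C u = Dom C q' \<and> Cod C u = Dom C q \<and> Comp C q u = q' \<and> Comp C d' u = d''"
    by (rule pullback_lift[OF P]) simp_all
  then obtain u where u: "u \<in> Arr C" "Dom C u = Dom C q'" "Cod C u = Dom C q" "Comp C q u = q'"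
    "Comp C d' u = d''" by blast
  have "\<exists>v. v \<in> Arr C \<and> Dom C v = Dom C q \<and> Cod C v = Dom C q' \<and> Comp C q' v = q \<and> Comp C d'' v = d'"
    by (rule pullback_lift[OF P']) simp_all
  then obtain v where v: "v \<in> Arr C" "Dom C v = Dom C q" "Cod C v = Dom C q'" "Comp C q' v = q"
    "Comp C d'' v = d'" by blast
  have uv: "Comp C q (Comp C u v) = q" "Comp C d' (Comp C u v) = d'"
    using cat_assoc[OF C, of q u v] cat_assoc[OF C, of d' u v] u v by simp_all
  have "Comp C u v = Id C (Dom C q)"
    by (rule pullback_unique[OF C P]) (use u v uv in simp_all)
  moreover have vu: "Comp C q' (Comp C v u) = q'" "Comp C d'' (Comp C v u) = d''"
    using cat_assoc[OF C, of q' v u] cat_assoc[OF C, of d'' v u] u v by simp_all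
  have "Comp C v u = Id C (Dom C q')"
    by (rule pullback_unique[OF C P']) (use u v vu in simp_all)
  ultimately have "is_iso C u" using u v by (intro is_isoI[of _ _ v]) simp_all
  then show ?thesis using u that by blast
qed

lemma iso_cancel:
  assumes C: "category C" and u: "is_iso C u"
    and "h \<in> Arr C" "k \<in> Arr C" "Cod C h = Dom C u" "Cod C k = Dom C u" "Comp C u h = Comp C u k"
  shows "h = k"
proof -
  obtain v where v: "u \<in> Arr C" "v \<in> Arr C" "Dom C v = Cod C u" "Cod C v = Dom C u"
    "Comp C v u = Id C (Dom C u)" by (rule is_isoE[OF u])
  have vu: "Comp C v (Comp C u l) = l" if "l \<in> Arr C" "Cod C l = Dom C u" for l
  proof -
    have "Comp C v (Comp C u l) = Comp C (Comp C v u) l"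
      by (rule cat_assoc[OF C, symmetric]) (use v that in simp_all)
    also have "\<dots> = l" using that by (simp add: v(5) cat_id_left[OF C])
    finally show ?thesis .
  qed
  have "h = Comp C v (Comp C u h)" using vu assms(3,5) by simp
  also have "\<dots> = k" unfolding assms(7) using vu assms(4,6) by simp
  finally show ?thesis .
qed

text \<open>Together with \<open>pullback_iso\<close> this moves a statement about one chosen
  pullback to every pullback of the same cospan.\<close>

lemma pullback_transfer:
  assumes C: "category C" and P: "is_pullback C d f q d'" and u: "is_iso C u" "Cod C u = Dom C q"
  shows "is_pullback C d f (Comp C q u) (Comp C d' u)"
proof -
  note [simp] = cat_simps[OF C] pullback_facts(1-8)[OF C P]
  obtain v where v: "u \<in> Arr C" "v \<in> Arr C" "Dom C v = Cod C u" "Cod C v = Dom C u"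
    "Comp C v u = Id C (Dom C u)" "Comp C u v = Id C (Cod C u)" by (rule is_isoE[OF u(1)])
  have uv: "Comp C u (Comp C v h) = h" if "h \<in> Arr C" "Cod C h = Dom C q" for h
  proof -
    have "Comp C u (Comp C v h) = Comp C (Comp C u v) h"
      by (rule cat_assoc[OF C, symmetric]) (use u v that in simp_all)
    also have "\<dots> = h" using that u by (simp add: v(6))
    finally show ?thesis .
  qed
  show ?thesis
  proof (rule is_pullbackI)
    show "Comp C d (Comp C q u) = Comp C f (Comp C d' u)"
      by (rule cat_comp_cong[OF C pb_comm[OF C P]]) (use u v in simp_all)
    fix a b assume "a \<in> Arr C" "b \<in> Arr C" "Cod C a = Dom C d" "Cod C b = Dom C f"
      "Dom C a = Dom C b" "Comp C d a = Comp C f b"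
    then obtain h where "h \<in> Arr C" "Dom C h = Dom C a" "Cod C h = Dom C q" "Comp C q h = a"
      "Comp C d' h = b" using pullback_lift[OF P] by blast
    then show "\<exists>h. h \<in> Arr C \<and> Dom C h = Dom C a \<and> Cod C h = Dom C (Comp C q u) \<and>
        Comp C (Comp C q u) h = a \<and> Comp C (Comp C d' u) h = b"
      using u v by (intro exI[of _ "Comp C v h"]) (simp add: uv)
  next
    fix h k assume hk: "h \<in> Arr C" "k \<in> Arr C" "Cod C h = Dom C (Comp C q u)"
      "Cod C k = Dom C (Comp C q u)" "Dom C h = Dom C k"
      "Comp C (Comp C q u) h = Comp C (Comp C q u) k"
      "Comp C (Comp C d' u) h = Comp C (Comp C d' u) k"
    have "Comp C u h = Comp C u k"
      by (rule pullback_unique[OF C P]) (use hk u v in simp_all)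
    then show "h = k" using iso_cancel[OF C u(1)] hk u v by simp
  qed (use u v in simp_all)
qed

section \<open>Terminal objects\<close>

lemma terminalD:
  assumes "terminal C t"
  shows "t \<in> Obj C"
    and "X \<in> Obj C \<Longrightarrow> \<exists>f. f \<in> Arr C \<and> Dom C f = X \<and> Cod C f = t"
    and "X \<in> Obj C \<Longrightarrow> f \<in> Arr C \<Longrightarrow> g \<in> Arr C \<Longrightarrow> Dom C f = X \<Longrightarrow> Dom C g = X \<Longrightarrow>
      Cod C f = t \<Longrightarrow> Cod C g = t \<Longrightarrow> f = g"
  using assms unfolding terminal_def homs_def by auto

lemma terminal_eq:
  "category C \<Longrightarrow> terminal C t \<Longrightarrow> f \<in> Arr C \<Longrightarrow> g \<in> Arr C \<Longrightarrow> Dom C f = Dom C g \<Longrightarrow>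
    Cod C f = t \<Longrightarrow> Cod C g = t \<Longrightarrow> f = g"
  using terminalD(3)[of C t "Dom C f" f g] cat_dom[of C f] by metis

lemma terminal_iso:
  assumes C: "category C" and t: "terminal C t" and t': "terminal C t'"
  obtains u where "is_iso C u" "Dom C u = t'" "Cod C u = t"
proof -
  note [simp] = cat_simps[OF C] terminalD(1)[OF t] terminalD(1)[OF t']
  obtain u where u: "u \<in> Arr C" "Dom C u = t'" "Cod C u = t" using terminalD(2)[OF t terminalD(1)[OF t']] by blast
  obtain v where v: "v \<in> Arr C" "Dom C v = t" "Cod C v = t'" using terminalD(2)[OF t' terminalD(1)[OF t]] by blast
  have "Comp C u v = Id C t" by (rule terminal_eq[OF C t]) (use u v in simp_all)
  moreover have "Comp C v u = Id C t'" by (rule terminal_eq[OF C t']) (use u v in simp_all)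
  ultimately have "is_iso C u" using u v by (intro is_isoI[of _ _ v]) simp_all
  then show ?thesis using u that by blast
qed

lemma terminal_transfer:
  assumes C: "category C" and t: "terminal C t" and u: "is_iso C u" "Cod C u = t"
  shows "terminal C (Dom C u)"
proof -
  note [simp] = cat_simps[OF C]
  obtain v where v: "u \<in> Arr C" "v \<in> Arr C" "Dom C v = t" "Cod C v = Dom C u"
    by (rule is_isoE[OF u(1)]) (simp add: u(2))
  show ?thesis
    unfolding terminal_def
  proof (intro conjI ballI)
    fix X assume X: "X \<in> Obj C"
    obtain f where f: "f \<in> Arr C" "Dom C f = X" "Cod C f = t" using terminalD(2)[OF t X] by blast
    show "\<exists>!f. f \<in> homs C X (Dom C u)"
    proof (rule ex1I)
      show "Comp C v f \<in> homs C X (Dom C u)" using f v by (intro homsI) simp_all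
      fix g assume g: "g \<in> homs C X (Dom C u)"
      show "g = Comp C v f"
        by (rule iso_cancel[OF C u(1)], use homsD[OF g] f v in simp_all)
          (rule terminal_eq[OF C t], use homsD[OF g] f v u in simp_all)
    qed
  qed (use v in simp)
qed

section \<open>Pullbacks, equalizers and their preservation\<close>

definition has_pullbacks :: "('o, 'm) cat \<Rightarrow> bool" where
  "has_pullbacks C \<longleftrightarrow>
     (\<forall>d \<in> Arr C. \<forall>f \<in> Arr C. Cod C d = Cod C f \<longrightarrow> (\<exists>q d'. is_pullback C d f q d'))"

definition preserves_pullbacks ::
    "('o, 'm) cat \<Rightarrow> ('p, 'n) cat \<Rightarrow> ('o, 'm, 'p, 'n) ftor \<Rightarrow> bool" where
  "preserves_pullbacks C C' F \<longleftrightarrow>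
     (\<forall>d f q d'. is_pullback C d f q d' \<longrightarrow>
        is_pullback C' (farr F d) (farr F f) (farr F q) (farr F d'))"

definition preserves_terminal ::
    "('o, 'm) cat \<Rightarrow> ('p, 'n) cat \<Rightarrow> ('o, 'm, 'p, 'n) ftor \<Rightarrow> bool" where
  "preserves_terminal C C' F \<longleftrightarrow> (\<forall>t. terminal C t \<longrightarrow> terminal C' (fob F t))"

definition is_equalizer :: "('o, 'm) cat \<Rightarrow> 'm \<Rightarrow> 'm \<Rightarrow> 'm \<Rightarrow> bool" where
  "is_equalizer C f g e \<longleftrightarrow>
     f \<in> Arr C \<and> g \<in> Arr C \<and> e \<in> Arr C \<and> Dom C f = Dom C g \<and> Cod C f = Cod C g \<and>
     Cod C e = Dom C f \<and> Comp C f e = Comp C g e \<and>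
     (\<forall>a \<in> Arr C. Cod C a = Dom C f \<and> Comp C f a = Comp C g a \<longrightarrow>
        (\<exists>!h. h \<in> homs C (Dom C a) (Dom C e) \<and> Comp C e h = a))"

lemma equalizerD:
  assumes "is_equalizer C f g e"
  shows "f \<in> Arr C" "g \<in> Arr C" "e \<in> Arr C" "Dom C f = Dom C g" "Cod C f = Cod C g"
    "Cod C e = Dom C g" "Comp C f e = Comp C g e"
  using assms by (auto simp: is_equalizer_def)

lemma equalizer_universal:
  assumes "is_equalizer C f g e" "a \<in> Arr C" "Cod C a = Dom C g" "Comp C f a = Comp C g a"
  shows "\<exists>!h. h \<in> homs C (Dom C a) (Dom C e) \<and> Comp C e h = a"
  using assms unfolding is_equalizer_def by simp

lemma equalizer_lift:
  assumes "is_equalizer C f g e" "a \<in> Arr C" "Cod C a = Dom C g" "Comp C f a = Comp C g a"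
  shows "\<exists>h. h \<in> Arr C \<and> Dom C h = Dom C a \<and> Cod C h = Dom C e \<and> Comp C e h = a"
  using equalizer_universal[OF assms] by (auto simp: homs_def)

lemma equalizer_mono:
  assumes C: "category C" and E: "is_equalizer C f g e"
    and "h \<in> Arr C" "k \<in> Arr C" "Cod C h = Dom C e" "Cod C k = Dom C e" "Comp C e h = Comp C e k"
  shows "h = k"
proof -
  note [simp] = cat_simps[OF C] equalizerD[OF E]
  have D: "Dom C h = Dom C k" by (rule comp_eq_ends[OF C assms(7)]) (use assms(3-6) in simp_all)
  have "Comp C f (Comp C e k) = Comp C g (Comp C e k)"
    by (rule cat_comp_cong[OF C equalizerD(7)[OF E]]) (use assms in simp_all)
  then have "\<exists>!h. h \<in> homs C (Dom C (Comp C e k)) (Dom C e) \<and> Comp C e h = Comp C e k"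
    by (intro equalizer_universal[OF E]) (use assms(3-6) in simp_all)
  then show ?thesis using assms(3-7) D homsI[of h C "Dom C k" "Dom C e"] homsI[of k C "Dom C k" "Dom C e"]
    by auto
qed

lemma is_equalizerI:
  assumes "f \<in> Arr C" "g \<in> Arr C" "e \<in> Arr C" "Dom C f = Dom C g" "Cod C f = Cod C g"
    "Cod C e = Dom C g" "Comp C f e = Comp C g e"
    and "\<And>a. a \<in> Arr C \<Longrightarrow> Cod C a = Dom C g \<Longrightarrow> Comp C f a = Comp C g a \<Longrightarrow>
      \<exists>h. h \<in> Arr C \<and> Dom C h = Dom C a \<and> Cod C h = Dom C e \<and> Comp C e h = a"
    and "\<And>h k. h \<in> Arr C \<Longrightarrow> k \<in> Arr C \<Longrightarrow> Cod C h = Dom C e \<Longrightarrow> Cod C k = Dom C e \<Longrightarrow>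
      Dom C h = Dom C k \<Longrightarrow> Comp C e h = Comp C e k \<Longrightarrow> h = k"
  shows "is_equalizer C f g e"
  unfolding is_equalizer_def
proof (intro conjI ballI impI)
  fix a assume "a \<in> Arr C" "Cod C a = Dom C f \<and> Comp C f a = Comp C g a"
  then obtain h where "h \<in> Arr C" "Dom C h = Dom C a" "Cod C h = Dom C e" "Comp C e h = a"
    using assms(4,8) by metis
  then show "\<exists>!h. h \<in> homs C (Dom C a) (Dom C e) \<and> Comp C e h = a"
    using assms(9) by (intro ex1I[of _ h]) (auto simp: homs_def)
qed (use assms in simp_all)

text \<open>
  The equalizer of \<open>f\<close> and \<open>g\<close> is the pullback along \<open>(f, g)\<close> of the diagonal of the common
  codomain; \<open>p\<close> and \<open>p'\<close> are product projections, being a pullback of two maps \<open>a\<close>, \<open>b\<close>.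
\<close>

lemma equalizer_from_pullback:
  assumes C: "category C" and P: "is_pullback C a b p p'" and E: "is_pullback C \<Delta> m x e"
    and \<Delta>: "Cod C \<Delta> = Dom C p" "Comp C p \<Delta> = Id C Y" "Comp C p' \<Delta> = Id C Y"
    and Y: "Dom C \<Delta> = Y"
    and m: "Comp C p m = f" "Comp C p' m = g"
  shows "is_equalizer C f g e"
proof -
  note [simp] = cat_simps[OF C] pullback_facts(1-8)[OF C P] pullback_facts(1-8)[OF C E]
  have [simp]: "Cod C m = Dom C p'" using pb_dom(4)[OF C E] \<Delta>(1) by simp
  have [simp]: "Dom C p = Dom C p'" by (rule pb_dom(3)[OF C P])
  note [simp] = Y
  have [simp]: "Dom C a = Y" "Dom C b = Y"
    using arg_cong[OF \<Delta>(2), of "Cod C"] arg_cong[OF \<Delta>(3), of "Cod C"] \<Delta>(1) Y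
      cat_dom[OF C pb_arr(1)[OF C E]] by simp_all
  have px: "Comp C p (Comp C \<Delta> h) = h" "Comp C p' (Comp C \<Delta> h) = h"
    if "h \<in> Arr C" "Cod C h = Y" for h
    using cat_assoc[OF C, of p \<Delta> h] cat_assoc[OF C, of p' \<Delta> h] that \<Delta> Y by simp_all
  have fm: "Comp C f h = Comp C p (Comp C m h)" "Comp C g h = Comp C p' (Comp C m h)"
    if "h \<in> Arr C" "Cod C h = Dom C m" for h
    using that m by (auto)
  have fg: "f \<in> Arr C" "g \<in> Arr C" "Dom C f = Dom C m" "Dom C g = Dom C m" "Cod C f = Y" "Cod C g = Y"
    using m by auto
  show ?thesis
  proof (rule is_equalizerI)
    \<comment> \<open>Both composites equal \<open>x\<close>: since \<open>m e\<close> equals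
      \<Delta> followed on \<open>x\<close>, either projection returns \<open>x\<close>.\<close>
    show "Comp C f e = Comp C g e"
      using pb_comm[OF C E] px[of x] Y by (simp add: fm flip: pb_comm[OF C E])
  next
    fix a assume a: "a \<in> Arr C" "Cod C a = Dom C g" "Comp C f a = Comp C g a"
    \<comment> \<open>Checked on the two projections, which give \<open>f a\<close> and
      \<open>g a\<close> on the right and \<open>f a\<close> twice on the left.\<close>
    have "Comp C \<Delta> (Comp C f a) = Comp C m a"
      by (rule pullback_unique[OF C P]) (use a fg \<Delta> Y px[of "Comp C f a"] in \<open>simp_all add: fm\<close>)
    then show "\<exists>h. h \<in> Arr C \<and> Dom C h = Dom C a \<and> Cod C h = Dom C e \<and> Comp C e h = a"
      using pullback_lift[OF E, of "Comp C f a" a] a fg Y by auto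
  next
    fix h k assume hk: "h \<in> Arr C" "k \<in> Arr C" "Cod C h = Dom C e" "Cod C k = Dom C e"
      "Dom C h = Dom C k" "Comp C e h = Comp C e k"
    have "Comp C \<Delta> (Comp C x l) = Comp C m (Comp C e l)" if "l \<in> Arr C" "Cod C l = Dom C e" for l
      by (rule cat_comp_cong[OF C pb_comm[OF C E]]) (use that in simp_all)
    \<comment> \<open>The other leg \<open>x\<close> is recovered from \<open>e\<close> by
      projecting the pullback equation, so equality after \<open>e\<close> alone already gives
      equality after both legs.\<close>
    then have xhk: "Comp C x h = Comp C x k"
      using px[of "Comp C x h"] px[of "Comp C x k"] hk Y by simp
    show "h = k" by (rule pullback_unique[OF C E]) (use hk xhk in simp_all)
  qed (use fg in simp_all)
qed

text \<open>
  Finite limits are built by induction on parts of the index: an object is added by a product with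
  its value, an arrow by an equalizer.
\<close>

definition partial_cone :: "('i, 'j) cat \<Rightarrow> ('o, 'm) cat \<Rightarrow> ('i, 'j, 'o, 'm) ftor \<Rightarrow> 'i set \<Rightarrow> 'j set \<Rightarrow>
    'o \<Rightarrow> ('i \<Rightarrow> 'm) \<Rightarrow> bool" where
  "partial_cone J C D I A M k \<longleftrightarrow> M \<in> Obj C \<and> (\<forall>i \<in> I. k i \<in> homs C M (fob D i)) \<and>
     (\<forall>u \<in> A. Comp C (farr D u) (k (Dom J u)) = k (Cod J u))"

definition partial_limit :: "('i, 'j) cat \<Rightarrow> ('o, 'm) cat \<Rightarrow> ('i, 'j, 'o, 'm) ftor \<Rightarrow> 'i set \<Rightarrow> 'j set \<Rightarrow>
    'o \<Rightarrow> ('i \<Rightarrow> 'm) \<Rightarrow> bool" where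
  "partial_limit J C D I A L l \<longleftrightarrow> partial_cone J C D I A L l \<and>
     (\<forall>M k. partial_cone J C D I A M k \<longrightarrow>
        (\<exists>!h. h \<in> homs C M L \<and> (\<forall>i \<in> I. Comp C (l i) h = k i)))"

lemma is_limit_iff_partial: "is_limit J C D L l \<longleftrightarrow> partial_limit J C D (Obj J) (Arr J) L l"
  by (simp add: is_limit_def partial_limit_def is_cone_def partial_cone_def)

lemma partial_limitD:
  assumes "partial_limit J C D I A L l"
  shows "L \<in> Obj C"
    and "i \<in> I \<Longrightarrow> l i \<in> Arr C" "i \<in> I \<Longrightarrow> Dom C (l i) = L" "i \<in> I \<Longrightarrow> Cod C (l i) = fob D i"
    and "u \<in> A \<Longrightarrow> Comp C (farr D u) (l (Dom J u)) = l (Cod J u)"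
  using assms by (auto simp: partial_limit_def partial_cone_def homs_def)

lemma partial_limit_universal:
  "partial_limit J C D I A L l \<Longrightarrow> partial_cone J C D I A M k \<Longrightarrow>
    \<exists>!h. h \<in> homs C M L \<and> (\<forall>i \<in> I. Comp C (l i) h = k i)"
  by (simp add: partial_limit_def)

lemma partial_limit_lift:
  assumes "partial_limit J C D I A L l" "partial_cone J C D I A M k"
  shows "\<exists>h. h \<in> Arr C \<and> Dom C h = M \<and> Cod C h = L \<and> (\<forall>i \<in> I. Comp C (l i) h = k i)"
  using partial_limit_universal[OF assms] by (auto simp: homs_def)

lemma partial_cone_comp:
  assumes C: "category C" and L: "partial_cone J C D I A L l" and h: "h \<in> Arr C" "Cod C h = L"
    and A: "\<And>u. u \<in> A \<Longrightarrow> Dom J u \<in> I \<and> Cod J u \<in> I \<and> farr D u \<in> Arr C \<and>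
      Dom C (farr D u) = fob D (Dom J u)"
  shows "partial_cone J C D I A (Dom C h) (\<lambda>i. Comp C (l i) h)"
  unfolding partial_cone_def
proof (intro conjI ballI)
  note [simp] = cat_simps[OF C]
  have l: "l i \<in> Arr C" "Dom C (l i) = L" "Cod C (l i) = fob D i" if "i \<in> I" for i
    using L that by (auto simp: partial_cone_def homs_def)
  show "Comp C (l i) h \<in> homs C (Dom C h) (fob D i)" if "i \<in> I" for i
    using l[OF that] h by (intro homsI) simp_all
  fix u assume u: "u \<in> A"
  then have "Comp C (farr D u) (l (Dom J u)) = l (Cod J u)" using L by (simp add: partial_cone_def)
  from arg_cong[OF this, of "\<lambda>f. Comp C f h"]
  show "Comp C (farr D u) (Comp C (l (Dom J u)) h) = Comp C (l (Cod J u)) h"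
    using A[OF u] l h by simp
qed (use h in \<open>simp add: cat_simps[OF C]\<close>)

lemma partial_limit_unique:
  assumes C: "category C" and L: "partial_limit J C D I A L l"
    and h: "h \<in> Arr C" "Cod C h = L" and k: "k \<in> Arr C" "Cod C k = L" and hk: "Dom C h = Dom C k"
    and A: "\<And>u. u \<in> A \<Longrightarrow> Dom J u \<in> I \<and> Cod J u \<in> I \<and> farr D u \<in> Arr C \<and>
      Dom C (farr D u) = fob D (Dom J u)"
    and eq: "\<And>i. i \<in> I \<Longrightarrow> Comp C (l i) h = Comp C (l i) k"
  shows "h = k"
proof -
  have "partial_cone J C D I A (Dom C k) (\<lambda>i. Comp C (l i) k)"
    using L partial_cone_comp[OF C _ k A] by (simp add: partial_limit_def)
  from partial_limit_universal[OF L this] show ?thesis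
    using h k hk eq homsI[of h C "Dom C k" L] homsI[of k C "Dom C k" L] by blast
qed

lemma partial_limitI:
  assumes "partial_cone J C D I A L l"
    and "\<And>M k. partial_cone J C D I A M k \<Longrightarrow>
      \<exists>h. h \<in> Arr C \<and> Dom C h = M \<and> Cod C h = L \<and> (\<forall>i \<in> I. Comp C (l i) h = k i)"
    and "\<And>h k. h \<in> Arr C \<Longrightarrow> k \<in> Arr C \<Longrightarrow> Cod C h = L \<Longrightarrow> Cod C k = L \<Longrightarrow> Dom C h = Dom C k \<Longrightarrow>
      (\<And>i. i \<in> I \<Longrightarrow> Comp C (l i) h = Comp C (l i) k) \<Longrightarrow> h = k"
  shows "partial_limit J C D I A L l"
  unfolding partial_limit_def
proof (intro conjI allI impI)
  fix M k assume "partial_cone J C D I A M k"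
  then obtain h where h: "h \<in> Arr C" "Dom C h = M" "Cod C h = L" "\<And>i. i \<in> I \<Longrightarrow> Comp C (l i) h = k i"
    using assms(2) by blast
  show "\<exists>!h. h \<in> homs C M L \<and> (\<forall>i \<in> I. Comp C (l i) h = k i)"
  proof (rule ex1I)
    show "h \<in> homs C M L \<and> (\<forall>i \<in> I. Comp C (l i) h = k i)" using h by (simp add: homs_def)
    fix h' assume h': "h' \<in> homs C M L \<and> (\<forall>i \<in> I. Comp C (l i) h' = k i)"
    show "h' = h" by (rule assms(3)) (use h h' in \<open>auto simp: homs_def\<close>)
  qed
qed (rule assms(1))

lemma partial_limit_empty:
  "category C \<Longrightarrow> terminal C t \<Longrightarrow> partial_limit J C D {} {} t l"
  by (rule partial_limitI) (auto simp: partial_cone_def terminalD(1) terminalD(2) intro: terminal_eq)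

text \<open>The product of \<open>L\<close> with the new value is taken as a pullback over the
  terminal object, where commutativity is automatic. The legs \<open>l'\<close> are characterised by
  equations instead of being given by a formula, so that the lemma applies equally to the image of a
  family under a functor.\<close>

lemma partial_limit_insert_obj:
  assumes C: "category C" and t: "terminal C t" and L: "partial_limit J C D I {} L l"
    and P: "is_pullback C a b p q" and ab: "Cod C a = t" "Dom C a = L" "Dom C b = fob D i"
    and l': "\<And>j. j \<in> I \<Longrightarrow> l' j = Comp C (l j) p" "l' i = q"
  shows "partial_limit J C D (insert i I) {} (Dom C p) l'"
proof (rule partial_limitI)
  note [simp] = cat_simps[OF C] pullback_facts(1-8)[OF C P] partial_limitD[OF L] ab
  have [simp]: "Cod C b = t" by (rule trans[OF pb_dom(4)[OF C P, symmetric] ab(1)])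
  show "partial_cone J C D (insert i I) {} (Dom C p) l'"
    using l' pb_dom(3)[OF C P] pb_dom(2)[OF C P] by (auto simp: partial_cone_def homs_def)
  show "\<exists>h. h \<in> Arr C \<and> Dom C h = M \<and> Cod C h = Dom C p \<and> (\<forall>j \<in> insert i I. Comp C (l' j) h = k j)"
    if k: "partial_cone J C D (insert i I) {} M k" for M k
  proof -
    have ki: "k i \<in> Arr C" "Dom C (k i) = M" "Cod C (k i) = fob D i"
      using k by (auto simp: partial_cone_def homs_def)
    have "partial_cone J C D I {} M k" using k by (simp add: partial_cone_def)
    then obtain h0 where h0: "h0 \<in> Arr C" "Dom C h0 = M" "Cod C h0 = L"
      "\<And>j. j \<in> I \<Longrightarrow> Comp C (l j) h0 = k j"
      using partial_limit_lift[OF L] by blast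
    have "Comp C a h0 = Comp C b (k i)"
      by (rule terminal_eq[OF C t]) (use h0 ki in simp_all)
    then obtain h where h: "h \<in> Arr C" "Dom C h = M" "Cod C h = Dom C p" "Comp C p h = h0"
      "Comp C q h = k i"
      using pullback_lift[OF P, of h0 "k i"] h0(1-3) ki by auto
    have "Comp C (l' j) h = k j" if "j \<in> I" for j
      using l'(1)[OF that] h0(4)[OF that] h that by simp
    then show ?thesis using h l' by auto
  qed
  show "h = k" if hk: "h \<in> Arr C" "k \<in> Arr C" "Cod C h = Dom C p" "Cod C k = Dom C p"
      "Dom C h = Dom C k" "\<And>j. j \<in> insert i I \<Longrightarrow> Comp C (l' j) h = Comp C (l' j) k" for h k
  proof -
    have "Comp C (l j) (Comp C p h) = Comp C (l j) (Comp C p k)" if "j \<in> I" for j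
      using hk(6)[of j] l'(1)[OF that] that hk(1-5) by simp
    note lhk = this
    have "Comp C p h = Comp C p k"
      by (rule partial_limit_unique[OF C L]) (use hk(1-5) lhk in simp_all)
    moreover have "Comp C q h = Comp C q k" using hk(6)[of i] l'(2) by simp
    ultimately show ?thesis using pullback_unique[OF C P hk(1-4)] by blast
  qed
qed

text \<open>A cone for the enlarged set of arrows is a cone for \<open>A\<close> satisfying one more
  equation, and for the map into \<open>L\<close> induced by it this equation says that it equalizes
  the two maps in the premise on \<open>e\<close>.\<close>

lemma partial_limit_insert_arr:
  assumes C: "category C" and L: "partial_limit J C D I A L l"
    and A: "\<And>v. v \<in> insert u A \<Longrightarrow> Dom J v \<in> I \<and> Cod J v \<in> I \<and> farr D v \<in> Arr C \<and>
      Dom C (farr D v) = fob D (Dom J v)"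
    and E: "is_equalizer C (Comp C (farr D u) (l (Dom J u))) (l (Cod J u)) e"
    and l': "\<And>j. j \<in> I \<Longrightarrow> l' j = Comp C (l j) e"
  shows "partial_limit J C D I (insert u A) (Dom C e) l'"
proof (rule partial_limitI)
  note [simp] = cat_simps[OF C] partial_limitD(1-4)[OF L] equalizerD(3)[OF E]
  have u [simp]: "Dom J u \<in> I" "Cod J u \<in> I" "farr D u \<in> Arr C" "Dom C (farr D u) = fob D (Dom J u)"
    using A[of u] by simp_all
  have e [simp]: "Cod C e = L" using equalizerD(6)[OF E] by simp
  have A': "v \<in> A \<Longrightarrow> Dom J v \<in> I \<and> Cod J v \<in> I \<and> farr D v \<in> Arr C \<and>
      Dom C (farr D v) = fob D (Dom J v)" for v
    using A by blast
  have Lc: "partial_cone J C D I A L l" using L by (simp add: partial_limit_def)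
  have "partial_cone J C D I A (Dom C e) (\<lambda>j. Comp C (l j) e)"
    by (rule partial_cone_comp[OF C Lc _ _ A']) simp_all
  moreover have "Comp C (farr D u) (Comp C (l (Dom J u)) e) = Comp C (l (Cod J u)) e"
    using equalizerD(7)[OF E] by simp
  ultimately show "partial_cone J C D I (insert u A) (Dom C e) l'"
    using A l' by (auto simp: partial_cone_def)
  show "\<exists>h. h \<in> Arr C \<and> Dom C h = M \<and> Cod C h = Dom C e \<and> (\<forall>j \<in> I. Comp C (l' j) h = k j)"
    if k: "partial_cone J C D I (insert u A) M k" for M k
  proof -
    have "partial_cone J C D I A M k" using k by (simp add: partial_cone_def)
    then obtain h0 where h0: "h0 \<in> Arr C" "Dom C h0 = M" "Cod C h0 = L"
      "\<And>j. j \<in> I \<Longrightarrow> Comp C (l j) h0 = k j"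
      using partial_limit_lift[OF L] by blast
    have "Comp C (farr D u) (k (Dom J u)) = k (Cod J u)" using k by (simp add: partial_cone_def)
    then have "Comp C (Comp C (farr D u) (l (Dom J u))) h0 = Comp C (l (Cod J u)) h0"
      using h0 by simp
    then obtain h where h: "h \<in> Arr C" "Dom C h = M" "Cod C h = Dom C e" "Comp C e h = h0"
      using equalizer_lift[OF E h0(1)] h0(2,3) by auto
    have "Comp C (l' j) h = k j" if "j \<in> I" for j
      using l'[OF that] h0(4)[OF that] h that by simp
    then show ?thesis using h by auto
  qed
  show "h = k" if hk: "h \<in> Arr C" "k \<in> Arr C" "Cod C h = Dom C e" "Cod C k = Dom C e"
      "Dom C h = Dom C k" "\<And>j. j \<in> I \<Longrightarrow> Comp C (l' j) h = Comp C (l' j) k" for h k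
  proof -
    have "Comp C (l j) (Comp C e h) = Comp C (l j) (Comp C e k)" if "j \<in> I" for j
      using hk(6)[of j] l'[OF that] that hk(1-5) by simp
    note lhk = this
    have "Comp C e h = Comp C e k"
      by (rule partial_limit_unique[OF C L _ _ _ _ _ A']) (use hk(1-5) lhk in simp_all)
    then show ?thesis using equalizer_mono[OF C E hk(1-4)] by blast
  qed
qed

lemma has_pullbacksD:
  "has_pullbacks C \<Longrightarrow> d \<in> Arr C \<Longrightarrow> f \<in> Arr C \<Longrightarrow> Cod C d = Cod C f \<Longrightarrow>
    \<exists>q d'. is_pullback C d f q d'"
  by (simp add: has_pullbacks_def)

text \<open>The equalizer is built in \<open>C\<close> by pulling back a diagonal, and
  \<open>F\<close> carries every ingredient of that construction to the corresponding ingredient in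
  \<open>C'\<close>. Hence the same arrow serves for both claims.\<close>

lemma equalizers_preserved:
  assumes C: "category C" and C': "category C'" and F: "is_functor C C' F"
    and pb: "has_pullbacks C" and t: "terminal C t" and F_pb: "preserves_pullbacks C C' F"
    and fg: "f \<in> Arr C" "g \<in> Arr C" "Dom C f = Dom C g" "Cod C f = Cod C g"
  shows "\<exists>e. is_equalizer C f g e \<and> is_equalizer C' (farr F f) (farr F g) (farr F e)"
proof -
  note [simp] = cat_simps[OF C] cat_simps[OF C'] ftor_simps[OF F] fg
  let ?Y = "Cod C g"
  obtain a where a: "a \<in> Arr C" "Dom C a = ?Y" "Cod C a = t"
    using terminalD(2)[OF t cat_cod[OF C fg(2)]] by blast
  obtain p p' where P: "is_pullback C a a p p'" using has_pullbacksD[OF pb a(1) a(1) refl] by blast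
  note [simp] = pullback_facts(1-7)[OF C P] a
  have "\<exists>h. h \<in> Arr C \<and> Dom C h = Dom C (Id C ?Y) \<and> Cod C h = Dom C p \<and> Comp C p h = Id C ?Y \<and>
      Comp C p' h = Id C ?Y"
    by (rule pullback_lift[OF P]) simp_all
  then obtain \<Delta> where \<Delta>: "\<Delta> \<in> Arr C" "Dom C \<Delta> = Dom C (Id C ?Y)" "Cod C \<Delta> = Dom C p"
    "Comp C p \<Delta> = Id C ?Y" "Comp C p' \<Delta> = Id C ?Y" by blast
  have \<Delta>_dom: "Dom C \<Delta> = ?Y" using \<Delta>(2) by simp
  have "Comp C a f = Comp C a g" by (rule terminal_eq[OF C t]) simp_all
  then have "\<exists>h. h \<in> Arr C \<and> Dom C h = Dom C f \<and> Cod C h = Dom C p \<and> Comp C p h = f \<and>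
      Comp C p' h = g"
    by (intro pullback_lift[OF P]) simp_all
  then obtain m where m: "m \<in> Arr C" "Cod C m = Dom C p" "Comp C p m = f" "Comp C p' m = g"
    by blast
  have "Cod C \<Delta> = Cod C m" using \<Delta>(3) m(2) by simp
  then obtain x e where E: "is_pullback C \<Delta> m x e" using has_pullbacksD[OF pb \<Delta>(1) m(1)] by blast
  have F': "Comp C' (farr F p) (farr F \<Delta>) = Id C' (fob F ?Y)"
    "Comp C' (farr F p') (farr F \<Delta>) = Id C' (fob F ?Y)"
    "Comp C' (farr F p) (farr F m) = farr F f" "Comp C' (farr F p') (farr F m) = farr F g"
    using arg_cong[OF \<Delta>(4), of "farr F"] arg_cong[OF \<Delta>(5), of "farr F"]
      arg_cong[OF m(3), of "farr F"] arg_cong[OF m(4), of "farr F"] \<Delta>(1,3) m(1,2) by simp_all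
  have "is_equalizer C f g e"
    by (rule equalizer_from_pullback[OF C P E \<Delta>(3-5) \<Delta>_dom m(3,4)])
  moreover have "is_equalizer C' (farr F f) (farr F g) (farr F e)"
  proof (rule equalizer_from_pullback[OF C' _ _ _ F'(1,2) _ F'(3,4)])
    show "is_pullback C' (farr F a) (farr F a) (farr F p) (farr F p')"
      "is_pullback C' (farr F \<Delta>) (farr F m) (farr F x) (farr F e)"
      using F_pb P E unfolding preserves_pullbacks_def by blast+
  qed (use \<Delta>(1,3) \<Delta>_dom in simp_all)
  ultimately show ?thesis by blast
qed

text \<open>Existence and preservation are proved at once: the induction produces one limit cone
  whose image is again a limit. With the identity functor this yields existence of finite limits;
  with a comparison of limits it yields preservation of all of them.\<close>

lemma partial_limits_preserved:
  assumes C: "category C" and C': "category C'" and F: "is_functor C C' F"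
    and pb: "has_pullbacks C" and t: "terminal C t" and F_pb: "preserves_pullbacks C C' F"
    and F_t: "preserves_terminal C C' F" and J: "finite_category J" and D: "is_functor J C D"
  shows "\<exists>L l. is_limit J C D L l \<and> is_limit J C' (fcomp J F D) (fob F L) (\<lambda>i. farr F (l i))"
proof -
  have cJ: "category J" and fin: "finite (Obj J)" "finite (Arr J)"
    using J by (auto simp: finite_category_def)
  note [simp] = cat_simps[OF C] cat_simps[OF C'] cat_simps[OF cJ] ftor_simps[OF F] ftor_simps[OF D]
  let ?D' = "fcomp J F D"
  have t': "terminal C' (fob F t)" using F_t t by (simp add: preserves_terminal_def)
  \<comment> \<open>Induction over the objects of the index with no arrows imposed yet: these are
    finite products of values of the diagram.\<close>
  have "\<exists>L l. partial_limit J C D I {} L l \<and> partial_limit J C' ?D' I {} (fob F L) (\<lambda>i. farr F (l i))"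
    if "finite I" "I \<subseteq> Obj J" for I
    using that
  proof (induction I rule: finite_induct)
    case empty
    show ?case using partial_limit_empty[OF C t] partial_limit_empty[OF C' t'] by blast
  next
    case (insert i I)
    then obtain L l where L: "partial_limit J C D I {} L l"
      and L': "partial_limit J C' ?D' I {} (fob F L) (\<lambda>i. farr F (l i))" by auto
    have i: "i \<in> Obj J" and I: "I \<subseteq> Obj J" using insert.prems by auto
    obtain a where a: "a \<in> Arr C" "Dom C a = L" "Cod C a = t"
      using terminalD(2)[OF t partial_limitD(1)[OF L]] by blast
    obtain b where b: "b \<in> Arr C" "Dom C b = fob D i" "Cod C b = t"
      using terminalD(2)[OF t ftor_ob[OF D i]] by blast
    obtain p q where P: "is_pullback C a b p q" using has_pullbacksD[OF pb a(1) b(1)] a(3) b(3) by auto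
    have P': "is_pullback C' (farr F a) (farr F b) (farr F p) (farr F q)"
      using F_pb P by (simp add: preserves_pullbacks_def)
    let ?l = "\<lambda>j. if j = i then q else Comp C (l j) p"
    note [simp] = pullback_facts(1-8)[OF C P]
    have "partial_limit J C D (insert i I) {} (Dom C p) ?l"
      by (rule partial_limit_insert_obj[OF C t L P a(3,2) b(2)]) (use insert.hyps in auto)
    moreover have "partial_limit J C' ?D' (insert i I) {} (Dom C' (farr F p)) (\<lambda>j. farr F (?l j))"
      by (rule partial_limit_insert_obj[OF C' t' L' P'])
        (use a b i insert.hyps partial_limitD[OF L] in auto)
    moreover have "Dom C' (farr F p) = fob F (Dom C p)" by (rule ftor_dom[OF F pb_arr(3)[OF C P]])
    ultimately show ?case by metis
  qed
  from this[OF fin(1) order.refl]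
  obtain L0 l0 where L0: "partial_limit J C D (Obj J) {} L0 l0"
    "partial_limit J C' ?D' (Obj J) {} (fob F L0) (\<lambda>i. farr F (l0 i))" by blast
  \<comment> \<open>The arrows come after all the objects, so that each new arrow finds the legs at
    both its ends.\<close>
  have "\<exists>L l. partial_limit J C D (Obj J) A L l \<and>
      partial_limit J C' ?D' (Obj J) A (fob F L) (\<lambda>i. farr F (l i))"
    if "finite A" "A \<subseteq> Arr J" for A
    using that
  proof (induction A rule: finite_induct)
    case empty
    show ?case using L0 by blast
  next
    case (insert u A)
    then obtain L l where L: "partial_limit J C D (Obj J) A L l"
      and L': "partial_limit J C' ?D' (Obj J) A (fob F L) (\<lambda>i. farr F (l i))" by auto
    have u [simp]: "u \<in> Arr J" and A: "A \<subseteq> Arr J" using insert.prems by auto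
    note [simp] = partial_limitD(1-4)[OF L]
    obtain e where E: "is_equalizer C (Comp C (farr D u) (l (Dom J u))) (l (Cod J u)) e"
      and E': "is_equalizer C' (farr F (Comp C (farr D u) (l (Dom J u)))) (farr F (l (Cod J u))) (farr F e)"
      using equalizers_preserved[OF C C' F pb t F_pb, of "Comp C (farr D u) (l (Dom J u))"
          "l (Cod J u)"] by auto
    have [simp]: "e \<in> Arr C" "Cod C e = L" using equalizerD(3,6)[OF E] by simp_all
    have A': "v \<in> Arr J" if "v \<in> insert u A" for v using that A u by auto
    have "partial_limit J C D (Obj J) (insert u A) (Dom C e) (\<lambda>j. Comp C (l j) e)"
      by (rule partial_limit_insert_arr[OF C L _ E]) (use A' in auto)
    moreover have "partial_limit J C' ?D' (Obj J) (insert u A) (Dom C' (farr F e))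
        (\<lambda>j. farr F (Comp C (l j) e))"
      by (rule partial_limit_insert_arr[OF C' L', where e = "farr F e"]) (use A' E' in auto)
    moreover have "Dom C' (farr F e) = fob F (Dom C e)" by (rule ftor_dom[OF F]) simp
    ultimately show ?case by metis
  qed
  from this[OF fin(2) order.refl] show ?thesis by (simp add: is_limit_iff_partial)
qed

lemma limit_iso:
  assumes C: "category C" and J: "category J" and D: "is_functor J C D"
    and L: "is_limit J C D L l" and M: "is_limit J C D M m"
  obtains h where "is_iso C h" "Dom C h = M" "Cod C h = L" "\<And>i. i \<in> Obj J \<Longrightarrow> Comp C (l i) h = m i"
proof -
  note PL = L[unfolded is_limit_iff_partial] and PM = M[unfolded is_limit_iff_partial]
  note [simp] = cat_simps[OF C] cat_simps[OF J] ftor_simps[OF D] partial_limitD(1-4)[OF PL]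
    partial_limitD(1-4)[OF PM]
  obtain h where h: "h \<in> Arr C" "Dom C h = M" "Cod C h = L" "\<And>i. i \<in> Obj J \<Longrightarrow> Comp C (l i) h = m i"
    using partial_limit_lift[OF PL] PM unfolding partial_limit_def by blast
  obtain k where k: "k \<in> Arr C" "Dom C k = L" "Cod C k = M" "\<And>i. i \<in> Obj J \<Longrightarrow> Comp C (m i) k = l i"
    using partial_limit_lift[OF PM] PL unfolding partial_limit_def by blast
  have "Comp C (l i) (Comp C h k) = l i" "Comp C (m i) (Comp C k h) = m i" if "i \<in> Obj J" for i
    using cat_assoc[OF C, of "l i" h k, symmetric] cat_assoc[OF C, of "m i" k h, symmetric] h k that
    by (simp_all del: cat_assoc)
  note hk = this
  have "Comp C h k = Id C L"
    by (rule partial_limit_unique[OF C PL]) (use h(1-3) k(1-3) hk in simp_all)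
  moreover have "Comp C k h = Id C M"
    by (rule partial_limit_unique[OF C PM]) (use h(1-3) k(1-3) hk in simp_all)
  ultimately have "is_iso C h" using h(1-3) k(1-3) by (intro is_isoI[of _ _ k]) simp_all
  then show ?thesis using h(2-4) by (rule that)
qed

text \<open>Used with \<open>limit_iso\<close>: any limit is isomorphic to the constructed one, a
  functor preserves that isomorphism, and so the image of any limit cone is a limit cone.\<close>

lemma limit_transfer:
  assumes C: "category C" and J: "category J" and D: "is_functor J C D"
    and L: "is_limit J C D L l" and h: "is_iso C h" "Cod C h = L"
    and m: "\<And>i. i \<in> Obj J \<Longrightarrow> m i = Comp C (l i) h"
  shows "is_limit J C D (Dom C h) m"
  unfolding is_limit_iff_partial
proof (rule partial_limitI)
  note PL = L[unfolded is_limit_iff_partial]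
  note [simp] = cat_simps[OF C] cat_simps[OF J] ftor_simps[OF D] partial_limitD(1-4)[OF PL]
  have Lc: "partial_cone J C D (Obj J) (Arr J) L l" using PL by (simp add: partial_limit_def)
  obtain k where k: "h \<in> Arr C" "k \<in> Arr C" "Dom C k = L" "Cod C k = Dom C h" "Comp C h k = Id C L"
    by (rule is_isoE[OF h(1)]) (use h(2) in auto)
  have "partial_cone J C D (Obj J) (Arr J) (Dom C h) (\<lambda>i. Comp C (l i) h)"
    by (rule partial_cone_comp[OF C Lc k(1) h(2)]) simp
  then show "partial_cone J C D (Obj J) (Arr J) (Dom C h) m"
    using m by (simp add: partial_cone_def)
  show "\<exists>x. x \<in> Arr C \<and> Dom C x = M \<and> Cod C x = Dom C h \<and> (\<forall>i\<in>Obj J. Comp C (m i) x = y i)"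
    if y: "partial_cone J C D (Obj J) (Arr J) M y" for M y
  proof -
    obtain x where x: "x \<in> Arr C" "Dom C x = M" "Cod C x = L" "\<And>i. i \<in> Obj J \<Longrightarrow> Comp C (l i) x = y i"
      using partial_limit_lift[OF PL y] by blast
    have "Comp C h (Comp C k x) = Comp C (Comp C h k) x"
      by (rule cat_assoc[OF C, symmetric]) (use k x h(2) in simp_all)
    also have "\<dots> = x" using k(5) x by simp
    finally show ?thesis using x k h(2) m by (intro exI[of _ "Comp C k x"]) simp
  qed
  show "x = y" if xy: "x \<in> Arr C" "y \<in> Arr C" "Cod C x = Dom C h" "Cod C y = Dom C h"
      "Dom C x = Dom C y" "\<And>i. i \<in> Obj J \<Longrightarrow> Comp C (m i) x = Comp C (m i) y" for x y
  proof -
    have "Comp C (l i) (Comp C h x) = Comp C (l i) (Comp C h y)" if "i \<in> Obj J" for i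
      using xy(6)[OF that] m[OF that] xy(1-5) k(1) h(2) that by simp
    note lxy = this
    have "Comp C h x = Comp C h y"
      by (rule partial_limit_unique[OF C PL]) (use xy(1-5) k(1) h(2) lxy in simp_all)
    then show ?thesis using iso_cancel[OF C h(1) xy(1-4)] by blast
  qed
qed

section \<open>Terminal objects and pullbacks as limits of finite diagrams\<close>

definition empty_cat :: "(nat, nat) cat" where
  "empty_cat = \<lparr> Obj = {}, Arr = {}, Dom = (\<lambda>_. undefined), Cod = (\<lambda>_. undefined),
     Id = (\<lambda>_. undefined), Comp = (\<lambda>_ _. undefined) \<rparr>"

definition empty_diagram :: "(nat, nat, 'o, 'm) ftor" where
  "empty_diagram = \<lparr> fob = (\<lambda>_. undefined), farr = (\<lambda>_. undefined) \<rparr>"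

lemma empty_diagram:
  "finite_category empty_cat" "is_functor empty_cat C empty_diagram"
  "is_limit empty_cat C D L l \<longleftrightarrow> terminal C L"
  "fcomp empty_cat F D = empty_diagram"
  by (auto simp: finite_category_def category_def is_functor_def empty_cat_def empty_diagram_def
      composable_def is_limit_def is_cone_def terminal_def fcomp_def compose_def)

text \<open>The cospan \<open>0 \<rightarrow> 2 \<leftarrow> 1\<close>, with arrows 3 and 4 besides the identities 0, 1 and 2.\<close>

definition cospan_cat :: "(nat, nat) cat" where
  "cospan_cat = \<lparr> Obj = {..2}, Arr = {..4},
     Dom = (\<lambda>n \<in> {..4}. if n = 3 then 0 else if n = 4 then 1 else n), Cod = (\<lambda>n \<in> {..4}. min n 2),
     Id = (\<lambda>n \<in> {..2}. n),
     Comp = (\<lambda>g f. if g \<le> 4 \<and> f \<le> 4 \<and> min f 2 = (if g = 3 then 0 else if g = 4 then 1 else g)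
       then max g f else undefined) \<rparr>"

definition cospan_diagram :: "('o, 'm) cat \<Rightarrow> 'm \<Rightarrow> 'm \<Rightarrow> (nat, nat, 'o, 'm) ftor" where
  "cospan_diagram C d f =
     (let ob = (\<lambda>n. if n = 0 then Dom C d else if n = 1 then Dom C f else Cod C d) in
      \<lparr> fob = (\<lambda>n \<in> {..2}. ob n),
        farr = (\<lambda>n \<in> {..4}. if n = 3 then d else if n = 4 then f else Id C (ob n)) \<rparr>)"

lemma le4_cases: "(n::nat) \<le> 4 \<longleftrightarrow> n = 0 \<or> n = 1 \<or> n = 2 \<or> n = 3 \<or> n = 4"
  by auto

lemma le2_cases: "(n::nat) \<le> 2 \<longleftrightarrow> n = 0 \<or> n = 1 \<or> n = 2"
  by auto

lemma cospan_cat_simps: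
  "Obj cospan_cat = {..2}" "Arr cospan_cat = {..4}"
  "n \<le> 4 \<Longrightarrow> Dom cospan_cat n = (if n = 3 then 0 else if n = 4 then 1 else n)"
  "n \<le> 4 \<Longrightarrow> Cod cospan_cat n = min n 2"
  "n \<le> 2 \<Longrightarrow> Id cospan_cat n = n"
  "g \<le> 4 \<Longrightarrow> f \<le> 4 \<Longrightarrow> Cod cospan_cat f = Dom cospan_cat g \<Longrightarrow> Comp cospan_cat g f = max g f"
  by (simp_all add: cospan_cat_def)

text \<open>In a composable pair at least one factor is an identity, and the identities carry the
  smallest numbers; so the maximum of the two numbers is the other factor, and \<open>max\<close> is
  a correct composition.\<close>

lemma cospan_comp:
  assumes "g \<le> 4" "f \<le> 4" "Cod cospan_cat f = Dom cospan_cat g"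
  shows "max g f \<le> 4" "Dom cospan_cat (max g f) = Dom cospan_cat f"
    "Cod cospan_cat (max g f) = Cod cospan_cat g"
  using assms by (auto simp: cospan_cat_simps max_def min_def split: if_splits)

lemma finite_category_cospan: "finite_category cospan_cat"
proof -
  have "category cospan_cat"
  proof (rule categoryI)
    fix g f assume "g \<in> Arr cospan_cat" "f \<in> Arr cospan_cat" "Cod cospan_cat f = Dom cospan_cat g"
    then show "Comp cospan_cat g f \<in> homs cospan_cat (Dom cospan_cat f) (Cod cospan_cat g)"
      using cospan_comp[of g f] by (simp add: homs_def cospan_cat_simps(1,2,6))
  next
    fix h g f assume "h \<in> Arr cospan_cat" "g \<in> Arr cospan_cat" "f \<in> Arr cospan_cat"
      "Cod cospan_cat f = Dom cospan_cat g" "Cod cospan_cat g = Dom cospan_cat h"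
    then show "Comp cospan_cat h (Comp cospan_cat g f) = Comp cospan_cat (Comp cospan_cat h g) f"
      using cospan_comp[of g f] cospan_comp[of h g] by (simp add: cospan_cat_simps(1,2,6) max.assoc)
  qed (auto simp: cospan_cat_def homs_def composable_def)
  then show ?thesis by (simp add: finite_category_def cospan_cat_simps)
qed

lemma cospan_diagram_simps:
  "fob (cospan_diagram C d f) 0 = Dom C d" "fob (cospan_diagram C d f) 1 = Dom C f"
  "fob (cospan_diagram C d f) 2 = Cod C d"
  "farr (cospan_diagram C d f) 0 = Id C (Dom C d)" "farr (cospan_diagram C d f) 1 = Id C (Dom C f)"
  "farr (cospan_diagram C d f) 2 = Id C (Cod C d)"
  "farr (cospan_diagram C d f) 3 = d" "farr (cospan_diagram C d f) 4 = f"
  by (simp_all add: cospan_diagram_def)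

lemma cospan_diagram_functor:
  assumes C: "category C" and d: "d \<in> Arr C" and f: "f \<in> Arr C" and c: "Cod C d = Cod C f"
  shows "is_functor cospan_cat C (cospan_diagram C d f)"
proof (rule is_functorI)
  note [simp] = cat_simps[OF C] d f c cospan_diagram_simps cospan_diagram_simps[simplified]
  show "farr (cospan_diagram C d f) (Comp cospan_cat v u) =
      Comp C (farr (cospan_diagram C d f) v) (farr (cospan_diagram C d f) u)"
    if "v \<in> Arr cospan_cat" "u \<in> Arr cospan_cat" "Cod cospan_cat u = Dom cospan_cat v" for v u
  proof -
    have vu: "v \<le> 4" "u \<le> 4" using that by (simp_all add: cospan_cat_simps)
    \<comment> \<open>The composable pairs: each identity with itself, and each of 3 and 4 with the
      identities at its two ends.\<close>
    have "(v, u) \<in> {(0, 0), (1, 1), (2, 2), (3, 0), (4, 1), (2, 3), (2, 4)}"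
      using vu that(3) by (auto simp: cospan_cat_simps min_def split: if_splits)
    then show ?thesis by (elim insertE emptyE) (simp_all add: cospan_cat_simps)
  qed
  show "farr (cospan_diagram C d f) u \<in> homs C (fob (cospan_diagram C d f) (Dom cospan_cat u))
      (fob (cospan_diagram C d f) (Cod cospan_cat u))" if "u \<in> Arr cospan_cat" for u
  proof -
    have "u \<in> {0, 1, 2, 3, 4}" using that by (auto simp: cospan_cat_simps)
    then show ?thesis by (elim insertE emptyE) (simp_all add: cospan_cat_simps homs_def)
  qed
  show "fob (cospan_diagram C d f) X \<in> Obj C"
    "farr (cospan_diagram C d f) (Id cospan_cat X) = Id C (fob (cospan_diagram C d f) X)"
    if "X \<in> Obj cospan_cat" for X
  proof -
    have "X \<in> {0, 1, 2}" using that by (auto simp: cospan_cat_simps)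
    then show "fob (cospan_diagram C d f) X \<in> Obj C"
      "farr (cospan_diagram C d f) (Id cospan_cat X) = Id C (fob (cospan_diagram C d f) X)"
      by (elim insertE emptyE; simp add: cospan_cat_simps)+
  qed
qed (simp_all add: cospan_diagram_def cospan_cat_simps)

lemma cospan_ball:
  "(\<forall>i \<in> Obj cospan_cat. P i) \<longleftrightarrow> P 0 \<and> P 1 \<and> P 2"
  "(\<forall>i \<in> Arr cospan_cat. P i) \<longleftrightarrow> P 0 \<and> P 1 \<and> P 2 \<and> P 3 \<and> P 4"
  by (auto simp: cospan_cat_simps le2_cases le4_cases)

lemma cospan_cone_iff:
  assumes C: "category C" and d: "d \<in> Arr C" and f: "f \<in> Arr C" and c: "Cod C d = Cod C f"
  shows "is_cone cospan_cat C (cospan_diagram C d f) M k \<longleftrightarrow>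
    k 0 \<in> homs C M (Dom C d) \<and> k 1 \<in> homs C M (Dom C f) \<and> Comp C d (k 0) = Comp C f (k 1) \<and>
    k 2 = Comp C d (k 0)" (is "?L \<longleftrightarrow> ?R")
proof
  note simps = cospan_cat_simps cospan_diagram_simps
  assume ?L
  then have "k 0 \<in> homs C M (Dom C d)" "k 1 \<in> homs C M (Dom C f)"
    "Comp C d (k 0) = k 2" "Comp C f (k 1) = k 2"
    unfolding is_cone_def cospan_ball by (simp_all add: simps del: One_nat_def)
  then show ?R by simp
next
  note simps = cospan_cat_simps cospan_diagram_simps
  assume R: ?R
  then have k: "k 0 \<in> Arr C" "Dom C (k 0) = M" "Cod C (k 0) = Dom C d"
    "k 1 \<in> Arr C" "Dom C (k 1) = M" "Cod C (k 1) = Dom C f" by (auto simp: homs_def)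
  have "M \<in> Obj C" using cat_dom[OF C k(1)] k(2) by simp
  moreover have "Comp C d (k 0) \<in> homs C M (Cod C d)"
    using k d by (intro homsI) (simp_all add: cat_simps[OF C])
  ultimately show ?L
    unfolding is_cone_def cospan_ball using R k d f c
    by (simp add: simps homs_def cat_simps[OF C] del: One_nat_def)
qed

text \<open>A cone over a cospan is a commutative square together with its diagonal. The leg at the
  vertex 2 is determined by the others and imposes nothing new on a mediating map, but it has to be
  pinned down since a cone consists of all three legs.\<close>

lemma cospan_limit_iff:
  assumes C: "category C" and d: "d \<in> Arr C" and f: "f \<in> Arr C" and c: "Cod C d = Cod C f"
  shows "is_limit cospan_cat C (cospan_diagram C d f) L l \<longleftrightarrow>
    is_pullback C d f (l 0) (l 1) \<and> Dom C (l 0) = L \<and> l 2 = Comp C d (l 0)"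
proof
  note cone = cospan_cone_iff[OF assms]
  assume L: "is_limit cospan_cat C (cospan_diagram C d f) L l"
  then have l: "l 0 \<in> homs C L (Dom C d)" "l 1 \<in> homs C L (Dom C f)"
    "Comp C d (l 0) = Comp C f (l 1)" "l 2 = Comp C d (l 0)"
    unfolding is_limit_def cone by blast+
  note l' = homsD[OF l(1)] homsD[OF l(2)]
  have lim: "\<exists>!h. h \<in> homs C M L \<and> Comp C (l 0) h = k 0 \<and> Comp C (l 1) h = k 1 \<and> Comp C (l 2) h = k 2"
    if "is_cone cospan_cat C (cospan_diagram C d f) M k" for M k
    using L that unfolding is_limit_def cospan_ball by blast
  have univ: "\<exists>!h. h \<in> homs C (Dom C a) L \<and> Comp C (l 0) h = a \<and> Comp C (l 1) h = b"
    if ab: "a \<in> Arr C" "b \<in> Arr C" "Cod C a = Dom C d" "Cod C b = Dom C f" "Dom C a = Dom C b"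
      "Comp C d a = Comp C f b" for a b
  proof -
    \<comment> \<open>The given pair of maps, completed to a cone by the diagonal of its
      square.\<close>
    let ?k = "\<lambda>i::nat. if i = 0 then a else if i = 1 then b else Comp C d a"
    have "is_cone cospan_cat C (cospan_diagram C d f) (Dom C a) ?k"
      unfolding cone using ab by (simp add: homs_def)
    from lim[OF this] have "\<exists>!h. h \<in> homs C (Dom C a) L \<and> Comp C (l 0) h = a \<and> Comp C (l 1) h = b \<and>
        Comp C (l 2) h = Comp C d a" by simp
    moreover have "Comp C (l 2) h = Comp C d a" if "h \<in> homs C (Dom C a) L" "Comp C (l 0) h = a" for h
    proof -
      have "Comp C (l 2) h = Comp C d (Comp C (l 0) h)"
        unfolding l(4) by (rule cat_assoc[OF C]) (use homsD[OF that(1)] l' d in simp_all)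
      then show ?thesis using that(2) by simp
    qed
    ultimately show ?thesis by blast
  qed
  show "is_pullback C d f (l 0) (l 1) \<and> Dom C (l 0) = L \<and> l 2 = Comp C d (l 0)"
    unfolding is_pullback_def composable_def using l' l(3,4) univ d f by auto
next
  note cone = cospan_cone_iff[OF assms]
  assume L: "is_pullback C d f (l 0) (l 1) \<and> Dom C (l 0) = L \<and> l 2 = Comp C d (l 0)"
  then have P: "is_pullback C d f (l 0) (l 1)" and l0: "Dom C (l 0) = L"
    and l2: "l 2 = Comp C d (l 0)" by auto
  note pf = pullback_facts[OF C P]
  have "\<exists>!h. h \<in> homs C M L \<and> Comp C (l 0) h = k 0 \<and> Comp C (l 1) h = k 1 \<and> Comp C (l 2) h = k 2"
    if "is_cone cospan_cat C (cospan_diagram C d f) M k" for M k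
  proof -
    have k: "k 0 \<in> homs C M (Dom C d)" "k 1 \<in> homs C M (Dom C f)"
      "Comp C d (k 0) = Comp C f (k 1)" "k 2 = Comp C d (k 0)"
      using that unfolding cone by blast+
    note k' = homsD[OF k(1)] homsD[OF k(2)]
    have "\<exists>!h. h \<in> homs C M L \<and> Comp C (l 0) h = k 0 \<and> Comp C (l 1) h = k 1"
      using pullback_universal[OF P k'(1,4,3,6) _ k(3)] k' l0 by simp
    moreover have "Comp C (l 2) h = k 2" if "h \<in> homs C M L" "Comp C (l 0) h = k 0" for h
    proof -
      have "Comp C (l 2) h = Comp C d (Comp C (l 0) h)"
        unfolding l2 by (rule cat_assoc[OF C]) (use homsD[OF that(1)] pf l0 in simp_all)
      then show ?thesis using that(2) k(4) by simp
    qed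
    ultimately show ?thesis by blast
  qed
  moreover have "is_cone cospan_cat C (cospan_diagram C d f) L l"
    unfolding cone using pf(3,4,5,6,9) pf(7)[symmetric] l0 l2 by (simp add: homs_def)
  ultimately show "is_limit cospan_cat C (cospan_diagram C d f) L l"
    unfolding is_limit_def cospan_ball by blast
qed

lemma fcomp_cospan_diagram:
  assumes C: "category C" and F: "is_functor C C' F"
    and d: "d \<in> Arr C" and f: "f \<in> Arr C" and c: "Cod C d = Cod C f"
  shows "fcomp cospan_cat F (cospan_diagram C d f) = cospan_diagram C' (farr F d) (farr F f)"
  by (rule ftor.equality) (auto simp: fun_eq_iff fcomp_def compose_def cospan_diagram_def Let_def
      cospan_cat_def cat_simps[OF C] ftor_simps[OF F] d f c)

lemma has_finite_limits_iff:
  assumes C: "category C"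
  shows "has_finite_limits C \<longleftrightarrow> (\<exists>t. terminal C t) \<and> has_pullbacks C"
proof
  assume lim: "has_finite_limits C"
  have "\<exists>t. terminal C t"
    using lim empty_diagram unfolding has_finite_limits_def by metis
  moreover have "\<exists>q d'. is_pullback C d f q d'"
    if "d \<in> Arr C" "f \<in> Arr C" "Cod C d = Cod C f" for d f
    using lim finite_category_cospan cospan_diagram_functor[OF C that] cospan_limit_iff[OF C that]
    unfolding has_finite_limits_def by metis
  ultimately show "(\<exists>t. terminal C t) \<and> has_pullbacks C" unfolding has_pullbacks_def by blast
next
  assume *: "(\<exists>t. terminal C t) \<and> has_pullbacks C"
  then obtain t where t: "terminal C t" by blast
  \<comment> \<open>The lemma on preservation is applied to the identity functor and only its
    existence part is kept.\<close>
  have F: "preserves_pullbacks C C (id_functor C)" "preserves_terminal C C (id_functor C)"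
    by (auto simp: preserves_pullbacks_def preserves_terminal_def pullback_facts[OF C] terminalD(1))
  show "has_finite_limits C"
    unfolding has_finite_limits_def
    using partial_limits_preserved[OF C C id_functor[OF C] _ t F] * by blast
qed

text \<open>This is the bridge between left exact functors and clan maps. Pullbacks and terminal
  objects are limits of particular finite diagrams; conversely one limit of each diagram is built
  from them and preserved along with them.\<close>

lemma preserves_finite_limits_iff:
  assumes C: "category C" and C': "category C'" and F: "is_functor C C' F"
    and lim: "has_finite_limits C"
  shows "preserves_finite_limits C C' F \<longleftrightarrow> preserves_pullbacks C C' F \<and> preserves_terminal C C' F"
proof
  assume F_lim: "preserves_finite_limits C C' F"
  have "terminal C' (fob F t)" if "terminal C t" for t
    using F_lim that empty_diagram unfolding preserves_finite_limits_def by metis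
  moreover have "is_pullback C' (farr F d) (farr F f) (farr F q) (farr F d')"
    if P: "is_pullback C d f q d'" for d f q d'
  proof -
    note pf = pullback_facts[OF C P]
    let ?l = "\<lambda>i::nat. if i = 0 then q else if i = 1 then d' else Comp C d q"
    have "is_limit cospan_cat C (cospan_diagram C d f) (Dom C q) ?l"
      using P by (simp add: cospan_limit_iff[OF C pf(1,2,8)])
    then have "is_limit cospan_cat C' (cospan_diagram C' (farr F d) (farr F f)) (fob F (Dom C q))
        (\<lambda>i. farr F (?l i))"
      using F_lim finite_category_cospan cospan_diagram_functor[OF C pf(1,2,8)]
        fcomp_cospan_diagram[OF C F pf(1,2,8)] unfolding preserves_finite_limits_def by metis
    then show ?thesis
      using pf by (simp add: cospan_limit_iff[OF C'] ftor_simps[OF F])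
  qed
  ultimately show "preserves_pullbacks C C' F \<and> preserves_terminal C C' F"
    by (simp add: preserves_pullbacks_def preserves_terminal_def)
next
  assume *: "preserves_pullbacks C C' F \<and> preserves_terminal C C' F"
  obtain t where t: "terminal C t" and pb: "has_pullbacks C"
    using lim has_finite_limits_iff[OF C] by blast
  show "preserves_finite_limits C C' F"
    unfolding preserves_finite_limits_def
  proof (intro allI impI, elim conjE)
    fix J :: "(nat, nat) cat" and D M m
    assume J: "finite_category J" and D: "is_functor J C D" and M: "is_limit J C D M m"
    have cJ: "category J" using J by (simp add: finite_category_def)
    note D' = fcomp_functor[OF cJ D F]
    obtain L l where L: "is_limit J C D L l"
      and L': "is_limit J C' (fcomp J F D) (fob F L) (\<lambda>i. farr F (l i))"
      using partial_limits_preserved[OF C C' F pb t _ _ J D] * by blast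
    \<comment> \<open>The given limit \<open>M\<close> need not be the constructed limit
      \<open>L\<close>; the isomorphism between them, carried along by \<open>F\<close>, makes up
      the difference.\<close>
    obtain h where h: "is_iso C h" "Dom C h = M" "Cod C h = L"
      "\<And>i. i \<in> Obj J \<Longrightarrow> Comp C (l i) h = m i"
      using limit_iso[OF C cJ D L M] by metis
    have hA: "h \<in> Arr C" using h(1) by (simp add: is_iso_def)
    have "is_limit J C' (fcomp J F D) (Dom C' (farr F h)) (\<lambda>i. farr F (m i))"
    proof (rule limit_transfer[OF C' cJ D' L' ftor_iso[OF C F h(1)]])
      show "Cod C' (farr F h) = fob F L" using h hA by (simp add: ftor_simps[OF F])
      fix i assume i: "i \<in> Obj J"
      have "l i \<in> Arr C" "Dom C (l i) = L"
        using partial_limitD[OF L[unfolded is_limit_iff_partial]] i by auto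
      then show "farr F (m i) = Comp C' (farr F (l i)) (farr F h)"
        using h(3,4) hA i by (simp add: ftor_comp[OF F, symmetric])
    qed
    then show "is_limit J C' (fcomp J F D) (fob F M) (\<lambda>i. farr F (m i))"
      using h hA by (simp add: ftor_simps[OF F])
  qed
qed

section \<open>Full subcategories\<close>

lemma full_subcat_simps:
  "Obj (full_subcat C S) = S"
  "f \<in> Arr (full_subcat C S) \<longleftrightarrow> f \<in> Arr C \<and> Dom C f \<in> S \<and> Cod C f \<in> S"
  "f \<in> Arr C \<Longrightarrow> Dom C f \<in> S \<Longrightarrow> Cod C f \<in> S \<Longrightarrow> Dom (full_subcat C S) f = Dom C f"
  "f \<in> Arr C \<Longrightarrow> Dom C f \<in> S \<Longrightarrow> Cod C f \<in> S \<Longrightarrow> Cod (full_subcat C S) f = Cod C f"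
  "X \<in> S \<Longrightarrow> Id (full_subcat C S) X = Id C X"
  "g \<in> Arr C \<Longrightarrow> Dom C g \<in> S \<Longrightarrow> Cod C g \<in> S \<Longrightarrow> f \<in> Arr C \<Longrightarrow> Dom C f \<in> S \<Longrightarrow> Cod C f \<in> S \<Longrightarrow>
    Comp (full_subcat C S) g f = Comp C g f"
  by (simp_all add: full_subcat_def Let_def)

lemma category_full_subcat:
  assumes C: "category C" and S: "S \<subseteq> Obj C"
  shows "category (full_subcat C S)"
proof (rule categoryI)
  note [simp] = full_subcat_simps cat_simps[OF C]
  show "Id (full_subcat C S) X \<in> homs (full_subcat C S) X X" if "X \<in> Obj (full_subcat C S)" for X
  proof -
    have "X \<in> S" "X \<in> Obj C" using that S by auto
    then show ?thesis by (simp add: homs_def)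
  qed
  show "Comp (full_subcat C S) g f = undefined" if "\<not> composable (full_subcat C S) g f" for g f
  proof (cases "g \<in> Arr (full_subcat C S) \<and> f \<in> Arr (full_subcat C S)")
    case True
    then have "\<not> composable C g f" using that by (auto simp: composable_def)
    then show ?thesis using True cat_comp_undefined[OF C] by simp
  next
    case False
    then show ?thesis by (auto simp: full_subcat_def Let_def)
  qed
  show "Comp (full_subcat C S) g f \<in> homs (full_subcat C S) (Dom (full_subcat C S) f)
      (Cod (full_subcat C S) g)"
    if "g \<in> Arr (full_subcat C S)" "f \<in> Arr (full_subcat C S)"
      "Cod (full_subcat C S) f = Dom (full_subcat C S) g" for g f
    using that by (auto simp: homs_def)
qed (auto simp: full_subcat_simps cat_simps[OF C], simp_all add: full_subcat_def Let_def)

lemma full_subcat_iso_iff: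
  assumes "category C" "S \<subseteq> Obj C" "Dom C f \<in> S" "Cod C f \<in> S"
  shows "is_iso (full_subcat C S) f \<longleftrightarrow> is_iso C f"
proof
  assume "is_iso (full_subcat C S) f"
  then obtain g where "f \<in> Arr (full_subcat C S)" "g \<in> Arr (full_subcat C S)"
    "Dom (full_subcat C S) g = Cod (full_subcat C S) f" "Cod (full_subcat C S) g = Dom (full_subcat C S) f"
    "Comp (full_subcat C S) g f = Id (full_subcat C S) (Dom (full_subcat C S) f)"
    "Comp (full_subcat C S) f g = Id (full_subcat C S) (Cod (full_subcat C S) f)"
    by (rule is_isoE)
  then show "is_iso C f"
    by (intro is_isoI[of _ _ g]) (auto simp: full_subcat_simps)
next
  assume "is_iso C f"
  then obtain g where "f \<in> Arr C" "g \<in> Arr C" "Dom C g = Cod C f" "Cod C g = Dom C f"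
    "Comp C g f = Id C (Dom C f)" "Comp C f g = Id C (Cod C f)" by (rule is_isoE)
  then show "is_iso (full_subcat C S) f"
    using assms by (intro is_isoI[of _ _ g]) (auto simp: full_subcat_simps)
qed

text \<open>The functor is the same record on both sides, as no target is stored in it. This is the
  source of the literal equalities between hom-categories.\<close>

lemma full_subcat_functor_iff:
  assumes C: "category C" and S: "S \<subseteq> Obj C" and B: "category B"
  shows "is_functor B (full_subcat C S) F \<longleftrightarrow> is_functor B C F \<and> (\<forall>X \<in> Obj B. fob F X \<in> S)"
proof
  assume F: "is_functor B (full_subcat C S) F"
  note FS = ftor_simps[OF F]
  have *: "farr F f \<in> Arr C" "Dom C (farr F f) = fob F (Dom B f)" "Cod C (farr F f) = fob F (Cod B f)"
    if "f \<in> Arr B" for f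
    using FS(2-4)[OF that] by (auto simp: full_subcat_simps)
  have ob: "fob F X \<in> S" if "X \<in> Obj B" for X using FS(1)[OF that] by (simp add: full_subcat_simps)
  have "is_functor B C F"
  proof (rule is_functorI)
    show "farr F (Id B X) = Id C (fob F X)" if "X \<in> Obj B" for X
      using FS(5)[OF that] ob[OF that] by (simp add: full_subcat_simps)
    show "farr F (Comp B g f) = Comp C (farr F g) (farr F f)"
      if "g \<in> Arr B" "f \<in> Arr B" "Cod B f = Dom B g" for g f
      using FS(6)[OF that] that ob * by (simp add: full_subcat_simps cat_simps[OF B])
  qed (use * ob S ftor_ob_ext[OF F] ftor_arr_ext[OF F] in \<open>auto intro!: homsI\<close>)
  then show "is_functor B C F \<and> (\<forall>X \<in> Obj B. fob F X \<in> S)" using ob by blast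
next
  assume "is_functor B C F \<and> (\<forall>X \<in> Obj B. fob F X \<in> S)"
  then have F: "is_functor B C F" and ob: "\<And>X. X \<in> Obj B \<Longrightarrow> fob F X \<in> S" by auto
  note [simp] = ftor_simps[OF F] ob cat_simps[OF B] full_subcat_simps
  show "is_functor B (full_subcat C S) F"
    by (rule is_functorI) (auto simp: homs_def ftor_ob_ext[OF F] ftor_arr_ext[OF F])
qed

text \<open>Composition in the subcategory is \<open>undefined\<close> off its arrows, so the
  comparison rests on the components having source and target in \<open>S\<close>, which follows
  from where the functors take their values.\<close>

lemma full_subcat_nat_trans:
  assumes C: "category C" and S: "S \<subseteq> Obj C" and B: "category B"
    and F: "is_functor B (full_subcat C S) F" and G: "is_functor B (full_subcat C S) G"
  shows "nat_trans B (full_subcat C S) F G = nat_trans B C F G"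
    and "id_nt B (full_subcat C S) F = id_nt B C F"
    and "nat_trans B C F G \<alpha> \<Longrightarrow> nat_trans B C G H \<beta> \<Longrightarrow> is_functor B (full_subcat C S) H \<Longrightarrow>
      vcomp_nt B (full_subcat C S) \<beta> \<alpha> = vcomp_nt B C \<beta> \<alpha>"
proof -
  have ob: "fob K X \<in> S" if "is_functor B (full_subcat C S) K" "X \<in> Obj B" for K X
    using full_subcat_functor_iff[OF C S B, of K] that by blast
  have FG: "is_functor B C F" "is_functor B C G"
    using F G full_subcat_functor_iff[OF C S B] by blast+
  note [simp] = ftor_simps[OF FG(1)] ftor_simps[OF FG(2)] ob[OF F] ob[OF G] full_subcat_simps
    cat_simps[OF B]
  show "nat_trans B (full_subcat C S) F G = nat_trans B C F G"
  proof (rule HOL.ext, rule iffI)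
    fix \<alpha>
    assume \<alpha>: "nat_trans B (full_subcat C S) F G \<alpha>"
    have c: "\<alpha> X \<in> Arr C" "Dom C (\<alpha> X) = fob F X" "Cod C (\<alpha> X) = fob G X" if "X \<in> Obj B" for X
      using nt_simps[OF \<alpha> that] by auto
    have "Comp C (\<alpha> (Cod B f)) (farr F f) = Comp C (farr G f) (\<alpha> (Dom B f))" if "f \<in> Arr B" for f
      using nt_nat[OF \<alpha> that] that by (simp add: c)
    then show "nat_trans B C F G \<alpha>"
      using c nt_ext[OF \<alpha>] by (intro nat_transI homsI) auto
  next
    fix \<alpha>
    assume \<alpha>: "nat_trans B C F G \<alpha>"
    note [simp] = nt_simps[OF \<alpha>]
    have "Comp (full_subcat C S) (\<alpha> (Cod B f)) (farr F f) =
        Comp (full_subcat C S) (farr G f) (\<alpha> (Dom B f))" if "f \<in> Arr B" for f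
      using nt_nat[OF \<alpha> that] that by simp
    then show "nat_trans B (full_subcat C S) F G \<alpha>"
      using nt_ext[OF \<alpha>] by (intro nat_transI homsI) auto
  qed
  show "id_nt B (full_subcat C S) F = id_nt B C F"
    by (auto simp: id_nt_def)
  assume \<alpha>: "nat_trans B C F G \<alpha>" and \<beta>: "nat_trans B C G H \<beta>"
    and H: "is_functor B (full_subcat C S) H"
  note [simp] = nt_simps[OF \<alpha>] nt_simps[OF \<beta>] ob[OF H]
  show "vcomp_nt B (full_subcat C S) \<beta> \<alpha> = vcomp_nt B C \<beta> \<alpha>"
    by (auto simp: vcomp_nt_def)
qed

lemma full_subcat_hcomp:
  assumes C: "category C" and S: "S \<subseteq> Obj C" and B: "category B" and A: "category A"
    and G: "is_functor B (full_subcat C S) G" and G': "is_functor B (full_subcat C S) G'"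
    and F: "is_functor A B F" and F': "is_functor A B F'"
    and \<alpha>: "nat_trans A B F F' \<alpha>" and \<beta>: "nat_trans B C G G' \<beta>"
  shows "hcomp_nt A (full_subcat C S) G F' \<beta> \<alpha> = hcomp_nt A C G F' \<beta> \<alpha>"
proof -
  have ob: "fob K X \<in> S" if "is_functor B (full_subcat C S) K" "X \<in> Obj B" for K X
    using full_subcat_functor_iff[OF C S B, of K] that by blast
  have GG: "is_functor B C G" "is_functor B C G'"
    using G G' full_subcat_functor_iff[OF C S B] by blast+
  note [simp] = ftor_simps[OF GG(1)] ftor_simps[OF GG(2)] ftor_simps[OF F] ftor_simps[OF F']
    ob[OF G] ob[OF G'] full_subcat_simps cat_simps[OF B] nt_simps[OF \<alpha>] nt_simps[OF \<beta>]
  show ?thesis by (auto simp: hcomp_nt_def)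
qed

text \<open>A replete full subcategory closed under finite limits. The last clause asks for a single
  pullback with apex in \<open>S\<close>; closure under isomorphism extends it to every pullback of
  the same cospan.\<close>

definition lex_full :: "('o, 'm) cat \<Rightarrow> 'o set \<Rightarrow> bool" where
  "lex_full C S \<longleftrightarrow> category C \<and> S \<subseteq> Obj C \<and> (\<exists>t \<in> S. terminal C t) \<and>
     (\<forall>u. is_iso C u \<and> Cod C u \<in> S \<longrightarrow> Dom C u \<in> S) \<and>
     (\<forall>d f. d \<in> Arr (full_subcat C S) \<and> f \<in> Arr (full_subcat C S) \<and> Cod C d = Cod C f \<longrightarrow>
        (\<exists>q d'. is_pullback C d f q d' \<and> Dom C q \<in> S))"

lemma lex_fullD:
  assumes "lex_full C S"
  shows "category C" "S \<subseteq> Obj C" "\<exists>t \<in> S. terminal C t"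
    and "is_iso C u \<Longrightarrow> Cod C u \<in> S \<Longrightarrow> Dom C u \<in> S"
    and "d \<in> Arr (full_subcat C S) \<Longrightarrow> f \<in> Arr (full_subcat C S) \<Longrightarrow> Cod C d = Cod C f \<Longrightarrow>
      \<exists>q d'. is_pullback C d f q d' \<and> Dom C q \<in> S"
  using assms unfolding lex_full_def by blast+

text \<open>A pullback formed inside a full subcategory need not be one outside. Here an ambient
  pullback with apex in \<open>S\<close> exists and is a pullback in both categories; every other
  pullback, in either category, is isomorphic to it.\<close>

lemma lex_full_pullback:
  assumes S: "lex_full C S" and d: "d \<in> Arr (full_subcat C S)" and f: "f \<in> Arr (full_subcat C S)"
  shows "is_pullback (full_subcat C S) d f q d' \<longleftrightarrow> is_pullback C d f q d'"
proof -
  let ?E = "full_subcat C S"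
  note C = lex_fullD(1)[OF S]
  note cE = category_full_subcat[OF C lex_fullD(2)[OF S]]
  note [simp] = full_subcat_simps
  have df: "d \<in> Arr C" "Dom C d \<in> S" "Cod C d \<in> S" "f \<in> Arr C" "Dom C f \<in> S" "Cod C f \<in> S"
    using d f by auto
  have sub: "is_pullback ?E d f q d'" if P: "is_pullback C d f q d'" and q: "Dom C q \<in> S" for q d'
  proof (rule is_pullbackI)
    note [simp] = pullback_facts(1-6)[OF C P] q df pb_dom(3)[OF C P, symmetric]
    show "Comp ?E d q = Comp ?E f d'" using pb_comm[OF C P] by simp
    fix a b assume "a \<in> Arr ?E" "b \<in> Arr ?E" "Cod ?E a = Dom ?E d" "Cod ?E b = Dom ?E f"
      "Dom ?E a = Dom ?E b" "Comp ?E d a = Comp ?E f b"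
    then have ab: "a \<in> Arr C" "b \<in> Arr C" "Cod C a = Dom C d" "Cod C b = Dom C f"
      "Dom C a = Dom C b" "Dom C b \<in> S" "Comp C d a = Comp C f b" by auto
    show "\<exists>h. h \<in> Arr ?E \<and> Dom ?E h = Dom ?E a \<and> Cod ?E h = Dom ?E q \<and> Comp ?E q h = a \<and>
        Comp ?E d' h = b"
      using pullback_lift[OF P ab(1-5,7)] ab q by auto
  next
    note [simp] = pullback_facts(1-6)[OF C P] q df pb_dom(3)[OF C P, symmetric]
    fix h k assume "h \<in> Arr ?E" "k \<in> Arr ?E" "Cod ?E h = Dom ?E q" "Cod ?E k = Dom ?E q"
      "Comp ?E q h = Comp ?E q k" "Comp ?E d' h = Comp ?E d' k"
    then have "h \<in> Arr C" "k \<in> Arr C" "Cod C h = Dom C q" "Cod C k = Dom C q"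
      "Comp C q h = Comp C q k" "Comp C d' h = Comp C d' k" by auto
    then show "h = k" by (rule pullback_unique[OF C P])
  qed (simp_all add: pullback_facts(1-6)[OF C P] q df pb_dom(3)[OF C P, symmetric]
      pb_dom(4)[OF C P])
  \<comment> \<open>Repleteness enters here: the apex is isomorphic to one known to lie in
    \<open>S\<close>.\<close>
  have apex: "Dom C q \<in> S \<and> is_pullback ?E d f q d'" if P: "is_pullback C d f q d'" for q d'
  proof -
    obtain q0 d0 where P0: "is_pullback C d f q0 d0" "Dom C q0 \<in> S"
      using lex_fullD(5)[OF S d f pb_dom(4)[OF C P]] by blast
    obtain u where "is_iso C u" "Dom C u = Dom C q" "Cod C u = Dom C q0" "Comp C q0 u = q"
      "Comp C d0 u = d'" by (rule pullback_iso[OF C P0(1) P])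
    then have "Dom C q \<in> S" using lex_fullD(4)[OF S, of u] P0(2) by simp
    then show ?thesis using sub[OF P] by blast
  qed
  show ?thesis
  proof
    assume P: "is_pullback ?E d f q d'"
    note pE = pullback_facts[OF cE P]
    have "Cod C d = Cod C f" using pE(8) df by simp
    then obtain q0 d0 where P0: "is_pullback C d f q0 d0" "Dom C q0 \<in> S"
      using lex_fullD(5)[OF S d f] by blast
    note p0 = pullback_facts[OF C P0(1)]
    obtain u where u: "is_iso ?E u" "Dom ?E u = Dom ?E q" "Cod ?E u = Dom ?E q0"
      "Comp ?E q0 u = q" "Comp ?E d0 u = d'"
      by (rule pullback_iso[OF cE sub[OF P0] P])
    have uA: "u \<in> Arr ?E" using u(1) by (simp add: is_iso_def)
    have q0: "q0 \<in> Arr ?E" "d0 \<in> Arr ?E" using p0 P0(2) df by auto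
    have "is_iso C u"
      using u(1) uA full_subcat_iso_iff[OF C lex_fullD(2)[OF S], of u] by simp
    moreover have "Cod C u = Dom C q0" using u(3) uA q0 by simp
    ultimately have "is_pullback C d f (Comp C q0 u) (Comp C d0 u)"
      by (rule pullback_transfer[OF C P0(1)])
    moreover have "Comp C q0 u = q" "Comp C d0 u = d'" using u(4,5) uA q0 by simp_all
    ultimately show "is_pullback C d f q d'" by simp
  next
    assume "is_pullback C d f q d'"
    then show "is_pullback ?E d f q d'" using apex by blast
  qed
qed

text \<open>The same comparison as for pullbacks, with the terminal object known to lie in
  \<open>S\<close> as reference.\<close>

lemma lex_full_terminal:
  assumes S: "lex_full C S"
  shows "terminal (full_subcat C S) t \<longleftrightarrow> terminal C t"
proof -
  let ?E = "full_subcat C S"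
  note C = lex_fullD(1)[OF S]
  note cE = category_full_subcat[OF C lex_fullD(2)[OF S]]
  have homs: "homs ?E X Y = homs C X Y" if "X \<in> S" "Y \<in> S" for X Y
    using that by (auto simp: homs_def full_subcat_simps)
  have sub: "terminal ?E s" if "terminal C s" "s \<in> S" for s
    using that lex_fullD(2)[OF S] by (auto simp: terminal_def full_subcat_simps(1) homs)
  obtain t0 where t0: "t0 \<in> S" "terminal C t0" using lex_fullD(3)[OF S] by blast
  show ?thesis
  proof
    assume t: "terminal C t"
    obtain u where "is_iso C u" "Dom C u = t" "Cod C u = t0" by (rule terminal_iso[OF C t0(2) t])
    then have "t \<in> S" using lex_fullD(4)[OF S, of u] t0(1) by simp
    then show "terminal ?E t" by (rule sub[OF t])
  next
    assume t: "terminal ?E t"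
    obtain u where u: "is_iso ?E u" "Dom ?E u = t" "Cod ?E u = t0"
      by (rule terminal_iso[OF cE sub[OF t0(2,1)] t])
    have uA: "u \<in> Arr C" "Dom C u \<in> S" "Cod C u \<in> S"
      using u(1) by (auto simp: is_iso_def full_subcat_simps)
    then have "is_iso C u" "Dom C u = t" "Cod C u = t0"
      using u full_subcat_iso_iff[OF C lex_fullD(2)[OF S], of u] by (simp_all add: full_subcat_simps)
    then show "terminal C t" using terminal_transfer[OF C t0(2), of u] by simp
  qed
qed

lemma lex_full_has_finite_limits:
  assumes S: "lex_full C S"
  shows "has_finite_limits (full_subcat C S)" "has_pullbacks (full_subcat C S)"
proof -
  note C = lex_fullD(1)[OF S]
  note cE = category_full_subcat[OF C lex_fullD(2)[OF S]]
  show pb: "has_pullbacks (full_subcat C S)"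
    unfolding has_pullbacks_def
  proof (intro ballI impI)
    fix d f assume df: "d \<in> Arr (full_subcat C S)" "f \<in> Arr (full_subcat C S)"
      "Cod (full_subcat C S) d = Cod (full_subcat C S) f"
    then have "Cod C d = Cod C f" by (simp add: full_subcat_simps)
    then show "\<exists>q d'. is_pullback (full_subcat C S) d f q d'"
      using lex_fullD(5)[OF S df(1,2)] lex_full_pullback[OF S df(1,2)] by blast
  qed
  show "has_finite_limits (full_subcat C S)"
    using pb lex_fullD(3)[OF S] lex_full_terminal[OF S] by (auto simp: has_finite_limits_iff[OF cE])
qed

section \<open>Clans\<close>

lemma clanD:
  assumes "clan (C, D)"
  shows "category C" "D \<subseteq> Arr C"
    and "d \<in> D \<Longrightarrow> d' \<in> Arr C \<Longrightarrow> isomorphic (arrow_cat C) d d' \<Longrightarrow> d' \<in> D"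
    and "d \<in> D \<Longrightarrow> f \<in> Arr C \<Longrightarrow> Cod C f = Cod C d \<Longrightarrow> \<exists>q. \<exists>d' \<in> D. is_pullback C d f q d'"
    and "g \<in> D \<Longrightarrow> f \<in> D \<Longrightarrow> Cod C f = Dom C g \<Longrightarrow> Comp C g f \<in> D"
    and "X \<in> Obj C \<Longrightarrow> Id C X \<in> D"
    and "\<exists>t. terminal C t \<and> (\<forall>f \<in> Arr C. Cod C f = t \<longrightarrow> f \<in> display_composites C D)"
proof -
  have *: "display_map_category C D" "comp_closed C D"
    using assms by (auto simp: clan_def rooted_dmc_def)
  then show "category C" and D: "D \<subseteq> Arr C" unfolding display_map_category_def by blast+
  have "replete_in (arrow_cat C) D" using * unfolding display_map_category_def by blast
  then show "d \<in> D \<Longrightarrow> d' \<in> Arr C \<Longrightarrow> isomorphic (arrow_cat C) d d' \<Longrightarrow> d' \<in> D"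
    by (auto simp: replete_in_def arrow_cat_simps)
  show "d \<in> D \<Longrightarrow> f \<in> Arr C \<Longrightarrow> Cod C f = Cod C d \<Longrightarrow> \<exists>q. \<exists>d' \<in> D. is_pullback C d f q d'"
    using * unfolding display_map_category_def by blast
  show "g \<in> D \<Longrightarrow> f \<in> D \<Longrightarrow> Cod C f = Dom C g \<Longrightarrow> Comp C g f \<in> D"
    using * D unfolding comp_closed_def composable_def by blast
  show "X \<in> Obj C \<Longrightarrow> Id C X \<in> D" using * unfolding comp_closed_def by blast
  show "\<exists>t. terminal C t \<and> (\<forall>f \<in> Arr C. Cod C f = t \<longrightarrow> f \<in> display_composites C D)"
    using assms by (auto simp: clan_def rooted_dmc_def)
qed

text \<open>An isomorphism is isomorphic, in the arrow category, to the identity of its target, and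
  the class of display maps is replete.\<close>

lemma clan_iso:
  assumes D: "clan (C, D)" and f: "is_iso C f"
  shows "f \<in> D"
proof -
  note C = clanD(1)[OF D]
  have fA: "f \<in> Arr C" using f by (simp add: is_iso_def)
  show ?thesis
    by (rule clanD(3)[OF D clanD(6)[OF D cat_cod[OF C fA]] fA iso_isomorphic_id[OF C f]])
qed

text \<open>Rootedness speaks of composites of display maps and isomorphisms; closure under
  composition collapses these to display maps.\<close>

lemma clan_terminal:
  assumes D: "clan (C, D)"
  shows "\<exists>t. terminal C t \<and> (\<forall>f \<in> Arr C. Cod C f = t \<longrightarrow> f \<in> D)"
proof -
  have "f \<in> D" if "f \<in> display_composites C D" for f
    using that by induction (auto intro: clan_iso[OF D] clanD(5)[OF D] simp: composable_def)
  then show ?thesis using clanD(7)[OF D] by blast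
qed

text \<open>The axiom provides one pullback that is a display map. Any other is its composite with
  an isomorphism, which is itself a display map.\<close>

lemma clan_pullback:
  assumes D: "clan (C, D)" and d: "d \<in> D" and P: "is_pullback C d f q d'"
  shows "d' \<in> D"
proof -
  note C = clanD(1)[OF D]
  obtain q0 d0 where P0: "d0 \<in> D" "is_pullback C d f q0 d0"
    using clanD(4)[OF D d, of f] pullback_facts[OF C P] by auto
  obtain u where u: "is_iso C u" "Dom C u = Dom C q" "Cod C u = Dom C q0" "Comp C q0 u = q"
    "Comp C d0 u = d'" by (rule pullback_iso[OF C P0(2) P])
  show ?thesis
    using clanD(5)[OF D P0(1) clan_iso[OF D u(1)]] u pb_dom(3)[OF C P0(2)] by simp
qed

text \<open>
  An object is separated when its diagonal is a display map; this formulation by equalizers does not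
  mention products.
\<close>

definition separated :: "('o, 'm) cat \<Rightarrow> 'm set \<Rightarrow> 'o set" where
  "separated C D = {X \<in> Obj C. \<forall>f \<in> Arr C. \<forall>g \<in> Arr C.
     Dom C f = Dom C g \<and> Cod C f = X \<and> Cod C g = X \<longrightarrow> (\<exists>e \<in> D. is_equalizer C f g e)}"

lemma separatedD:
  "Cod C f \<in> separated C D \<Longrightarrow> f \<in> Arr C \<Longrightarrow> g \<in> Arr C \<Longrightarrow> Dom C f = Dom C g \<Longrightarrow> Cod C f = Cod C g \<Longrightarrow>
    \<exists>e \<in> D. is_equalizer C f g e"
  unfolding separated_def by auto

text \<open>
  The graph of \<open>f\<close> is an equalizer of maps into a separated object, hence a display map, and \<open>f\<close> is
  its composite with a product projection.
\<close>

lemma separated_display: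
  assumes D: "clan (C, D)" and f: "f \<in> Arr C" and X: "Cod C f \<in> separated C D"
  shows "f \<in> D"
proof -
  note C = clanD(1)[OF D]
  note [simp] = cat_simps[OF C] f
  obtain t where t: "terminal C t" and td: "\<And>f. f \<in> Arr C \<Longrightarrow> Cod C f = t \<Longrightarrow> f \<in> D"
    using clan_terminal[OF D] by blast
  obtain a where a: "a \<in> Arr C" "Dom C a = Dom C f" "Cod C a = t"
    using terminalD(2)[OF t cat_dom[OF C f]] by blast
  obtain b where b: "b \<in> Arr C" "Dom C b = Cod C f" "Cod C b = t"
    using terminalD(2)[OF t cat_cod[OF C f]] by blast
  \<comment> \<open>The product of the target and the source of \<open>f\<close>, as a pullback over
    the terminal object: \<open>p\<close> projects to the target, \<open>p'\<close> to the source.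
    It exists because maps to the terminal object are display maps.\<close>
  obtain p p' where P: "is_pullback C b a p p'"
    using clanD(4)[OF D td[OF b(1,3)] a(1)] a(3) b(3) by auto
  note [simp] = pullback_facts(1-7)[OF C P] a(2) b(2)
  have p': "p' \<in> D" by (rule clan_pullback[OF D td[OF b(1,3)] P])
  have p: "p \<in> D" by (rule clan_pullback[OF D td[OF a(1,3)] pullback_sym[OF C P]])
  have "Comp C b f = Comp C a (Id C (Dom C f))"
    by (rule terminal_eq[OF C t]) (use a b in simp_all)
  then have "\<exists>m. m \<in> Arr C \<and> Dom C m = Dom C f \<and> Cod C m = Dom C p \<and> Comp C p m = f \<and>
      Comp C p' m = Id C (Dom C f)"
    by (intro pullback_lift[OF P]) simp_all
  \<comment> \<open>The graph of \<open>f\<close>.\<close>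
  then obtain m where m: "m \<in> Arr C" "Dom C m = Dom C f" "Cod C m = Dom C p" "Comp C p m = f"
    "Comp C p' m = Id C (Dom C f)" by blast
  have "Cod C (Comp C f p') \<in> separated C D" using X by simp
  \<comment> \<open>The part of the product where \<open>p\<close> and \<open>f p'\<close> agree.
    Separatedness makes its inclusion a display map; the graph \<open>m\<close> is then shown to be
    this inclusion up to the isomorphism \<open>h\<close>.\<close>
  then obtain e where e: "e \<in> D" "is_equalizer C (Comp C f p') p e"
    using separatedD[of C "Comp C f p'" D p] by auto
  note [simp] = equalizerD(3)[OF e(2)]
  have e_cod [simp]: "Cod C e = Dom C p'" using equalizerD(6)[OF e(2)] by simp
  have "Comp C (Comp C f p') m = Comp C p m" using m by simp
  then obtain h where h: "h \<in> Arr C" "Dom C h = Dom C f" "Cod C h = Dom C e" "Comp C e h = m"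
    using equalizer_lift[OF e(2) m(1)] m(2,3) by auto
  \<comment> \<open>The candidate inverse of \<open>h\<close>: a point of the equalizer is
    determined by its component in the source of \<open>f\<close>.\<close>
  let ?k = "Comp C p' e"
  have fk: "Comp C f ?k = Comp C p e" using equalizerD(7)[OF e(2)] by simp
  have "Comp C m ?k = e"
  proof (rule pullback_unique[OF C P])
    have "Comp C p (Comp C m ?k) = Comp C (Comp C p m) ?k"
      by (rule cat_assoc[OF C, symmetric]) (use m in simp_all)
    then show "Comp C p (Comp C m ?k) = Comp C p e" using fk by (simp add: m(4))
    have "Comp C p' (Comp C m ?k) = Comp C (Comp C p' m) ?k"
      by (rule cat_assoc[OF C, symmetric]) (use m in simp_all)
    then show "Comp C p' (Comp C m ?k) = Comp C p' e" by (simp add: m(5))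
  qed (use m in simp_all)
  then have "Comp C e (Comp C h ?k) = e"
    using cat_assoc[OF C, of e h ?k] h by simp
  then have hk: "Comp C h ?k = Id C (Dom C e)"
    by (intro equalizer_mono[OF C e(2), of "Comp C h ?k" "Id C (Dom C e)"]) (use h in simp_all)
  have "Comp C ?k h = Comp C p' m"
    using cat_assoc[OF C, of p' e h] h by simp
  then have "is_iso C h"
    using h hk m(5) by (intro is_isoI[of _ _ ?k]) simp_all
  then have "Comp C e h \<in> D" by (intro clanD(5)[OF D e(1) clan_iso[OF D]]) (use h in simp_all)
  then have "Comp C p m \<in> D" using clanD(5)[OF D p] m(3) h(4) by simp
  then show ?thesis using m(4) by simp
qed

text \<open>Two maps into a pullback agree exactly where both their components agree. Equalizing
  first the \<open>q\<close>-components and then, on the result, the \<open>d'\<close>-components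
  gives the equalizer as a composite of two display maps.\<close>

lemma separated_pullback:
  assumes D: "clan (C, D)" and P: "is_pullback C d f q d'"
    and X: "Dom C d \<in> separated C D" and Y: "Dom C f \<in> separated C D"
  shows "Dom C q \<in> separated C D"
proof -
  note C = clanD(1)[OF D]
  note [simp] = cat_simps[OF C] pullback_facts(1-6)[OF C P] pb_dom(3)[OF C P, symmetric]
  have "\<exists>e \<in> D. is_equalizer C r s e"
    if r [simp]: "r \<in> Arr C" "s \<in> Arr C" "Dom C r = Dom C s" "Cod C r = Dom C q" "Cod C s = Dom C q" for r s
  proof -
    obtain e1 where e1: "e1 \<in> D" "is_equalizer C (Comp C q r) (Comp C q s) e1"
      using separatedD[of C "Comp C q r" D "Comp C q s"] X by auto
    note E1 = equalizerD[OF e1(2)]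
    have [simp]: "e1 \<in> Arr C" "Cod C e1 = Dom C s" using E1(3,6) by simp_all
    obtain e2 where e2: "e2 \<in> D"
      "is_equalizer C (Comp C d' (Comp C r e1)) (Comp C d' (Comp C s e1)) e2"
      using separatedD[of C "Comp C d' (Comp C r e1)" D "Comp C d' (Comp C s e1)"] Y by auto
    note E2 = equalizerD[OF e2(2)]
    have [simp]: "e2 \<in> Arr C" "Cod C e2 = Dom C e1" using E2(3,6) by simp_all
    have q1: "Comp C q (Comp C r (Comp C e1 h)) = Comp C q (Comp C s (Comp C e1 h))"
      if "h \<in> Arr C" "Cod C h = Dom C e1" for h
      using cat_comp_cong[OF C E1(7), of h] that by simp
    have "is_equalizer C r s (Comp C e1 e2)"
    proof (rule is_equalizerI)
      have "Comp C d' (Comp C r (Comp C e1 e2)) = Comp C d' (Comp C s (Comp C e1 e2))"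
        using E2(7) by simp
      then show "Comp C r (Comp C e1 e2) = Comp C s (Comp C e1 e2)"
        using q1[of e2] by (intro pullback_unique[OF C P, of "Comp C r (Comp C e1 e2)"
              "Comp C s (Comp C e1 e2)"]) simp_all
      fix a assume a: "a \<in> Arr C" "Cod C a = Dom C s" "Comp C r a = Comp C s a"
      have "Comp C (Comp C q r) a = Comp C (Comp C q s) a" using a by simp
      then obtain h where h: "h \<in> Arr C" "Dom C h = Dom C a" "Cod C h = Dom C e1" "Comp C e1 h = a"
        using equalizer_lift[OF e1(2) a(1)] a(2) by auto
      have "Comp C (Comp C d' (Comp C r e1)) h = Comp C (Comp C d' (Comp C s e1)) h"
        using h a by simp
      then obtain k where k: "k \<in> Arr C" "Dom C k = Dom C a" "Cod C k = Dom C e2" "Comp C e2 k = h"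
        using equalizer_lift[OF e2(2) h(1)] h(2,3) by auto
      show "\<exists>h. h \<in> Arr C \<and> Dom C h = Dom C a \<and> Cod C h = Dom C (Comp C e1 e2) \<and>
          Comp C (Comp C e1 e2) h = a"
        using k h(4) by (intro exI[of _ k]) simp
    next
      fix h k assume hk: "h \<in> Arr C" "k \<in> Arr C" "Cod C h = Dom C (Comp C e1 e2)"
        "Cod C k = Dom C (Comp C e1 e2)" "Comp C (Comp C e1 e2) h = Comp C (Comp C e1 e2) k"
      then have hk': "Cod C h = Dom C e2" "Cod C k = Dom C e2"
        and 1: "Comp C e1 (Comp C e2 h) = Comp C e1 (Comp C e2 k)" by simp_all
      have "Comp C e2 h = Comp C e2 k"
        by (rule equalizer_mono[OF C e1(2) _ _ _ _ 1]) (use hk(1,2) hk' in simp_all)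
      then show "h = k" by (rule equalizer_mono[OF C e2(2) hk(1,2) hk'])
    qed simp_all
    moreover have "Comp C e1 e2 \<in> D" by (rule clanD(5)[OF D e1(1) e2(1)]) simp
    ultimately show ?thesis by blast
  qed
  then show ?thesis unfolding separated_def by auto
qed

text \<open>Parallel maps into a terminal object are equal, so an identity, which is a display map,
  is their equalizer.\<close>

lemma separated_terminal:
  assumes D: "clan (C, D)" and t: "terminal C t"
  shows "t \<in> separated C D"
proof -
  note C = clanD(1)[OF D]
  note [simp] = cat_simps[OF C]
  have "\<exists>e \<in> D. is_equalizer C f g e"
    if "f \<in> Arr C" "g \<in> Arr C" "Dom C f = Dom C g" "Cod C f = t" "Cod C g = t" for f g
  proof -
    have "f = g" by (rule terminal_eq[OF C t that(1,2,3,4,5)])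
    then have "is_equalizer C f g (Id C (Dom C g))"
      using that by (intro is_equalizerI) auto
    moreover have "Id C (Dom C g) \<in> D" using clanD(6)[OF D] that(2) by simp
    ultimately show ?thesis by blast
  qed
  then show ?thesis using terminalD(1)[OF t] unfolding separated_def by auto
qed

text \<open>Composition with \<open>u\<close> is cancellable, so the pairs \<open>f\<close>,
  \<open>g\<close> and \<open>u f\<close>, \<open>u g\<close> have the same equalizers.\<close>

lemma separated_iso:
  assumes D: "clan (C, D)" and u: "is_iso C u" and X: "Cod C u \<in> separated C D"
  shows "Dom C u \<in> separated C D"
proof -
  note C = clanD(1)[OF D]
  have uA [simp]: "u \<in> Arr C" using u by (simp add: is_iso_def)
  note [simp] = cat_simps[OF C]
  have "\<exists>e \<in> D. is_equalizer C f g e"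
    if fg [simp]: "f \<in> Arr C" "g \<in> Arr C" "Dom C f = Dom C g" "Cod C f = Dom C u" "Cod C g = Dom C u" for f g
  proof -
    obtain e where e: "e \<in> D" "is_equalizer C (Comp C u f) (Comp C u g) e"
      using separatedD[of C "Comp C u f" D "Comp C u g"] X by auto
    note E = equalizerD[OF e(2)]
    have [simp]: "e \<in> Arr C" "Cod C e = Dom C g" using E(3,6) by simp_all
    have "Comp C u (Comp C f e) = Comp C u (Comp C g e)" using E(7) by simp
    then have 1: "Comp C f e = Comp C g e"
      using iso_cancel[OF C u, of "Comp C f e" "Comp C g e"] by simp
    have "is_equalizer C f g e"
    proof (rule is_equalizerI)
      fix a assume a: "a \<in> Arr C" "Cod C a = Dom C g" "Comp C f a = Comp C g a"
      have "Comp C (Comp C u f) a = Comp C (Comp C u g) a" using a by simp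
      then show "\<exists>h. h \<in> Arr C \<and> Dom C h = Dom C a \<and> Cod C h = Dom C e \<and> Comp C e h = a"
        using equalizer_lift[OF e(2) a(1)] a(2) by simp
    next
      fix h k assume "h \<in> Arr C" "k \<in> Arr C" "Cod C h = Dom C e" "Cod C k = Dom C e"
        "Comp C e h = Comp C e k"
      then show "h = k" by (rule equalizer_mono[OF C e(2)])
    qed (simp_all add: 1)
    then show ?thesis using e(1) by blast
  qed
  then show ?thesis using cat_dom[OF C uA] unfolding separated_def by auto
qed

text \<open>A clan provides pullbacks of display maps only. They suffice because every map between
  separated objects is a display map.\<close>

lemma lex_full_separated:
  assumes D: "clan (C, D)"
  shows "lex_full C (separated C D)"
  unfolding lex_full_def
proof (intro conjI allI impI)
  note C = clanD(1)[OF D]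
  show "category C" by (rule C)
  show "separated C D \<subseteq> Obj C" by (auto simp: separated_def)
  obtain t where "terminal C t" using clan_terminal[OF D] by blast
  then show "\<exists>t\<in>separated C D. terminal C t" using separated_terminal[OF D] by blast
  show "Dom C u \<in> separated C D" if "is_iso C u \<and> Cod C u \<in> separated C D" for u
    using that separated_iso[OF D] by blast
  fix d f assume df: "d \<in> Arr (full_subcat C (separated C D)) \<and> f \<in> Arr (full_subcat C (separated C D)) \<and>
    Cod C d = Cod C f"
  then have *: "d \<in> Arr C" "Cod C d \<in> separated C D" "f \<in> Arr C" "Dom C d \<in> separated C D"
    "Dom C f \<in> separated C D" "Cod C f = Cod C d"
    by (auto simp: full_subcat_simps)
  obtain q d' where P: "is_pullback C d f q d'"
    using clanD(4)[OF D separated_display[OF D *(1,2)] *(3,6)] by blast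
  then show "\<exists>q d'. is_pullback C d f q d' \<and> Dom C q \<in> separated C D"
    using separated_pullback[OF D P *(4,5)] by blast
qed

text \<open>
  The diagonal of \<open>F X\<close> is the image of that of \<open>X\<close>, hence a display map, and every equalizer of maps
  into \<open>F X\<close> is a pullback of it.
\<close>

lemma clan_map_separated:
  assumes B: "category B" "has_finite_limits B" and D: "clan (C, D)"
    and F: "clan_map (B, Arr B) (C, D) F" and X: "X \<in> Obj B"
  shows "fob F X \<in> separated C D"
proof -
  note C = clanD(1)[OF D]
  have fF: "is_functor B C F" and F_D: "\<And>d. d \<in> Arr B \<Longrightarrow> farr F d \<in> D"
    and F_t: "\<And>t. terminal B t \<Longrightarrow> terminal C (fob F t)"
    and F_pb: "\<And>d f q d'. d \<in> Arr B \<Longrightarrow> is_pullback B d f q d' \<Longrightarrow>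
      is_pullback C (farr F d) (farr F f) (farr F q) (farr F d')"
    using F unfolding clan_map_def by auto
  note [simp] = cat_simps[OF B(1)] cat_simps[OF C] ftor_simps[OF fF] X
  obtain t where t: "terminal B t" and pb: "has_pullbacks B"
    using B has_finite_limits_iff by blast
  obtain a where a: "a \<in> Arr B" "Dom B a = X" "Cod B a = t" using terminalD(2)[OF t X] by blast
  obtain p p' where P: "is_pullback B a a p p'" using has_pullbacksD[OF pb a(1) a(1) refl] by blast
  note [simp] = pullback_facts(1-7)[OF B(1) P] a
  have "\<exists>h. h \<in> Arr B \<and> Dom B h = Dom B (Id B X) \<and> Cod B h = Dom B p \<and> Comp B p h = Id B X \<and>
      Comp B p' h = Id B X"
    by (rule pullback_lift[OF P]) simp_all
  then obtain \<Delta> where \<Delta>: "\<Delta> \<in> Arr B" "Dom B \<Delta> = Dom B (Id B X)" "Cod B \<Delta> = Dom B p"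
    "Comp B p \<Delta> = Id B X" "Comp B p' \<Delta> = Id B X" by blast
  have \<Delta>_dom: "Dom B \<Delta> = X" using \<Delta>(2) by simp
  \<comment> \<open>No product of \<open>fob F X\<close> with itself is assumed in \<open>C\<close>;
    the image of the product in \<open>B\<close> serves as one, because the projection
    \<open>a\<close> to the terminal object is a display map of the source clan.\<close>
  have FP: "is_pullback C (farr F a) (farr F a) (farr F p) (farr F p')" by (rule F_pb[OF a(1) P])
  have F\<Delta>: "Comp C (farr F p) (farr F \<Delta>) = Id C (fob F X)"
    "Comp C (farr F p') (farr F \<Delta>) = Id C (fob F X)"
    using arg_cong[OF \<Delta>(4), of "farr F"] arg_cong[OF \<Delta>(5), of "farr F"] \<Delta>(1,3) by simp_all
  have "\<exists>e \<in> D. is_equalizer C f g e"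
    if fg: "f \<in> Arr C" "g \<in> Arr C" "Dom C f = Dom C g" "Cod C f = fob F X" "Cod C g = fob F X" for f g
  proof -
    have "Comp C (farr F a) f = Comp C (farr F a) g"
      by (rule terminal_eq[OF C F_t[OF t]]) (use fg in simp_all)
    \<comment> \<open>The pairing of \<open>f\<close> and \<open>g\<close> into the image of the
      product.\<close>
    then have "\<exists>h. h \<in> Arr C \<and> Dom C h = Dom C f \<and> Cod C h = Dom C (farr F p) \<and>
        Comp C (farr F p) h = f \<and> Comp C (farr F p') h = g"
      by (intro pullback_lift[OF FP]) (use fg in simp_all)
    then obtain m where m: "m \<in> Arr C" "Cod C m = Dom C (farr F p)"
      "Comp C (farr F p) m = f" "Comp C (farr F p') m = g" by blast
    have "Cod C m = Cod C (farr F \<Delta>)" using m(2) \<Delta>(1,3) by simp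
    \<comment> \<open>The image of the diagonal is a display map, so it has a pullback along the
      pairing, and that pullback can be taken to be a display map.\<close>
    then obtain x e where e: "e \<in> D" "is_pullback C (farr F \<Delta>) m x e"
      using clanD(4)[OF D F_D[OF \<Delta>(1)] m(1)] by blast
    have "is_equalizer C f g e"
      by (rule equalizer_from_pullback[OF C FP e(2) _ F\<Delta> _ m(3,4)])
        (use \<Delta>(1,3) \<Delta>_dom in simp_all)
    then show ?thesis using e(1) by blast
  qed
  then show ?thesis unfolding separated_def by auto
qed

section \<open>Clan maps out of finite-limit categories\<close>

lemma clan_Arr_iff: "clan (C, Arr C) \<longleftrightarrow> category C \<and> has_finite_limits C"
proof
  assume D: "clan (C, Arr C)"
  note C = clanD(1)[OF D]
  obtain t where "terminal C t" using clan_terminal[OF D] by blast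
  moreover have "has_pullbacks C"
    unfolding has_pullbacks_def
  proof (intro ballI impI)
    fix d f assume "d \<in> Arr C" "f \<in> Arr C" "Cod C d = Cod C f"
    then show "\<exists>q d'. is_pullback C d f q d'" using clanD(4)[OF D, of d f] by auto
  qed
  ultimately show "category C \<and> has_finite_limits C" using C has_finite_limits_iff[OF C] by blast
next
  assume *: "category C \<and> has_finite_limits C"
  then have C: "category C" and pb: "has_pullbacks C" and t: "\<exists>t. terminal C t"
    using has_finite_limits_iff by blast+
  have "\<exists>q. \<exists>d' \<in> Arr C. is_pullback C d f q d'" if "d \<in> Arr C" "f \<in> Arr C" "Cod C f = Cod C d" for d f
    using has_pullbacksD[OF pb that(1,2) that(3)[symmetric]] pb_arr(4)[OF C] by blast
  then have "display_map_category C (Arr C)"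
    using C by (auto simp: display_map_category_def replete_in_def arrow_cat_simps)
  then have "rooted_dmc C (Arr C)"
    unfolding rooted_dmc_def using t display_composites.display[of _ "Arr C" C] by blast
  moreover have "comp_closed C (Arr C)"
    by (auto simp: comp_closed_def composable_def cat_simps[OF C])
  ultimately show "clan (C, Arr C)" by (simp add: clan_def)
qed

lemma clan_map_Arr_iff:
  assumes "category B" "has_finite_limits B" "category C"
  shows "clan_map (B, Arr B) (C, Arr C) F \<longleftrightarrow> is_functor B C F \<and> preserves_finite_limits B C F"
proof (cases "is_functor B C F")
  case True
  have "clan_map (B, Arr B) (C, Arr C) F \<longleftrightarrow> preserves_pullbacks B C F \<and> preserves_terminal B C F"
    using True pb_arr(1)[OF assms(1)]
    unfolding clan_map_def preserves_pullbacks_def preserves_terminal_def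
    by (auto simp: ftor_simps[OF True])
  then show ?thesis using True preserves_finite_limits_iff[OF assms(1,3) True assms(2)] by blast
qed (simp add: clan_map_def)

text \<open>The bijection on 1-cells behind the adjunction. From left to right,
  \<open>clan_map_separated\<close> puts the values into the subcategory; from right to left,
  \<open>separated_display\<close> turns all images of maps into display maps. Pullbacks and
  terminal objects are the same on both sides by \<open>lex_full_pullback\<close> and
  \<open>lex_full_terminal\<close>.\<close>

lemma clan_map_separated_iff:
  assumes B: "category B" "has_finite_limits B" and D: "clan (C, D)"
  shows "clan_map (B, Arr B) (C, D) F \<longleftrightarrow>
    is_functor B (full_subcat C (separated C D)) F \<and>
    preserves_finite_limits B (full_subcat C (separated C D)) F"
proof -
  let ?S = "separated C D"
  let ?E = "full_subcat C ?S"
  note S = lex_full_separated[OF D]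
  note C = clanD(1)[OF D] and SO = lex_fullD(2)[OF S]
  note cE = category_full_subcat[OF C SO]
  note ff = full_subcat_functor_iff[OF C SO B(1)]
  have arr: "farr F f \<in> Arr ?E" if "is_functor B ?E F" "f \<in> Arr B" for f
    using ftor_arr[OF that] .
  let ?pb = "\<forall>d f q d'. is_pullback B d f q d' \<longrightarrow>
      is_pullback C (farr F d) (farr F f) (farr F q) (farr F d')"
  let ?t = "\<forall>t. terminal B t \<longrightarrow> terminal C (fob F t)"
  have lim: "preserves_finite_limits B ?E F \<longleftrightarrow> ?pb \<and> ?t" if F: "is_functor B ?E F"
  proof -
    have "is_pullback ?E (farr F d) (farr F f) (farr F q) (farr F d') \<longleftrightarrow>
        is_pullback C (farr F d) (farr F f) (farr F q) (farr F d')" if "is_pullback B d f q d'" for d f q d'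
      by (rule lex_full_pullback[OF S arr[OF F] arr[OF F]]) (rule pb_arr[OF B(1) that])+
    then show ?thesis
      unfolding preserves_finite_limits_iff[OF B(1) cE F B(2)] preserves_pullbacks_def
        preserves_terminal_def lex_full_terminal[OF S] by simp
  qed
  have "(\<forall>d \<in> Arr B. \<forall>f q d'. is_pullback B d f q d' \<longrightarrow>
      is_pullback C (farr F d) (farr F f) (farr F q) (farr F d')) \<longleftrightarrow> ?pb"
    using pb_arr(1)[OF B(1)] by meson
  then have cm: "clan_map (B, Arr B) (C, D) F \<longleftrightarrow>
      is_functor B C F \<and> (\<forall>d \<in> Arr B. farr F d \<in> D) \<and> ?pb \<and> ?t"
    by (simp add: clan_map_def)
  show ?thesis
  proof
    assume F: "clan_map (B, Arr B) (C, D) F"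
    have "\<forall>X \<in> Obj B. fob F X \<in> ?S" using clan_map_separated[OF B D F] by simp
    with F have fE: "is_functor B ?E F" by (simp add: ff cm)
    have "?pb \<and> ?t" using F[unfolded cm] by (elim conjE) (rule conjI)
    then show "is_functor B ?E F \<and> preserves_finite_limits B ?E F"
      by (rule conjI[OF fE iffD2[OF lim[OF fE]]])
  next
    assume F: "is_functor B ?E F \<and> preserves_finite_limits B ?E F"
    have "\<forall>d \<in> Arr B. farr F d \<in> D"
      using separated_display[OF D] arr[OF conjunct1[OF F]] by (simp add: full_subcat_simps)
    moreover have "is_functor B C F" using F ff by simp
    moreover have "?pb \<and> ?t" by (rule iffD1[OF lim[OF conjunct1[OF F]] conjunct2[OF F]])
    ultimately show "clan_map (B, Arr B) (C, D) F" unfolding cm by (intro conjI; elim conjE)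
  qed
qed

lemma clan_map_id: "clan (C, D) \<Longrightarrow> clan_map (C, D) (C, D) (id_functor C)"
  using clanD(1,2)[of C D]
  by (auto simp: clan_map_def id_functor pullback_facts(1-4) subset_iff terminalD(1))

lemma clan_map_comp:
  assumes C: "clan (C, D)" and F: "clan_map (C, D) (C', D') F" and G: "clan_map (C', D') (C'', D'') G"
  shows "clan_map (C, D) (C'', D'') (fcomp C G F)"
proof -
  note c = clanD(1)[OF C]
  have F': "is_functor C C' F" "\<And>d. d \<in> D \<Longrightarrow> farr F d \<in> D'"
    "\<And>d f q d'. d \<in> D \<Longrightarrow> is_pullback C d f q d' \<Longrightarrow>
      is_pullback C' (farr F d) (farr F f) (farr F q) (farr F d')"
    "\<And>t. terminal C t \<Longrightarrow> terminal C' (fob F t)"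
    using F unfolding clan_map_def by auto
  have G': "is_functor C' C'' G" "\<And>d. d \<in> D' \<Longrightarrow> farr G d \<in> D''"
    "\<And>d f q d'. d \<in> D' \<Longrightarrow> is_pullback C' d f q d' \<Longrightarrow>
      is_pullback C'' (farr G d) (farr G f) (farr G q) (farr G d')"
    "\<And>t. terminal C' t \<Longrightarrow> terminal C'' (fob G t)"
    using G unfolding clan_map_def by auto
  have "is_pullback C'' (farr (fcomp C G F) d) (farr (fcomp C G F) f) (farr (fcomp C G F) q)
      (farr (fcomp C G F) d')" if "d \<in> D" "is_pullback C d f q d'" for d f q d'
    using G'(3)[OF F'(2)[OF that(1)] F'(3)[OF that]] pb_arr[OF c that(2)] by simp
  moreover have "farr (fcomp C G F) d \<in> D''" if "d \<in> D" for d
    using G'(2)[OF F'(2)[OF that]] clanD(2)[OF C] that by auto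
  moreover have "terminal C'' (fob (fcomp C G F) t)" if "terminal C t" for t
    using G'(4)[OF F'(4)[OF that]] terminalD(1)[OF that] by simp
  ultimately show ?thesis
    unfolding clan_map_def using fcomp_functor[OF c F'(1) G'(1)] by auto
qed

section \<open>The two 2-categories and their adjunction\<close>

lemma two_category_Clan: "two_category (Clan :: ('o, 'm) clan_2cat)"
  unfolding Clan_def
proof (rule two_category_cat_two_cat)
  fix X Y Z :: "('o, 'm) cat \<times> 'm set" and F G
  obtain C D where X [simp]: "X = (C, D)" by (cases X)
  obtain C' D' where Y [simp]: "Y = (C', D')" by (cases Y)
  obtain C'' D'' where Z [simp]: "Z = (C'', D'')" by (cases Z)
  assume x: "X \<in> {X. clan X}"
  then show "category (fst X)" using clanD(1)[of C D] by simp
  show "id_functor (fst X) \<in> {F. clan_map X X F}" using x clan_map_id[of C D] by simp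
  show "is_functor (fst X) (fst Y) F" if "F \<in> {F. clan_map X Y F}"
    using that by (simp add: clan_map_def)
  show "fcomp (fst X) G F \<in> {F. clan_map X Z F}" if "G \<in> {F. clan_map Y Z F}" "F \<in> {F. clan_map X Y F}"
    using that clan_map_comp[of C D C' D' F C'' D'' G] x by simp
qed

text \<open>Finite-limit functors are the clan maps between the clans in which all maps are display
  maps, so identities and composites are inherited from clans.\<close>

lemma two_category_Lex: "two_category (Lex :: ('o, 'm) lex_2cat)"
  unfolding Lex_def
proof (rule two_category_cat_two_cat)
  fix X Y Z :: "('o, 'm) cat" and F G
  assume X: "X \<in> {C. category C \<and> has_finite_limits C}"
  then show "category X" by simp
  from X have cX: "clan (X, Arr X)" by (simp add: clan_Arr_iff)
  show "id_functor X \<in> {F. is_functor X X F \<and> preserves_finite_limits X X F}"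
    using clan_map_id[OF cX] X by (simp add: clan_map_Arr_iff)
  assume Y: "Y \<in> {C. category C \<and> has_finite_limits C}"
  show "is_functor X Y F" if "F \<in> {F. is_functor X Y F \<and> preserves_finite_limits X Y F}"
    using that by simp
  assume Z: "Z \<in> {C. category C \<and> has_finite_limits C}"
  show "fcomp X G F \<in> {F. is_functor X Z F \<and> preserves_finite_limits X Z F}"
    if "G \<in> {F. is_functor Y Z F \<and> preserves_finite_limits Y Z F}"
      "F \<in> {F. is_functor X Y F \<and> preserves_finite_limits X Y F}"
    using that clan_map_comp[OF cX, of Y "Arr Y" F Z "Arr Z" G] X Y Z by (simp add: clan_map_Arr_iff)
qed

text \<open>Natural transformations, identities and vertical composites agree by
  \<open>full_subcat_nat_trans\<close>; outside their domains the operations of both records are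
  \<open>undefined\<close>, so the records are equal.\<close>

lemma functor_cat_full_subcat:
  assumes C: "category C" and S: "S \<subseteq> Obj C" and B: "category B"
    and F: "\<And>F. F \<in> A \<Longrightarrow> is_functor B (full_subcat C S) F"
  shows "functor_cat B (full_subcat C S) A = functor_cat B C A"
proof -
  note fs = full_subcat_nat_trans[OF C S B F F]
  have Arr: "{(F, G, \<alpha>). F \<in> A \<and> G \<in> A \<and> nat_trans B (full_subcat C S) F G \<alpha>} =
      {(F, G, \<alpha>). F \<in> A \<and> G \<in> A \<and> nat_trans B C F G \<alpha>}"
    using fs(1) by auto
  show ?thesis
    unfolding functor_cat_def Let_def Arr
  proof (intro cat.equality HOL.ext; simp only: cat.simps)
    fix F show "(\<lambda>F\<in>A. (F, F, id_nt B (full_subcat C S) F)) F = (\<lambda>F\<in>A. (F, F, id_nt B C F)) F"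
      using fs(2) by simp
  next
    fix g f :: "('c, 'd, 'a, 'b) nt"
    obtain F G \<alpha> where f: "f = (F, G, \<alpha>)" by (cases f)
    obtain G' H \<beta> where g: "g = (G', H, \<beta>)" by (cases g)
    have "vcomp_nt B (full_subcat C S) \<beta> \<alpha> = vcomp_nt B C \<beta> \<alpha>"
      if "F \<in> A" "G \<in> A" "H \<in> A" "nat_trans B C F G \<alpha>" "nat_trans B C G H \<beta>"
      by (rule fs(3)[OF that(1,2,4,5) F[OF that(3)]])
    then show "(\<lambda>(G', H, \<beta>) (F, G, \<alpha>).
        if (G', H, \<beta>) \<in> {(F, G, \<alpha>). F \<in> A \<and> G \<in> A \<and> nat_trans B C F G \<alpha>} \<and>
           (F, G, \<alpha>) \<in> {(F, G, \<alpha>). F \<in> A \<and> G \<in> A \<and> nat_trans B C F G \<alpha>} \<and> G = G'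
        then (F, H, vcomp_nt B (full_subcat C S) \<beta> \<alpha>) else undefined) g f =
      (\<lambda>(G', H, \<beta>) (F, G, \<alpha>).
        if (G', H, \<beta>) \<in> {(F, G, \<alpha>). F \<in> A \<and> G \<in> A \<and> nat_trans B C F G \<alpha>} \<and>
           (F, G, \<alpha>) \<in> {(F, G, \<alpha>). F \<in> A \<and> G \<in> A \<and> nat_trans B C F G \<alpha>} \<and> G = G'
        then (F, H, vcomp_nt B C \<beta> \<alpha>) else undefined) g f"
      by (auto simp: f g)
  qed
qed

lemma Lex_Clan_right_adjoint:
  "has_right_2_adjoint (Lex :: ('o, 'm) lex_2cat) (Clan :: ('o, 'm) clan_2cat) Lex_to_Clan"
proof (rule has_right_2_adjointI[OF two_category_Lex two_category_Clan])
  \<comment> \<open>The value of the right adjoint at a clan.\<close>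
  let ?E = "\<lambda>Y :: ('o, 'm) cat \<times> 'm set. full_subcat (fst Y) (separated (fst Y) (snd Y))"
  show "Lex_to_Clan = \<lparr> tob = \<lambda>C. (C, Arr C), thom = \<lambda>C D. id_functor (Hom Lex C D) \<rparr>"
    by (simp add: Lex_to_Clan_def)
  have obL: "X \<in> Ob Lex \<longleftrightarrow> category X \<and> has_finite_limits X" for X :: "('o, 'm) cat"
    by (simp add: Lex_def cat_two_cat_simps)
  have obC: "Y \<in> Ob Clan \<longleftrightarrow> clan Y" for Y :: "('o, 'm) cat \<times> 'm set"
    by (simp add: Clan_def cat_two_cat_simps)
  have homL: "Hom Lex X Y = functor_cat X Y {F. is_functor X Y F \<and> preserves_finite_limits X Y F}"
    for X Y :: "('o, 'm) cat" by (simp add: Lex_def cat_two_cat_simps)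
  have homC: "Hom Clan X Y = functor_cat (fst X) (fst Y) {F. clan_map X Y F}"
    for X Y :: "('o, 'm) cat \<times> 'm set" by (simp add: Clan_def cat_two_cat_simps)
  note hcL = Lex_def cat_two_cat_def[of "{C. category C \<and> has_finite_limits C}"]
  note hcC = Clan_def cat_two_cat_def[of "{X. clan X}"]
  show i: "(X, Arr X) \<in> Ob Clan" if "X \<in> Ob Lex" for X :: "('o, 'm) cat"
    using that by (simp add: obL obC clan_Arr_iff)
  show hom_i: "Hom Clan (X, Arr X) (X', Arr X') = Hom Lex X X'"
    if "X \<in> Ob Lex" "X' \<in> Ob Lex" for X X' :: "('o, 'm) cat"
    using that by (simp add: obL homL homC clan_map_Arr_iff)
  show "Unit Clan (X, Arr X) = Unit Lex X" for X :: "('o, 'm) cat"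
    by (simp add: Clan_def Lex_def cat_two_cat_simps)
  show "HComp Clan (X, Arr X) (X', Arr X') (X'', Arr X'') = HComp Lex X X' X''"
    if "X \<in> Ob Lex" "X' \<in> Ob Lex" "X'' \<in> Ob Lex" for X X' X'' :: "('o, 'm) cat"
    using hom_i[OF that(1,2)] hom_i[OF that(2,3)]
    by (simp add: homL homC) (simp add: hcL hcC Let_def)
  show "?E Y \<in> Ob Lex" if "Y \<in> Ob Clan" for Y :: "('o, 'm) cat \<times> 'm set"
  proof -
    have S: "lex_full (fst Y) (separated (fst Y) (snd Y))"
      using that lex_full_separated[of "fst Y" "snd Y"] by (simp add: obC)
    show ?thesis
      using category_full_subcat[OF lex_fullD(1,2)[OF S]] lex_full_has_finite_limits(1)[OF S]
      by (simp add: obL)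
  qed
  have sep: "category C" "separated C D \<subseteq> Obj C" if "(C, D) \<in> Ob Clan" for C :: "('o, 'm) cat" and D
    using that lex_fullD(1,2)[OF lex_full_separated[of C D]] by (simp_all add: obC)
  show hom_r: "Hom Clan (X, Arr X) Y = Hom Lex X (?E Y)"
    if X: "X \<in> Ob Lex" and Y: "Y \<in> Ob Clan" for X and Y :: "('o, 'm) cat \<times> 'm set"
  proof -
    obtain C D where [simp]: "Y = (C, D)" by (cases Y)
    let ?A = "{F. is_functor X (?E Y) F \<and> preserves_finite_limits X (?E Y) F}"
    have X': "category X" "has_finite_limits X" and D: "clan (C, D)"
      using X Y by (simp_all add: obL obC)
    have "{F. clan_map (X, Arr X) Y F} = ?A"
      using clan_map_separated_iff[OF X' D] by simp
    moreover have "functor_cat X (?E Y) ?A = functor_cat X C ?A"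
      using functor_cat_full_subcat[OF sep[of C D] X'(1), of ?A] Y by simp
    ultimately show ?thesis by (simp add: homL homC)
  qed
  show "HComp Clan (X, Arr X) (X', Arr X') Y = HComp Lex X X' (?E Y)"
    if X: "X \<in> Ob Lex" and X': "X' \<in> Ob Lex" and Y: "Y \<in> Ob Clan"
    for X X' and Y :: "('o, 'm) cat \<times> 'm set"
  proof -
    let ?P = "Arr (Hom Clan (X', Arr X') Y) \<times> Arr (Hom Clan (X, Arr X) (X', Arr X'))"
    let ?f = "\<lambda>Z. \<lambda>((G, G', \<beta>), (F, F', \<alpha>)) \<in> ?P.
      (fcomp X G F, fcomp X G' F', hcomp_nt X Z G F' \<beta> \<alpha>)"
    obtain C D where Y': "Y = (C, D)" by (cases Y)
    \<comment> \<open>The third category of a horizontal composite enters only through its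
      composition, and on the components that occur this is inherited by the full
      subcategory.\<close>
    have "?f C = ?f (?E Y)"
    proof (rule restrict_ext)
      fix p assume p: "p \<in> ?P"
      obtain G G' \<beta> F F' \<alpha> where p': "p = ((G, G', \<beta>), (F, F', \<alpha>))" by (cases p) auto
      have "(G, G', \<beta>) \<in> Arr (Hom Clan (X', Arr X') Y)" "(G, G', \<beta>) \<in> Arr (Hom Lex X' (?E Y))"
        "(F, F', \<alpha>) \<in> Arr (Hom Lex X X')"
        using p unfolding p' hom_r[OF X' Y] hom_i[OF X X'] by simp_all
      then have "is_functor X' (?E Y) G" "is_functor X' (?E Y) G'" "nat_trans X' C G G' \<beta>"
        "is_functor X X' F" "is_functor X X' F'" "nat_trans X X' F F' \<alpha>"
        unfolding homL homC functor_cat_simps by (simp_all add: Y')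
      then have "hcomp_nt X (?E Y) G F' \<beta> \<alpha> = hcomp_nt X C G F' \<beta> \<alpha>"
        using full_subcat_hcomp[OF sep[of C D], of X' X G G' F F' \<alpha> \<beta>] X X' Y
        by (simp add: Y' obL)
      then show "(case p of (x, y) \<Rightarrow> (case x of (G, G', \<beta>) \<Rightarrow> \<lambda>(F, F', \<alpha>).
          (fcomp X G F, fcomp X G' F', hcomp_nt X C G F' \<beta> \<alpha>)) y) =
        (case p of (x, y) \<Rightarrow> (case x of (G, G', \<beta>) \<Rightarrow> \<lambda>(F, F', \<alpha>).
          (fcomp X G F, fcomp X G' F', hcomp_nt X (?E Y) G F' \<beta> \<alpha>)) y)"
        by (simp add: p')
    qed
    moreover have "HComp Clan (X, Arr X) (X', Arr X') Y =
        \<lparr> fob = \<lambda>(G, F) \<in> Obj (Hom Clan (X', Arr X') Y) \<times> Obj (Hom Clan (X, Arr X) (X', Arr X')).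
            fcomp X G F, farr = ?f C \<rparr>"
      by (simp add: homC Y') (simp add: hcC Let_def)
    moreover have "HComp Lex X X' (?E Y) =
        \<lparr> fob = \<lambda>(G, F) \<in> Obj (Hom Clan (X', Arr X') Y) \<times> Obj (Hom Clan (X, Arr X) (X', Arr X')).
            fcomp X G F, farr = ?f (?E Y) \<rparr>"
      unfolding hom_r[OF X' Y] hom_i[OF X X']
      by (simp add: homL) (simp add: hcL Let_def)
    ultimately show ?thesis by simp
  qed
qed

section \<open>Rooted comprehension categories\<close>

lemma squares_full_subcat:
  "s \<in> squares (full_subcat C S) \<longleftrightarrow>
    s \<in> squares C \<and> sq_src s \<in> Arr (full_subcat C S) \<and> sq_tgt s \<in> Arr (full_subcat C S)"
  by (cases s) (auto simp: square_iff full_subcat_simps)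

lemma full_subcat_full_subcat:
  assumes "S' \<subseteq> S"
  shows "full_subcat (full_subcat C S) S' = full_subcat C S'"
  using assms by (intro cat.equality) (auto simp: full_subcat_def Let_def fun_eq_iff)

text \<open>An equality of records and not merely an isomorphism: restricting the structure maps
  changes nothing because they are already \<open>undefined\<close> off their domains.\<close>

lemma full_subcat_self:
  assumes C: "category C"
  shows "full_subcat C (Obj C) = C"
proof (rule cat.equality)
  have A: "{f \<in> Arr C. Dom C f \<in> Obj C \<and> Cod C f \<in> Obj C} = Arr C"
    by (auto simp: cat_simps[OF C])
  show "Obj (full_subcat C (Obj C)) = Obj C" "Arr (full_subcat C (Obj C)) = Arr C"
    by (simp_all add: full_subcat_def Let_def A)
  show "Dom (full_subcat C (Obj C)) = Dom C"
    using extensional_restrict[OF cat_dom_ext[OF C]] by (simp add: full_subcat_def Let_def A)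
  show "Cod (full_subcat C (Obj C)) = Cod C"
    using extensional_restrict[OF cat_cod_ext[OF C]] by (simp add: full_subcat_def Let_def A)
  show "Id (full_subcat C (Obj C)) = Id C"
    using extensional_restrict[OF cat_id_ext[OF C]] by (simp add: full_subcat_def Let_def A)
  show "Comp (full_subcat C (Obj C)) = Comp C"
    using cat_comp_undefined[OF C] by (auto simp: full_subcat_def Let_def A fun_eq_iff composable_def)
qed simp

text \<open>By fullness, all sides of a square between arrows of the subcategory lie in it. Equality
  of records is required because triviality and subcategoricality are themselves defined by
  equations between categories and functors.\<close>

lemma arrow_cat_full_subcat:
  assumes C: "category C"
  shows "arrow_cat (full_subcat C S) = full_subcat (arrow_cat C) (Arr (full_subcat C S))"
proof (rule cat.equality)
  let ?E = "full_subcat C S"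
  let ?A = "full_subcat (arrow_cat C) (Arr ?E)"
  note sq = squares_full_subcat[of _ C S]
  have E: "f \<in> Arr C" "Dom C f \<in> S" "Cod C f \<in> S" if "f \<in> Arr ?E" for f
    using that by (auto simp: full_subcat_simps)
  have A: "{s \<in> Arr (arrow_cat C). Dom (arrow_cat C) s \<in> Arr ?E \<and> Cod (arrow_cat C) s \<in> Arr ?E} =
      squares ?E"
    by (rule set_eqI) (auto simp: sq arrow_cat_simps)
  have eq: "?A = \<lparr> Obj = Arr ?E, Arr = squares ?E, Dom = restrict (Dom (arrow_cat C)) (squares ?E),
      Cod = restrict (Cod (arrow_cat C)) (squares ?E), Id = restrict (Id (arrow_cat C)) (Arr ?E),
      Comp = \<lambda>t s. if t \<in> squares ?E \<and> s \<in> squares ?E then Comp (arrow_cat C) t s else undefined \<rparr>"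
    unfolding full_subcat_def[of "arrow_cat C"] Let_def A ..
  have sqC: "s \<in> squares C" if "s \<in> squares ?E" for s using that by (simp add: sq)
  show "Obj (arrow_cat ?E) = Obj ?A" "Arr (arrow_cat ?E) = Arr ?A"
    unfolding eq by (simp_all add: arrow_cat_simps)
  have "restrict sq_src (squares ?E) = restrict (Dom (arrow_cat C)) (squares ?E)"
    by (rule restrict_ext) (simp add: arrow_cat_simps sqC)
  then show "Dom (arrow_cat ?E) = Dom ?A"
    unfolding eq arrow_cat_def[of ?E] by (simp only: cat.simps)
  have "restrict sq_tgt (squares ?E) = restrict (Cod (arrow_cat C)) (squares ?E)"
    by (rule restrict_ext) (simp add: arrow_cat_simps sqC)
  then show "Cod (arrow_cat ?E) = Cod ?A"
    unfolding eq arrow_cat_def[of ?E] by (simp only: cat.simps)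
  have "(\<lambda>f \<in> Arr ?E. Square f f (Id ?E (Dom ?E f)) (Id ?E (Cod ?E f))) =
      restrict (Id (arrow_cat C)) (Arr ?E)"
    by (rule restrict_ext) (simp add: arrow_cat_simps full_subcat_simps)
  then show "Id (arrow_cat ?E) = Id ?A"
    unfolding eq arrow_cat_def[of ?E] by (simp only: cat.simps)
  show "Comp (arrow_cat ?E) = Comp ?A"
  proof (intro HOL.ext)
    fix t s
    show "Comp (arrow_cat ?E) t s = Comp ?A t s"
    proof (cases "t \<in> squares ?E \<and> s \<in> squares ?E")
      case ts: True
      show ?thesis
      proof (cases "sq_tgt s = sq_src t")
        case True
        have "sq_top t \<in> Arr ?E" "sq_bot t \<in> Arr ?E" "sq_top s \<in> Arr ?E" "sq_bot s \<in> Arr ?E"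
          using ts by (auto simp: squares_def homs_def)
        then have "Comp ?E (sq_top t) (sq_top s) = Comp C (sq_top t) (sq_top s)"
          "Comp ?E (sq_bot t) (sq_bot s) = Comp C (sq_bot t) (sq_bot s)"
          using E by (simp_all add: full_subcat_simps(6))
        then have "Comp (arrow_cat ?E) t s = Comp (arrow_cat C) t s"
          using ts True sqC[of t] sqC[of s] by (simp add: arrow_cat_simps(6))
        moreover have "Comp ?A t s = Comp (arrow_cat C) t s"
          unfolding eq using ts by (simp only: cat.simps if_True simp_thms)
        ultimately show ?thesis by simp
      next
        case False
        then have "Comp (arrow_cat C) t s = undefined" "Comp (arrow_cat ?E) t s = undefined"
          by (simp_all add: arrow_cat_def)
        moreover have "Comp ?A t s = Comp (arrow_cat C) t s"
          unfolding eq using ts by (simp only: cat.simps if_True simp_thms)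
        ultimately show ?thesis by simp
      qed
    next
      case False
      then have "Comp (arrow_cat ?E) t s = undefined" by (auto simp: arrow_cat_def)
      moreover have "Comp ?A t s = undefined"
        unfolding eq using False by (simp only: cat.simps if_False simp_thms)
      ultimately show ?thesis by simp
    qed
  qed
qed simp

lemma arrow_functor_functor:
  assumes C: "category C" and D: "category D" and F: "is_functor C D F"
  shows "is_functor (arrow_cat C) (arrow_cat D) (arrow_functor C F)"
proof (rule is_functorI)
  note [simp] = arrow_cat_simps cat_simps[OF C] ftor_simps[OF F] map_square_squares[OF C F]
  show "farr (arrow_functor C F) s \<in> homs (arrow_cat D)
      (fob (arrow_functor C F) (Dom (arrow_cat C) s)) (fob (arrow_functor C F) (Cod (arrow_cat C) s))"
    if "s \<in> Arr (arrow_cat C)" for s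
  proof -
    have "s \<in> squares C" "sq_src s \<in> Arr C" "sq_tgt s \<in> Arr C"
      using that by (simp_all add: squares_def)
    then show ?thesis by (intro homsI) simp_all
  qed
  show "farr (arrow_functor C F) (Id (arrow_cat C) f) = Id (arrow_cat D) (fob (arrow_functor C F) f)"
    if "f \<in> Obj (arrow_cat C)" for f
    using that by (simp add: square_iff) (simp add: map_square_def)
  show "farr (arrow_functor C F) (Comp (arrow_cat C) t s) =
      Comp (arrow_cat D) (farr (arrow_functor C F) t) (farr (arrow_functor C F) s)"
    if "t \<in> Arr (arrow_cat C)" "s \<in> Arr (arrow_cat C)" "Cod (arrow_cat C) s = Dom (arrow_cat C) t" for t s
  proof -
    have st: "t \<in> squares C" "s \<in> squares C" "sq_tgt s = sq_src t" using that by simp_all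
    then have "Comp (arrow_cat C) t s \<in> squares C"
      using cat_comp[OF category_arrow_cat[OF C], of t s] by simp
    moreover have "sq_top t \<in> Arr C" "sq_top s \<in> Arr C" "sq_bot t \<in> Arr C" "sq_bot s \<in> Arr C"
      "Cod C (sq_top s) = Dom C (sq_top t)" "Cod C (sq_bot s) = Dom C (sq_bot t)"
      using st by (auto simp: squares_def homs_def)
    ultimately show ?thesis using st by simp (simp add: map_square_def)
  qed
qed (auto simp: arrow_functor_def arrow_cat_simps ftor_simps[OF F])

text \<open>With an identity as comprehension, every square of the total category is its own
  comprehension, and the condition that codomain after comprehension is the projection forces the
  projection to be the codomain functor.\<close>

lemma subcategorical_facts:
  assumes X: "comprehension_category X" and sub: "subcategorical X"
  shows sub_Obj: "Obj (total X) \<subseteq> Arr (base X)"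
    and sub_total: "total X = full_subcat (arrow_cat (base X)) (Obj (total X))"
    and sub_Arr: "s \<in> Arr (total X) \<longleftrightarrow>
      s \<in> squares (base X) \<and> sq_src s \<in> Obj (total X) \<and> sq_tgt s \<in> Obj (total X)"
    and sub_Dom: "s \<in> Arr (total X) \<Longrightarrow> Dom (total X) s = sq_src s"
    and sub_Cod: "s \<in> Arr (total X) \<Longrightarrow> Cod (total X) s = sq_tgt s"
    and sub_compr_ob: "A \<in> Obj (total X) \<Longrightarrow> fob (compr X) A = A"
    and sub_compr_arr: "s \<in> Arr (total X) \<Longrightarrow> farr (compr X) s = s"
    and sub_proj_ob: "A \<in> Obj (total X) \<Longrightarrow> fob (proj X) A = Cod (base X) A"
    and sub_proj_arr: "s \<in> Arr (total X) \<Longrightarrow> farr (proj X) s = sq_bot s"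
    and sub_ext_dom: "A \<in> Obj (total X) \<Longrightarrow> ext_dom X A = Dom (base X) A"
proof -
  show T: "Obj (total X) \<subseteq> Arr (base X)"
    and tot: "total X = full_subcat (arrow_cat (base X)) (Obj (total X))"
    using sub by (auto simp: subcategorical_def)
  have c: "compr X = id_functor (total X)" using sub by (simp add: subcategorical_def)
  show A: "s \<in> Arr (total X) \<longleftrightarrow>
      s \<in> squares (base X) \<and> sq_src s \<in> Obj (total X) \<and> sq_tgt s \<in> Obj (total X)" for s
    by (subst tot) (auto simp: full_subcat_simps arrow_cat_simps)
  show "Dom (total X) s = sq_src s" "Cod (total X) s = sq_tgt s" if "s \<in> Arr (total X)" for s
    using that[unfolded A] by (subst tot; simp add: full_subcat_simps arrow_cat_simps)+
  show ob: "A \<in> Obj (total X) \<Longrightarrow> fob (compr X) A = A" for A by (simp add: c)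
  show arr: "s \<in> Arr (total X) \<Longrightarrow> farr (compr X) s = s" for s by (simp add: c)
  show "A \<in> Obj (total X) \<Longrightarrow> fob (proj X) A = Cod (base X) A" for A
    using compr_cod[OF X, of A] ob by simp
  show "s \<in> Arr (total X) \<Longrightarrow> farr (proj X) s = sq_bot s" for s
    using compr_bot[OF X, of s] arr by simp
  show "A \<in> Obj (total X) \<Longrightarrow> ext_dom X A = Dom (base X) A" for A
    by (simp add: ext_dom_def ob)
qed

text \<open>For a codomain projection, a lift of \<open>h\<close> is a map into the upper left
  corner of \<open>s\<close> with prescribed composites, which is what a pullback provides. Fullness
  makes the resulting square a map of the total category.\<close>

lemma pullback_cartesian:
  assumes B: "category B" and T: "T \<subseteq> Arr B"
    and p: "\<And>f. f \<in> T \<Longrightarrow> fob p f = Cod B f"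
      "\<And>s. s \<in> Arr (full_subcat (arrow_cat B) T) \<Longrightarrow> farr p s = sq_bot s"
    and s: "s \<in> Arr (full_subcat (arrow_cat B) T)"
    and P: "is_pullback B (sq_tgt s) (sq_bot s) (sq_top s) (sq_src s)"
  shows "cartesian (full_subcat (arrow_cat B) T) B p s"
proof -
  let ?T = "full_subcat (arrow_cat B) T"
  have A: "r \<in> Arr ?T \<longleftrightarrow> r \<in> squares B \<and> sq_src r \<in> T \<and> sq_tgt r \<in> T" for r
    by (auto simp: full_subcat_simps arrow_cat_simps)
  have DC: "Dom ?T r = sq_src r" "Cod ?T r = sq_tgt r" if "r \<in> Arr ?T" for r
    using that[unfolded A] by (simp_all add: full_subcat_simps arrow_cat_simps)
  have Cmp: "Comp ?T t r = Square (sq_src r) (sq_tgt t)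
        (Comp B (sq_top t) (sq_top r)) (Comp B (sq_bot t) (sq_bot r))"
    if "t \<in> Arr ?T" "r \<in> Arr ?T" "sq_tgt r = sq_src t" for t r
    using that(1,2)[unfolded A] that(3) by (simp add: full_subcat_simps arrow_cat_simps)
  note [simp] = cat_simps[OF B] pullback_facts(1-7)[OF B P]
  have sT: "sq_src s \<in> T" "sq_tgt s \<in> T" using s A by auto
  show ?thesis
    unfolding cartesian_def
  proof (intro conjI ballI allI impI)
    show "s \<in> Arr ?T" by (rule s)
    fix r h assume r: "r \<in> Arr ?T"
      and rh: "Cod ?T r = Cod ?T s \<and> h \<in> homs B (fob p (Dom ?T r)) (fob p (Dom ?T s)) \<and>
        Comp B (farr p s) h = farr p r"
    have rT: "sq_src r \<in> T" "r \<in> squares B" using r A by auto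
    have tgt: "sq_tgt r = sq_tgt s" using rh r s by (simp add: DC)
    have h: "h \<in> Arr B" "Dom B h = Cod B (sq_src r)" "Cod B h = Cod B (sq_src s)"
      "Comp B (sq_bot s) h = sq_bot r"
      using rh r s rT sT by (auto simp: DC p homs_def)
    have r': "sq_src r \<in> Arr B" "sq_top r \<in> Arr B" "Dom B (sq_top r) = Dom B (sq_src r)"
      "Cod B (sq_top r) = Dom B (sq_tgt s)"
      "Comp B (sq_bot r) (sq_src r) = Comp B (sq_tgt s) (sq_top r)"
      using rT(2) tgt by (auto simp: squares_def homs_def)
    have "Comp B (sq_tgt s) (sq_top r) = Comp B (Comp B (sq_bot s) h) (sq_src r)"
      by (simp add: h(4) r'(5))
    also have "\<dots> = Comp B (sq_bot s) (Comp B h (sq_src r))"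
      using h(1-3) r'(1) by simp
    finally have c: "Comp B (sq_tgt s) (sq_top r) = Comp B (sq_bot s) (Comp B h (sq_src r))" .
    \<comment> \<open>The two composites to be matched are the upper side of \<open>r\<close> and
      \<open>h\<close> after the left side of \<open>r\<close>; the preceding equation says that
      they form a commutative square over the cospan.\<close>
    have "\<exists>k. k \<in> Arr B \<and> Dom B k = Dom B (sq_top r) \<and> Cod B k = Dom B (sq_top s) \<and>
        Comp B (sq_top s) k = sq_top r \<and> Comp B (sq_src s) k = Comp B h (sq_src r)"
      by (rule pullback_lift[OF P _ _ _ _ _ c]) (use h(1-3) r' in simp_all)
    then obtain k where k: "k \<in> Arr B" "Dom B k = Dom B (sq_top r)" "Cod B k = Dom B (sq_top s)"
      "Comp B (sq_top s) k = sq_top r" "Comp B (sq_src s) k = Comp B h (sq_src r)" by blast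
    let ?k = "Square (sq_src r) (sq_src s) k h"
    have kA: "?k \<in> Arr ?T"
      unfolding A using k h r' rT sT by (simp add: square_iff)
    show "\<exists>!k. k \<in> homs ?T (Dom ?T r) (Dom ?T s) \<and> farr p k = h \<and> Comp ?T s k = r"
    proof (rule ex1I)
      show "?k \<in> homs ?T (Dom ?T r) (Dom ?T s) \<and> farr p ?k = h \<and> Comp ?T s ?k = r"
        using kA r s k(4) h(4) tgt by (cases r) (auto simp: homs_def DC p Cmp)
      fix l assume l: "l \<in> homs ?T (Dom ?T r) (Dom ?T s) \<and> farr p l = h \<and> Comp ?T s l = r"
      have lA: "l \<in> Arr ?T" and l': "sq_src l = sq_src r" "sq_tgt l = sq_src s" "sq_bot l = h"
        using l r s by (auto simp: homs_def DC p)
      have lS: "sq_top l \<in> Arr B" "Cod B (sq_top l) = Dom B (sq_src s)"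
        "Comp B h (sq_src r) = Comp B (sq_src s) (sq_top l)"
        using lA l' by (auto simp: A squares_def homs_def)
      have "sq_top (Comp ?T s l) = sq_top r" using l by simp
      then have "Comp B (sq_top s) (sq_top l) = sq_top r" using s lA l' by (simp add: Cmp)
      then have "sq_top l = k"
        by (intro pullback_unique[OF B P lS(1) k(1)]) (use lS k in simp_all)
      then show "l = ?k" using l' by (cases l) simp
    qed
  qed
qed

text \<open>One direction is the axiom on comprehension, the other is
  \<open>pullback_cartesian\<close>.\<close>

lemma cartesian_iff_pullback:
  assumes X: "comprehension_category X" and sub: "subcategorical X"
  shows "cartesian (total X) (base X) (proj X) s \<longleftrightarrow>
    s \<in> Arr (total X) \<and> is_pullback (base X) (sq_tgt s) (sq_bot s) (sq_top s) (sq_src s)"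
proof
  assume s: "cartesian (total X) (base X) (proj X) s"
  then have sA: "s \<in> Arr (total X)" by (simp add: cartesian_def)
  have "let s = farr (compr X) s in is_pullback (base X) (sq_tgt s) (sq_bot s) (sq_top s) (sq_src s)"
    using X s unfolding comprehension_category_def by blast
  then show "s \<in> Arr (total X) \<and> is_pullback (base X) (sq_tgt s) (sq_bot s) (sq_top s) (sq_src s)"
    using sA sub_compr_arr[OF X sub sA] by simp
next
  note tot = sub_total[OF X sub]
  assume s: "s \<in> Arr (total X) \<and> is_pullback (base X) (sq_tgt s) (sq_bot s) (sq_top s) (sq_src s)"
  have "cartesian (full_subcat (arrow_cat (base X)) (Obj (total X))) (base X) (proj X) s"
    by (rule pullback_cartesian[OF compcat_base[OF X] sub_Obj[OF X sub]])
      (use s sub_proj_ob[OF X sub] sub_proj_arr[OF X sub] in \<open>simp_all flip: tot\<close>)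
  then show "cartesian (total X) (base X) (proj X) s" by (simp flip: tot)
qed

section \<open>Trivial comprehension categories\<close>

definition triv_compcat :: "('o, 'm) cat \<Rightarrow> 'o \<Rightarrow> ('o, 'm, 'm, 'm square) rcompcat" where
  "triv_compcat C t = \<lparr> base = C, total = arrow_cat C, proj = cod_functor C,
     compr = id_functor (arrow_cat C), root = t \<rparr>"

lemma triv_compcat_sel [simp]:
  "base (triv_compcat C t) = C" "total (triv_compcat C t) = arrow_cat C"
  "proj (triv_compcat C t) = cod_functor C" "compr (triv_compcat C t) = id_functor (arrow_cat C)"
  "root (triv_compcat C t) = t"
  by (simp_all add: triv_compcat_def)

lemma cod_functor_simps:
  "f \<in> Arr C \<Longrightarrow> fob (cod_functor C) f = Cod C f"
  "s \<in> squares C \<Longrightarrow> farr (cod_functor C) s = sq_bot s"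
  by (simp_all add: cod_functor_def)

lemma cod_functor:
  assumes C: "category C"
  shows "is_functor (arrow_cat C) C (cod_functor C)"
proof (rule is_functorI)
  note [simp] = arrow_cat_simps cat_simps[OF C] cod_functor_simps
  show "farr (cod_functor C) (Id (arrow_cat C) f) = Id C (fob (cod_functor C) f)"
    if "f \<in> Obj (arrow_cat C)" for f
    using that by (simp add: square_iff)
  show "farr (cod_functor C) (Comp (arrow_cat C) t s) =
      Comp C (farr (cod_functor C) t) (farr (cod_functor C) s)"
    if "t \<in> Arr (arrow_cat C)" "s \<in> Arr (arrow_cat C)" "Cod (arrow_cat C) s = Dom (arrow_cat C) t" for t s
    using that cat_comp[OF category_arrow_cat[OF C], of t s] by simp
  show "farr (cod_functor C) s \<in> homs C (fob (cod_functor C) (Dom (arrow_cat C) s))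
      (fob (cod_functor C) (Cod (arrow_cat C) s))" if "s \<in> Arr (arrow_cat C)" for s
    using that by (simp add: squares_def)
qed (auto simp: cod_functor_def arrow_cat_simps cat_simps[OF C])

text \<open>When every map of the base is an object of the total category, closure under isomorphism
  and composition holds automatically. This makes the inclusion of 2-categories well defined on
  objects.\<close>

lemma trivial_replete:
  assumes X: "comprehension_category X" and triv: "trivial X"
  shows "replete X" "composition_closed X" "Obj (total X) = Arr (base X)"
proof -
  note C = compcat_base[OF X]
  have t: "total X = arrow_cat (base X)" "compr X = id_functor (arrow_cat (base X))"
    using triv by (auto simp: trivial_def)
  show ob: "Obj (total X) = Arr (base X)" by (simp add: t arrow_cat_simps)
  have "full_subcat (arrow_cat (base X)) (Arr (base X)) = arrow_cat (base X)"
    using full_subcat_self[OF category_arrow_cat[OF C]] by (simp add: arrow_cat_simps(1))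
  then have sub: "subcategorical X"
    unfolding subcategorical_def using ob t by simp
  then show "replete X" using ob by (simp add: replete_def replete_in_def arrow_cat_simps)
  show "composition_closed X"
    unfolding composition_closed_def comp_closed_def composable_def ob
    using sub by (simp add: cat_simps[OF C])
qed

lemma rooted_triv_compcat:
  assumes C: "category C" and pb: "has_pullbacks C" and t: "terminal C t"
  shows "rooted_compcat (triv_compcat C t)" "trivial (triv_compcat C t)"
proof -
  let ?p = "cod_functor C"
  note [simp] = cat_simps[OF C]
  note cA = category_arrow_cat[OF C] and fp = cod_functor[OF C]
  show "trivial (triv_compcat C t)" by (simp add: trivial_def)
  have self: "full_subcat (arrow_cat C) (Arr C) = arrow_cat C"
    using full_subcat_self[OF cA] by (simp add: arrow_cat_simps(1))
  have cart: "cartesian (arrow_cat C) C ?p s"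
    if "s \<in> squares C" "is_pullback C (sq_tgt s) (sq_bot s) (sq_top s) (sq_src s)" for s
    using pullback_cartesian[OF C order.refl, of ?p s] that
    by (simp add: self arrow_cat_simps(1,2) cod_functor_simps)
  have lift: "\<exists>s. s \<in> squares C \<and> sq_tgt s = A \<and> sq_bot s = f \<and>
      is_pullback C (sq_tgt s) (sq_bot s) (sq_top s) (sq_src s)"
    if Af: "A \<in> Arr C" "f \<in> Arr C" "Cod C f = Cod C A" for A f
  proof -
    obtain q d' where P: "is_pullback C A f q d'"
      using has_pullbacksD[OF pb Af(1,2) Af(3)[symmetric]] by blast
    have "Square d' A q f \<in> squares C"
      using pullback_facts(1-7)[OF C P] pb_comm[OF C P, symmetric] Af(3) by (simp add: square_iff)
    then show ?thesis using P by (intro exI[of _ "Square d' A q f"]) simp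
  qed
  have fib: "fibration (arrow_cat C) C ?p"
    unfolding fibration_def
  proof (intro conjI ballI impI)
    fix A f assume A: "A \<in> Obj (arrow_cat C)" and f: "f \<in> Arr C" "Cod C f = fob ?p A"
    then obtain s where "s \<in> squares C" "sq_tgt s = A" "sq_bot s = f"
      "is_pullback C (sq_tgt s) (sq_bot s) (sq_top s) (sq_src s)"
      using lift[of A f] by (auto simp: arrow_cat_simps(1) cod_functor_simps)
    then show "\<exists>s. cartesian (arrow_cat C) C ?p s \<and> Cod (arrow_cat C) s = A \<and> farr ?p s = f"
      using cart[of s] by (intro exI[of _ s]) (simp add: arrow_cat_simps(4) cod_functor_simps)
  qed (rule fp)
  \<comment> \<open>A cartesian square \<open>s\<close> is compared with a pullback square
    \<open>r\<close> on the same cospan. Cartesianness of \<open>s\<close> and the pullback property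
    of \<open>r\<close> give maps \<open>k\<close> and \<open>l\<close> between them, which turn out
    to be inverse to each other on the upper left corners.\<close>
  have cart_pb: "is_pullback C (sq_tgt s) (sq_bot s) (sq_top s) (sq_src s)"
    if s: "cartesian (arrow_cat C) C ?p s" for s
  proof -
    have sq: "s \<in> squares C" using s by (simp add: cartesian_def arrow_cat_simps)
    have sq': "sq_src s \<in> Arr C" "sq_tgt s \<in> Arr C" "sq_top s \<in> Arr C" "sq_bot s \<in> Arr C"
      "Dom C (sq_top s) = Dom C (sq_src s)" "Cod C (sq_top s) = Dom C (sq_tgt s)"
      "Dom C (sq_bot s) = Cod C (sq_src s)" "Cod C (sq_bot s) = Cod C (sq_tgt s)"
      "Comp C (sq_bot s) (sq_src s) = Comp C (sq_tgt s) (sq_top s)"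
      using sq by (auto simp: squares_def homs_def)
    \<comment> \<open>The universal property of \<open>s\<close>, specialised to lifts of an
      identity of the base.\<close>
    have univ: "\<exists>!k. k \<in> homs (arrow_cat C) (sq_src r) (sq_src s) \<and> farr ?p k = Id C (Cod C (sq_src s)) \<and>
        Comp (arrow_cat C) s k = r"
      if "r \<in> squares C" "sq_tgt r = sq_tgt s" "sq_bot r = sq_bot s" for r
    proof -
      have r: "sq_src r \<in> Arr C" "Cod C (sq_src r) = Cod C (sq_src s)"
        using that(1,3) sq' by (auto simp: squares_def homs_def)
      have "Id C (Cod C (sq_src s)) \<in> homs C (fob ?p (Dom (arrow_cat C) r)) (fob ?p (Dom (arrow_cat C) s))"
        using that sq sq' r by (simp add: arrow_cat_simps(3) cod_functor_simps homs_def)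
      moreover have "Comp C (farr ?p s) (Id C (Cod C (sq_src s))) = farr ?p r"
        using that sq sq' by (simp add: cod_functor_simps)
      ultimately have "\<exists>!k. k \<in> homs (arrow_cat C) (Dom (arrow_cat C) r) (Dom (arrow_cat C) s) \<and>
          farr ?p k = Id C (Cod C (sq_src s)) \<and> Comp (arrow_cat C) s k = r"
        using s that sq unfolding cartesian_def by (simp add: arrow_cat_simps(2,4))
      then show ?thesis using that(1) sq by (simp add: arrow_cat_simps(3))
    qed
    obtain r where r: "r \<in> squares C" "sq_tgt r = sq_tgt s" "sq_bot r = sq_bot s"
      and P: "is_pullback C (sq_tgt s) (sq_bot s) (sq_top r) (sq_src r)"
      using lift[OF sq'(2,4,8)] by auto
    note pf = pullback_facts(1-7)[OF C P]
    obtain k where k: "k \<in> homs (arrow_cat C) (sq_src r) (sq_src s)"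
      "farr ?p k = Id C (Cod C (sq_src s))" "Comp (arrow_cat C) s k = r"
      using univ[OF r] by blast
    have kS: "k \<in> squares C" "sq_src k = sq_src r" "sq_tgt k = sq_src s"
      using homsD[OF k(1)] by (auto simp: arrow_cat_simps)
    have kb: "sq_bot k = Id C (Cod C (sq_src s))" using k(2) kS(1) by (simp add: cod_functor_simps)
    have kt: "sq_top k \<in> Arr C" "Dom C (sq_top k) = Dom C (sq_src r)" "Cod C (sq_top k) = Dom C (sq_src s)"
      using kS by (auto simp: squares_def homs_def)
    have cr: "Cod C (sq_src r) = Cod C (sq_src s)" using pf(6) sq'(7) by simp
    have k1: "Comp C (sq_top s) (sq_top k) = sq_top r"
      using arg_cong[OF k(3), of sq_top] sq kS by (simp add: arrow_cat_simps(6))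
    have k2: "Comp C (sq_src s) (sq_top k) = sq_src r"
      using kS kb pf(4) cr by (auto simp: squares_def)
    have "\<exists>l. l \<in> Arr C \<and> Dom C l = Dom C (sq_top s) \<and> Cod C l = Dom C (sq_top r) \<and>
        Comp C (sq_top r) l = sq_top s \<and> Comp C (sq_src r) l = sq_src s"
      by (rule pullback_lift[OF P]) (simp_all add: sq')
    then obtain l where l: "l \<in> Arr C" "Dom C l = Dom C (sq_top s)" "Cod C l = Dom C (sq_top r)"
      "Comp C (sq_top r) l = sq_top s" "Comp C (sq_src r) l = sq_src s" by blast
    have lk: "Comp C l (sq_top k) = Id C (Dom C (sq_src r))"
    proof (rule pullback_unique[OF C P])
      have "Comp C (sq_top r) (Comp C l (sq_top k)) = Comp C (Comp C (sq_top r) l) (sq_top k)"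
        by (rule cat_assoc[OF C, symmetric]) (use l(1-3) kt pf sq' in simp_all)
      then show "Comp C (sq_top r) (Comp C l (sq_top k)) = Comp C (sq_top r) (Id C (Dom C (sq_src r)))"
        using pf by (simp add: l(4) k1)
      have "Comp C (sq_src r) (Comp C l (sq_top k)) = Comp C (Comp C (sq_src r) l) (sq_top k)"
        by (rule cat_assoc[OF C, symmetric]) (use l(1-3) kt pf sq' in simp_all)
      then show "Comp C (sq_src r) (Comp C l (sq_top k)) = Comp C (sq_src r) (Id C (Dom C (sq_src r)))"
        using pf by (simp add: l(5) k2)
    qed (use l(1-3) kt pf sq' in simp_all)
    let ?X = "Cod C (sq_src s)"
    \<comment> \<open>\<open>?i\<close> has the composite of the two comparison maps on top,
      \<open>?j\<close> an identity. Both factor \<open>s\<close> through itself over an identity,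
      so by uniqueness they coincide.\<close>
    let ?i = "Square (sq_src s) (sq_src s) (Comp C (sq_top k) l) (Id C ?X)"
    let ?j = "Square (sq_src s) (sq_src s) (Id C (Dom C (sq_src s))) (Id C ?X)"
    have tkl: "Comp C (sq_top s) (Comp C (sq_top k) l) = sq_top s"
    proof -
      have "Comp C (sq_top s) (Comp C (sq_top k) l) = Comp C (Comp C (sq_top s) (sq_top k)) l"
        by (rule cat_assoc[OF C, symmetric]) (use l(1-3) kt pf sq' in simp_all)
      then show ?thesis by (simp add: k1 l(4))
    qed
    have skl: "Comp C (sq_src s) (Comp C (sq_top k) l) = sq_src s"
    proof -
      have "Comp C (sq_src s) (Comp C (sq_top k) l) = Comp C (Comp C (sq_src s) (sq_top k)) l"
        by (rule cat_assoc[OF C, symmetric]) (use l(1-3) kt pf sq' in simp_all)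
      then show ?thesis by (simp add: k2 l(5))
    qed
    have ij: "?i \<in> squares C" "?j \<in> squares C"
      using sq' l(1-3) kt pf skl by (simp_all add: square_iff)
    have "?i \<in> homs (arrow_cat C) (sq_src s) (sq_src s) \<and> farr ?p ?i = Id C ?X \<and> Comp (arrow_cat C) s ?i = s"
      using ij sq sq' tkl by (cases s) (auto simp: homs_def arrow_cat_simps cod_functor_simps)
    moreover have "?j \<in> homs (arrow_cat C) (sq_src s) (sq_src s) \<and> farr ?p ?j = Id C ?X \<and>
        Comp (arrow_cat C) s ?j = s"
      using ij sq sq' by (cases s) (auto simp: homs_def arrow_cat_simps cod_functor_simps)
    ultimately have "?i = ?j" using univ[OF sq refl refl] by blast
    then have kl: "Comp C (sq_top k) l = Id C (Dom C (sq_src s))" by simp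
    have "is_iso C l"
      by (rule is_isoI[of _ _ "sq_top k"]) (use l(1-3) kt lk kl sq' pf in simp_all)
    then show ?thesis using pullback_transfer[OF C P, of l] l(3-5) by simp
  qed
  have "comprehension_category (triv_compcat C t)"
    unfolding comprehension_category_def triv_compcat_sel Let_def
    using C cA fib id_functor[OF cA] fcomp_id_right[OF fp] cart_pb
    by (auto simp: cartesian_def arrow_cat_simps(2))
  \<comment> \<open>The map from \<Gamma> to the terminal object is itself an object of the total
    category, so one extension of the root reaches every object.\<close>
  moreover have "\<exists>\<Delta>. iterated_ext (triv_compcat C t) \<Delta> \<and> isomorphic C \<Gamma> \<Delta>" if \<Gamma>: "\<Gamma> \<in> Obj C" for \<Gamma>
  proof -
    obtain f where f: "f \<in> Arr C" "Dom C f = \<Gamma>" "Cod C f = t" using terminalD(2)[OF t \<Gamma>] by blast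
    have "iterated_ext (triv_compcat C t) (ext_dom (triv_compcat C t) f)"
      by (rule iterated_ext.ext[OF iterated_ext.root])
        (use f in \<open>simp_all add: arrow_cat_simps cod_functor_simps\<close>)
    moreover have "ext_dom (triv_compcat C t) f = \<Gamma>" using f by (simp add: ext_dom_def arrow_cat_simps)
    moreover have "isomorphic C \<Gamma> \<Gamma>"
      unfolding isomorphic_def using \<Gamma> is_iso_id[OF C \<Gamma>] by (intro bexI[of _ "Id C \<Gamma>"]) (auto intro: homsI)
    ultimately show ?thesis by auto
  qed
  ultimately show "rooted_compcat (triv_compcat C t)"
    unfolding rooted_compcat_def using t by simp
qed

section \<open>The underlying clan, and the clan map underlying a pseudo map\<close>

lemma compcat_clan:
  fixes Y :: "('o, 'm, 'm, 'm square) rcompcat"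
  assumes Y: "rooted_compcat Y" and repl: "replete Y" and comp: "composition_closed Y"
  shows "clan (base Y, Obj (total Y))"
proof -
  note CY = rooted_compcatD(1)[OF Y]
  note C = compcat_base[OF CY]
  note [simp] = cat_simps[OF C]
  have sub: "subcategorical Y" using repl by (simp add: replete_def)
  let ?T = "Obj (total Y)"
  have cc: "Comp (base Y) g f \<in> ?T" if "g \<in> ?T" "f \<in> ?T" "Cod (base Y) f = Dom (base Y) g" for g f
    using comp sub_Obj[OF CY sub] that
    unfolding composition_closed_def comp_closed_def composable_def by blast
  have ci: "Id (base Y) X \<in> ?T" if "X \<in> Obj (base Y)" for X
    using comp that unfolding composition_closed_def comp_closed_def by blast
  have pb: "\<exists>q. \<exists>d' \<in> ?T. is_pullback (base Y) d f q d'"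
    if d: "d \<in> ?T" and f: "f \<in> Arr (base Y)" "Cod (base Y) f = Cod (base Y) d" for d f
  proof -
    have "Cod (base Y) f = fob (proj Y) d" using f(2) sub_proj_ob[OF CY sub d] by simp
    then obtain s where s: "cartesian (total Y) (base Y) (proj Y) s" "Cod (total Y) s = d"
      "farr (proj Y) s = f"
      using compcat_fibration[OF CY] d f(1) unfolding fibration_def by blast
    then have sA: "s \<in> Arr (total Y)"
      and P: "is_pullback (base Y) (sq_tgt s) (sq_bot s) (sq_top s) (sq_src s)"
      using cartesian_iff_pullback[OF CY sub] by blast+
    have "sq_tgt s = d" "sq_bot s = f" "sq_src s \<in> ?T"
      using s(2,3) sub_Cod[OF CY sub sA] sub_proj_arr[OF CY sub sA] sA sub_Arr[OF CY sub] by auto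
    then show ?thesis using P by auto
  qed
  have dm: "display_map_category (base Y) ?T"
    unfolding display_map_category_def
    using C sub_Obj[OF CY sub] repl pb by (simp add: replete_def)
  have iso_T: "u \<in> ?T" if u: "is_iso (base Y) u" for u
  proof -
    have uA: "u \<in> Arr (base Y)" using u by (simp add: is_iso_def)
    then have "Id (base Y) (Cod (base Y) u) \<in> ?T" by (intro ci) simp
    then show ?thesis
      using repl uA iso_isomorphic_id[OF C u] by (auto simp: replete_def replete_in_def arrow_cat_simps)
  qed
  \<comment> \<open>The map from an iterated extension to the root is, by uniqueness of maps into a
    terminal object, the composite of the successive display maps, so closure under composition
    applies along the induction.\<close>
  have ie: "\<Delta> \<in> Obj (base Y) \<and> (\<forall>f \<in> Arr (base Y). Dom (base Y) f = \<Delta> \<and> Cod (base Y) f = root Y \<longrightarrow> f \<in> ?T)"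
    if "iterated_ext Y \<Delta>" for \<Delta>
    using that
  proof induction
    case root
    have "f = Id (base Y) (root Y)"
      if "f \<in> Arr (base Y)" "Dom (base Y) f = root Y" "Cod (base Y) f = root Y" for f
      by (rule terminal_eq[OF C rooted_compcatD(2)[OF Y]]) (use that rooted_compcatD(3)[OF Y] in simp_all)
    then show ?case using ci rooted_compcatD(3)[OF Y] by auto
  next
    case (ext \<Gamma> A)
    have A: "A \<in> Arr (base Y)" using ext sub_Obj[OF CY sub] by blast
    have AD: "Dom (base Y) A = ext_dom Y A" "Cod (base Y) A = \<Gamma>"
      using sub_ext_dom[OF CY sub ext(2)] sub_proj_ob[OF CY sub ext(2)] ext(3) by simp_all
    have "f \<in> ?T" if f: "f \<in> Arr (base Y)" "Dom (base Y) f = ext_dom Y A" "Cod (base Y) f = root Y" for f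
    proof -
      obtain g where g: "g \<in> Arr (base Y)" "Dom (base Y) g = \<Gamma>" "Cod (base Y) g = root Y"
        using terminalD(2)[OF rooted_compcatD(2)[OF Y], of \<Gamma>] ext.IH by blast
      then have "g \<in> ?T" using ext.IH by blast
      moreover have "f = Comp (base Y) g A"
        by (rule terminal_eq[OF C rooted_compcatD(2)[OF Y]]) (use f g A AD in simp_all)
      ultimately show ?thesis using cc[of g A] ext(2) g AD by simp
    qed
    then show ?case using A cat_dom[OF C A] AD by auto
  qed
  have "f \<in> ?T" if f: "f \<in> Arr (base Y)" "Cod (base Y) f = root Y" for f
  proof -
    have "Dom (base Y) f \<in> Obj (base Y)" using f by simp
    \<comment> \<open>An arbitrary object is only isomorphic to an iterated extension; its map to
      the root is corrected by this isomorphism, a display map by repleteness.\<close>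
    then obtain \<Delta> u where \<Delta>: "iterated_ext Y \<Delta>" and u: "is_iso (base Y) u"
      "u \<in> Arr (base Y)" "Dom (base Y) u = Dom (base Y) f" "Cod (base Y) u = \<Delta>"
      using Y unfolding rooted_compcat_def isomorphic_def by (fastforce simp: homs_def)
    obtain g where g: "g \<in> Arr (base Y)" "Dom (base Y) g = \<Delta>" "Cod (base Y) g = root Y"
      using terminalD(2)[OF rooted_compcatD(2)[OF Y], of \<Delta>] ie[OF \<Delta>] by blast
    then have "g \<in> ?T" using ie[OF \<Delta>] by blast
    moreover have "f = Comp (base Y) g u"
      by (rule terminal_eq[OF C rooted_compcatD(2)[OF Y]]) (use f g u in simp_all)
    ultimately show ?thesis using cc[of g u] iso_T[OF u(1)] g u by simp
  qed
  then have "rooted_dmc (base Y) ?T"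
    unfolding rooted_dmc_def using dm rooted_compcatD(2)[OF Y] display_composites.display by metis
  then show ?thesis using comp by (simp add: clan_def composition_closed_def)
qed

text \<open>Replaces the map that is pulled back by an isomorphic one over the same object. It
  serves to pass from the image of a display map under the total functor to its image under the base
  functor.\<close>

lemma pullback_iso_leg:
  assumes C: "category C" and P: "is_pullback C d f q d'" and u: "is_iso C u" "Dom C u = Dom C d"
    and d1: "d1 \<in> Arr C" "Dom C d1 = Cod C u" "Comp C d1 u = d"
  shows "is_pullback C d1 f (Comp C u q) d'"
proof (rule is_pullbackI)
  obtain v where v: "u \<in> Arr C" "v \<in> Arr C" "Dom C v = Cod C u" "Cod C v = Dom C u"
    "Comp C v u = Id C (Dom C u)" "Comp C u v = Id C (Cod C u)" by (rule is_isoE[OF u(1)])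
  note [simp] = cat_simps[OF C] pullback_facts(1-7)[OF C P] v(1-4) u(2) d1(1,2)
  have uq [simp]: "Comp C u q \<in> Arr C" "Dom C (Comp C u q) = Dom C d'" by simp_all
  have du: "Comp C d1 (Comp C u h) = Comp C d h" if "h \<in> Arr C" "Cod C h = Dom C d" for h
    using that cat_assoc[OF C, of d1 u h] by (simp add: d1(3))
  have uv: "Comp C u (Comp C v h) = h" if "h \<in> Arr C" "Cod C h = Cod C u" for h
    using that cat_assoc[OF C, of u v h] by (simp add: v(6))
  show "d1 \<in> Arr C" "f \<in> Arr C" "Comp C u q \<in> Arr C" "d' \<in> Arr C" "Cod C (Comp C u q) = Dom C d1"
    "Cod C d' = Dom C f" "Dom C (Comp C u q) = Dom C d'" by simp_all
  show "Comp C d1 (Comp C u q) = Comp C f d'" using du[of q] pb_comm[OF C P] by simp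
  show "\<exists>h. h \<in> Arr C \<and> Dom C h = Dom C a \<and> Cod C h = Dom C (Comp C u q) \<and>
      Comp C (Comp C u q) h = a \<and> Comp C d' h = b"
    if ab: "a \<in> Arr C" "b \<in> Arr C" "Cod C a = Dom C d1" "Cod C b = Dom C f" "Dom C a = Dom C b"
      "Comp C d1 a = Comp C f b" for a b
  proof -
    have "Comp C d (Comp C v a) = Comp C f b"
      using du[of "Comp C v a"] uv[of a] ab by simp
    then have "\<exists>h. h \<in> Arr C \<and> Dom C h = Dom C (Comp C v a) \<and> Cod C h = Dom C q \<and>
        Comp C q h = Comp C v a \<and> Comp C d' h = b"
      by (intro pullback_lift[OF P]) (use ab in simp_all)
    then obtain h where h: "h \<in> Arr C" "Dom C h = Dom C (Comp C v a)" "Cod C h = Dom C q"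
      "Comp C q h = Comp C v a" "Comp C d' h = b" by blast
    show ?thesis using h uv[of a] ab by (intro exI[of _ h]) simp
  qed
  show "h = k" if hk: "h \<in> Arr C" "k \<in> Arr C" "Cod C h = Dom C (Comp C u q)"
      "Cod C k = Dom C (Comp C u q)" "Comp C (Comp C u q) h = Comp C (Comp C u q) k"
      "Comp C d' h = Comp C d' k" for h k
  proof (rule pullback_unique[OF C P])
    show "Comp C q h = Comp C q k"
      by (rule iso_cancel[OF C u(1)]) (use hk in simp_all)
  qed (use hk in simp_all)
qed

text \<open>A pseudo map preserves cartesian maps and thus controls pullbacks through its total
  functor, whereas a clan map concerns the base functor. The comprehension isomorphisms convert one
  into the other.\<close>

lemma pseudo_map_clan_map:
  fixes X Y :: "('o, 'm, 'm, 'm square) rcompcat"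
  assumes X: "rooted_compcat X" and triv: "trivial X"
    and Y: "rooted_compcat Y" and repl: "replete Y" and cc: "composition_closed Y"
    and F: "rooted_pseudo_map X Y F"
  shows "clan_map (base X, Arr (base X)) (base Y, Obj (total Y)) (pm_base F)"
proof -
  note CX = rooted_compcatD(1)[OF X] and CY = rooted_compcatD(1)[OF Y]
  note bX = compcat_base[OF CX] and bY = compcat_base[OF CY]
  note PF = rooted_pseudo_mapD(1)[OF F]
  note bF = pm_base_functor[OF CX CY PF] and tF = pm_total_functor[OF CX CY PF]
  note D = compcat_clan[OF Y repl cc]
  have subX: "subcategorical X" using trivial_replete(1)[OF CX triv] by (simp add: replete_def)
  have subY: "subcategorical Y" using repl by (simp add: replete_def)
  note obX [simp] = trivial_replete(3)[OF CX triv]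
  note [simp] = cat_simps[OF bX] cat_simps[OF bY] ftor_simps[OF bF]
  have Ft: "fob (pm_total F) A \<in> Obj (total Y)" if "A \<in> Arr (base X)" for A
    using ftor_ob[OF tF] that by simp
  have e: "is_iso (base Y) (pm_ext F A)" "pm_ext F A \<in> Arr (base Y)"
    "Dom (base Y) (pm_ext F A) = Dom (base Y) (fob (pm_total F) A)"
    "Cod (base Y) (pm_ext F A) = fob (pm_base F) (Dom (base X) A)"
    "Comp (base Y) (farr (pm_base F) A) (pm_ext F A) = fob (pm_total F) A" if A: "A \<in> Arr (base X)" for A
    using pm_ext_iso[OF CX CY PF, of A] pm_ext_arr[OF CX CY PF, of A] pm_ext_dom[OF CX CY PF, of A]
      pm_ext_cod[OF CX CY PF, of A] pm_ext_compr[OF CX CY PF, of A] A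
      sub_ext_dom[OF CX subX, of A] sub_ext_dom[OF CY subY Ft[OF A]] sub_compr_ob[OF CX subX, of A]
      sub_compr_ob[OF CY subY Ft[OF A]]
    by simp_all
  have disp: "farr (pm_base F) d \<in> Obj (total Y)" if d: "d \<in> Arr (base X)" for d
  proof -
    obtain v where v: "is_iso (base Y) v" "v \<in> Arr (base Y)" "Dom (base Y) v = Cod (base Y) (pm_ext F d)"
      "Cod (base Y) v = Dom (base Y) (pm_ext F d)"
      "Comp (base Y) (pm_ext F d) v = Id (base Y) (Cod (base Y) (pm_ext F d))"
      using iso_inverse[OF e(1)[OF d]] by blast
    \<comment> \<open>The image of \<open>d\<close> under the base functor is its image under the
      total functor composed with an inverse comprehension isomorphism.\<close>
    have "Comp (base Y) (fob (pm_total F) d) v =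
        Comp (base Y) (farr (pm_base F) d) (Comp (base Y) (pm_ext F d) v)"
      unfolding e(5)[OF d, symmetric]
      by (rule cat_assoc[OF bY]) (use v d e(2-4)[OF d] in simp_all)
    also have "\<dots> = farr (pm_base F) d" using v(5) e(4)[OF d] d by simp
    finally show ?thesis
      using clanD(5)[OF D Ft[OF d] clan_iso[OF D v(1)]] v(4) e(3)[OF d] by simp
  qed
  have pb: "is_pullback (base Y) (farr (pm_base F) d) (farr (pm_base F) f) (farr (pm_base F) q)
      (farr (pm_base F) d')" if P: "is_pullback (base X) d f q d'" for d f q d'
  proof -
    note pf = pullback_facts[OF bX P]
    let ?s = "Square d' d q f"
    have sX: "?s \<in> Arr (total X)"
      using pf by (simp add: sub_Arr[OF CX subX] square_iff)
    then have "cartesian (total X) (base X) (proj X) ?s"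
      using P by (simp add: cartesian_iff_pullback[OF CX subX])
    then have c: "cartesian (total Y) (base Y) (proj Y) (farr (pm_total F) ?s)"
      by (rule pm_cartesian[OF CX CY PF])
    let ?t = "farr (pm_total F) ?s"
    have tA: "?t \<in> Arr (total Y)" using c by (simp add: cartesian_def)
    have DX: "Dom (total X) ?s = d'" "Cod (total X) ?s = d"
      using sub_Dom[OF CX subX sX] sub_Cod[OF CX subX sX] by simp_all
    have t: "sq_src ?t = fob (pm_total F) d'" "sq_tgt ?t = fob (pm_total F) d"
      "sq_bot ?t = farr (pm_base F) f"
      using sub_Dom[OF CY subY tA] sub_Cod[OF CY subY tA] ftor_dom[OF tF sX] ftor_cod[OF tF sX] DX
        sub_proj_arr[OF CY subY tA] pm_proj_arr[OF CX CY PF sX] sub_proj_arr[OF CX subX sX] by simp_all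
    \<comment> \<open>The image of the pullback square is cartesian, hence a pullback, with the
      total functor applied to both vertical sides. The right side is corrected in 2, and the left
      side last by a change of apex.\<close>
    have 1: "is_pullback (base Y) (fob (pm_total F) d) (farr (pm_base F) f) (sq_top ?t)
        (fob (pm_total F) d')"
      using c unfolding cartesian_iff_pullback[OF CY subY] t by blast
    have 2: "is_pullback (base Y) (farr (pm_base F) d) (farr (pm_base F) f)
        (Comp (base Y) (pm_ext F d) (sq_top ?t)) (fob (pm_total F) d')"
      by (rule pullback_iso_leg[OF bY 1 e(1)[OF pf(1)] e(3)[OF pf(1)]])
        (use e(4,5)[OF pf(1)] pf(1) in simp_all)
    have nat: "Comp (base Y) (pm_ext F d) (sq_top ?t) = Comp (base Y) (farr (pm_base F) q) (pm_ext F d')"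
      using pm_ext_nat[OF CX CY PF sX] DX sub_compr_arr[OF CY subY tA] sub_compr_arr[OF CX subX sX] by simp
    obtain v where v: "is_iso (base Y) v" "v \<in> Arr (base Y)"
      "Dom (base Y) v = Cod (base Y) (pm_ext F d')" "Cod (base Y) v = Dom (base Y) (pm_ext F d')"
      "Comp (base Y) (pm_ext F d') v = Id (base Y) (Cod (base Y) (pm_ext F d'))"
      using iso_inverse[OF e(1)[OF pf(4)]] by blast
    have c': "Comp (base Y) (Comp (base Y) h (pm_ext F d')) v = h"
      if "h \<in> Arr (base Y)" "Dom (base Y) h = fob (pm_base F) (Dom (base X) d')" for h
      using that v e(2,4)[OF pf(4)] pf(4) by simp
    \<comment> \<open>Precomposing with \<open>v\<close>, inverse to the comprehension isomorphism
      at \<open>d'\<close>, moves the apex to the image of the old one; naturality turns the upper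
      side into the image of \<open>q\<close>.\<close>
    have "is_pullback (base Y) (farr (pm_base F) d) (farr (pm_base F) f)
        (Comp (base Y) (Comp (base Y) (pm_ext F d) (sq_top ?t)) v)
        (Comp (base Y) (fob (pm_total F) d') v)"
      by (rule pullback_transfer[OF bY 2 v(1)])
        (use v(4) e(3)[OF pf(4)] pb_dom(3)[OF bY 2] in simp)
    then show ?thesis
      unfolding nat e(5)[OF pf(4), symmetric] using c'[of "farr (pm_base F) q"]
        c'[of "farr (pm_base F) d'"] pf by simp
  qed
  have F_t: "terminal (base Y) (fob (pm_base F) t)" if t: "terminal (base X) t" for t
  proof -
    obtain u where u: "is_iso (base X) u" "Dom (base X) u = t" "Cod (base X) u = root X"
      by (rule terminal_iso[OF bX rooted_compcatD(2)[OF X] t])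
    have uA: "u \<in> Arr (base X)" using u(1) by (simp add: is_iso_def)
    \<comment> \<open>The specified isomorphism makes the image of the root terminal; any other
      terminal object is isomorphic to the root, and the base functor carries that isomorphism
      along.\<close>
    have "terminal (base Y) (Dom (base Y) (pm_root F))"
      by (rule terminal_transfer[OF bY rooted_compcatD(2)[OF Y] rooted_pseudo_mapD(5)[OF F]
            rooted_pseudo_mapD(4)[OF F]])
    then have "terminal (base Y) (fob (pm_base F) (root X))"
      by (simp add: rooted_pseudo_mapD(3)[OF F])
    then have "terminal (base Y) (Dom (base Y) (farr (pm_base F) u))"
      by (rule terminal_transfer[OF bY _ ftor_iso[OF bX bF u(1)]]) (use u uA in simp)
    then show ?thesis using u uA by simp
  qed
  show ?thesis
    unfolding clan_map_def using bF disp pb F_t by auto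
qed

text \<open>The right adjoint on objects: the separated objects, with all maps between them.\<close>

definition core_compcat :: "('o, 'm, 'm, 'm square) rcompcat \<Rightarrow> ('o, 'm, 'm, 'm square) rcompcat" where
  "core_compcat Y =
     triv_compcat (full_subcat (base Y) (separated (base Y) (Obj (total Y)))) (root Y)"

section \<open>The coreflection of a rooted replete composition-closed comprehension
  category\<close>

locale repl_compcl =
  fixes Y :: "('o, 'm, 'm, 'm square) rcompcat"
  assumes rooted: "rooted_compcat Y" and repl: "replete Y" and compcl: "composition_closed Y"
begin

abbreviation S :: "'o set" where "S \<equiv> separated (base Y) (Obj (total Y))"
abbreviation E :: "('o, 'm) cat" where "E \<equiv> full_subcat (base Y) S"
abbreviation R :: "('o, 'm, 'm, 'm square) rcompcat" where "R \<equiv> core_compcat Y"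

lemmas CY = rooted_compcatD(1)[OF rooted]
lemmas bY = compcat_base[OF CY]
lemmas tY = compcat_total[OF CY]
lemmas D = compcat_clan[OF rooted repl compcl]
lemmas SD = lex_full_separated[OF D]
lemmas SO = lex_fullD(2)[OF SD]
lemmas cE = category_full_subcat[OF bY SO]

lemma sub: "subcategorical Y" using repl by (simp add: replete_def)

lemma R_sel [simp]:
  "base R = E" "total R = arrow_cat E" "proj R = cod_functor E" "compr R = id_functor (arrow_cat E)"
  "root R = root Y"
  by (simp_all add: core_compcat_def)

lemma R: "rooted_compcat R" "trivial R"
  unfolding core_compcat_def
  by (rule rooted_triv_compcat[OF cE lex_full_has_finite_limits(2)[OF SD]];
      simp add: lex_full_terminal[OF SD] rooted_compcatD(2)[OF rooted])+

lemmas CR = rooted_compcatD(1)[OF R(1)]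

lemma subR: "subcategorical R" using trivial_replete(1)[OF CR R(2)] by (simp add: replete_def)

lemma ArrE: "Arr E \<subseteq> Obj (total Y)"
  using separated_display[OF D] by (auto simp: full_subcat_simps)

text \<open>The arrow category of \<open>E\<close> is described twice: here as full in the total
  category of \<open>Y\<close>, for comparing total functors, and in \<open>arrow_E'\<close> as full
  in the arrow category of the base, for comparing comprehension isomorphisms.\<close>

lemma arrow_E: "arrow_cat E = full_subcat (total Y) (Arr E)"
  using arrow_cat_full_subcat[OF bY, of S] full_subcat_full_subcat[OF ArrE, of "arrow_cat (base Y)"]
    sub_total[OF CY sub] by simp

lemma arrow_E': "arrow_cat E = full_subcat (arrow_cat (base Y)) (Arr E)"
  by (rule arrow_cat_full_subcat[OF bY])

lemma ArrE_sub: "Arr E \<subseteq> Obj (arrow_cat (base Y))"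
  by (auto simp: full_subcat_simps arrow_cat_simps)

lemma squares_E: "s \<in> squares E \<Longrightarrow> s \<in> Arr (total Y)"
  using ArrE by (auto simp: squares_full_subcat sub_Arr[OF CY sub])

lemma functor_E:
  assumes B: "category B"
  shows "is_functor B E F \<Longrightarrow> is_functor B (base Y) F"
    and "is_functor B (arrow_cat E) G \<Longrightarrow> is_functor B (total Y) G"
  using full_subcat_functor_iff[OF bY SO B, of F] full_subcat_functor_iff[OF tY ArrE B, of G]
  by (simp_all add: arrow_E)

lemma arr_E: "f \<in> Arr E \<Longrightarrow> f \<in> Arr (base Y) \<and> Dom (base Y) f \<in> S \<and> Cod (base Y) f \<in> S \<and>
    Dom E f = Dom (base Y) f \<and> Cod E f = Cod (base Y) f"
  by (simp add: full_subcat_simps)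

lemma comp_E: "g \<in> Arr E \<Longrightarrow> f \<in> Arr E \<Longrightarrow> Comp E g f = Comp (base Y) g f"
  by (simp add: full_subcat_simps)

lemma comp_arrow_E: "t \<in> squares E \<Longrightarrow> s \<in> squares E \<Longrightarrow>
    Comp (arrow_cat E) t s = Comp (arrow_cat (base Y)) t s"
  unfolding arrow_E' by (auto simp: full_subcat_simps arrow_cat_simps squares_full_subcat)

text \<open>Once both functors are known to take values in \<open>E\<close>, each clause of the
  definition says the same about \<open>R\<close> as about \<open>Y\<close>: cartesian maps are
  pullback squares, which agree by \<open>lex_full_pullback\<close>, and natural isomorphisms agree
  by fullness.\<close>

lemma pseudo_map_iff:
  fixes X :: "('o, 'm, 'm, 'm square) rcompcat" and F :: "('o, 'm, 'm, 'm square) rpmap"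
  assumes X: "comprehension_category X"
    and bF: "is_functor (base X) E (pm_base F)" and tF: "is_functor (total X) (arrow_cat E) (pm_total F)"
  shows "pseudo_map X R F \<longleftrightarrow> pseudo_map X Y F"
proof -
  note bX = compcat_base[OF X] and tX = compcat_total[OF X]
  have base: "is_functor (base X) (base Y) (pm_base F)" and total: "is_functor (total X) (total Y) (pm_total F)"
    using functor_E[OF bX] functor_E[OF tX] bF tF by blast+
  have obF: "fob (pm_total F) A \<in> Arr E" if "A \<in> Obj (total X)" for A
    using ftor_ob[OF tF that] by (simp add: arrow_cat_simps)
  have sqF: "farr (pm_total F) s \<in> squares E" if "s \<in> Arr (total X)" for s
    using ftor_arr[OF tF that] by (simp add: arrow_cat_simps)
  have obY: "fob (pm_total F) A \<in> Obj (total Y)" if "A \<in> Obj (total X)" for A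
    using obF[OF that] ArrE by blast
  have proj: "fcomp (total X) (cod_functor E) (pm_total F) = fcomp (total X) (proj Y) (pm_total F)"
    by (rule ftor_eqI[OF fcomp_functor[OF tX tF cod_functor[OF cE]]
          fcomp_functor[OF tX total compcat_proj[OF CY]]])
      (use obF obY sqF squares_E arr_E in \<open>simp_all add: cod_functor_simps sub_proj_ob[OF CY sub]
         sub_proj_arr[OF CY sub]\<close>)
  have idE: "is_functor (arrow_cat E) (arrow_cat E) (id_functor (arrow_cat E))"
    by (rule id_functor[OF category_arrow_cat[OF cE]])
  have compr: "fcomp (total X) (id_functor (arrow_cat E)) (pm_total F) = fcomp (total X) (compr Y) (pm_total F)"
    by (rule ftor_eqI[OF fcomp_functor[OF tX tF idE]
          fcomp_functor[OF tX total compcat_compr[OF CY]]])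
      (use obF obY sqF squares_E in \<open>simp_all add: arrow_cat_simps sub_compr_ob[OF CY sub]
         sub_compr_arr[OF CY sub]\<close>)
  have cart: "cartesian (total R) (base R) (proj R) (farr (pm_total F) s) \<longleftrightarrow>
      cartesian (total Y) (base Y) (proj Y) (farr (pm_total F) s)"
    if s: "cartesian (total X) (base X) (proj X) s" for s
  proof -
    let ?t = "farr (pm_total F) s"
    have t: "?t \<in> squares E" using sqF s by (simp add: cartesian_def)
    then have "sq_tgt ?t \<in> Arr E" "sq_bot ?t \<in> Arr E" by (auto simp: squares_def homs_def)
    from lex_full_pullback[OF SD this] show ?thesis
      using t squares_E[OF t]
      unfolding cartesian_iff_pullback[OF CR subR] cartesian_iff_pullback[OF CY sub]
      by (simp add: arrow_cat_simps)
  qed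
  let ?G = "fcomp (total X) (arrow_functor (base X) (pm_base F)) (compr X)"
  have G: "is_functor (total X) (arrow_cat E) ?G"
    by (rule fcomp_functor[OF tX compcat_compr[OF X] arrow_functor_functor[OF bX cE bF]])
  have H: "is_functor (total X) (arrow_cat E) (fcomp (total X) (compr Y) (pm_total F))"
    using fcomp_functor[OF tX tF idE] by (simp flip: compr)
  note nt = full_subcat_nat_trans(1)[OF category_arrow_cat[OF bY] ArrE_sub tX, folded arrow_E', OF H G]
  have iso: "is_iso (arrow_cat E) (pm_compr F A) \<longleftrightarrow> is_iso (arrow_cat (base Y)) (pm_compr F A)"
    if \<phi>: "nat_trans (total X) (arrow_cat E) (fcomp (total X) (compr Y) (pm_total F)) ?G (pm_compr F)"
      and A: "A \<in> Obj (total X)" for A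
  proof -
    have s: "pm_compr F A \<in> squares E" using nt_arr[OF \<phi> A] by (simp add: arrow_cat_simps)
    then have "pm_compr F A \<in> squares (base Y)" "sq_src (pm_compr F A) \<in> Arr E" "sq_tgt (pm_compr F A) \<in> Arr E"
      by (simp_all add: squares_full_subcat)
    then show ?thesis
      unfolding arrow_E'
      by (intro full_subcat_iso_iff[OF category_arrow_cat[OF bY] ArrE_sub])
        (simp_all add: arrow_cat_simps)
  qed
  have nti: "nat_iso (total X) (arrow_cat E) (fcomp (total X) (compr Y) (pm_total F)) ?G (pm_compr F) \<longleftrightarrow>
      nat_iso (total X) (arrow_cat (base Y)) (fcomp (total X) (compr Y) (pm_total F)) ?G (pm_compr F)"
    unfolding nat_iso_def nt[symmetric] using iso by blast
  have Ids: "Id E (fob (pm_base F) (fob (proj X) A)) = Id (base Y) (fob (pm_base F) (fob (proj X) A))"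
    if "A \<in> Obj (total X)" for A
    using ftor_ob[OF bF ftor_ob[OF compcat_proj[OF X] that]] by (simp add: full_subcat_simps)
  have cart_all: "(\<forall>s. cartesian (total X) (base X) (proj X) s \<longrightarrow>
        cartesian (total R) (base R) (proj R) (farr (pm_total F) s)) \<longleftrightarrow>
      (\<forall>s. cartesian (total X) (base X) (proj X) s \<longrightarrow>
        cartesian (total Y) (base Y) (proj Y) (farr (pm_total F) s))"
    using cart by blast
  have Ids_all: "(\<forall>A \<in> Obj (total X). sq_bot (pm_compr F A) = Id E (fob (pm_base F) (fob (proj X) A))) \<longleftrightarrow>
      (\<forall>A \<in> Obj (total X). sq_bot (pm_compr F A) = Id (base Y) (fob (pm_base F) (fob (proj X) A)))"
    using Ids by simp
  show ?thesis
    unfolding pseudo_map_def cart_all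
    unfolding R_sel proj compr
    unfolding nti Ids_all using bF tF base total by blast
qed

text \<open>Triviality of \<open>X\<close> is what forces the values into \<open>E\<close>: its base
  has finite limits and the base functor is a clan map with all maps of the source as display
  maps.\<close>

lemma rooted_pseudo_map_iff:
  assumes X: "rooted_compcat X" and triv: "trivial X"
  shows "rooted_pseudo_map X R F \<longleftrightarrow> rooted_pseudo_map X Y F"
proof -
  note CX = rooted_compcatD(1)[OF X]
  note bX = compcat_base[OF CX] and tX = compcat_total[OF CX]
  have lex: "has_finite_limits (base X)"
    using compcat_clan[OF X trivial_replete(1,2)[OF CX triv]] trivial_replete(3)[OF CX triv]
      clan_Arr_iff by metis
  have lands: "is_functor (base X) E (pm_base F) \<and> is_functor (total X) (arrow_cat E) (pm_total F)"
    if F: "rooted_pseudo_map X Y F"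
  proof -
    note PF = rooted_pseudo_mapD(1)[OF F]
    note bF = pm_base_functor[OF CX CY PF] and tF = pm_total_functor[OF CX CY PF]
    have ob: "fob (pm_base F) Z \<in> S" if "Z \<in> Obj (base X)" for Z
      by (rule clan_map_separated[OF bX lex D pseudo_map_clan_map[OF X triv rooted repl compcl F] that])
    have "fob (pm_total F) A \<in> Arr E" if A: "A \<in> Obj (total X)" for A
    proof -
      have FA: "fob (pm_total F) A \<in> Obj (total Y)" by (rule ftor_ob[OF tF A])
      then have "fob (pm_total F) A \<in> Arr (base Y)" using sub_Obj[OF CY sub] by blast
      moreover have "Cod (base Y) (fob (pm_total F) A) \<in> S"
        using ob[OF ftor_ob[OF compcat_proj[OF CX] A]] pm_proj_ob[OF CX CY PF A]
          sub_proj_ob[OF CY sub FA] by simp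
      \<comment> \<open>The source of the image of \<open>A\<close> is only isomorphic, through the
        comprehension isomorphism, to a value of the base functor; separated objects are closed
        under isomorphism.\<close>
      moreover have "Cod (base Y) (pm_ext F A) \<in> S"
        using pm_ext_cod[OF CX CY PF A] ob[OF ext_dom_obj[OF CX A]] by simp
      then have "Dom (base Y) (pm_ext F A) \<in> S"
        by (rule separated_iso[OF D pm_ext_iso[OF CX CY PF A]])
      then have "Dom (base Y) (fob (pm_total F) A) \<in> S"
        using pm_ext_dom[OF CX CY PF A] sub_ext_dom[OF CY sub FA] by simp
      ultimately show ?thesis by (simp add: full_subcat_simps)
    qed
    then show ?thesis
      using ob bF tF full_subcat_functor_iff[OF bY SO bX] full_subcat_functor_iff[OF tY ArrE tX]
      by (simp add: arrow_E)
  qed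
  have root: "pm_root F \<in> homs E (fob (pm_base F) (root X)) (root Y) \<and> is_iso E (pm_root F) \<longleftrightarrow>
      pm_root F \<in> homs (base Y) (fob (pm_base F) (root X)) (root Y) \<and> is_iso (base Y) (pm_root F)"
    if "is_functor (base X) E (pm_base F)"
  proof -
    have "fob (pm_base F) (root X) \<in> S"
      using ftor_ob[OF that rooted_compcatD(3)[OF X]] by (simp add: full_subcat_simps)
    moreover have "root Y \<in> S" using rooted_compcatD(3)[OF R(1)] by (simp add: full_subcat_simps)
    ultimately show ?thesis
      using full_subcat_iso_iff[OF bY SO, of "pm_root F"] by (auto simp: homs_def full_subcat_simps)
  qed
  show ?thesis
  proof
    assume F: "rooted_pseudo_map X R F"
    note PF = rooted_pseudo_mapD(1)[OF F]
    have bF: "is_functor (base X) E (pm_base F)" "is_functor (total X) (arrow_cat E) (pm_total F)"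
      using pm_base_functor[OF CX CR PF] pm_total_functor[OF CX CR PF] by simp_all
    then show "rooted_pseudo_map X Y F"
      using F pseudo_map_iff[OF CX bF] root[OF bF(1)] unfolding rooted_pseudo_map_def by simp
  next
    assume F: "rooted_pseudo_map X Y F"
    note bF = lands[OF F, THEN conjunct1] lands[OF F, THEN conjunct2]
    show "rooted_pseudo_map X R F"
      using F pseudo_map_iff[OF CX bF] root[OF bF(1)] unfolding rooted_pseudo_map_def by simp
  qed
qed

lemma functors_R:
  assumes X: "rooted_compcat X" and triv: "trivial X" and F: "rooted_pseudo_map X Y F"
  shows "is_functor (base X) E (pm_base F)" "is_functor (total X) (arrow_cat E) (pm_total F)"
proof -
  have "rooted_pseudo_map X R F" using F rooted_pseudo_map_iff[OF X triv] by simp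
  note PF = rooted_pseudo_mapD(1)[OF this]
  show "is_functor (base X) E (pm_base F)" "is_functor (total X) (arrow_cat E) (pm_total F)"
    using pm_base_functor[OF rooted_compcatD(1)[OF X] CR PF]
      pm_total_functor[OF rooted_compcatD(1)[OF X] CR PF] by simp_all
qed

text \<open>For components in \<open>E\<close> all composites in the conditions are formed as in
  \<open>Y\<close>. The conditions are compared after settling naturality, which puts the components
  into \<open>E\<close>.\<close>

lemma rooted_transformation_iff:
  assumes X: "rooted_compcat X" and triv: "trivial X"
    and F: "rooted_pseudo_map X Y F" and G: "rooted_pseudo_map X Y G"
  shows "rooted_transformation X R F G \<alpha> \<alpha>' \<longleftrightarrow> rooted_transformation X Y F G \<alpha> \<alpha>'"
proof -
  note CX = rooted_compcatD(1)[OF X]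
  note bX = compcat_base[OF CX] and tX = compcat_total[OF CX]
  note fF = functors_R[OF X triv F] and fG = functors_R[OF X triv G]
  have FR: "rooted_pseudo_map X R F" "rooted_pseudo_map X R G"
    using F G rooted_pseudo_map_iff[OF X triv] by simp_all
  note PF = rooted_pseudo_mapD(1)[OF FR(1)] and PG = rooted_pseudo_mapD(1)[OF FR(2)]
  have nb: "nat_trans (base X) E (pm_base F) (pm_base G) = nat_trans (base X) (base Y) (pm_base F) (pm_base G)"
    by (rule full_subcat_nat_trans(1)[OF bY SO bX fF(1) fG(1)])
  have nt: "nat_trans (total X) (arrow_cat E) (pm_total F) (pm_total G) =
      nat_trans (total X) (total Y) (pm_total F) (pm_total G)"
    using full_subcat_nat_trans(1)[OF tY ArrE tX, folded arrow_E, OF fF(2) fG(2)] .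
  have eq: "(farr (proj R) (\<alpha>' A) = \<alpha> (fob (proj X) A) \<and>
        Comp (base R) (pm_ext G A) (ext_map R (\<alpha>' A)) = Comp (base R) (\<alpha> (ext_dom X A)) (pm_ext F A)) \<longleftrightarrow>
      (farr (proj Y) (\<alpha>' A) = \<alpha> (fob (proj X) A) \<and>
        Comp (base Y) (pm_ext G A) (ext_map Y (\<alpha>' A)) = Comp (base Y) (\<alpha> (ext_dom X A)) (pm_ext F A))"
    if \<alpha>: "nat_trans (base X) E (pm_base F) (pm_base G) \<alpha>"
      and \<alpha>': "nat_trans (total X) (arrow_cat E) (pm_total F) (pm_total G) \<alpha>'"
      and A: "A \<in> Obj (total X)" for A
  proof -
    have s: "\<alpha>' A \<in> squares E" using nt_arr[OF \<alpha>' A] by (simp add: arrow_cat_simps)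
    then have "sq_top (\<alpha>' A) \<in> Arr E" by (auto simp: squares_def homs_def)
    moreover have "pm_ext G A \<in> Arr E" "pm_ext F A \<in> Arr E"
      using pm_ext_arr[OF CX CR PF A] pm_ext_arr[OF CX CR PG A] by simp_all
    moreover have "\<alpha> (ext_dom X A) \<in> Arr E" by (rule nt_arr[OF \<alpha> ext_dom_obj[OF CX A]])
    ultimately show ?thesis
      using s squares_E[OF s]
      by (simp add: comp_E cod_functor_simps arrow_cat_simps sub_proj_arr[OF CY sub] sub_compr_arr[OF CY sub])
  qed
  have root: "Comp E (pm_root G) (\<alpha> (root X)) = Comp (base Y) (pm_root G) (\<alpha> (root X))"
    if \<alpha>: "nat_trans (base X) E (pm_base F) (pm_base G) \<alpha>"
    using nt_arr[OF \<alpha> rooted_compcatD(3)[OF X]] rooted_pseudo_mapD(2)[OF FR(2)] by (simp add: comp_E)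
  show ?thesis
  proof (cases "nat_trans (base X) E (pm_base F) (pm_base G) \<alpha> \<and>
      nat_trans (total X) (arrow_cat E) (pm_total F) (pm_total G) \<alpha>'")
    case True
    then have n: "nat_trans (base X) E (pm_base F) (pm_base G) \<alpha>"
      "nat_trans (total X) (arrow_cat E) (pm_total F) (pm_total G) \<alpha>'" by blast+
    have "(\<forall>A \<in> Obj (total X). farr (proj R) (\<alpha>' A) = \<alpha> (fob (proj X) A) \<and>
        Comp (base R) (pm_ext G A) (ext_map R (\<alpha>' A)) = Comp (base R) (\<alpha> (ext_dom X A)) (pm_ext F A)) \<longleftrightarrow>
      (\<forall>A \<in> Obj (total X). farr (proj Y) (\<alpha>' A) = \<alpha> (fob (proj X) A) \<and>
        Comp (base Y) (pm_ext G A) (ext_map Y (\<alpha>' A)) = Comp (base Y) (\<alpha> (ext_dom X A)) (pm_ext F A))"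
      by (rule ball_cong[OF refl eq[OF n]])
    then show ?thesis
      unfolding rooted_transformation_def transformation_def R_sel(1,2) nb nt root[OF n(1)] by simp
  next
    case False
    then show ?thesis
      unfolding rooted_transformation_def transformation_def R_sel(1,2) nb nt by blast
  qed
qed

text \<open>The equality of hom-categories behind the second adjunction: 1-cells agree by
  \<open>rooted_pseudo_map_iff\<close>, 2-cells by \<open>rooted_transformation_iff\<close>, and the
  operations by the comparison lemmas for full subcategories.\<close>

lemma hom_R:
  assumes X: "rooted_compcat X" and triv: "trivial X"
  shows "compcat_hom X Y = compcat_hom X R"
proof -
  note CX = rooted_compcatD(1)[OF X]
  note bX = compcat_base[OF CX] and tX = compcat_total[OF CX]
  note pm = rooted_pseudo_map_iff[OF X triv]
  let ?A = "{(F, G, \<alpha>, \<alpha>'). F \<in> {F. rooted_pseudo_map X Y F} \<and> G \<in> {F. rooted_pseudo_map X Y F} \<and>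
      rooted_transformation X Y F G \<alpha> \<alpha>'}"
  have A: "{(F, G, \<alpha>, \<alpha>'). F \<in> {F. rooted_pseudo_map X Y F} \<and> G \<in> {F. rooted_pseudo_map X Y F} \<and>
      rooted_transformation X R F G \<alpha> \<alpha>'} = ?A"
    using rooted_transformation_iff[OF X triv] by auto
  note fb = full_subcat_nat_trans[OF bY SO bX functors_R(1)[OF X triv] functors_R(1)[OF X triv]]
  note ft = full_subcat_nat_trans[OF tY ArrE tX, folded arrow_E,
      OF functors_R(2)[OF X triv] functors_R(2)[OF X triv]]
  have ids: "(\<lambda>F \<in> {F. rooted_pseudo_map X Y F}. (F, F, id_nt (base X) (base R) (pm_base F),
        id_nt (total X) (total R) (pm_total F))) =
      (\<lambda>F \<in> {F. rooted_pseudo_map X Y F}. (F, F, id_nt (base X) (base Y) (pm_base F),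
        id_nt (total X) (total Y) (pm_total F)))"
    by (rule restrict_ext) (simp add: fb(2) ft(2))
  have v: "vcomp_nt (base X) (base R) \<beta> \<alpha> = vcomp_nt (base X) (base Y) \<beta> \<alpha>"
    "vcomp_nt (total X) (total R) \<beta>' \<alpha>' = vcomp_nt (total X) (total Y) \<beta>' \<alpha>'"
    if "(G', H, \<beta>, \<beta>') \<in> ?A" "(F, G, \<alpha>, \<alpha>') \<in> ?A" "G = G'" for F G G' H \<alpha> \<alpha>' \<beta> \<beta>'
  proof -
    have *: "rooted_pseudo_map X Y F" "rooted_pseudo_map X Y G" "rooted_pseudo_map X Y H"
      "rooted_transformation X Y F G \<alpha> \<alpha>'" "rooted_transformation X Y G H \<beta> \<beta>'"
      using that by auto
    show "vcomp_nt (base X) (base R) \<beta> \<alpha> = vcomp_nt (base X) (base Y) \<beta> \<alpha>"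
      using fb(3)[OF *(1,2) rooted_transformationD(1)[OF *(4)] rooted_transformationD(1)[OF *(5)]
          functors_R(1)[OF X triv *(3)]] by simp
    show "vcomp_nt (total X) (total R) \<beta>' \<alpha>' = vcomp_nt (total X) (total Y) \<beta>' \<alpha>'"
      using ft(3)[OF *(1,2) rooted_transformationD(2)[OF *(4)] rooted_transformationD(2)[OF *(5)]
          functors_R(2)[OF X triv *(3)]] by simp
  qed
  show ?thesis
    unfolding compcat_hom_def Let_def pm A ids
  proof (intro cat.equality HOL.ext; simp only: cat.simps)
    fix g f :: "('o, 'm, 'm, 'm square) rtrans"
    obtain F G \<alpha> \<alpha>' where f: "f = (F, G, \<alpha>, \<alpha>')" by (cases f)
    obtain G' H \<beta> \<beta>' where g: "g = (G', H, \<beta>, \<beta>')" by (cases g)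
    show "(case g of (G', H, \<beta>, \<beta>') \<Rightarrow> \<lambda>(F, G, \<alpha>, \<alpha>').
        if (G', H, \<beta>, \<beta>') \<in> ?A \<and> (F, G, \<alpha>, \<alpha>') \<in> ?A \<and> G = G'
        then (F, H, vcomp_nt (base X) (base Y) \<beta> \<alpha>, vcomp_nt (total X) (total Y) \<beta>' \<alpha>')
        else undefined) f =
      (case g of (G', H, \<beta>, \<beta>') \<Rightarrow> \<lambda>(F, G, \<alpha>, \<alpha>').
        if (G', H, \<beta>, \<beta>') \<in> ?A \<and> (F, G, \<alpha>, \<alpha>') \<in> ?A \<and> G = G'
        then (F, H, vcomp_nt (base X) (base R) \<beta> \<alpha>, vcomp_nt (total X) (total R) \<beta>' \<alpha>')
        else undefined) f"
      unfolding f g prod.case by (rule if_cong[OF refl _ refl], elim conjE) (simp only: v)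
  qed
qed

text \<open>The target enters a composite of pseudo maps only where comprehension squares and root
  isomorphisms are composed, and these lie in \<open>E\<close> because \<open>G\<close> also maps
  into \<open>R\<close>.\<close>

lemma comp_R:
  assumes X: "rooted_compcat X" and X': "rooted_compcat X'" and triv: "trivial X'"
    and F: "rooted_pseudo_map X X' F" and G: "rooted_pseudo_map X' Y G"
  shows "comp_rpmap X Y G F = comp_rpmap X R G F"
proof -
  note CX = rooted_compcatD(1)[OF X] and CX' = rooted_compcatD(1)[OF X']
  note bX' = compcat_base[OF CX']
  note PF = rooted_pseudo_mapD(1)[OF F]
  have GR: "rooted_pseudo_map X' R G" using G rooted_pseudo_map_iff[OF X' triv] by simp
  note PG = rooted_pseudo_mapD(1)[OF GR]
  note bG = functors_R(1)[OF X' triv G]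
  have "Comp (arrow_cat (base Y)) (map_square (pm_base G) (pm_compr F A)) (pm_compr G (fob (pm_total F) A)) =
      Comp (arrow_cat E) (map_square (pm_base G) (pm_compr F A)) (pm_compr G (fob (pm_total F) A))"
    if A: "A \<in> Obj (total X)" for A
  proof -
    have "map_square (pm_base G) (pm_compr F A) \<in> squares E"
      by (rule map_square_squares[OF bX' bG pm_compr_squares[OF CX CX' PF A]])
    moreover have "pm_compr G (fob (pm_total F) A) \<in> squares E"
      using pm_compr_squares[OF CX' CR PG ftor_ob[OF pm_total_functor[OF CX CX' PF] A]] by simp
    ultimately show ?thesis by (simp add: comp_arrow_E)
  qed
  moreover have "Comp (base Y) (pm_root G) (farr (pm_base G) (pm_root F)) =
      Comp E (pm_root G) (farr (pm_base G) (pm_root F))"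
    using rooted_pseudo_mapD(2)[OF GR] ftor_arr[OF bG rooted_pseudo_mapD(2)[OF F]]
    by (simp add: comp_E)
  ultimately show ?thesis
    unfolding comp_rpmap_def R_sel(1) by (auto intro!: rpmap.equality restrict_ext)
qed

lemma hcomp_R:
  assumes X: "rooted_compcat X" and X': "rooted_compcat X'" and triv: "trivial X'"
    and F: "rooted_pseudo_map X X' F" and F': "rooted_pseudo_map X X' F'"
    and G: "rooted_pseudo_map X' Y G" and G': "rooted_pseudo_map X' Y G'"
    and \<alpha>: "rooted_transformation X X' F F' \<alpha> \<alpha>'" and \<beta>: "rooted_transformation X' Y G G' \<beta> \<beta>'"
  shows "hcomp_nt (base X) (base R) (pm_base G) (pm_base F') \<beta> \<alpha> =
      hcomp_nt (base X) (base Y) (pm_base G) (pm_base F') \<beta> \<alpha>"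
    and "hcomp_nt (total X) (total R) (pm_total G) (pm_total F') \<beta>' \<alpha>' =
      hcomp_nt (total X) (total Y) (pm_total G) (pm_total F') \<beta>' \<alpha>'"
proof -
  note f = compcat_hom_objI[OF X X' F] and f' = compcat_hom_objI(5,6)[OF X X' F']
  note g = functors_R[OF X' triv G] and g' = functors_R[OF X' triv G']
  show "hcomp_nt (base X) (base R) (pm_base G) (pm_base F') \<beta> \<alpha> =
      hcomp_nt (base X) (base Y) (pm_base G) (pm_base F') \<beta> \<alpha>"
    using full_subcat_hcomp[OF bY SO f(3,1) g(1) g'(1) f(5) f'(1) rooted_transformationD(1)[OF \<alpha>]
        rooted_transformationD(1)[OF \<beta>]] by simp
  show "hcomp_nt (total X) (total R) (pm_total G) (pm_total F') \<beta>' \<alpha>' =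
      hcomp_nt (total X) (total Y) (pm_total G) (pm_total F') \<beta>' \<alpha>'"
    using full_subcat_hcomp[OF tY ArrE f(4,2), folded arrow_E, OF g(2) g'(2) f(6) f'(2)
        rooted_transformationD(2)[OF \<alpha>] rooted_transformationD(2)[OF \<beta>]] by simp
qed

text \<open>\<open>obs\<close> and \<open>obs'\<close> are independent because the two sides of the
  adjunction live in 2-categories with different objects.\<close>

lemma HComp_R:
  assumes X: "rooted_compcat X" and X': "rooted_compcat X'" and triv: "trivial X'"
  shows "HComp (CompCat_rtd_on obs) X X' Y = HComp (CompCat_rtd_on obs') X X' R"
proof -
  note hom = hom_R[OF X' triv]
  have 1: "(\<lambda>(G, F) \<in> Obj (compcat_hom X' Y) \<times> Obj (compcat_hom X X'). comp_rpmap X Y G F) =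
      (\<lambda>(G, F) \<in> Obj (compcat_hom X' Y) \<times> Obj (compcat_hom X X'). comp_rpmap X R G F)"
    by (rule restrict_ext) (auto simp: compcat_hom_simps comp_R[OF X X' triv])
  let ?f = "\<lambda>Z. \<lambda>((G, G', \<beta>, \<beta>'), (F, F', \<alpha>, \<alpha>')) \<in> Arr (compcat_hom X' Y) \<times> Arr (compcat_hom X X').
      (comp_rpmap X Z G F, comp_rpmap X Z G' F',
       hcomp_nt (base X) (base Z) (pm_base G) (pm_base F') \<beta> \<alpha>,
       hcomp_nt (total X) (total Z) (pm_total G) (pm_total F') \<beta>' \<alpha>')"
  have 2: "?f Y = ?f R"
    by (rule restrict_ext)
      (auto simp: compcat_hom_simps comp_R[OF X X' triv] hcomp_R[OF X X' triv] simp del: R_sel)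
  show ?thesis
    unfolding CompCat_rtd_on_def two_cat.simps hom[symmetric] 1 2 ..
qed

end

lemma CompCat_right_adjoint:
  "has_right_2_adjoint (CompCat_rtd_triv :: ('o, 'm, 'm, 'm square) compcat_2cat)
     (CompCat_rtd_repl_compcl :: ('o, 'm, 'm, 'm square) compcat_2cat) CompCat_inclusion"
proof (rule has_right_2_adjointI[where i = "\<lambda>X. X" and r = core_compcat])
  let ?K = "CompCat_rtd_triv :: ('o, 'm, 'm, 'm square) compcat_2cat"
  let ?L = "CompCat_rtd_repl_compcl :: ('o, 'm, 'm, 'm square) compcat_2cat"
  note K = CompCat_rtd_triv_def and L = CompCat_rtd_repl_compcl_def
  have obK: "X \<in> Ob ?K \<longleftrightarrow> rooted_compcat X \<and> trivial X" for X
    by (auto simp: K CompCat_rtd_on_simps)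
  have obL: "Y \<in> Ob ?L \<longleftrightarrow> repl_compcl Y" for Y
    by (auto simp: L CompCat_rtd_on_simps repl_compcl_def)
  have hom: "Hom ?K = compcat_hom" "Hom ?L = compcat_hom" "Unit ?K = id_rpmap" "Unit ?L = id_rpmap"
    by (simp_all add: K L CompCat_rtd_on_simps)
  show "two_category ?K" "two_category ?L"
    by (simp_all add: K L two_category_CompCat_rtd_on)
  show "CompCat_inclusion = \<lparr> tob = \<lambda>X. X, thom = \<lambda>X X'. id_functor (Hom ?K X X') \<rparr>"
    by (simp add: CompCat_inclusion_def)
  show "X \<in> Ob ?L" if "X \<in> Ob ?K" for X
    using that trivial_replete(1,2) rooted_compcatD(1) unfolding obK obL repl_compcl_def by blast
  show "Hom ?L X X' = Hom ?K X X'" "Unit ?L X = Unit ?K X" for X X' by (simp_all add: hom)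
  show "HComp ?L X X' X'' = HComp ?K X X' X''" for X X' X''
    by (simp add: K L CompCat_rtd_on_def)
  show "core_compcat Y \<in> Ob ?K" if "Y \<in> Ob ?L" for Y
    using repl_compcl.R[of Y] that by (simp add: obK obL)
  show "Hom ?L X Y = Hom ?K X (core_compcat Y)" if "X \<in> Ob ?K" "Y \<in> Ob ?L" for X Y
    using repl_compcl.hom_R[of Y X] that by (simp add: obK obL hom)
  show "HComp ?L X X' Y = HComp ?K X X' (core_compcat Y)"
    if "X \<in> Ob ?K" "X' \<in> Ob ?K" "Y \<in> Ob ?L" for X X' Y
    unfolding K L using repl_compcl.HComp_R[of Y X X'] that by (simp add: obK obL)
qed

theorem theorem36:
  shows "has_right_2_adjoint (Lex :: ('o, 'm) lex_2cat) (Clan :: ('o, 'm) clan_2cat) Lex_to_Clan \<and>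
         has_right_2_adjoint
           (CompCat_rtd_triv :: ('o, 'm, 'm, 'm square) compcat_2cat)
           (CompCat_rtd_repl_compcl :: ('o, 'm, 'm, 'm square) compcat_2cat)
           CompCat_inclusion"
  using Lex_Clan_right_adjoint CompCat_right_adjoint by blast

end
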